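(* Let $A$ be a maximal indecomposable cyclotomic matrix over the ring $\mathbb{Z}[\omega]$, where $\omega=1/2+\sqrt{-3}/2$. Then $A$ is equivalent to an adjacency matrix of one of the graphs $T_{2k}$ ($k\geqslant3$), $T_{2k}^{(\omega)}$ ($k\geqslant3$), $S_2$, $S_4^{\ddagger}$, $S_{10}$, $S_{12}$, $S_{14}$, $S_{16}$, $S_1$, $S_2^\dagger$, $C_{2k}^{++}$ ($k\geqslant2$), $C_{2k}^{+-}$ ($k\geqslant2$), $S_5$, $S_6$, $S_6^\dagger$, $S_7$, $S_8$, $S_8'$. Moreover, every indecomposable cyclotomic $\mathbb{Z}[\omega]$-matrix is contained in (i.e. is, up to simultaneous permutation of rows and columns, equal to or a principal submatrix of) a maximal indecomposable cyclotomic $\mathbb{Z}[\omega]$-matrix.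
   Context: **Matrices.** Let $R=\mathbb{Z}[\omega]$, $\omega=1/2+\sqrt{-3}/2$. A cyclotomic matrix over $R$ is a (finite, square) Hermitian matrix with entries in $R$ all of whose eigenvalues lie in $[-2,2]$. A Hermitian $R$-matrix is the adjacency matrix $(w(u,v))_{u,v}$ of a weighted directed graph ($R$-graph) with weight function $w$ satisfying $w(v,u)=\overline{w(u,v)}$; $w(v,v)$ is the charge of $v$. A matrix is indecomposable if its underlying graph (distinct $u,v$ adjacent iff $w(u,v)\neq 0$) is connected. An indecomposable cyclotomic $R$-matrix is maximal if it is not a (proper) principal submatrix of any other indecomposable cyclotomic $R$-matrix. Two $n\times n$ matrices $A,B$ over $R$ are equivalent if $A=\pm\sigma(QBQ^* )$ for some unitary matrix $Q$ with entries in $R$ ($QQ^*=Q^*Q=I$), some choice of sign, and $\sigma$ either the identity or complex conjugation applied entrywise. **Graphs.** Weights not determined by the listed ones via $w(v,u)=\overline{w(u,v)}$ are $0$; in particular vertices are uncharged unless a charge is listed. "Ladder on $t_1,b_1,\dots,t_k,b_k$" means: for $1\le j\le k-1$, $w(t_j,t_{j+1})=w(t_j,b_{j+1})=1$ and $w(b_j,t_{j+1})=w(b_j,b_{j+1})=-1$. $T_{2k}$ ($k\ge 3$): ladder on $t_1,b_1,\dots,t_k,b_k$, and $w(t_k,t_1)=w(t_k,b_1)=1$, $w(b_k,t_1)=w(b_k,b_1)=-1$. $T_{2k}^{(\omega)}$ ($k\ge3$): ladder on $t_1,b_1,\dots,t_k,b_k$, and $w(t_k,t_1)=w(t_k,b_1)=\omega$,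 $w(b_k,t_1)=w(b_k,b_1)=-\omega$. $S_2$: two uncharged vertices joined by an edge of weight $2$. $S_4^{\ddagger}$: vertices $a,b,c,d$; $w(a,b)=w(c,d)=1$, $w(a,c)=-1-\omega$, $w(b,d)=1+\omega$. $S_{10}$: vertices $o_j,n_j$, $j\in\mathbb{Z}/5$; $w(o_j,n_j)=w(o_j,n_{j-1})=1$, $w(o_j,n_{j+1})=w(o_j,n_{j+3})=-\omega$. $S_{12}$: vertices $o_j,n_j$, $j\in\mathbb{Z}/6$; for $j$ even: $w(o_j,n_j)=1$, $w(o_j,n_{j-1})=w(o_j,n_{j+3})=-1$, $w(o_j,n_{j+1})=\omega$; for $j$ odd: $w(o_j,n_j)=w(o_j,n_{j+1})=w(o_j,n_{j+3})=1$, $w(n_{j-1},o_j)=-\omega$. $S_{14}$: vertices $o_j,n_j$, $j\in\mathbb{Z}/7$; $w(o_j,n_j)=w(o_j,n_{j+1})=w(o_j,n_{j+3})=1$, $w(o_j,n_{j-1})=-1$. $S_{16}$: vertices $o_j,n_j$, $j\in\mathbb{Z}/8$; $w(o_j,o_{j+1})=1$, $w(n_j,n_{j+3})=1$, $w(o_j,n_{j+1})=-1$, $w(o_j,n_{j-1})=1$. $S_1$: a single vertex of charge $2$. $S_2^\dagger$: vertices $a,b$ of charges $-1,1$; $w(b,a)=1+\omega$. $C_{2k}^{++}$ ($k\ge2$): ladder on $t_1,b_1,\dots,t_k,b_k$, with $t_1,b_1,t_k,b_k$ of charge $1$, $w(t_1,b_1)=1$, $w(t_k,b_k)=-1$. $C_{2k}^{+-}$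 ($k\ge2$): ladder on $t_1,b_1,\dots,t_k,b_k$, with $t_1,b_1$ of charge $1$, $t_k,b_k$ of charge $-1$, $w(t_1,b_1)=1$, $w(t_k,b_k)=1$. $S_5$: vertices $a,b,c,d,e$; $c,d$ have charge $1$, $a,b,e$ charge $0$; weight $1$: $ce, de, ad, bc, ab$; $w(a,c)=w(b,d)=w(e,b)=w(e,a)=-\omega$. $S_6$: vertices $a,\dots,f$; $b,d,f$ have charge $1$, $a,c,e$ charge $-1$; weight $1$: $bc, cf, cd, af, be$; $w(b,a)=w(a,d)=w(f,e)=w(e,d)=-\omega$. $S_6^\dagger$: vertices $a,\dots,f$; $d$ has charge $1$, $c$ charge $-1$, $a,b,e,f$ charge $0$; weight $1$: $bc, cf, cd, bf, af, be$; weight $-1$: $ae$; $w(b,a)=w(a,d)=w(f,e)=w(e,d)=-\omega$. $S_7$: vertices $a,\dots,g$; $a,e,f$ have charge $1$, $d$ has charge $-1$, $b,c,g$ charge $0$; weight $1$: $ab, ad, cf, bg, de, df, cg, eg, bc$; weight $-1$: $ac, fg, be$. $S_8$: vertices $a,\dots,h$; $b,c,e,h$ have charge $1$, $a,d,f,g$ charge $-1$; weight $1$: $ab, ae, cg, cd, bd, ef, eg, fh, dh$; weight $-1$: $ac, bf, gh$. $S_8'$: vertices $a,\dots,h$; $b,g$ have charge $1$, $a,h$ charge $-1$, $c,d,e,f$ charge $0$; weight $1$: $ab, ac, ae, cg, bd, ef, gh, fh, dh, df, ce$; weight $-1$: $cd, bf, eg$. *)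

theory Defs
  imports
    "Jordan_Normal_Form.Schur_Decomposition"
    "Jordan_Normal_Form.DL_Submatrix"
    "HOL-Combinatorics.Permutations"
begin

section \<open>Cyclotomic matrices over the Eisenstein integers\<close>

definition omega :: complex  (\<open>\<omega>\<close>)
  where "\<omega> = Complex (1/2) (sqrt 3 / 2)"

definition eisenstein_ints :: "complex set"
  where "eisenstein_ints = {of_int a + of_int b * \<omega> | a b. True}"

definition R_matrix :: "complex mat \<Rightarrow> bool"
  where "R_matrix A \<longleftrightarrow> elements_mat A \<subseteq> eisenstein_ints"

definition hermitian_mat :: "complex mat \<Rightarrow> bool"
  where "hermitian_mat A \<longleftrightarrow> square_mat A \<and> mat_adjoint A = A"

definition cyclotomic :: "complex mat \<Rightarrow> bool"
  where "cyclotomic A \<longleftrightarrow> hermitian_mat A \<and> R_matrix A \<and>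
    (\<forall>k. eigenvalue A k \<longrightarrow> k \<in> complex_of_real ` {-2..2})"

definition adjacency :: "complex mat \<Rightarrow> (nat \<times> nat) set"
  where "adjacency A = {(u, v). u < dim_row A \<and> v < dim_row A \<and> u \<noteq> v \<and> A $$ (u, v) \<noteq> 0}"

text \<open>Connected graphs are nonempty, so the \<open>0 \<times> 0\<close> matrix is not indecomposable.
  \<open>indecomposable\<close> is meant for Hermitian matrices, whose adjacency relation is symmetric.\<close>

definition indecomposable :: "complex mat \<Rightarrow> bool"
  where "indecomposable A \<longleftrightarrow> dim_row A > 0 \<and>
    (\<forall>u < dim_row A. \<forall>v < dim_row A. (u, v) \<in> (adjacency A)\<^sup>*)"

definition proper_principal_submatrix :: "complex mat \<Rightarrow> complex mat \<Rightarrow> bool"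
  where "proper_principal_submatrix A B \<longleftrightarrow> (\<exists>I. I \<subset> {..<dim_row B} \<and> A = submatrix B I I)"

definition maximal_cyclotomic :: "complex mat \<Rightarrow> bool"
  where "maximal_cyclotomic A \<longleftrightarrow> cyclotomic A \<and> indecomposable A \<and>
    \<not> (\<exists>B. cyclotomic B \<and> indecomposable B \<and> proper_principal_submatrix A B)"

definition permute_mat :: "(nat \<Rightarrow> nat) \<Rightarrow> 'a mat \<Rightarrow> 'a mat"
  where "permute_mat p A = mat (dim_row A) (dim_col A) (\<lambda>(i, j). A $$ (p i, p j))"

definition contained_in :: "complex mat \<Rightarrow> complex mat \<Rightarrow> bool"
  where "contained_in A B \<longleftrightarrow> (\<exists>p. p permutes {..<dim_row A} \<and>
    (permute_mat p A = B \<or> proper_principal_submatrix (permute_mat p A) B))"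

definition R_unitary :: "nat \<Rightarrow> complex mat \<Rightarrow> bool"
  where "R_unitary n Q \<longleftrightarrow> Q \<in> carrier_mat n n \<and> R_matrix Q \<and>
    Q * mat_adjoint Q = 1\<^sub>m n \<and> mat_adjoint Q * Q = 1\<^sub>m n"

definition R_equivalent :: "complex mat \<Rightarrow> complex mat \<Rightarrow> bool"
  where "R_equivalent A B \<longleftrightarrow> R_matrix A \<and> R_matrix B \<and>
    (\<exists>n Q s \<sigma>. A \<in> carrier_mat n n \<and> B \<in> carrier_mat n n \<and> R_unitary n Q \<and>
      s \<in> {1, -1} \<and> \<sigma> \<in> {id, cnj} \<and>
      A = s \<cdot>\<^sub>m map_mat \<sigma> (Q * B * mat_adjoint Q))"


section \<open>Weighted graphs\<close>

text \<open>A graph is a finite vertex set with its weight function.\<close>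

type_synonym 'v R_graph = "'v set \<times> ('v \<Rightarrow> 'v \<Rightarrow> complex)"

type_synonym 'v weights = "(('v \<times> 'v) \<times> complex) list"

text \<open>A list of weights determines the opposite weights by conjugation; all others are \<open>0\<close>.
  In the lists below each unordered pair of vertices occurs at most once; an entry
  \<open>((v, v), c)\<close> is the charge of \<open>v\<close>.\<close>

definition weight_of :: "'v weights \<Rightarrow> 'v \<Rightarrow> 'v \<Rightarrow> complex"
  where "weight_of ws u v = (case map_of ws (u, v) of
      Some x \<Rightarrow> x
    | None \<Rightarrow> (case map_of ws (v, u) of Some x \<Rightarrow> cnj x | None \<Rightarrow> 0))"

text \<open>The list \<open>vs\<close> is an ordering of the vertices.\<close>

definition is_adjacency_matrix :: "complex mat \<Rightarrow> 'v R_graph \<Rightarrow> bool"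
  where "is_adjacency_matrix M G \<longleftrightarrow> (\<exists>vs. distinct vs \<and> set vs = fst G \<and>
    M = mat (length vs) (length vs) (\<lambda>(i, j). snd G (vs ! i) (vs ! j)))"

definition equivalent_to_graph :: "complex mat \<Rightarrow> 'v R_graph \<Rightarrow> bool"
  where "equivalent_to_graph A G \<longleftrightarrow> (\<exists>M. is_adjacency_matrix M G \<and> R_equivalent A M)"


subsection \<open>The infinite families\<close>

text \<open>\<open>Top j\<close> and \<open>Bot j\<close> are \<open>t\<^sub>j\<close> and \<open>b\<^sub>j\<close>, for \<open>1 \<le> j \<le> k\<close>.\<close>

datatype ladder_vertex = Top nat | Bot nat

definition ladder_verts :: "nat \<Rightarrow> ladder_vertex set"
  where "ladder_verts k = Top ` {1..k} \<union> Bot ` {1..k}"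

definition ladder :: "nat \<Rightarrow> ladder_vertex weights"
  where "ladder k = concat (map (\<lambda>j.
     [((Top j, Top (j + 1)), 1), ((Top j, Bot (j + 1)), 1),
      ((Bot j, Top (j + 1)), -1), ((Bot j, Bot (j + 1)), -1)]) [1..<k])"

definition graph_T :: "complex \<Rightarrow> nat \<Rightarrow> ladder_vertex R_graph"
  where "graph_T x k = (ladder_verts k, weight_of (ladder k @
     [((Top k, Top 1), x), ((Top k, Bot 1), x), ((Bot k, Top 1), -x), ((Bot k, Bot 1), -x)]))"

abbreviation T2k :: "nat \<Rightarrow> ladder_vertex R_graph"
  where "T2k k \<equiv> graph_T 1 k"

abbreviation T2k_omega :: "nat \<Rightarrow> ladder_vertex R_graph"
  where "T2k_omega k \<equiv> graph_T \<omega> k"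

definition C2k_pp :: "nat \<Rightarrow> ladder_vertex R_graph"
  where "C2k_pp k = (ladder_verts k, weight_of (ladder k @
     [((Top 1, Top 1), 1), ((Bot 1, Bot 1), 1), ((Top k, Top k), 1), ((Bot k, Bot k), 1),
      ((Top 1, Bot 1), 1), ((Top k, Bot k), -1)]))"

definition C2k_pm :: "nat \<Rightarrow> ladder_vertex R_graph"
  where "C2k_pm k = (ladder_verts k, weight_of (ladder k @
     [((Top 1, Top 1), 1), ((Bot 1, Bot 1), 1), ((Top k, Top k), -1), ((Bot k, Bot k), -1),
      ((Top 1, Bot 1), 1), ((Top k, Bot k), 1)]))"


subsection \<open>The cyclic sporadic graphs\<close>

text \<open>\<open>Out j\<close> and \<open>Inn j\<close> are \<open>o\<^sub>j\<close> and \<open>n\<^sub>j\<close>; indices are residues in \<open>{0..<m}\<close>.\<close>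

datatype cyclic_vertex = Out int | Inn int

definition cyclic_verts :: "int \<Rightarrow> cyclic_vertex set"
  where "cyclic_verts m = Out ` {0..<m} \<union> Inn ` {0..<m}"

definition S10 :: "cyclic_vertex R_graph"
  where "S10 = (cyclic_verts 5, weight_of (concat (map (\<lambda>j.
     [((Out j, Inn j), 1), ((Out j, Inn ((j - 1) mod 5)), 1),
      ((Out j, Inn ((j + 1) mod 5)), -\<omega>), ((Out j, Inn ((j + 3) mod 5)), -\<omega>)]) [0..4])))"

definition S12 :: "cyclic_vertex R_graph"
  where "S12 = (cyclic_verts 6, weight_of (concat (map (\<lambda>j.
     if even j then
       [((Out j, Inn j), 1),
        ((Out j, Inn ((j - 1) mod 6)), -1), ((Out j, Inn ((j + 3) mod 6)), -1),
        ((Out j, Inn ((j + 1) mod 6)), \<omega>)]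
     else
       [((Out j, Inn j), 1),
        ((Out j, Inn ((j + 1) mod 6)), 1), ((Out j, Inn ((j + 3) mod 6)), 1),
        ((Inn ((j - 1) mod 6), Out j), -\<omega>)]) [0..5])))"

definition S14 :: "cyclic_vertex R_graph"
  where "S14 = (cyclic_verts 7, weight_of (concat (map (\<lambda>j.
     [((Out j, Inn j), 1), ((Out j, Inn ((j + 1) mod 7)), 1),
      ((Out j, Inn ((j + 3) mod 7)), 1), ((Out j, Inn ((j - 1) mod 7)), -1)]) [0..6])))"

definition S16 :: "cyclic_vertex R_graph"
  where "S16 = (cyclic_verts 8, weight_of (concat (map (\<lambda>j.
     [((Out j, Out ((j + 1) mod 8)), 1), ((Inn j, Inn ((j + 3) mod 8)), 1),
      ((Out j, Inn ((j + 1) mod 8)), -1), ((Out j, Inn ((j - 1) mod 8)), 1)]) [0..7])))"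


subsection \<open>The small sporadic graphs\<close>

text \<open>Vertices are characters. In \<open>wt x es\<close>, a two-letter string \<open>uv\<close> in \<open>es\<close> stands for
  \<open>w(u, v) = x\<close>, and \<open>vv\<close> for the charge \<open>x\<close> at \<open>v\<close>.\<close>

definition wt :: "complex \<Rightarrow> string list \<Rightarrow> char weights"
  where "wt x es = map (\<lambda>e. ((e ! 0, e ! 1), x)) es"

definition letter_graph :: "string \<Rightarrow> char weights \<Rightarrow> char R_graph"
  where "letter_graph vs ws = (set vs, weight_of ws)"

definition S1 :: "char R_graph"
  where "S1 = letter_graph ''a'' (wt 2 [''aa''])"

definition S2 :: "char R_graph"
  where "S2 = letter_graph ''ab'' (wt 2 [''ab''])"

definition S2_dagger :: "char R_graph"
  where "S2_dagger = letter_graph ''ab''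
    (wt (-1) [''aa''] @ wt 1 [''bb''] @ wt (1 + \<omega>) [''ba''])"

definition S4_ddagger :: "char R_graph"
  where "S4_ddagger = letter_graph ''abcd''
    (wt 1 [''ab'', ''cd''] @ wt (-1 - \<omega>) [''ac''] @ wt (1 + \<omega>) [''bd''])"

definition S5 :: "char R_graph"
  where "S5 = letter_graph ''abcde''
    (wt 1 [''cc'', ''dd''] @
     wt 1 [''ce'', ''de'', ''ad'', ''bc'', ''ab''] @
     wt (-\<omega>) [''ac'', ''bd'', ''eb'', ''ea''])"

definition S6 :: "char R_graph"
  where "S6 = letter_graph ''abcdef''
    (wt 1 [''bb'', ''dd'', ''ff''] @ wt (-1) [''aa'', ''cc'', ''ee''] @
     wt 1 [''bc'', ''cf'', ''cd'', ''af'', ''be''] @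
     wt (-\<omega>) [''ba'', ''ad'', ''fe'', ''ed''])"

definition S6_dagger :: "char R_graph"
  where "S6_dagger = letter_graph ''abcdef''
    (wt 1 [''dd''] @ wt (-1) [''cc''] @
     wt 1 [''bc'', ''cf'', ''cd'', ''bf'', ''af'', ''be''] @
     wt (-1) [''ae''] @
     wt (-\<omega>) [''ba'', ''ad'', ''fe'', ''ed''])"

definition S7 :: "char R_graph"
  where "S7 = letter_graph ''abcdefg''
    (wt 1 [''aa'', ''ee'', ''ff''] @ wt (-1) [''dd''] @
     wt 1 [''ab'', ''ad'', ''cf'', ''bg'', ''de'', ''df'', ''cg'', ''eg'', ''bc''] @
     wt (-1) [''ac'', ''fg'', ''be''])"

definition S8 :: "char R_graph"
  where "S8 = letter_graph ''abcdefgh''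
    (wt 1 [''bb'', ''cc'', ''ee'', ''hh''] @ wt (-1) [''aa'', ''dd'', ''ff'', ''gg''] @
     wt 1 [''ab'', ''ae'', ''cg'', ''cd'', ''bd'', ''ef'', ''eg'', ''fh'', ''dh''] @
     wt (-1) [''ac'', ''bf'', ''gh''])"

definition S8_prime :: "char R_graph"
  where "S8_prime = letter_graph ''abcdefgh''
    (wt 1 [''bb'', ''gg''] @ wt (-1) [''aa'', ''hh''] @
     wt 1 [''ab'', ''ac'', ''ae'', ''cg'', ''bd'', ''ef'', ''gh'', ''fh'', ''dh'', ''df'', ''ce''] @
     wt (-1) [''cd'', ''bf'', ''eg''])"

end

(* A Hermitian matrix A is cyclotomic iff A^2 <= 4, that is, iff the block matrix with diagonal
   blocks 2 and off-diagonal blocks A is positive semidefinite; it is then the Gram matrix of two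
   orthogonal families of vectors of norm 2. If a row of A has norm 3 or an integral vector of
   norm 4 lies in the kernel, then a combination of these vectors can be adjoined to enlarge A.
   Once A is saturated in this sense, a row of norm 4 is orthogonal to all other rows. Entries of
   norm 3 or 4 then leave only the four smallest graphs. Otherwise all entries are units or 0 and
   the rows of norm 4 have four neighbours. If two such neighbourhoods overlap in three vertices,
   or two overlaps of size two with a third one share one vertex, a finite search that completes
   rows and columns in turn determines the rectangular unit matrix between the two sides of the
   bipartite double cover; it yields the sporadic graphs, either as the double cover itself or as
   one of its Hermitian quotients. Otherwise vertices with equal neighbourhoods pair off into
   rungs, and A embeds into a ladder T, C++ or C+-. All listed graphs satisfy A^2 = 4, which
   forces maximality. *)

theory Submission
  imports Defs "Jordan_Normal_Form.Spectral_Radius"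
begin

subsection \<open>The Eisenstein integers\<close>

text \<open>New vertices are combinations of vectors in one fixed positive semidefinite space with
  \<open>2 n\<close> coordinates, and orthogonality makes all vertices independent there. This stops
  the enlargement; the eigenvalue bound alone does not bound the size. The obstacle afterwards is
  the coupling of rows and columns in a Hermitian matrix. In the double cover a row and a column are
  scaled by independent units, so each new row can start with 1, and a step on columns is a step on
  rows of the adjoint. The coupling is restored at the end by matching columns with rows in all
  possible ways. Where a neighbourhood of size 4 meets another one, units must cancel: one common
  vertex is impossible, two force opposite signs, three force the cube roots of unity. The kernel
  condition has another use: if the four neighbours are split into two pairs, the conjugated row
  with signs + and - on the pairs is an integral vector of norm 4, and a vertex whose row does not
  annihilate it is the missing twin that completes a rung.\<close>

lemma omega_sq: "\<omega> * \<omega> = \<omega> - 1"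
  by (simp add: omega_def complex_eq_iff)

lemma cnj_omega: "cnj \<omega> = 1 - \<omega>"
  by (simp add: omega_def complex_eq_iff)

lemma R_iff: "z \<in> eisenstein_ints \<longleftrightarrow> (\<exists>a b. z = of_int a + of_int b * \<omega>)"
  by (auto simp: eisenstein_ints_def)

lemma R_add: "x \<in> eisenstein_ints \<Longrightarrow> y \<in> eisenstein_ints \<Longrightarrow> x + y \<in> eisenstein_ints"
proof -
  assume "x \<in> eisenstein_ints" "y \<in> eisenstein_ints"
  then obtain a b c d where "x = of_int a + of_int b * \<omega>" "y = of_int c + of_int d * \<omega>"
    unfolding R_iff by blast
  then have "x + y = of_int (a + c) + of_int (b + d) * \<omega>" by (simp add: algebra_simps)
  then show ?thesis unfolding R_iff by blast
qed

lemma R_mult: "x \<in> eisenstein_ints \<Longrightarrow> y \<in> eisenstein_ints \<Longrightarrow> x * y \<in> eisenstein_ints"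
proof -
  assume "x \<in> eisenstein_ints" "y \<in> eisenstein_ints"
  then obtain a b c d where *: "x = of_int a + of_int b * \<omega>" "y = of_int c + of_int d * \<omega>"
    unfolding R_iff by blast
  have "x * y = of_int a * of_int c + (of_int a * of_int d + of_int b * of_int c) * \<omega>
      + of_int b * of_int d * (\<omega> * \<omega>)"
    unfolding * by (simp add: algebra_simps)
  also have "\<dots> = of_int (a * c - b * d) + of_int (a * d + b * c + b * d) * \<omega>"
    unfolding omega_sq by (simp add: algebra_simps)
  finally show ?thesis unfolding R_iff by blast
qed

lemma R_cnj: "x \<in> eisenstein_ints \<Longrightarrow> cnj x \<in> eisenstein_ints"
proof -
  assume "x \<in> eisenstein_ints"
  then obtain a b where "x = of_int a + of_int b * \<omega>" unfolding R_iff by blast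
  then have "cnj x = of_int (a + b) + of_int (- b) * \<omega>" by (simp add: cnj_omega algebra_simps)
  then show ?thesis unfolding R_iff by blast
qed

lemma R_of_int [simp]: "of_int k \<in> eisenstein_ints"
  unfolding R_iff by (rule exI[of _ k], rule exI[of _ 0]) simp

lemma R_0 [simp]: "0 \<in> eisenstein_ints" and R_1 [simp]: "1 \<in> eisenstein_ints"
  using R_of_int[of 0] R_of_int[of 1] by simp_all

lemma R_numeral [simp]: "numeral k \<in> eisenstein_ints"
  using R_of_int[of "numeral k"] by simp

lemma R_omega [simp]: "\<omega> \<in> eisenstein_ints"
  unfolding R_iff by (rule exI[of _ 0], rule exI[of _ 1]) simp

lemma R_uminus: "x \<in> eisenstein_ints \<Longrightarrow> - x \<in> eisenstein_ints"
  using R_mult[OF R_of_int[of "-1"], of x] by simp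

lemma R_diff: "x \<in> eisenstein_ints \<Longrightarrow> y \<in> eisenstein_ints \<Longrightarrow> x - y \<in> eisenstein_ints"
  using R_add[of x "- y"] R_uminus[of y] by simp

lemma R_sum: "(\<And>i. i \<in> I \<Longrightarrow> f i \<in> eisenstein_ints) \<Longrightarrow> sum f I \<in> eisenstein_ints"
  by (induction I rule: infinite_finite_induct) (auto intro: R_add)

section \<open>Norms and units of the ring\<close>

lemma cmod_omega_form: "(cmod (of_int a + of_int b * \<omega>))\<^sup>2 = of_int (a * a + a * b + b * b)"
  unfolding cmod_power2 by (simp add: omega_def power2_eq_square algebra_simps)

lemma omega_form_0: "of_int a + of_int b * \<omega> = 0 \<longleftrightarrow> a = 0 \<and> b = (0::int)"
  by (auto simp: omega_def complex_eq_iff)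

lemma R_real_int:
  assumes "z \<in> eisenstein_ints" "cnj z = z"
  obtains k :: int where "z = of_int k"
proof -
  obtain a b where z: "z = of_int a + of_int b * \<omega>" using assms R_iff by blast
  have "Im z = of_int b * (sqrt 3 / 2)" unfolding z by (simp add: omega_def)
  moreover have "Im z = 0" using assms(2) by (simp add: complex_eq_iff)
  ultimately have "b = 0" by simp
  then show ?thesis using that z by simp
qed

text \<open>The bound on the coordinates comes from \<open>4 (a\<^sup>2 + a b + b\<^sup>2) = (2 a + b)\<^sup>2 + 3 b\<^sup>2\<close>.\<close>

lemma small_norm_coords:
  fixes a b :: int
  assumes "a * a + a * b + b * b \<le> 4"
  shows "a \<in> {-2..2}" "b \<in> {-2..2}"
proof -
  have 1: "3 * b\<^sup>2 \<le> 16" "3 * a\<^sup>2 \<le> 16"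
    using assms zero_le_power2[of "2 * a + b"] zero_le_power2[of "2 * b + a"]
    by (simp_all add: power2_eq_square algebra_simps)
  have "\<bar>x\<bar> \<le> 2" if "3 * x\<^sup>2 \<le> 16" for x :: int
  proof (rule ccontr)
    assume "\<not> ?thesis"
    then have "3\<^sup>2 \<le> \<bar>x\<bar>\<^sup>2" by (intro power_mono) auto
    then show False using that by simp
  qed
  from this[OF 1(1)] this[OF 1(2)] show "a \<in> {-2..2}" "b \<in> {-2..2}" by auto
qed

lemma interval_m2_2: "{-2..2::int} = {-2,-1,0,1,2}" by auto

text \<open>The form \<open>a * a + a * b + b * b\<close> does not represent 2; the coordinate bound
  leaves 25 pairs to inspect.\<close>

lemma R_norm_values:
  assumes "z \<in> eisenstein_ints" "(cmod z)\<^sup>2 \<le> 4"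
  shows "(cmod z)\<^sup>2 \<in> {0, 1, 3, 4}"
proof -
  obtain a b where z: "z = of_int a + of_int b * \<omega>" using assms R_iff by blast
  have *: "(cmod z)\<^sup>2 = of_int (a * a + a * b + b * b)" unfolding z by (rule cmod_omega_form)
  then have 4: "a * a + a * b + b * b \<le> 4" using assms(2) by (metis of_int_le_iff of_int_numeral)
  have "a * a + a * b + b * b \<in> {0, 1, 3, 4}"
    using small_norm_coords[OF 4] 4 unfolding interval_m2_2 by auto
  then have "real_of_int (a * a + a * b + b * b) \<in> real_of_int ` {0, 1, 3, 4}" by (rule imageI)
  then show ?thesis unfolding * by (simp only: image_insert image_empty of_int_0 of_int_1 of_int_numeral)
qed

text \<open>These are the powers of \<omega>, a primitive sixth root of unity, in the order of their
  exponents.\<close>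

definition eisenstein_units :: "complex set"
  where "eisenstein_units = {1, \<omega>, \<omega> - 1, -1, - \<omega>, 1 - \<omega>}"

lemma R_unit_iff: "z \<in> eisenstein_ints \<and> cmod z = 1 \<longleftrightarrow> z \<in> eisenstein_units"
proof
  assume "z \<in> eisenstein_ints \<and> cmod z = 1"
  then obtain a b where z: "z = of_int a + of_int b * \<omega>" and 1: "cmod z = 1" using R_iff by blast
  have "(cmod z)\<^sup>2 = of_int (a * a + a * b + b * b)" unfolding z by (rule cmod_omega_form)
  then have 2: "a * a + a * b + b * b = 1" using 1 by (metis of_int_eq_1_iff one_power2)
  have "(a, b) \<in> {(1,0), (0,1), (-1,1), (-1,0), (0,-1), (1,-1)}"
    using small_norm_coords[of a b] 2 unfolding interval_m2_2 by auto
  then show "z \<in> eisenstein_units" unfolding z eisenstein_units_def by auto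
next
  have "cmod (of_int a + of_int b * \<omega>) = 1" if "a * a + a * b + b * b = 1" for a b :: int
    using cmod_omega_form[of a b] that by (simp add: power2_eq_1_iff) (smt (verit) norm_ge_zero)
  from this[of 0 1] this[of "-1" 1] have "cmod \<omega> = 1" "cmod (\<omega> - 1) = 1" by simp_all
  then have "cmod z = 1" if "z \<in> eisenstein_units"
    using that norm_minus_commute[of 1 \<omega>] unfolding eisenstein_units_def by auto
  moreover have "z \<in> eisenstein_ints" if "z \<in> eisenstein_units"
    using that unfolding eisenstein_units_def by (auto intro: R_diff R_uminus)
  moreover assume "z \<in> eisenstein_units"
  ultimately show "z \<in> eisenstein_ints \<and> cmod z = 1" by blast
qed

lemma unit_R: "u \<in> eisenstein_units \<Longrightarrow> u \<in> eisenstein_ints"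
  and unit_cmod: "u \<in> eisenstein_units \<Longrightarrow> cmod u = 1"
  using R_unit_iff by blast+

lemma unit_mult: "u \<in> eisenstein_units \<Longrightarrow> v \<in> eisenstein_units \<Longrightarrow> u * v \<in> eisenstein_units"
  and unit_cnj: "u \<in> eisenstein_units \<Longrightarrow> cnj u \<in> eisenstein_units"
  and unit_uminus: "u \<in> eisenstein_units \<Longrightarrow> - u \<in> eisenstein_units"
  by (auto simp flip: R_unit_iff simp: R_mult R_cnj R_uminus norm_mult)

lemma unit_1 [simp]: "1 \<in> eisenstein_units" by (simp add: eisenstein_units_def)

lemma unit_cnj_mult: "u \<in> eisenstein_units \<Longrightarrow> u * cnj u = 1" "u \<in> eisenstein_units \<Longrightarrow> cnj u * u = 1"
  using unit_cmod[of u] complex_norm_square[of u] by (auto simp: mult.commute)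

lemma unit_nz: "u \<in> eisenstein_units \<Longrightarrow> u \<noteq> 0" using unit_cmod by force

subsection \<open>Hermitian weight functions\<close>

definition herm :: "'v set \<Rightarrow> ('v \<Rightarrow> 'v \<Rightarrow> complex) \<Rightarrow> bool"
  where "herm V A \<longleftrightarrow> (\<forall>i\<in>V. \<forall>j\<in>V. A i j \<in> eisenstein_ints \<and> A j i = cnj (A i j))"

text \<open>The eigenvalue condition as a bound on the operator norm, a form that can be tested on
  individual vectors such as rows.\<close>

definition bounded_by_2 :: "'v set \<Rightarrow> ('v \<Rightarrow> 'v \<Rightarrow> complex) \<Rightarrow> bool"
  where "bounded_by_2 V A \<longleftrightarrow>
    (\<forall>q. (\<Sum>i\<in>V. (cmod (\<Sum>j\<in>V. A i j * q j))\<^sup>2) \<le> 4 * (\<Sum>i\<in>V. (cmod (q i))\<^sup>2))"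

text \<open>Closed sets replace paths: \<open>V\<close> is identified by exhibiting one nonempty set
  that no edge leaves.\<close>

definition connected_on :: "'v set \<Rightarrow> ('v \<Rightarrow> 'v \<Rightarrow> complex) \<Rightarrow> bool"
  where "connected_on V A \<longleftrightarrow> V \<noteq> {} \<and>
    (\<forall>X \<subseteq> V. X \<noteq> {} \<longrightarrow> (\<forall>i\<in>X. \<forall>j\<in>V. A i j \<noteq> 0 \<longrightarrow> j \<in> X) \<longrightarrow> X = V)"

text \<open>For Hermitian \<open>A\<close> the last condition is A^2 = 4: each row has used up the
  norm that the bound allows.\<close>

definition complete_on :: "'v set \<Rightarrow> ('v \<Rightarrow> 'v \<Rightarrow> complex) \<Rightarrow> bool"
  where "complete_on V A \<longleftrightarrow> finite V \<and> herm V A \<and> connected_on V A \<and>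
    (\<forall>i\<in>V. \<forall>j\<in>V. (\<Sum>k\<in>V. A i k * cnj (A j k)) = (if i = j then 4 else 0))"

lemma hermD: "herm V A \<Longrightarrow> i \<in> V \<Longrightarrow> j \<in> V \<Longrightarrow> A i j \<in> eisenstein_ints"
  "herm V A \<Longrightarrow> i \<in> V \<Longrightarrow> j \<in> V \<Longrightarrow> A j i = cnj (A i j)"
  unfolding herm_def by blast+

section \<open>From eigenvalues to the operator norm\<close>

lemma cauchy_schwarz_real:
  fixes a b :: "'a \<Rightarrow> real"
  shows "(\<Sum>x\<in>S. a x * b x)\<^sup>2 \<le> (\<Sum>x\<in>S. (a x)\<^sup>2) * (\<Sum>x\<in>S. (b x)\<^sup>2)"
proof -
  \<comment> \<open>Lagrange's identity: twice the defect in Cauchy-Schwarz is a sum of squares of 2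
    by 2 minors.\<close>
  have "0 \<le> (\<Sum>x\<in>S. \<Sum>y\<in>S. (a x * b y - a y * b x)\<^sup>2)" by (intro sum_nonneg) auto
  also have "\<dots> = (\<Sum>x\<in>S. \<Sum>y\<in>S. (a x)\<^sup>2 * (b y)\<^sup>2 + (b x)\<^sup>2 * (a y)\<^sup>2 - 2 * ((a x * b x) * (a y * b y)))"
    by (simp add: power2_eq_square algebra_simps)
  also have "\<dots> = 2 * ((\<Sum>x\<in>S. (a x)\<^sup>2) * (\<Sum>x\<in>S. (b x)\<^sup>2)) - 2 * (\<Sum>x\<in>S. a x * b x)\<^sup>2"
    unfolding sum.distrib sum_subtractf sum_distrib_left[symmetric] sum_distrib_right[symmetric]
    by (simp add: power2_eq_square mult.commute)
  finally show ?thesis by simp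
qed

lemma cauchy_schwarz:
  fixes f g :: "'a \<Rightarrow> complex"
  shows "(cmod (\<Sum>x\<in>S. f x * g x))\<^sup>2 \<le> (\<Sum>x\<in>S. (cmod (f x))\<^sup>2) * (\<Sum>x\<in>S. (cmod (g x))\<^sup>2)"
proof -
  have "cmod (\<Sum>x\<in>S. f x * g x) \<le> (\<Sum>x\<in>S. cmod (f x) * cmod (g x))"
    by (rule order_trans[OF norm_sum]) (simp add: norm_mult)
  then have "(cmod (\<Sum>x\<in>S. f x * g x))\<^sup>2 \<le> (\<Sum>x\<in>S. cmod (f x) * cmod (g x))\<^sup>2"
    by (intro power_mono) auto
  also have "\<dots> \<le> (\<Sum>x\<in>S. (cmod (f x))\<^sup>2) * (\<Sum>x\<in>S. (cmod (g x))\<^sup>2)" by (rule cauchy_schwarz_real)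
  finally show ?thesis .
qed

lemma exp_not_poly_bounded:
  fixes r a c1 c2 :: real
  assumes "1 < r" "0 < a" and b: "\<And>k. a * r ^ k \<le> (c1 + c2 * real k ^ m)\<^sup>2 * d"
  shows False
proof -
  \<comment> \<open>The polynomial bound is squared, so r^k is split evenly and each factor of the
    square is divided by t^k.\<close>
  define t where "t = sqrt r"
  have t: "1 < t" "r = t\<^sup>2" using assms(1) by (auto simp: t_def)
  have pow: "(\<lambda>k. real k ^ j * (1 / t) ^ k) \<longlonglongrightarrow> 0" for j
  proof (cases "j = 0")
    case True
    then show ?thesis using LIMSEQ_power_zero[of "1 / t"] t by simp
  next
    case False
    \<comment> \<open>With this root, k^j (1/t)^k is the j-th power of k (1/s)^k, which tends to
      0.\<close>
    define s where "s = root j t"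
    have s: "1 < s" "s ^ j = t" using t(1) False by (auto simp: s_def)
    have "(\<lambda>k. (of_nat k * (1 / s) ^ k) ^ j) \<longlonglongrightarrow> 0 ^ j"
      using s(1) by (intro tendsto_power powser_times_n_limit_0) auto
    moreover have "(of_nat k * (1 / s) ^ k) ^ j = real k ^ j * (1 / t) ^ k" for k
      unfolding power_mult_distrib power_mult[symmetric] mult.commute[of k]
      unfolding power_mult by (simp add: power_one_over s(2))
    ultimately show ?thesis using False by (simp only: zero_power)
  qed
  have "(\<lambda>k. (c1 * (real k ^ 0 * (1 / t) ^ k) + c2 * (real k ^ m * (1 / t) ^ k))\<^sup>2 * d)
      \<longlonglongrightarrow> (c1 * 0 + c2 * 0)\<^sup>2 * d"
    by (intro tendsto_intros pow)
  moreover have "(c1 * (real k ^ 0 * (1 / t) ^ k) + c2 * (real k ^ m * (1 / t) ^ k))\<^sup>2 * d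
      = (c1 + c2 * real k ^ m)\<^sup>2 * d / r ^ k" for k
    unfolding t(2) power_mult[symmetric] mult.commute[of 2]
    using t(1) by (simp add: power_mult power_one_over field_simps power2_eq_square)
  ultimately have lim: "(\<lambda>k. (c1 + c2 * real k ^ m)\<^sup>2 * d / r ^ k) \<longlonglongrightarrow> 0" by simp
  have "a \<le> 0"
  proof (rule LIMSEQ_le_const[OF lim], intro exI allI impI)
    fix k :: nat
    show "a \<le> (c1 + c2 * real k ^ m)\<^sup>2 * d / r ^ k" using b[of k] assms(1) by (simp add: pos_le_divide_eq)
  qed
  then show False using assms(2) by simp
qed

text \<open>A Hermitian matrix has log-convex norms \<open>\<parallel>B\<^sup>k q\<parallel>\<close>; if \<open>\<parallel>B q\<parallel> > \<parallel>q\<parallel>\<close>, they would grow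
  exponentially, whereas spectral radius at most 1 permits only polynomial growth.\<close>

lemma spectral_bound:
  fixes B :: "complex mat"
  assumes B: "B \<in> carrier_mat n n" and sym: "\<And>i j. i < n \<Longrightarrow> j < n \<Longrightarrow> B $$ (j, i) = cnj (B $$ (i, j))"
    and ev: "\<And>k. eigenvalue B k \<Longrightarrow> cmod k \<le> 1"
  shows "(\<Sum>i<n. (cmod (\<Sum>j<n. B $$ (i, j) * q j))\<^sup>2) \<le> (\<Sum>i<n. (cmod (q i))\<^sup>2)"
proof (rule ccontr)
  define v where "v = vec n q"
  define x where "x k = (B ^\<^sub>m k) *\<^sub>v v" for k
  define f where "f k = (\<Sum>i<n. (cmod (x k $ i))\<^sup>2)" for k
  assume neg: "\<not> ?thesis"
  then have n: "n > 0" by (cases n) auto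
  have v: "v \<in> carrier_vec n" by (simp add: v_def)
  have Bk: "B ^\<^sub>m k \<in> carrier_mat n n" for k using B by (rule pow_carrier_mat)
  have x: "x k \<in> carrier_vec n" for k unfolding x_def using Bk v by (rule mult_mat_vec_carrier)
  have "x (Suc k) = B *\<^sub>v x k" for k
  proof -
    have "B ^\<^sub>m Suc k = B * B ^\<^sub>m k"
      by (induction k) (use B in \<open>auto simp: assoc_mult_mat[OF _ Bk, symmetric]
        assoc_mult_mat[OF B Bk B]\<close>)
    then show ?thesis unfolding x_def using assoc_mult_mat_vec[OF B Bk v] by simp
  qed
  then have step: "x (Suc k) $ i = (\<Sum>j<n. B $$ (i, j) * x k $ j)" if "i < n" for k i
    using that B x[of k] by (simp add: scalar_prod_def atLeast0LessThan)
  have x0: "x 0 $ i = q i" if "i < n" for i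
    using that B v unfolding x_def by (simp add: v_def)
  \<comment> \<open>By symmetry the squared norm of \<open>x (Suc k)\<close> is the inner product of
    \<open>x k\<close> with \<open>x (Suc (Suc k))\<close>; Cauchy-Schwarz then gives
    log-convexity.\<close>
  have conv: "(f (Suc k))\<^sup>2 \<le> f k * f (Suc (Suc k))" for k
  proof -
    have "of_real (f (Suc k)) = (\<Sum>i<n. x (Suc k) $ i * cnj (x (Suc k) $ i))"
      by (simp add: f_def complex_norm_square flip: of_real_power)
    also have "\<dots> = (\<Sum>i<n. \<Sum>j<n. B $$ (i, j) * x k $ j * cnj (x (Suc k) $ i))"
      by (simp add: step sum_distrib_right)
    also have "\<dots> = (\<Sum>j<n. \<Sum>i<n. B $$ (i, j) * x k $ j * cnj (x (Suc k) $ i))"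
      by (rule sum.swap)
    also have "\<dots> = (\<Sum>j<n. \<Sum>i<n. x k $ j * cnj (B $$ (j, i) * x (Suc k) $ i))"
    proof (rule sum.cong[OF refl], rule sum.cong[OF refl])
      fix i j assume "i \<in> {..<n}" "j \<in> {..<n}"
      then have s: "B $$ (j, i) = cnj (B $$ (i, j))" by (intro sym) auto
      show "B $$ (j, i) * x k $ i * cnj (x (Suc k) $ j) = x k $ i * cnj (B $$ (i, j) * x (Suc k) $ j)"
        unfolding s by (simp add: mult_ac)
    qed
    also have "\<dots> = (\<Sum>j<n. x k $ j * cnj (x (Suc (Suc k)) $ j))"
      by (simp add: step sum_distrib_left)
    finally have "(cmod (of_real (f (Suc k))))\<^sup>2 \<le> (\<Sum>j<n. (cmod (x k $ j))\<^sup>2) *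
        (\<Sum>j<n. (cmod (cnj (x (Suc (Suc k)) $ j)))\<^sup>2)"
      by (simp only: cauchy_schwarz)
    then show ?thesis unfolding f_def[symmetric] by (simp add: f_def[of "Suc (Suc _)"])
  qed
  have f1: "f (Suc 0) > f 0"
  proof -
    have "x (Suc 0) $ i = (\<Sum>j<n. B $$ (i, j) * q j)" if "i < n" for i
      unfolding step[OF that] by (rule sum.cong) (simp_all add: x0)
    then show ?thesis using neg unfolding f_def by (simp add: x0)
  qed
  have f00: "f k \<ge> 0" for k unfolding f_def by (simp add: sum_nonneg)
  have f0: "f 0 > 0"
  proof (rule ccontr)
    assume "\<not> ?thesis"
    then have "f 0 = 0" using f00[of 0] by simp
    then show False using conv[of 0] f1 by simp
  qed
  \<comment> \<open>By log-convexity the successive ratios of \<open>f\<close> do not decrease, so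
    the first one bounds them all from below.\<close>
  define r where "r = f (Suc 0) / f 0"
  have r: "1 < r" using f0 f1 by (simp add: r_def)
  have grow: "f k > 0 \<and> f (Suc k) \<ge> r * f k" for k
  proof (induction k)
    case 0
    then show ?case using f0 by (simp add: r_def)
  next
    case (Suc k)
    then have pos: "f (Suc k) > 0" using r by (smt (verit) mult_pos_pos)
    have "f k * (r * f (Suc k)) = (r * f k) * f (Suc k)" by simp
    also have "\<dots> \<le> f (Suc k) * f (Suc k)" using Suc pos by (intro mult_right_mono) auto
    also have "\<dots> \<le> f k * f (Suc (Suc k))" using conv[of k] by (simp add: power2_eq_square)
    finally show ?case using Suc pos by simp
  qed
  have exp: "f 0 * r ^ k \<le> f k" for k
  proof (induction k)
    case (Suc k)
    have "f 0 * r ^ Suc k = r * (f 0 * r ^ k)" by simp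
    also have "\<dots> \<le> r * f k" using Suc r by (intro mult_left_mono) auto
    also have "\<dots> \<le> f (Suc k)" using grow by blast
    finally show ?case .
  qed simp
  have "spectral_radius B \<le> 1"
    using spectral_radius_mem_max(1)[OF B n] ev by (auto simp: spectrum_def)
  \<comment> \<open>Jordan blocks of size at most \<open>n\<close> with eigenvalues in the unit disc
    have powers growing at most like k^(n-1).\<close>
  from spectral_radius_jnf_norm_bound_le_1_upper_triangular[OF B this]
  obtain c1 c2 where c: "\<And>k. norm_bound (B ^\<^sub>m k) (c1 + c2 * of_nat k ^ (n - 1))" by blast
  define d where "d = of_nat n * (\<Sum>j<n. cmod (q j))\<^sup>2"
  have "f k \<le> (c1 + c2 * real k ^ (n - 1))\<^sup>2 * d" for k
  proof -
    have "cmod (x k $ i) \<le> (c1 + c2 * real k ^ (n - 1)) * (\<Sum>j<n. cmod (q j))" if i: "i < n" for i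
    proof -
      have "x k $ i = (\<Sum>j<n. (B ^\<^sub>m k) $$ (i, j) * q j)"
        using carrier_matD[OF Bk[of k]] i by (simp add: x_def scalar_prod_def v_def atLeast0LessThan)
      also have "cmod \<dots> \<le> (\<Sum>j<n. cmod ((B ^\<^sub>m k) $$ (i, j) * q j))" by (rule norm_sum)
      also have "\<dots> \<le> (\<Sum>j<n. (c1 + c2 * real k ^ (n - 1)) * cmod (q j))"
      proof (rule sum_mono)
        fix j assume "j \<in> {..<n}"
        then have "cmod ((B ^\<^sub>m k) $$ (i, j)) \<le> c1 + c2 * real k ^ (n - 1)"
          using c[of k] carrier_matD[OF Bk[of k]] i unfolding norm_bound_def by simp
        then show "cmod ((B ^\<^sub>m k) $$ (i, j) * q j) \<le> (c1 + c2 * real k ^ (n - 1)) * cmod (q j)"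
          unfolding norm_mult by (rule mult_right_mono) simp
      qed
      finally show ?thesis by (simp add: sum_distrib_left)
    qed
    then have "(cmod (x k $ i))\<^sup>2 \<le> ((c1 + c2 * real k ^ (n - 1)) * (\<Sum>j<n. cmod (q j)))\<^sup>2" if "i < n" for i
      using that by (intro power_mono) auto
    then have "f k \<le> (\<Sum>i<n. ((c1 + c2 * real k ^ (n - 1)) * (\<Sum>j<n. cmod (q j)))\<^sup>2)"
      unfolding f_def by (intro sum_mono) auto
    then show ?thesis by (simp add: d_def power_mult_distrib mult_ac)
  qed
  then have "f 0 * r ^ k \<le> (c1 + c2 * real k ^ (n - 1))\<^sup>2 * d" for k using exp[of k] by (rule order_trans[rotated])
  from exp_not_poly_bounded[OF r f0 this] show False .
qed

text \<open>The test vector is the conjugate of row \<open>i\<close>. Its image has the norm w of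
  the row as \<open>i\<close>-th coordinate, so w^2 <= 4 w; if w = 4, this coordinate exhausts the
  bound and all the others vanish.\<close>

lemma row_bound:
  assumes "finite V" "herm V A" "bounded_by_2 V A" "i \<in> V"
  shows "(\<Sum>j\<in>V. (cmod (A i j))\<^sup>2) \<le> 4"
    and "(\<Sum>j\<in>V. (cmod (A i j))\<^sup>2) = 4 \<Longrightarrow> k \<in> V \<Longrightarrow> k \<noteq> i \<Longrightarrow> (\<Sum>j\<in>V. A k j * cnj (A i j)) = 0"
proof -
  define w where "w = (\<Sum>j\<in>V. (cmod (A i j))\<^sup>2)"
  define s where "s k = (\<Sum>j\<in>V. A k j * cnj (A i j))" for k
  have si: "s i = of_real w"
    unfolding s_def w_def by (simp add: complex_norm_square flip: of_real_power)
  have w0: "w \<ge> 0" unfolding w_def by (simp add: sum_nonneg)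
  have "(\<Sum>k\<in>V. (cmod (s k))\<^sup>2) \<le> 4 * (\<Sum>j\<in>V. (cmod (cnj (A i j)))\<^sup>2)"
    unfolding s_def by (rule assms(3)[unfolded bounded_by_2_def, THEN spec])
  then have b: "(\<Sum>k\<in>V. (cmod (s k))\<^sup>2) \<le> 4 * w" by (simp add: w_def)
  have "(cmod (s i))\<^sup>2 \<le> (\<Sum>k\<in>V. (cmod (s k))\<^sup>2)"
    using assms(1,4) by (intro member_le_sum) auto
  then have "w\<^sup>2 \<le> 4 * w" using b si w0 by simp
  then show "w \<le> 4" using w0 by (cases "w = 0") (auto simp: power2_eq_square)
  show "s k = 0" if "w = 4" "k \<in> V" "k \<noteq> i"
  proof -
    have "(\<Sum>k\<in>{i, k}. (cmod (s k))\<^sup>2) \<le> (\<Sum>k\<in>V. (cmod (s k))\<^sup>2)"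
      using assms(1,4) that by (intro sum_mono2) auto
    then have "(cmod (s i))\<^sup>2 + (cmod (s k))\<^sup>2 \<le> 16" using b that by simp
    then show ?thesis using si that by simp
  qed
qed

subsection \<open>Transfer to matrices\<close>

lemma mat_adjoint_index:
  assumes "A \<in> carrier_mat n n" "i < n" "j < n"
  shows "mat_adjoint A $$ (i, j) = cnj (A $$ (j, i))"
  using assms by (auto simp: mat_adjoint_def mat_of_rows_def)

lemma mat_adjoint_carrier: "A \<in> carrier_mat n n \<Longrightarrow> mat_adjoint A \<in> carrier_mat n n"
  by (auto simp: mat_adjoint_def mat_of_rows_def)

lemma smult_mat_vec:
  fixes A :: "'a :: comm_semiring_0 mat"
  assumes "A \<in> carrier_mat n m" "v \<in> carrier_vec m"
  shows "(k \<cdot>\<^sub>m A) *\<^sub>v v = k \<cdot>\<^sub>v (A *\<^sub>v v)"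
  using assms by (intro eq_vecI) (auto simp: scalar_prod_def sum_distrib_left mult.assoc intro!: sum.cong)

lemma cyclotomic_herm_bounded:
  assumes "cyclotomic A" "A \<in> carrier_mat n n"
  shows "herm {..<n} (\<lambda>i j. A $$ (i, j))" "bounded_by_2 {..<n} (\<lambda>i j. A $$ (i, j))"
proof -
  have sym: "A $$ (j, i) = cnj (A $$ (i, j))" if "i < n" "j < n" for i j
    using assms that mat_adjoint_index[of A n j i] unfolding cyclotomic_def hermitian_mat_def by simp
  have "A $$ (i, j) \<in> eisenstein_ints" if "i < n" "j < n" for i j
  proof -
    have "A $$ (i, j) \<in> elements_mat A" using elements_matI[OF assms(2) that refl] .
    then show ?thesis using assms(1) unfolding cyclotomic_def R_matrix_def by blast
  qed
  then show "herm {..<n} (\<lambda>i j. A $$ (i, j))" using sym unfolding herm_def lessThan_iff by blast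
  \<comment> \<open>Halving moves the spectrum into the unit disc required by
    \<open>spectral_bound\<close>.\<close>
  define B where "B = (1 / 2) \<cdot>\<^sub>m A"
  have B: "B \<in> carrier_mat n n" "\<And>i j. i < n \<Longrightarrow> j < n \<Longrightarrow> B $$ (i, j) = A $$ (i, j) / 2"
    using assms(2) by (auto simp: B_def)
  have ev: "cmod k \<le> 1" if "eigenvalue B k" for k
  proof -
    obtain v where v: "v \<in> carrier_vec n" "v \<noteq> 0\<^sub>v n" "B *\<^sub>v v = k \<cdot>\<^sub>v v"
      using \<open>eigenvalue B k\<close> B(1) unfolding eigenvalue_def eigenvector_def by auto
    have "A = 2 \<cdot>\<^sub>m B" unfolding B_def by (intro eq_matI) auto
    then have "A *\<^sub>v v = (2 * k) \<cdot>\<^sub>v v" using v B(1) by (simp add: smult_mat_vec[OF B(1)] smult_smult_assoc)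
    then have "eigenvalue A (2 * k)" using v assms(2) unfolding eigenvalue_def eigenvector_def by auto
    then obtain x where "2 * k = complex_of_real x" "x \<in> {-2..2}" using assms(1) unfolding cyclotomic_def by auto
    then have "cmod (2 * k) \<le> 2" by (simp add: abs_le_iff)
    then show ?thesis by (simp add: norm_mult)
  qed
  show "bounded_by_2 {..<n} (\<lambda>i j. A $$ (i, j))"
    unfolding bounded_by_2_def
  proof
    fix q
    have "(\<Sum>i<n. (cmod (\<Sum>j<n. B $$ (i, j) * q j))\<^sup>2) \<le> (\<Sum>i<n. (cmod (q i))\<^sup>2)"
    proof (rule spectral_bound[OF B(1) _ ev])
      fix i j assume "i < n" "j < n"
      then show "B $$ (j, i) = cnj (B $$ (i, j))" using sym[of i j] by (simp add: B(2))
    qed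
    moreover have "(cmod (\<Sum>j<n. A $$ (i, j) * q j))\<^sup>2 = 4 * (cmod (\<Sum>j<n. B $$ (i, j) * q j))\<^sup>2"
      if "i < n" for i
      using that by (simp add: B(2) norm_divide power_divide flip: sum_divide_distrib)
    ultimately show "(\<Sum>i<n. (cmod (\<Sum>j<n. A $$ (i, j) * q j))\<^sup>2) \<le> 4 * (\<Sum>i<n. (cmod (q i))\<^sup>2)"
      by (simp flip: sum_distrib_left)
  qed
qed

lemma indecomposable_connected:
  assumes "indecomposable A" "A \<in> carrier_mat n n"
  shows "connected_on {..<n} (\<lambda>i j. A $$ (i, j))"
proof -
  have "X = {..<n}" if X: "X \<subseteq> {..<n}" "X \<noteq> {}"
      "\<forall>i\<in>X. \<forall>j\<in>{..<n}. A $$ (i, j) \<noteq> 0 \<longrightarrow> j \<in> X" for X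
  proof -
    obtain u where u: "u \<in> X" using X by blast
    have "v \<in> X" if "v < n" for v
    proof -
      have "(u, v) \<in> (adjacency A)\<^sup>*" using assms u X(1) \<open>v < n\<close> unfolding indecomposable_def by auto
      then show ?thesis
        by (induction rule: rtrancl_induct) (use u X assms(2) in \<open>auto simp: adjacency_def\<close>)
    qed
    then show ?thesis using X(1) by auto
  qed
  then show ?thesis using assms unfolding connected_on_def indecomposable_def by auto
qed

lemma connected_on_cong:
  assumes "\<And>i j. i \<in> V \<Longrightarrow> j \<in> V \<Longrightarrow> A i j = B i j"
  shows "connected_on V A \<longleftrightarrow> connected_on V B"
proof -
  have "(\<forall>i\<in>X. \<forall>j\<in>V. A i j \<noteq> 0 \<longrightarrow> j \<in> X) \<longleftrightarrow> (\<forall>i\<in>X. \<forall>j\<in>V. B i j \<noteq> 0 \<longrightarrow> j \<in> X)" if "X \<subseteq> V" for X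
    using assms that by (metis subsetD)
  then show ?thesis unfolding connected_on_def by auto
qed

lemma connected_indecomposable:
  assumes "connected_on {..<n} (\<lambda>i j. A $$ (i, j))" "A \<in> carrier_mat n n"
  shows "indecomposable A"
proof -
  have "(u, v) \<in> (adjacency A)\<^sup>*" if "u < n" "v < n" for u v
  proof -
    define X where "X = {v. v < n \<and> (u, v) \<in> (adjacency A)\<^sup>*}"
    have "j \<in> X" if "i \<in> X" "j < n" "A $$ (i, j) \<noteq> 0" for i j
    proof (cases "i = j")
      case False
      then have "(i, j) \<in> adjacency A" using that assms(2) by (simp add: adjacency_def X_def)
      then show ?thesis using rtrancl_into_rtrancl[of u i "adjacency A" j] that by (simp add: X_def)
    qed (use that in simp)
    then have "\<forall>i\<in>X. \<forall>j\<in>{..<n}. A $$ (i, j) \<noteq> 0 \<longrightarrow> j \<in> X" by simp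
    moreover have "X \<subseteq> {..<n}" "u \<in> X" using \<open>u < n\<close> by (auto simp: X_def)
    ultimately have "X = {..<n}" using assms(1) unfolding connected_on_def by blast
    then show ?thesis using \<open>v < n\<close> by (auto simp: X_def)
  qed
  then show ?thesis using assms unfolding indecomposable_def connected_on_def by auto
qed

text \<open>The square of the matrix is 4, so every eigenvalue is 2 or -2.\<close>

lemma complete_cyclotomic:
  assumes "complete_on {..<n} B"
  shows "cyclotomic (mat n n (\<lambda>(i, j). B i j))" (is "cyclotomic ?M")
proof -
  have h: "herm {..<n} B" and sq: "\<And>i j. i < n \<Longrightarrow> j < n \<Longrightarrow> (\<Sum>k<n. B i k * cnj (B j k)) = (if i = j then 4 else 0)"
    using assms unfolding complete_on_def by auto
  have M: "?M \<in> carrier_mat n n" by simp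
  have "mat_adjoint ?M = ?M"
  proof (rule eq_matI)
    fix i j assume "i < dim_row ?M" "j < dim_col ?M"
    then have ij: "i < n" "j < n" by auto
    have "cnj (B j i) = B i j" using hermD(2)[OF h, of j i] ij by simp
    then show "mat_adjoint ?M $$ (i, j) = ?M $$ (i, j)" unfolding mat_adjoint_index[OF M ij] using ij by simp
  qed (use mat_adjoint_carrier[OF M] in auto)
  then have "hermitian_mat ?M" unfolding hermitian_mat_def by simp
  moreover have "R_matrix ?M" unfolding R_matrix_def
  proof
    fix a assume "a \<in> elements_mat ?M"
    then obtain i j where "i < n" "j < n" "a = B i j" unfolding elements_mat_def by auto
    then show "a \<in> eisenstein_ints" using hermD(1)[OF h] by simp
  qed
  moreover have "k \<in> complex_of_real ` {-2..2}" if "eigenvalue ?M k" for k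
  proof -
    obtain v where v: "v \<in> carrier_vec n" "v \<noteq> 0\<^sub>v n" "?M *\<^sub>v v = k \<cdot>\<^sub>v v"
      using \<open>eigenvalue ?M k\<close> unfolding eigenvalue_def eigenvector_def by auto
    have "?M * ?M = 4 \<cdot>\<^sub>m 1\<^sub>m n"
    proof (rule eq_matI)
      fix i j assume "i < dim_row (4 \<cdot>\<^sub>m 1\<^sub>m n :: complex mat)" "j < dim_col (4 \<cdot>\<^sub>m 1\<^sub>m n :: complex mat)"
      then have ij: "i < n" "j < n" by auto
      have "(?M * ?M) $$ (i, j) = (\<Sum>k<n. B i k * B k j)"
        using ij by (simp add: scalar_prod_def atLeast0LessThan)
      also have "\<dots> = (\<Sum>k<n. B i k * cnj (B j k))"
      proof (rule sum.cong[OF refl])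
        fix k assume "k \<in> {..<n}"
        then have "B k j = cnj (B j k)" by (intro hermD(2)[OF h]) (use ij in auto)
        then show "B i k * B k j = B i k * cnj (B j k)" by simp
      qed
      finally show "(?M * ?M) $$ (i, j) = (4 \<cdot>\<^sub>m 1\<^sub>m n) $$ (i, j)"
        using sq[OF ij] ij by auto
    qed auto
    then have "?M *\<^sub>v (?M *\<^sub>v v) = 4 \<cdot>\<^sub>v v"
      using v(1) by (simp flip: assoc_mult_mat_vec[OF M M v(1)] add: smult_mat_vec[of _ n n])
    then have kk: "(k * k) \<cdot>\<^sub>v v = 4 \<cdot>\<^sub>v v"
      using v M by (simp add: mult_mat_vec smult_smult_assoc)
    obtain i where i: "i < n" "v $ i \<noteq> 0" using v(1,2) by (metis carrier_vecD eq_vecI index_zero_vec)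
    have "k * k * v $ i = 4 * v $ i" using arg_cong[OF kk, of "\<lambda>x. x $ i"] i v(1) by simp
    then have "(k - 2) * (k + 2) = 0" using i(2) by (simp add: algebra_simps)
    then have "k = 2 \<or> k = - 2" by (simp add: add_eq_0_iff2)
    then have "k = complex_of_real 2 \<or> k = complex_of_real (- 2)" by simp
    moreover have "complex_of_real 2 \<in> complex_of_real ` {-2..2}" by (rule imageI) simp
    moreover have "complex_of_real (- 2) \<in> complex_of_real ` {-2..2}" by (rule imageI) simp
    ultimately show ?thesis by (elim disjE) (simp_all only:)
  qed
  ultimately show ?thesis unfolding cyclotomic_def by blast
qed

text \<open>Inside a larger cyclotomic matrix the rows still have norm at most 4, which they attain
  already. Hence nothing outside the index set is joined to it, and connectedness leaves no room for
  further vertices.\<close>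

lemma complete_maximal:
  assumes "complete_on {..<n} B"
  shows "maximal_cyclotomic (mat n n (\<lambda>(i, j). B i j))" (is "maximal_cyclotomic ?M")
proof -
  have sq: "\<And>i. i < n \<Longrightarrow> (\<Sum>k<n. B i k * cnj (B i k)) = 4" and c: "connected_on {..<n} B"
    using assms unfolding complete_on_def by auto
  have "indecomposable ?M"
  proof (rule connected_indecomposable[of n])
    have "connected_on {..<n} (\<lambda>i j. ?M $$ (i, j)) \<longleftrightarrow> connected_on {..<n} B"
      by (rule connected_on_cong) simp
    then show "connected_on {..<n} (\<lambda>i j. ?M $$ (i, j))" using c by blast
  qed simp
  moreover have False if C: "cyclotomic C" "indecomposable C" and p: "proper_principal_submatrix ?M C" for C
  proof -
    define N where "N = dim_row C"
    have CN: "C \<in> carrier_mat N N"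
      using C(1) unfolding cyclotomic_def hermitian_mat_def N_def square_mat.simps by auto
    obtain I where I: "I \<subset> {..<N}" "?M = submatrix C I I" using p unfolding proper_principal_submatrix_def N_def by blast
    have fin: "finite I" using I(1) finite_subset by blast
    have Ieq: "{i. i < N \<and> i \<in> I} = I" using I(1) by auto
    have nI: "n = card I" using arg_cong[OF I(2), of dim_row] CN by (simp add: dim_submatrix Ieq)
    have idx: "B (card {a \<in> I. a < i}) (card {a \<in> I. a < j}) = C $$ (i, j)" if "i \<in> I" "j \<in> I" for i j
    proof -
      have "card {a \<in> I. a < i} < n" "card {a \<in> I. a < j} < n"
        unfolding nI using that fin by (auto intro!: psubset_card_mono)
      then show ?thesis
        using submatrix_index_card[of i C j I I] that I CN
        by (metis (no_types, lifting) carrier_matD(1,2) index_mat(1) lessThan_iff prod.case psubsetD)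
    qed
    \<comment> \<open>The position of \<open>i\<close> in the submatrix, inverse to
      \<open>pick\<close>.\<close>
    define r where "r i = card {a \<in> I. a < i}" for i
    have "inj_on r I"
    proof (rule inj_onI)
      fix x y assume "x \<in> I" "y \<in> I" "r x = r y"
      then show "x = y" unfolding r_def using pick_card_in_set by metis
    qed
    moreover have "r ` I \<subseteq> {..<n}" unfolding r_def nI using fin by (auto intro!: psubset_card_mono)
    ultimately have rI: "bij_betw r I {..<n}"
      using nI fin by (metis bij_betw_def card_image card_lessThan card_subset_eq finite_lessThan)
    have hb: "herm {..<N} (\<lambda>i j. C $$ (i, j))" "bounded_by_2 {..<N} (\<lambda>i j. C $$ (i, j))"
      using cyclotomic_herm_bounded[OF C(1) CN] .
    have zero: "C $$ (i, j) = 0" if i: "i \<in> I" and j: "j < N" "j \<notin> I" for i j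
    proof -
      have "of_real (\<Sum>k\<in>I. (cmod (C $$ (i, k)))\<^sup>2) = (\<Sum>k\<in>I. B (r i) (r k) * cnj (B (r i) (r k)))"
        using i by (simp add: complex_norm_square r_def idx flip: of_real_power)
      also have "\<dots> = (\<Sum>k<n. B (r i) k * cnj (B (r i) k))"
        using rI by (rule sum.reindex_bij_betw)
      also have "\<dots> = of_real 4" using sq[of "r i"] rI i by (auto simp: bij_betw_def)
      finally have 4: "(\<Sum>k\<in>I. (cmod (C $$ (i, k)))\<^sup>2) = 4" unfolding of_real_eq_iff .
      have "(\<Sum>k\<in>insert j I. (cmod (C $$ (i, k)))\<^sup>2) \<le> (\<Sum>k<N. (cmod (C $$ (i, k)))\<^sup>2)"
        using I j by (intro sum_mono2) auto
      also have "\<dots> \<le> 4" using row_bound(1)[OF _ hb, of i] i I by auto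
      finally show ?thesis using 4 j fin by simp
    qed
    have "n > 0" using c unfolding connected_on_def by auto
    then have "I \<noteq> {}" using nI by auto
    moreover have "\<forall>i\<in>I. \<forall>j\<in>{..<N}. C $$ (i, j) \<noteq> 0 \<longrightarrow> j \<in> I" using zero by auto
    ultimately have "I = {..<N}"
      using indecomposable_connected[OF C(2) CN] I(1) unfolding connected_on_def by auto
    then show False using I(1) by blast
  qed
  ultimately show ?thesis using complete_cyclotomic[OF assms] unfolding maximal_cyclotomic_def by blast
qed

lemma pick_lessThan: "i < n \<Longrightarrow> pick {..<n} i = i"
proof -
  assume "i < n"
  then have "{a \<in> {..<n}. a < i} = {..<i}" by auto
  then show ?thesis using pick_card_in_set[of i "{..<n}"] \<open>i < n\<close> by simp
qed

text \<open>A matrix with a complete extension equals it or fails to be maximal, so a property of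
  the extension holds for every maximal matrix. As the given matrix is the leading block of the
  extension, containment needs only the identity permutation.\<close>

lemma reduction_to_extension:
  fixes P :: "complex mat \<Rightarrow> bool"
  assumes ext: "\<And>n A. herm {..<n} A \<Longrightarrow> bounded_by_2 {..<n} A \<Longrightarrow> connected_on {..<n} A \<Longrightarrow>
    \<exists>N B. n \<le> N \<and> (\<forall>i<n. \<forall>j<n. B i j = A i j) \<and> complete_on {..<N} B \<and> P (mat N N (\<lambda>(i, j). B i j))"
  shows "(\<forall>A. maximal_cyclotomic A \<longrightarrow> P A) \<and>
    (\<forall>B. cyclotomic B \<and> indecomposable B \<longrightarrow> (\<exists>M. maximal_cyclotomic M \<and> contained_in B M))"
proof -
  have main: "\<exists>M. maximal_cyclotomic M \<and> P M \<and> (A = M \<or> proper_principal_submatrix A M)"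
    if A: "cyclotomic A" "indecomposable A" for A
  proof -
    define n where "n = dim_row A"
    have An: "A \<in> carrier_mat n n"
      using A(1) unfolding cyclotomic_def hermitian_mat_def n_def square_mat.simps by auto
    obtain N B where B: "n \<le> N" "\<And>i j. i < n \<Longrightarrow> j < n \<Longrightarrow> B i j = A $$ (i, j)" "complete_on {..<N} B"
        "P (mat N N (\<lambda>(i, j). B i j))"
      using ext[OF cyclotomic_herm_bounded[OF A(1) An] indecomposable_connected[OF A(2) An]] by blast
    define M where "M = mat N N (\<lambda>(i, j). B i j)"
    have "A = M" if "n = N" using that B(2) An by (intro eq_matI) (auto simp: M_def)
    moreover have "proper_principal_submatrix A M" if "n < N"
    proof -
      have *: "{i. i < N \<and> i < n} = {..<n}" using that by auto
      have "A = submatrix M {..<n} {..<n}"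
        using An B that by (intro eq_matI) (auto simp: submatrix_def M_def * pick_lessThan)
      moreover have "{..<n} \<subset> {..<dim_row M}" using that by (auto simp: M_def)
      ultimately show ?thesis unfolding proper_principal_submatrix_def by blast
    qed
    ultimately show ?thesis
      using complete_maximal[OF B(3)] B(1,4) unfolding M_def[symmetric] by (auto simp: le_less)
  qed
  have "P A" if "maximal_cyclotomic A" for A
    using main[of A] that unfolding maximal_cyclotomic_def by blast
  moreover have "contained_in B M" if "B = M \<or> proper_principal_submatrix B M" for B M
  proof -
    have "permute_mat id B = B" by (intro eq_matI) (auto simp: permute_mat_def)
    then show ?thesis using that permutes_id unfolding contained_in_def by metis
  qed
  ultimately show ?thesis using main by blast
qed

subsection \<open>Saturating weights inside a Gram representation\<close>

text \<open>Gaussian elimination: the equation with index \<open>k\<close> is solved for the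
  coefficient at a pivot \<open>j\<close> and substituted into the others.\<close>

lemma homogeneous_solution:
  fixes X :: "'a \<Rightarrow> 'i \<Rightarrow> complex"
  assumes "finite I" "finite S" "card I < card S"
  shows "\<exists>c. (\<exists>i\<in>S. c i \<noteq> 0) \<and> (\<forall>k\<in>I. (\<Sum>i\<in>S. c i * X i k) = 0)"
  using assms
proof (induction I arbitrary: S X rule: finite_induct)
  case empty
  then have "S \<noteq> {}" by auto
  then show ?case by (intro exI[of _ "\<lambda>_. 1"]) auto
next
  case (insert k I)
  show ?case
  proof (cases "\<forall>i\<in>S. X i k = 0")
    case True
    have "card I < card S" using insert by simp
    then obtain c where "\<exists>i\<in>S. c i \<noteq> 0" "\<forall>k\<in>I. (\<Sum>i\<in>S. c i * X i k) = 0"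
      using insert.IH[OF insert.prems(1), of X] by blast
    then show ?thesis using True by (intro exI[of _ c]) auto
  next
    case False
    then obtain j where j: "j \<in> S" "X j k \<noteq> 0" by blast
    have "card I < card (S - {j})" using insert j by simp
    from insert.IH[OF _ this, of "\<lambda>i l. X i l - X i k / X j k * X j l"] insert.prems
    obtain c where c: "\<exists>i\<in>S - {j}. c i \<noteq> 0"
      "\<And>l. l \<in> I \<Longrightarrow> (\<Sum>i\<in>S - {j}. c i * (X i l - X i k / X j k * X j l)) = 0" by auto
    \<comment> \<open>The value that the equation with index \<open>k\<close> forces at the
      pivot.\<close>
    define m where "m = - (\<Sum>i\<in>S - {j}. c i * X i k / X j k)"
    have eq: "(\<Sum>i\<in>S. (c(j := m)) i * X i l) = m * X j l + (\<Sum>i\<in>S - {j}. c i * X i l)" for l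
      using insert.prems j(1) by (subst sum.remove[of S j]) (auto intro!: sum.cong)
    have "(\<Sum>i\<in>S. (c(j := m)) i * X i k) = 0"
      unfolding eq unfolding m_def sum_divide_distrib[symmetric] using j(2) by simp
    moreover have "(\<Sum>i\<in>S. (c(j := m)) i * X i l) = 0" if "l \<in> I" for l
    proof -
      have "m * X j l = - (\<Sum>i\<in>S - {j}. c i * X i k / X j k * X j l)"
        unfolding m_def by (simp add: sum_distrib_right)
      moreover have "(\<Sum>i\<in>S - {j}. c i * X i l) - (\<Sum>i\<in>S - {j}. c i * X i k / X j k * X j l) = 0"
        unfolding sum_subtractf[symmetric] c(2)[OF that, symmetric] by (intro sum.cong refl) (simp add: algebra_simps)
      ultimately show ?thesis unfolding eq by simp
    qed
    moreover have "\<exists>i\<in>S. (c(j := m)) i \<noteq> 0" using c(1) by auto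
    ultimately show ?thesis by (intro exI[of _ "c(j := m)"]) auto
  qed
qed

text \<open>\<open>H\<close> is linear in its second argument and conjugate linear in its first;
  \<open>t\<close> is an isometric involution that carries one family of vectors to the other.
  Functions vanishing on \<open>I\<close> are null vectors, so \<open>card I\<close> bounds the
  dimension.\<close>

locale gram_form =
  fixes H :: "('i \<Rightarrow> complex) \<Rightarrow> ('i \<Rightarrow> complex) \<Rightarrow> complex" and t :: "'i \<Rightarrow> 'i" and I :: "'i set"
  assumes H_add: "H p (\<lambda>k. q k + r k) = H p q + H p r"
    and H_scale: "H p (\<lambda>k. c * q k) = c * H p q"
    and H_cnj: "H q p = cnj (H p q)"
    and H_swap: "H (\<lambda>k. p (t k)) (\<lambda>k. q (t k)) = H p q"
    and t_t: "t (t k) = k"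
    and H_pos: "Re (H p p) \<ge> 0"
    and finite_I: "finite I"
    and H_supp: "(\<And>k. k \<in> I \<Longrightarrow> q k = 0) \<Longrightarrow> H p q = 0"
begin

lemma H_sum: "H p (\<lambda>k. \<Sum>x\<in>S. c x * q x k) = (\<Sum>x\<in>S. c x * H p (q x))"
proof (induction S rule: infinite_finite_induct)
  case (insert x S)
  then show ?case using H_add[of p "\<lambda>k. c x * q x k" "\<lambda>k. \<Sum>x\<in>S. c x * q x k"] by (simp add: H_scale)
qed (auto intro: H_supp)

lemma H_swap1: "H p (\<lambda>k. q (t k)) = H (\<lambda>k. p (t k)) q"
  using H_swap[of p "\<lambda>k. q (t k)"] by (simp add: t_t)

lemma H_sum_left: "H (\<lambda>k. \<Sum>x\<in>S. c x * q x k) p = (\<Sum>x\<in>S. cnj (c x) * H (q x) p)"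
  unfolding H_cnj[of _ p] H_sum by simp

text \<open>The \<open>X i\<close> and their images under \<open>t\<close> are the two orthogonal
  families; only the first is stored, so that adding one vector adds a vertex to both.\<close>

definition represents :: "nat \<Rightarrow> (nat \<Rightarrow> nat \<Rightarrow> complex) \<Rightarrow> (nat \<Rightarrow> 'i \<Rightarrow> complex) \<Rightarrow> bool"
  where "represents n A X \<longleftrightarrow> (\<forall>i<n. \<forall>j<n.
    H (X i) (X j) = (if i = j then 2 else 0) \<and> H (X i) (\<lambda>k. X j (t k)) = A i j)"

lemma representsD: "represents n A X \<Longrightarrow> i < n \<Longrightarrow> j < n \<Longrightarrow> H (X i) (X j) = (if i = j then 2 else 0)"
  "represents n A X \<Longrightarrow> i < n \<Longrightarrow> j < n \<Longrightarrow> H (X i) (\<lambda>k. X j (t k)) = A i j"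
  "represents n A X \<Longrightarrow> i < n \<Longrightarrow> j < n \<Longrightarrow> H (\<lambda>k. X i (t k)) (X j) = A i j"
  "represents n A X \<Longrightarrow> i < n \<Longrightarrow> j < n \<Longrightarrow> H (\<lambda>k. X i (t k)) (\<lambda>k. X j (t k)) = (if i = j then 2 else 0)"
  unfolding represents_def by (simp_all add: H_swap H_swap1[symmetric])

text \<open>Positivity is tested on the combination that minimises the form for given
  \<open>q\<close> in the second family: the optimal coefficients in the first family are -1/2 times
  those of A q.\<close>

lemma represents_bounded:
  assumes "represents n A X"
  shows "bounded_by_2 {..<n} A"
  unfolding bounded_by_2_def
proof
  fix q :: "nat \<Rightarrow> complex"
  define a where "a i = (\<Sum>j<n. A i j * q j)" for i
  define u where "u = (\<lambda>k. \<Sum>i<n. (- a i / 2) * X i k)"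
  define v where "v = (\<lambda>k. \<Sum>j<n. q j * X j (t k))"
  have uv: "H u v = - (\<Sum>i<n. cnj (a i) * a i) / 2"
  proof -
    have "H u v = (\<Sum>i<n. cnj (- a i / 2) * (\<Sum>j<n. q j * A i j))"
      unfolding u_def v_def H_sum_left H_sum[of _ q "\<lambda>j k. X j (t k)"] using representsD(2)[OF assms] by simp
    also have "\<dots> = (\<Sum>i<n. - (cnj (a i) * a i) / 2)" by (simp add: a_def mult.commute)
    finally show ?thesis by (simp add: sum_negf flip: sum_divide_distrib)
  qed
  have uu: "H u u = (\<Sum>i<n. cnj (a i) * a i) / 2"
  proof -
    have "H u u = (\<Sum>i<n. cnj (- a i / 2) * (\<Sum>j<n. (- a j / 2) * (if i = j then 2 else 0)))"
      unfolding u_def H_sum_left H_sum using representsD(1)[OF assms] by (intro sum.cong refl) simp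
    also have "\<dots> = (\<Sum>i<n. cnj (a i) * a i / 2)"
      by (intro sum.cong refl) (simp add: if_distrib[of "\<lambda>x. _ * x"] cong: if_cong)
    finally show ?thesis by (simp flip: sum_divide_distrib)
  qed
  have vv: "H v v = 2 * (\<Sum>i<n. cnj (q i) * q i)"
  proof -
    have "H v v = (\<Sum>i<n. cnj (q i) * (\<Sum>j<n. q j * (if i = j then 2 else 0)))"
      unfolding v_def H_sum_left[of q "\<lambda>j k. X j (t k)"] H_sum[of _ q "\<lambda>j k. X j (t k)"]
      using representsD(4)[OF assms] by (intro sum.cong refl) simp
    also have "\<dots> = (\<Sum>i<n. 2 * (cnj (q i) * q i))"
      by (intro sum.cong refl) (simp add: if_distrib[of "\<lambda>x. _ * x"] cong: if_cong)
    finally show ?thesis by (simp flip: sum_distrib_left)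
  qed
  define w where "w = (\<lambda>k. u k + v k)"
  have cc: "(\<Sum>i<n. cnj (f i) * f i) = of_real (\<Sum>i<n. (cmod (f i))\<^sup>2)" for f :: "nat \<Rightarrow> complex"
    by (simp add: complex_norm_square mult.commute flip: of_real_power)
  have "H w w = H w u + H w v" unfolding w_def by (rule H_add)
  also have "H w u = cnj (H u u + H u v)" unfolding H_cnj[of w u] unfolding w_def H_add by simp
  also have "H w v = cnj (H v u + H v v)" unfolding H_cnj[of w v] unfolding w_def H_add by simp
  finally have "H w w = cnj (H u u + H u v) + cnj (cnj (H u v) + H v v)" unfolding H_cnj[of v u] .
  then have "Re (H w w) = Re (H u u) + 2 * Re (H u v) + Re (H v v)" by simp
  then have "0 \<le> Re (H u u) + 2 * Re (H u v) + Re (H v v)" using H_pos[of w] by simp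
  then have "(\<Sum>i<n. (cmod (a i))\<^sup>2) \<le> 4 * (\<Sum>i<n. (cmod (q i))\<^sup>2)"
    unfolding uu uv vv cc by simp
  then show "(\<Sum>i<n. (cmod (\<Sum>j<n. A i j * q j))\<^sup>2) \<le> 4 * (\<Sum>i<n. (cmod (q i))\<^sup>2)"
    unfolding a_def .
qed

text \<open>Orthogonal vectors of norm 2 stay linearly independent after restriction to
  \<open>I\<close>.\<close>

lemma represents_card:
  assumes "represents n A X"
  shows "n \<le> card I"
proof (rule ccontr)
  assume "\<not> ?thesis"
  then obtain c where c: "\<exists>i\<in>{..<n}. c i \<noteq> 0" "\<And>k. k \<in> I \<Longrightarrow> (\<Sum>i<n. c i * X i k) = 0"
    using homogeneous_solution[OF finite_I, of "{..<n}" X] by auto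
  obtain j where j: "j < n" "c j \<noteq> 0" using c(1) by auto
  have "0 = H (X j) (\<lambda>k. \<Sum>i<n. c i * X i k)" using c(2) H_supp by simp
  also have "\<dots> = (\<Sum>i<n. c i * (if j = i then 2 else 0))"
    unfolding H_sum using representsD(1)[OF assms] j(1) by simp
  also have "\<dots> = 2 * c j" using j(1) by (simp add: if_distrib[of "\<lambda>x. _ * x"] cong: if_cong)
  finally show False using j(2) by simp
qed

text \<open>The new vector has coefficients \<alpha> in the first family and \<beta> in the second.
  \<open>orth\<close> makes it orthogonal to the first family, so only the \<beta> part contributes
  to its norm. \<open>b\<close> and \<open>d\<close> are the products of the old vectors and of the
  new one with its image under \<open>t\<close>: the new column and the new charge.\<close>

lemma represents_extend:
  fixes \<alpha> \<beta> :: "nat \<Rightarrow> complex"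
  assumes rep: "represents n A X" and h: "herm {..<n} A"
  defines "b \<equiv> \<lambda>i. (\<Sum>j<n. A i j * \<alpha> j) + 2 * \<beta> i"
  defines "d \<equiv> (\<Sum>i<n. \<alpha> i * cnj (b i))"
  defines "B \<equiv> \<lambda>i j. if i < n \<and> j < n then A i j else if i < n then b i else if j < n then cnj (b j) else d"
  assumes orth: "\<And>i. i < n \<Longrightarrow> 2 * \<alpha> i + (\<Sum>j<n. A i j * \<beta> j) = 0"
    and norm: "(\<Sum>j<n. \<beta> j * cnj (b j)) = 2"
    and int: "\<And>i. i < n \<Longrightarrow> b i \<in> eisenstein_ints" "d \<in> eisenstein_ints"
  shows "\<exists>Y. represents (Suc n) B Y" "herm {..<Suc n} B"
proof -
  define x where "x = (\<lambda>k. (\<Sum>i<n. \<alpha> i * X i k) + (\<Sum>j<n. \<beta> j * X j (t k)))"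
  have tx: "x (t k) = (\<Sum>i<n. \<alpha> i * X i (t k)) + (\<Sum>j<n. \<beta> j * X j k)" for k
    by (simp add: x_def t_t)
  have Hx: "H p x = (\<Sum>i<n. \<alpha> i * H p (X i)) + (\<Sum>j<n. \<beta> j * H p (\<lambda>k. X j (t k)))" for p
    unfolding x_def H_add H_sum H_sum[of p \<beta> "\<lambda>j k. X j (t k)"] ..
  have Htx: "H p (\<lambda>k. x (t k)) = (\<Sum>i<n. \<alpha> i * H p (\<lambda>k. X i (t k))) + (\<Sum>j<n. \<beta> j * H p (X j))" for p
    unfolding tx H_add H_sum H_sum[of p \<alpha> "\<lambda>j k. X j (t k)"] ..
  have delta: "(\<Sum>j<n. f j * (if i = j then 2 else 0)) = 2 * f i" if "i < n" for f :: "nat \<Rightarrow> complex" and i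
    using that by (simp add: if_distrib[of "\<lambda>x. _ * x"] cong: if_cong)
  have Xx: "H (X i) x = 0" if "i < n" for i
    using orth[OF that] delta[OF that, of \<alpha>] that representsD(1,2)[OF rep, of i]
    unfolding Hx by (simp add: mult.commute)
  have Xtx: "H (X i) (\<lambda>k. x (t k)) = b i" if "i < n" for i
    using delta[OF that, of \<beta>] that representsD(1,2)[OF rep, of i]
    unfolding Htx b_def by (simp add: mult.commute)
  have xX: "H x (X i) = 0" if "i < n" for i using Xx[OF that] H_cnj[of x "X i"] by simp
  have xtX: "H x (\<lambda>k. X i (t k)) = cnj (b i)" if "i < n" for i
    using Xtx[OF that] H_cnj[of x "\<lambda>k. X i (t k)"] H_swap1[of "X i" x] by simp
  have xx: "H x x = 2" unfolding Hx[of x] using xX xtX norm by simp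
  have xtx: "H x (\<lambda>k. x (t k)) = d" unfolding Htx d_def using xX xtX by simp
  have "represents (Suc n) B (X(n := x))"
    using representsD[OF rep] Xx Xtx xX xtX xx xtx
    unfolding represents_def B_def by (auto simp: less_Suc_eq)
  then show "\<exists>Y. represents (Suc n) B Y" by blast
  have "cnj d = d" using xtx H_cnj[of x "\<lambda>k. x (t k)"] H_swap1[of x x] by simp
  show "herm {..<Suc n} B"
    unfolding herm_def
  proof (intro ballI conjI)
    fix i j assume ij: "i \<in> {..<Suc n}" "j \<in> {..<Suc n}"
    show "B i j \<in> eisenstein_ints"
      using ij hermD(1)[OF h] int R_cnj by (auto simp: B_def less_Suc_eq)
    show "B j i = cnj (B i j)"
    proof (cases "i < n \<and> j < n")
      case True
      then show ?thesis using hermD(2)[OF h, of i j] unfolding B_def by simp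
    next
      case False
      then show ?thesis using ij \<open>cnj d = d\<close> by (auto simp: B_def less_Suc_eq)
    qed
  qed
qed

end

lemma connected_extend:
  fixes A :: "nat \<Rightarrow> nat \<Rightarrow> complex"
  assumes c: "connected_on {..<n} A" and h: "herm {..<Suc n} B" and AB: "\<And>i j. i < n \<Longrightarrow> j < n \<Longrightarrow> B i j = A i j"
    and k: "k < n" "B k n \<noteq> 0"
  shows "connected_on {..<Suc n} B"
  unfolding connected_on_def
proof (intro conjI allI impI)
  fix Z assume Z: "Z \<subseteq> {..<Suc n}" "Z \<noteq> {}" "\<forall>i\<in>Z. \<forall>j\<in>{..<Suc n}. B i j \<noteq> 0 \<longrightarrow> j \<in> Z"
  have kn: "B n k \<noteq> 0" using k hermD(2)[OF h, of k n] by auto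
  have ne: "Z \<inter> {..<n} \<noteq> {}"
  proof
    assume "Z \<inter> {..<n} = {}"
    moreover obtain x where "x \<in> Z" using Z(2) by blast
    ultimately have "n \<in> Z" using Z(1) by (metis disjoint_iff lessThan_iff less_Suc_eq subsetD)
    then have "k \<in> Z" using Z(3) kn k(1) by auto
    then show False using \<open>Z \<inter> {..<n} = {}\<close> k(1) by auto
  qed
  have "\<forall>i\<in>Z \<inter> {..<n}. \<forall>j\<in>{..<n}. A i j \<noteq> 0 \<longrightarrow> j \<in> Z \<inter> {..<n}"
    using Z(3) AB by auto
  then have "Z \<inter> {..<n} = {..<n}" using c ne unfolding connected_on_def by (meson inf_le2)
  moreover from this have "n \<in> Z" using Z(3) k by auto
  ultimately show "Z = {..<Suc n}" using Z(1) by (auto simp: less_Suc_eq)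
qed auto

text \<open>A vertex of weight 3 acquires its missing neighbour \<open>2 y\<^sub>j - \<Sum>\<^sub>i A\<^sub>i\<^sub>j x\<^sub>i\<close>,
  and a kernel vector \<open>c\<close> of norm 4 yields the new vertex \<open>\<Sum>\<^sub>i c\<^sub>i y\<^sub>i / 2\<close>.\<close>

definition saturated_on :: "'v set \<Rightarrow> ('v \<Rightarrow> 'v \<Rightarrow> complex) \<Rightarrow> bool"
  where "saturated_on V A \<longleftrightarrow> (\<forall>i\<in>V. (\<Sum>j\<in>V. (cmod (A i j))\<^sup>2) \<noteq> 3) \<and>
    (\<nexists>c. (\<forall>i\<in>V. c i \<in> eisenstein_ints) \<and> (\<Sum>i\<in>V. (cmod (c i))\<^sup>2) = 4 \<and>
      (\<forall>i\<in>V. (\<Sum>j\<in>V. A i j * c j) = 0))"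

lemma (in gram_form) unsaturated_extend:
  assumes rep: "represents n A X" and h: "herm {..<n} A" and c: "connected_on {..<n} A"
    and u: "\<not> saturated_on {..<n} A"
  shows "\<exists>B Y. represents (Suc n) B Y \<and> herm {..<Suc n} B \<and> connected_on {..<Suc n} B \<and>
    (\<forall>i<n. \<forall>j<n. B i j = A i j)"
proof -
  have step: ?thesis if orth: "\<And>i. i < n \<Longrightarrow> 2 * \<alpha> i + (\<Sum>j<n. A i j * \<beta> j) = 0"
    and b: "\<And>i. b i = (\<Sum>j<n. A i j * \<alpha> j) + 2 * \<beta> i"
    and norm: "(\<Sum>j<n. \<beta> j * cnj (b j)) = 2"
    and int: "\<And>i. i < n \<Longrightarrow> b i \<in> eisenstein_ints" "(\<Sum>i<n. \<alpha> i * cnj (b i)) \<in> eisenstein_ints"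
    and k: "k < n" "b k \<noteq> 0" for \<alpha> \<beta> b :: "nat \<Rightarrow> complex" and k
  proof -
    define B where "B = (\<lambda>i j. if i < n \<and> j < n then A i j else if i < n then b i else if j < n
      then cnj (b j) else (\<Sum>i<n. \<alpha> i * cnj (b i)))"
    have "\<exists>Y. represents (Suc n) B Y" "herm {..<Suc n} B"
      using represents_extend[of n A X \<alpha> \<beta>, OF rep h, folded b, OF orth norm int] unfolding B_def by auto
    then show ?thesis using connected_extend[OF c, of B k] k by (auto simp: B_def)
  qed
  consider (three) j0 where "j0 < n" "(\<Sum>j<n. (cmod (A j0 j))\<^sup>2) = 3"
    | (ker) v where "\<And>i. i < n \<Longrightarrow> v i \<in> eisenstein_ints" "(\<Sum>i<n. (cmod (v i))\<^sup>2) = 4"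
      "\<And>i. i < n \<Longrightarrow> (\<Sum>j<n. A i j * v j) = 0"
    using u unfolding saturated_on_def by auto
  then show ?thesis
  proof cases
    case three
    have R: "A i j \<in> eisenstein_ints" if "i < n" "j < n" for i j using hermD(1)[OF h] that by auto
    \<comment> \<open>The new weight at \<open>j0\<close> is then 4 minus the norm 3 of the row,
      that is 1, which fills the row up to norm 4.\<close>
    define \<alpha> where "\<alpha> i = - A i j0" for i
    define \<beta> where "\<beta> i = (if i = j0 then 2 else 0 :: complex)" for i
    define b where "b i = (\<Sum>j<n. A i j * \<alpha> j) + 2 * \<beta> i" for i
    have "(\<Sum>j<n. A j0 j * A j j0) = (\<Sum>j<n. of_real ((cmod (A j0 j))\<^sup>2))"
    proof (rule sum.cong[OF refl])
      fix j assume "j \<in> {..<n}"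
      then have "A j j0 = cnj (A j0 j)" using three(1) by (intro hermD(2)[OF h]) auto
      then show "A j0 j * A j j0 = of_real ((cmod (A j0 j))\<^sup>2)" by (simp only: complex_norm_square)
    qed
    also have "\<dots> = 3" using three(2) by (simp flip: of_real_sum del: of_real_power)
    finally have bj: "b j0 = 1" by (simp add: b_def \<alpha>_def \<beta>_def sum_negf)
    show ?thesis
    proof (rule step[of \<alpha> \<beta> b j0])
      show "2 * \<alpha> i + (\<Sum>j<n. A i j * \<beta> j) = 0" for i
        using three(1) by (simp add: \<alpha>_def \<beta>_def if_distrib[of "\<lambda>x. _ * x"] cong: if_cong)
      show "(\<Sum>j<n. \<beta> j * cnj (b j)) = 2"
        using three(1) bj by (simp add: \<beta>_def if_distrib[of "\<lambda>x. x * _"] cong: if_cong)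
      show bR: "b i \<in> eisenstein_ints" if "i < n" for i
        unfolding b_def \<alpha>_def \<beta>_def using R that three(1)
        by (intro R_add R_sum R_mult R_uminus) auto
      show "(\<Sum>i<n. \<alpha> i * cnj (b i)) \<in> eisenstein_ints"
        unfolding \<alpha>_def using R three(1) bR by (intro R_sum R_mult R_uminus R_cnj) auto
    qed (use three(1) bj in \<open>auto simp: b_def\<close>)
  next
    case ker
    have "\<exists>k<n. v k \<noteq> 0"
    proof (rule ccontr)
      assume "\<not> ?thesis"
      then show False using ker(2) by simp
    qed
    then obtain k where k: "k < n" "v k \<noteq> 0" by blast
    \<comment> \<open>Here the new column is the kernel vector itself and the new charge is
      0.\<close>
    show ?thesis
    proof (rule step[of "\<lambda>_. 0" "\<lambda>i. v i / 2" v k])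
      show "2 * 0 + (\<Sum>j<n. A i j * (v j / 2)) = 0" if "i < n" for i
        using ker(3)[OF that] by (simp flip: sum_divide_distrib)
      have "(\<Sum>j<n. v j / 2 * cnj (v j)) = of_real (\<Sum>j<n. (cmod (v j))\<^sup>2) / 2"
        by (simp add: complex_norm_square sum_divide_distrib flip: of_real_power)
      then show "(\<Sum>j<n. v j / 2 * cnj (v j)) = 2" using ker(2) by simp
    qed (use ker k in auto)
  qed
qed

text \<open>The Boolean names a side of the double space, and \<open>t\<close> exchanges the sides.
  Positivity combines Cauchy-Schwarz and the norm bound for the mixed term with 4 P Q <= (P +
  Q)^2.\<close>

lemma gram_form_exists:
  fixes A :: "nat \<Rightarrow> nat \<Rightarrow> complex"
  assumes h: "herm {..<n} A" and b: "bounded_by_2 {..<n} A"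
  defines "H \<equiv> \<lambda>p q :: bool \<times> nat \<Rightarrow> complex. (\<Sum>s\<in>UNIV. \<Sum>i<n. cnj (p (s, i)) * (2 * q (s, i) + (\<Sum>j<n. A i j * q (\<not> s, j))))"
  shows "gram_form H (\<lambda>(s, i). (\<not> s, i)) (UNIV \<times> {..<n})"
    and "gram_form.represents H (\<lambda>(s, i). (\<not> s, i)) n A (\<lambda>i k. if k = (False, i) then 1 else 0)"
proof -
  have U: "(\<Sum>s\<in>UNIV. f s) = f False + f True" for f :: "bool \<Rightarrow> complex" by (simp add: UNIV_bool)
  have dbl: "(\<Sum>i<n. cnj (p i) * (\<Sum>j<n. A i j * q j)) = cnj (\<Sum>i<n. cnj (q i) * (\<Sum>j<n. A i j * p j))" for p q
  proof -
    have "(\<Sum>i<n. cnj (p i) * (\<Sum>j<n. A i j * q j)) = (\<Sum>i<n. \<Sum>j<n. cnj (p i) * (A i j * q j))"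
      by (simp only: sum_distrib_left)
    also have "\<dots> = (\<Sum>j<n. \<Sum>i<n. cnj (p i) * (A i j * q j))" by (rule sum.swap)
    also have "\<dots> = (\<Sum>j<n. \<Sum>i<n. cnj (cnj (q j) * (A j i * p i)))"
    proof (rule sum.cong[OF refl], rule sum.cong[OF refl])
      fix i j assume "i \<in> {..<n}" "j \<in> {..<n}"
      then have s: "A j i = cnj (A i j)" by (intro hermD(2)[OF h])
      show "cnj (p j) * (A j i * q i) = cnj (cnj (q i) * (A i j * p j))" unfolding s by (simp add: mult_ac)
    qed
    also have "\<dots> = cnj (\<Sum>i<n. cnj (q i) * (\<Sum>j<n. A i j * p j))" by (simp add: sum_distrib_left)
    finally show ?thesis .
  qed
  have H2: "H p q = (\<Sum>s\<in>UNIV. 2 * (\<Sum>i<n. cnj (p (s, i)) * q (s, i)) + (\<Sum>i<n. cnj (p (s, i)) * (\<Sum>j<n. A i j * q (\<not> s, j))))" for p q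
    unfolding H_def U by (simp add: distrib_left sum.distrib sum_distrib_left mult.left_commute)
  show g: "gram_form H (\<lambda>(s, i). (\<not> s, i)) (UNIV \<times> {..<n})"
  proof
    fix p q r :: "bool \<times> nat \<Rightarrow> complex" and c :: complex and k :: "bool \<times> nat"
    show "H p (\<lambda>k. q k + r k) = H p q + H p r"
      unfolding H_def U by (simp add: algebra_simps sum.distrib)
    show "H p (\<lambda>k. c * q k) = c * H p q"
      unfolding H_def U by (simp add: algebra_simps sum_distrib_left)
    show "H q p = cnj (H p q)"
      unfolding H2 U using dbl[of "\<lambda>i. q (False, i)" "\<lambda>i. p (True, i)"] dbl[of "\<lambda>i. q (True, i)" "\<lambda>i. p (False, i)"]
      by (simp add: mult.commute)
    show "H (\<lambda>k. p (case k of (s, i) \<Rightarrow> (\<not> s, i))) (\<lambda>k. q (case k of (s, i) \<Rightarrow> (\<not> s, i))) = H p q"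
      unfolding H_def U by (simp add: add.commute)
    show "(case case k of (s, i) \<Rightarrow> (\<not> s, i) of (s, i) \<Rightarrow> (\<not> s, i)) = k" by (cases k) simp
    show "finite (UNIV \<times> {..<n} :: (bool \<times> nat) set)" by simp
    show "H p q = 0" if "\<And>k. k \<in> UNIV \<times> {..<n} \<Longrightarrow> q k = 0" using that unfolding H_def by simp
    define P where "P s = (\<Sum>i<n. (cmod (p (s, i)))\<^sup>2)" for s
    define C where "C = (\<Sum>i<n. cnj (p (False, i)) * (\<Sum>j<n. A i j * p (True, j)))"
    have sq: "(\<Sum>i<n. cnj (p (s, i)) * p (s, i)) = of_real (P s)" for s
      by (simp add: P_def complex_norm_square mult.commute flip: of_real_power)
    have "H p p = 2 * of_real (P False) + 2 * of_real (P True) + C + cnj C"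
      unfolding H2 U sq C_def using dbl[of "\<lambda>i. p (True, i)" "\<lambda>i. p (False, i)"] by simp
    then have Re: "Re (H p p) = 2 * P False + 2 * P True + 2 * Re C" by simp
    have "(cmod C)\<^sup>2 \<le> (\<Sum>i<n. (cmod (cnj (p (False, i))))\<^sup>2) * (\<Sum>i<n. (cmod (\<Sum>j<n. A i j * p (True, j)))\<^sup>2)"
      unfolding C_def by (rule cauchy_schwarz)
    also have "\<dots> \<le> P False * (4 * P True)"
      using b unfolding bounded_by_2_def P_def by (intro mult_mono sum_nonneg) auto
    finally have "(cmod C)\<^sup>2 \<le> 4 * P False * P True" by simp
    also have "\<dots> \<le> (P False + P True)\<^sup>2"
      using zero_le_power2[of "P False - P True"] by (simp add: power2_eq_square algebra_simps)
    finally have "cmod C \<le> P False + P True"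
      using power2_le_imp_le by (auto simp: P_def sum_nonneg)
    then show "0 \<le> Re (H p p)" using Re abs_Re_le_cmod[of C] by linarith
  qed
  show "gram_form.represents H (\<lambda>(s, i). (\<not> s, i)) n A (\<lambda>i k. if k = (False, i) then 1 else 0)"
    unfolding gram_form.represents_def[OF g] unfolding H_def U
    by (auto simp: if_distrib[of "\<lambda>x. _ * x"] if_distrib[of cnj] if_distrib[of "\<lambda>x. x * _"] cong: if_cong)
qed

text \<open>All extensions are represented in the same form and have at most \<open>card I\<close>
  vertices, so one of greatest size exists; by \<open>unsaturated_extend\<close> it is
  saturated.\<close>

lemma saturated_extension:
  fixes A :: "nat \<Rightarrow> nat \<Rightarrow> complex"
  assumes h: "herm {..<n} A" and b: "bounded_by_2 {..<n} A" and c: "connected_on {..<n} A"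
  obtains N B where "n \<le> N" "\<And>i j. i < n \<Longrightarrow> j < n \<Longrightarrow> B i j = A i j"
    "herm {..<N} B" "bounded_by_2 {..<N} B" "connected_on {..<N} B" "saturated_on {..<N} B"
proof -
  obtain H :: "(bool \<times> nat \<Rightarrow> complex) \<Rightarrow> (bool \<times> nat \<Rightarrow> complex) \<Rightarrow> complex" and t I X where g: "gram_form H t I" and r: "gram_form.represents H t n A X"
    by (rule that[OF gram_form_exists[OF h b]])
  interpret gram_form H t I by (rule g)
  define Q where "Q N \<longleftrightarrow> n \<le> N \<and> (\<exists>B Y. represents N B Y \<and> herm {..<N} B \<and> connected_on {..<N} B \<and>
    (\<forall>i<n. \<forall>j<n. B i j = A i j))" for N
  have "Q n" using r h c by (auto simp: Q_def)
  moreover have "\<forall>N. Q N \<longrightarrow> N \<le> card I" using represents_card by (auto simp: Q_def)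
  ultimately have "\<exists>N. Q N \<and> (\<forall>M. Q M \<longrightarrow> M \<le> N)"
    using ex_has_greatest_nat[of Q n "\<lambda>x. x" "Suc (card I)"] by (auto simp: less_Suc_eq_le)
  then obtain N where N: "Q N" "\<And>M. Q M \<Longrightarrow> M \<le> N" by blast
  obtain B Y where B: "n \<le> N" "represents N B Y" "herm {..<N} B" "connected_on {..<N} B" "\<forall>i<n. \<forall>j<n. B i j = A i j"
    using N(1) unfolding Q_def by blast
  have "saturated_on {..<N} B"
  proof (rule ccontr)
    assume "\<not> ?thesis"
    from unsaturated_extend[OF B(2,3,4) this] B(1,5) have "Q (Suc N)" unfolding Q_def
      by (metis le_Suc_eq less_le_trans)
    then show False using N(2) by fastforce
  qed
  then show ?thesis using that[of N B] B represents_bounded[OF B(2)] by blast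
qed

subsection \<open>Searching for unit-weighted frames\<close>

text \<open>\<open>N\<close> stands for 0 and \<open>P0\<close> to \<open>P5\<close> for the powers
  of \<omega>. The finite alphabet allows the enumeration to be evaluated without complex
  numbers.\<close>

datatype eis = N | P0 | P1 | P2 | P3 | P4 | P5

fun rot :: "eis \<Rightarrow> eis" where
  "rot N = N" | "rot P0 = P1" | "rot P1 = P2" | "rot P2 = P3" | "rot P3 = P4" | "rot P4 = P5" | "rot P5 = P0"

fun emul :: "eis \<Rightarrow> eis \<Rightarrow> eis" where
  "emul N y = N" | "emul P0 y = y" | "emul P1 y = rot y" | "emul P2 y = rot (rot y)"
| "emul P3 y = rot (rot (rot y))" | "emul P4 y = rot (rot (rot (rot y)))"
| "emul P5 y = rot (rot (rot (rot (rot y))))"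

fun ecnj :: "eis \<Rightarrow> eis" where
  "ecnj N = N" | "ecnj P0 = P0" | "ecnj P1 = P5" | "ecnj P2 = P4" | "ecnj P3 = P3" | "ecnj P4 = P2" | "ecnj P5 = P1"

text \<open>Pairs are coordinates with respect to the basis 1, \<omega>.\<close>

fun eadd :: "eis \<Rightarrow> int \<times> int \<Rightarrow> int \<times> int" where
  "eadd N p = p" | "eadd P0 (a, b) = (a + 1, b)" | "eadd P1 (a, b) = (a, b + 1)"
| "eadd P2 (a, b) = (a - 1, b + 1)" | "eadd P3 (a, b) = (a - 1, b)"
| "eadd P4 (a, b) = (a, b - 1)" | "eadd P5 (a, b) = (a + 1, b - 1)"

fun eip :: "eis list \<Rightarrow> eis list \<Rightarrow> int \<times> int" where
  "eip (x # xs) (y # ys) = eadd (emul x (ecnj y)) (eip xs ys)"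
| "eip _ _ = (0, 0)"

definition wgt :: "eis list \<Rightarrow> nat" where "wgt r = length (filter (\<lambda>x. x \<noteq> N) r)"

fun tr :: "'a list list \<Rightarrow> 'a list list" where
  "tr [] = []" | "tr [r] = map (\<lambda>x. [x]) r" | "tr (r # rs) = map2 (#) r (tr rs)"

definition eadj :: "eis list list \<Rightarrow> eis list list" where "eadj M = tr (map (map ecnj) M)"

text \<open>Only pairs containing a full row are constrained: the other inner products can still
  change when columns are added.\<close>

fun ok :: "eis list list \<Rightarrow> bool" where
  "ok [] = True"
| "ok (r # rs) = (list_all (\<lambda>s. wgt r = 4 \<or> wgt s = 4 \<longrightarrow> eip r s = (0, 0)) rs \<and> ok rs)"

text \<open>The test for an initial segment \<open>q\<close> of a new row. Scaling makes the first
  nonzero entry 1; \<open>cl\<close> contains full rows whose product with the new row is decided by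
  this segment.\<close>

definition chk :: "eis list list \<Rightarrow> eis list \<Rightarrow> bool" where
  "chk cl q = (wgt q \<le> 4 \<and> (case filter (\<lambda>x. x \<noteq> N) q of [] \<Rightarrow> True | y # _ \<Rightarrow> y = P0) \<and>
     list_all (\<lambda>r. eip r q = (0, 0)) cl)"

fun gen :: "(eis list \<times> eis list list) list \<Rightarrow> eis list \<Rightarrow> eis list list" where
  "gen [] p = [p]"
| "gen ((os, cl) # ps) p = concat (map (\<lambda>x. if chk cl (p @ [x]) then gen ps (p @ [x]) else []) os)"

text \<open>A marked column must receive a unit; a column that is closed or full can only receive
  0.\<close>

definition opts :: "eis list \<Rightarrow> bool \<Rightarrow> bool \<Rightarrow> eis list" where
  "opts c ban mk = (if mk then [P0, P1, P2, P3, P4, P5] else if ban \<or> wgt c = 4 then [N]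
     else [N, P0, P1, P2, P3, P4, P5])"

text \<open>A full row is attached to the position of its last nonzero entry, the earliest point at
  which its product with the new row is known.\<close>

definition positions :: "eis list list \<Rightarrow> eis list list \<Rightarrow> (eis list \<times> eis list list) list" where
  "positions sat os = map (\<lambda>k. (os ! k, filter (\<lambda>r. r ! k \<noteq> N \<and> list_all (\<lambda>x. x = N) (drop (Suc k) r)) sat))
     [0..<length os]"

definition newrows :: "eis list list \<Rightarrow> bool list \<Rightarrow> bool list \<Rightarrow> eis list list" where
  "newrows M bc mk = filter (\<lambda>x. ok (M @ [x]) \<and> ok (eadj (M @ [x])))
     (gen (positions (filter (\<lambda>r. wgt r = 4) M) (map2 (\<lambda>c (b, m). opts c b m) (eadj M) (zip bc mk))) [])"

text \<open>At most one line gets marked, so the search branches on a single line at a time.\<close>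

fun mark :: "('a \<Rightarrow> bool) \<Rightarrow> 'a list \<Rightarrow> bool list" where
  "mark p [] = []"
| "mark p (x # xs) = (if p x then True # map (\<lambda>_. False) xs else False # mark p xs)"

text \<open>\<open>search f M br bc\<close> enumerates the completions of a rectangular array of weights between two vertex
  lists: a line of weight 3 needs a fourth entry, and for a line of smaller weight it is decided whether
  it is left as it is (flagged in \<open>br\<close> or \<open>bc\<close>) or gets a further entry from a new line of the other kind.
  The fuel \<open>f\<close> is exhausted if \<open>[]\<close> occurs in the result.\<close>

fun search :: "nat \<Rightarrow> eis list list \<Rightarrow> bool list \<Rightarrow> bool list \<Rightarrow> eis list list list" where
  "search 0 M br bc = [[]]"
| "search (Suc f) M br bc =
    (let cs = eadj M;
         rws = zip (map wgt M) br; cws = zip (map wgt cs) bc;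
         m3 = mark (\<lambda>(w, b). w = 3) cws
     in if list_ex (\<lambda>(w, b). w = 3 \<and> b) cws then []
        else if list_ex (\<lambda>b. b) m3
          then concat (map (\<lambda>x. search f (M @ [x]) (br @ [False]) bc) (newrows M bc m3))
        else if list_ex (\<lambda>(w, b). w = 3) rws then search f cs bc br
        else (let m = mark (\<lambda>(w, b). w < 4 \<and> \<not> b) cws
           in if list_ex (\<lambda>b. b) m
             then search f M br (map2 (\<or>) bc m) @
                  concat (map (\<lambda>x. search f (M @ [x]) (br @ [False]) bc) (newrows M bc m))
             else if list_ex (\<lambda>(w, b). w < 4 \<and> \<not> b) rws then search f cs bc br
             else [M]))"

section \<open>Complex meaning of the coded arithmetic\<close>

fun val :: "eis \<Rightarrow> complex" where
  "val N = 0" | "val P0 = 1" | "val P1 = \<omega>" | "val P2 = \<omega> - 1" | "val P3 = - 1" | "val P4 = - \<omega>" | "val P5 = 1 - \<omega>"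

lemma val_rot: "val (rot x) = \<omega> * val x"
  by (cases x) (simp_all add: right_diff_distrib omega_sq)

lemma val_emul: "val (emul x y) = val x * val y"
proof -
  have w: "\<omega> * (\<omega> * z) = \<omega> * z - z" for z
    using omega_sq by (simp add: mult.assoc[symmetric] left_diff_distrib)
  show ?thesis by (cases x) (simp_all add: val_rot w right_diff_distrib left_diff_distrib)
qed

lemma val_ecnj: "val (ecnj x) = cnj (val x)"
  by (cases x) (simp_all add: cnj_omega)

lemma val_0_iff: "val x = 0 \<longleftrightarrow> x = N"
  by (cases x) (auto simp: omega_def complex_eq_iff)

lemma val_1_iff: "val x = 1 \<longleftrightarrow> x = P0"
  by (cases x) (auto simp: omega_def complex_eq_iff)

lemma val_units: "x \<noteq> N \<Longrightarrow> val x \<in> eisenstein_units"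
  by (cases x) (auto simp: eisenstein_units_def)

lemma val_surj: "z = 0 \<or> z \<in> eisenstein_units \<Longrightarrow> \<exists>x. val x = z"
  unfolding eisenstein_units_def by (metis (no_types, opaque_lifting) val.simps insert_iff empty_iff)

definition pair_val :: "int \<times> int \<Rightarrow> complex" where "pair_val p = of_int (fst p) + of_int (snd p) * \<omega>"

lemma pair_val_0: "pair_val p = 0 \<longleftrightarrow> p = (0, 0)"
  unfolding pair_val_def omega_form_0 by (simp add: prod_eq_iff)

lemma pair_val_eadd: "pair_val (eadd x p) = val x + pair_val p"
  by (cases p; cases x) (simp_all add: pair_val_def algebra_simps)

lemma pair_val_eip:
  "length r = length s \<Longrightarrow> pair_val (eip r s) = (\<Sum>j<length r. val (r ! j) * cnj (val (s ! j)))"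
proof (induction r s rule: list_induct2)
  case (Cons x xs y ys)
  then show ?case by (simp add: pair_val_eadd val_emul val_ecnj sum.lessThan_Suc_shift del: sum.lessThan_Suc)
qed (simp add: pair_val_def)

text \<open>This justifies the early orthogonality tests made in \<open>gen\<close>.\<close>

lemma eip_take: "list_all (\<lambda>x. x = N) (drop n r) \<Longrightarrow> eip r (take n x) = eip r x"
proof (induction n arbitrary: r x)
  case 0
  have "eip r x = (0, 0)" if "list_all (\<lambda>x. x = N) r" for r x
    using that by (induction r x rule: eip.induct) auto
  then show ?case using 0 by (cases r) auto
next
  case (Suc n)
  then show ?case by (cases r; cases x) auto
qed

lemma tr_nth:
  assumes "M \<noteq> []" "\<And>r. r \<in> set M \<Longrightarrow> length r = m"
  shows "length (tr M) = m \<and> (\<forall>j<m. tr M ! j = map (\<lambda>r. r ! j) M)"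
  using assms by (induction M rule: tr.induct) auto

lemma eadj_nth:
  assumes "M \<noteq> []" "\<And>r. r \<in> set M \<Longrightarrow> length r = m"
  shows "length (eadj M) = m" "j < m \<Longrightarrow> eadj M ! j = map (\<lambda>r. ecnj (r ! j)) M"
proof -
  have l: "length r = m" if "r \<in> set (map (map ecnj) M)" for r using assms(2) that by auto
  have "length (tr (map (map ecnj) M)) = m \<and> (\<forall>j<m. tr (map (map ecnj) M) ! j = map (\<lambda>r. r ! j) (map (map ecnj) M))"
    by (rule tr_nth) (use assms(1) l in auto)
  then show "length (eadj M) = m" "j < m \<Longrightarrow> eadj M ! j = map (\<lambda>r. ecnj (r ! j)) M"
    using assms(2) unfolding eadj_def by auto
qed

lemma wgt_card: "wgt r = card {j. j < length r \<and> r ! j \<noteq> N}"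
  unfolding wgt_def by (rule length_filter_conv_card)

lemma wgt_take: "wgt (take n r) \<le> wgt r"
  unfolding wgt_def using append_take_drop_id[of n r] by (metis filter_append length_append le_add1)

lemma ok_iff: "ok M \<longleftrightarrow> (\<forall>i<length M. \<forall>k<length M. i < k \<longrightarrow> wgt (M ! i) = 4 \<or> wgt (M ! k) = 4 \<longrightarrow> eip (M ! i) (M ! k) = (0, 0))"
proof (induction M)
  case (Cons r M)
  show ?case unfolding ok.simps Cons.IH list_all_length by (auto simp: All_less_Suc2)
qed simp

text \<open>If all initial segments of a row pass their tests, no branch leading to it is
  cut.\<close>

lemma gen_complete:
  assumes "length x = length ps" "\<And>k. k < length ps \<Longrightarrow> x ! k \<in> set (fst (ps ! k)) \<and> chk (snd (ps ! k)) (p @ take (Suc k) x)"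
  shows "p @ x \<in> set (gen ps p)"
  using assms
proof (induction ps arbitrary: p x)
  case (Cons q ps)
  obtain y ys where x: "x = y # ys" using Cons.prems(1) by (cases x) auto
  obtain os cl where q: "q = (os, cl)" by (cases q)
  have "y \<in> set os" "chk cl (p @ [y])" using Cons.prems(2)[of 0] x q by auto
  moreover have "(p @ [y]) @ ys \<in> set (gen ps (p @ [y]))"
  proof (rule Cons.IH)
    show "length ys = length ps" using Cons.prems(1) x by simp
    fix k assume "k < length ps"
    then show "ys ! k \<in> set (fst (ps ! k)) \<and> chk (snd (ps ! k)) ((p @ [y]) @ take (Suc k) ys)"
      using Cons.prems(2)[of "Suc k"] x by simp
  qed
  ultimately show ?case using x q by auto
qed simp

lemma mark_length [simp]: "length (mark p xs) = length xs" by (induction xs) auto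

lemma mark_ex:
  "list_ex (\<lambda>b. b) (mark p xs) \<Longrightarrow> \<exists>j<length xs. p (xs ! j) \<and> (\<forall>i<length xs. mark p xs ! i \<longleftrightarrow> i = j)"
proof (induction xs)
  case (Cons x xs)
  show ?case
  proof (cases "p x")
    case True
    then show ?thesis by (intro exI[of _ 0]) (auto simp: nth_Cons split: nat.split)
  next
    case False
    then obtain j where "j < length xs" "p (xs ! j)" "\<forall>i<length xs. mark p xs ! i \<longleftrightarrow> i = j"
      using Cons by auto
    then show ?thesis using False by (intro exI[of _ "Suc j"]) (auto simp: nth_Cons split: nat.split)
  qed
qed simp

lemma mark_not_ex: "\<not> list_ex (\<lambda>b. b) (mark p xs) \<Longrightarrow> x \<in> set xs \<Longrightarrow> \<not> p x"
  by (induction xs) (auto split: if_splits)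

text \<open>Saturated weights with unit entries: saturation excludes degree 3, and connectedness
  excludes degree 0 except for a single uncharged vertex. The kernel condition is added only in
  \<open>toral\<close>.\<close>

locale frame =
  fixes V :: "'v set" and A :: "'v \<Rightarrow> 'v \<Rightarrow> complex"
  assumes finite_V: "finite V"
    and herm_A: "herm V A"
    and unit_entries: "i \<in> V \<Longrightarrow> j \<in> V \<Longrightarrow> A i j = 0 \<or> A i j \<in> eisenstein_units"
    and deg: "i \<in> V \<Longrightarrow> card {j \<in> V. A i j \<noteq> 0} \<in> {1, 2, 4}"
    and orth: "i \<in> V \<Longrightarrow> card {j \<in> V. A i j \<noteq> 0} = 4 \<Longrightarrow> k \<in> V \<Longrightarrow> k \<noteq> i \<Longrightarrow> (\<Sum>j\<in>V. A k j * cnj (A i j)) = 0"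
begin

definition nb :: "'v \<Rightarrow> 'v set" where "nb i = {j \<in> V. A i j \<noteq> 0}"

lemma nb_sym: "i \<in> V \<Longrightarrow> j \<in> nb i \<Longrightarrow> i \<in> nb j"
  using hermD(2)[OF herm_A, of i j] unfolding nb_def by auto

lemma nb_V: "nb i \<subseteq> V" and finite_nb: "finite (nb i)"
  using finite_V unfolding nb_def by auto

lemma nb_card: "i \<in> V \<Longrightarrow> card (nb i) \<in> {1, 2, 4}" using deg unfolding nb_def .

lemma nb_card_le: "i \<in> V \<Longrightarrow> card (nb i) \<le> 4" using nb_card[of i] by auto

text \<open>The lists stand for vertices on the two sides of the bipartite double cover and may
  overlap; the scalings \<open>u\<close> and \<open>v\<close> are independent even at a vertex that
  occurs in both.\<close>

definition realizes :: "eis list list \<Rightarrow> 'v list \<Rightarrow> 'v list \<Rightarrow> (nat \<Rightarrow> complex) \<Rightarrow> (nat \<Rightarrow> complex) \<Rightarrow> bool"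
  where "realizes M \<rho> \<gamma> u v \<longleftrightarrow> distinct \<rho> \<and> distinct \<gamma> \<and> set \<rho> \<subseteq> V \<and> set \<gamma> \<subseteq> V \<and>
    \<rho> \<noteq> [] \<and> \<gamma> \<noteq> [] \<and> length M = length \<rho> \<and> (\<forall>r\<in>set M. length r = length \<gamma>) \<and>
    (\<forall>i<length \<rho>. u i \<in> eisenstein_units) \<and> (\<forall>j<length \<gamma>. v j \<in> eisenstein_units) \<and>
    (\<forall>i<length \<rho>. \<forall>j<length \<gamma>. A (\<rho> ! i) (\<gamma> ! j) = u i * val (M ! i ! j) * cnj (v j))"

lemma realizes_adj:
  assumes "realizes M \<rho> \<gamma> u v"
  shows "realizes (eadj M) \<gamma> \<rho> v u"
proof -
  have M: "M \<noteq> []" "\<And>r. r \<in> set M \<Longrightarrow> length r = length \<gamma>" using assms unfolding realizes_def by auto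
  note e = eadj_nth[OF M]
  have "\<forall>r\<in>set (eadj M). length r = length \<rho>"
    using e assms unfolding realizes_def by (auto simp: in_set_conv_nth)
  moreover have "A (\<gamma> ! j) (\<rho> ! i) = v j * val (eadj M ! j ! i) * cnj (u i)"
    if "i < length \<rho>" "j < length \<gamma>" for i j
  proof -
    have "A (\<gamma> ! j) (\<rho> ! i) = cnj (A (\<rho> ! i) (\<gamma> ! j))"
      using assms that by (intro hermD(2)[OF herm_A]) (auto simp: realizes_def)
    also have "A (\<rho> ! i) (\<gamma> ! j) = u i * val (M ! i ! j) * cnj (v j)"
      using assms that unfolding realizes_def by blast
    finally show ?thesis using that e assms unfolding realizes_def by (simp add: val_ecnj mult_ac)
  qed
  ultimately show ?thesis using assms e unfolding realizes_def by auto
qed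

lemma realizes_nz:
  assumes "realizes M \<rho> \<gamma> u v" "i < length \<rho>" "j < length \<gamma>"
  shows "A (\<rho> ! i) (\<gamma> ! j) \<noteq> 0 \<longleftrightarrow> M ! i ! j \<noteq> N"
proof -
  have "u i \<noteq> 0" "v j \<noteq> 0" "A (\<rho> ! i) (\<gamma> ! j) = u i * val (M ! i ! j) * cnj (v j)"
    using assms unit_nz unfolding realizes_def by blast+
  then show ?thesis by (simp add: val_0_iff)
qed

lemma realizes_wgt:
  assumes r: "realizes M \<rho> \<gamma> u v" and i: "i < length \<rho>"
  shows "wgt (M ! i) = card (nb (\<rho> ! i) \<inter> set \<gamma>)"
proof -
  have len: "length (M ! i) = length \<gamma>" using r i unfolding realizes_def by auto
  have "nb (\<rho> ! i) \<inter> set \<gamma> = (\<lambda>j. \<gamma> ! j) ` {j. j < length \<gamma> \<and> M ! i ! j \<noteq> N}"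
  proof -
    have "\<gamma> ! j \<in> V" if "j < length \<gamma>" for j using r nth_mem[OF that] unfolding realizes_def by blast
    then show ?thesis using realizes_nz[OF r i] unfolding nb_def by (auto simp: in_set_conv_nth)
  qed
  moreover have "inj_on (\<lambda>j. \<gamma> ! j) {j. j < length \<gamma> \<and> M ! i ! j \<noteq> N}"
    using r unfolding realizes_def by (auto simp: inj_on_def nth_eq_iff_index_eq)
  ultimately show ?thesis unfolding wgt_card len by (simp add: card_image)
qed

lemma wgt4:
  assumes r: "realizes M \<rho> \<gamma> u v" and i: "i < length \<rho>"
  shows "wgt (M ! i) \<le> 4" "wgt (M ! i) \<ge> 4 \<Longrightarrow> nb (\<rho> ! i) \<subseteq> set \<gamma>"
proof -
  have V: "\<rho> ! i \<in> V" using r i unfolding realizes_def by auto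
  have le: "card (nb (\<rho> ! i) \<inter> set \<gamma>) \<le> card (nb (\<rho> ! i))" using finite_nb by (intro card_mono) auto
  then show "wgt (M ! i) \<le> 4" using nb_card_le[OF V] realizes_wgt[OF r i] by simp
  assume "wgt (M ! i) \<ge> 4"
  then have "card (nb (\<rho> ! i) \<inter> set \<gamma>) = card (nb (\<rho> ! i))"
    using nb_card_le[OF V] realizes_wgt[OF r i] le by simp
  then have "nb (\<rho> ! i) \<inter> set \<gamma> = nb (\<rho> ! i)" using finite_nb by (intro card_subset_eq) auto
  then show "nb (\<rho> ! i) \<subseteq> set \<gamma>" by blast
qed

text \<open>A full row has its whole support among the listed columns, so orthogonality over
  \<open>V\<close> becomes orthogonality in the array: column units cancel and row units factor
  out.\<close>

lemma realizes_eip: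
  assumes r: "realizes M \<rho> \<gamma> u v" and i: "i < length \<rho>" and k: "k < length \<rho>" "k \<noteq> i"
    and w: "wgt (M ! i) = 4"
  shows "eip (M ! i) (M ! k) = (0, 0)" "eip (M ! k) (M ! i) = (0, 0)"
proof -
  have R: "distinct \<rho>" "distinct \<gamma>" "set \<rho> \<subseteq> V" "set \<gamma> \<subseteq> V" "\<And>i. i < length \<rho> \<Longrightarrow> u i \<in> eisenstein_units"
      "\<And>j. j < length \<gamma> \<Longrightarrow> v j \<in> eisenstein_units" "\<And>i. i < length \<rho> \<Longrightarrow> length (M ! i) = length \<gamma>"
      "\<And>i j. i < length \<rho> \<Longrightarrow> j < length \<gamma> \<Longrightarrow> A (\<rho> ! i) (\<gamma> ! j) = u i * val (M ! i ! j) * cnj (v j)"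
    using r unfolding realizes_def by auto
  have V: "\<rho> ! i \<in> V" "\<rho> ! k \<in> V" "\<rho> ! k \<noteq> \<rho> ! i" using R i k by (auto simp: nth_eq_iff_index_eq)
  have sub: "nb (\<rho> ! i) \<subseteq> set \<gamma>" using wgt4(2)[OF r i] w by simp
  then have "card (nb (\<rho> ! i)) = 4" using realizes_wgt[OF r i] w by (simp add: Int_absorb2)
  then have "0 = (\<Sum>c\<in>V. A (\<rho> ! k) c * cnj (A (\<rho> ! i) c))" using orth[OF V(1) _ V(2,3)] unfolding nb_def by simp
  also have "\<dots> = (\<Sum>c\<in>set \<gamma>. A (\<rho> ! k) c * cnj (A (\<rho> ! i) c))"
    using sub R(4) finite_V by (intro sum.mono_neutral_right) (auto simp: nb_def)
  also have "\<dots> = (\<Sum>j<length \<gamma>. A (\<rho> ! k) (\<gamma> ! j) * cnj (A (\<rho> ! i) (\<gamma> ! j)))"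
    using R(2) by (intro sum.reindex_bij_betw[symmetric] bij_betw_nth) auto
  also have "\<dots> = (\<Sum>j<length \<gamma>. u k * cnj (u i) * (val (M ! k ! j) * cnj (val (M ! i ! j))))"
  proof (rule sum.cong[OF refl])
    fix j assume "j \<in> {..<length \<gamma>}"
    then have j: "j < length \<gamma>" by simp
    show "A (\<rho> ! k) (\<gamma> ! j) * cnj (A (\<rho> ! i) (\<gamma> ! j)) = u k * cnj (u i) * (val (M ! k ! j) * cnj (val (M ! i ! j)))"
      unfolding R(8)[OF i j] R(8)[OF k(1) j] using unit_cnj_mult[OF R(6)[OF j]] by (simp add: mult_ac)
  qed
  also have "\<dots> = u k * cnj (u i) * pair_val (eip (M ! k) (M ! i))"
    using R(7)[OF i] R(7)[OF k(1)] by (simp add: pair_val_eip sum_distrib_left)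
  finally have "pair_val (eip (M ! k) (M ! i)) = 0" using unit_nz[OF R(5)[OF i]] unit_nz[OF R(5)[OF k(1)]] by simp
  then show "eip (M ! k) (M ! i) = (0, 0)" unfolding pair_val_0 .
  have "pair_val (eip (M ! i) (M ! k)) = cnj (pair_val (eip (M ! k) (M ! i)))"
    using R(7)[OF i] R(7)[OF k(1)] by (simp add: pair_val_eip mult.commute)
  then show "eip (M ! i) (M ! k) = (0, 0)" using \<open>pair_val (eip (M ! k) (M ! i)) = 0\<close> unfolding pair_val_0[symmetric] by simp
qed

lemma realizes_ok: "realizes M \<rho> \<gamma> u v \<Longrightarrow> ok M"
  unfolding ok_iff
proof (intro allI impI)
  fix i k assume r: "realizes M \<rho> \<gamma> u v" and "i < length M" "k < length M" "i < k" and w: "wgt (M ! i) = 4 \<or> wgt (M ! k) = 4"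
  then have "i < length \<rho>" "k < length \<rho>" "k \<noteq> i" "i \<noteq> k" unfolding realizes_def by auto
  with w show "eip (M ! i) (M ! k) = (0, 0)"
    using realizes_eip(1)[OF r, of i k] realizes_eip(2)[OF r, of k i] by blast
qed

lemma realizes_new_row:
  assumes r: "realizes M \<rho> \<gamma> u v" and p: "p \<in> V" "p \<notin> set \<rho>" and j: "j < length \<gamma>" "A p (\<gamma> ! j) \<noteq> 0"
  obtains x a where "realizes (M @ [x]) (\<rho> @ [p]) \<gamma> (u(length \<rho> := a)) v"
    "case filter (\<lambda>x. x \<noteq> N) x of [] \<Rightarrow> True | y # _ \<Rightarrow> y = P0" "length x = length \<gamma>"
proof -
  have R: "set \<gamma> \<subseteq> V" "\<And>j. j < length \<gamma> \<Longrightarrow> v j \<in> eisenstein_units" using r unfolding realizes_def by auto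
  define z where "z j = A p (\<gamma> ! j) * v j" for j
  have z: "z j = 0 \<or> z j \<in> eisenstein_units" if "j < length \<gamma>" for j
    using unit_entries[OF p(1) subsetD[OF R(1) nth_mem[OF that]]] R(2)[OF that] unit_mult unfolding z_def by auto
  have "z j \<noteq> 0" using j R(2)[OF j(1)] unit_nz unfolding z_def by auto
  then have ex: "\<exists>j. j < length \<gamma> \<and> z j \<noteq> 0" using j(1) by blast
  \<comment> \<open>The first listed neighbour of \<open>p\<close>; taking \<open>z l\<close> as the
    unit of the new row turns its entry into 1.\<close>
  define l where "l = (LEAST j. j < length \<gamma> \<and> z j \<noteq> 0)"
  have l: "l < length \<gamma>" "z l \<noteq> 0" using LeastI_ex[OF ex] unfolding l_def by auto
  have before: "z i = 0" if "i < l" for i using not_less_Least[of i] that l unfolding l_def[symmetric]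
    by (metis (mono_tags, lifting) l_def less_trans not_less_Least)
  have a: "z l \<in> eisenstein_units" using z l by blast
  have "\<exists>e. val e = cnj (z l) * z i" if "i < length \<gamma>" for i
    using z[OF that] a unit_cnj unit_mult by (intro val_surj) auto
  then obtain e where e: "\<And>i. i < length \<gamma> \<Longrightarrow> val (e i) = cnj (z l) * z i" by metis
  define x where "x = map e [0..<length \<gamma>]"
  have x: "length x = length \<gamma>" "\<And>i. i < length \<gamma> \<Longrightarrow> val (x ! i) = cnj (z l) * z i" using e by (auto simp: x_def)
  have xl: "x ! l = P0" unfolding val_1_iff[symmetric] using x(2)[OF l(1)] unit_cnj_mult(2)[OF a] by simp
  have "x ! i = N" if "i < l" for i
    unfolding val_0_iff[symmetric] using x(2)[of i] before[OF that] that l(1) by simp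
  then have "filter (\<lambda>x. x \<noteq> N) (take l x) = []" by (auto simp: filter_empty_conv in_set_conv_nth)
  moreover have "x = take l x @ P0 # drop (Suc l) x" using l(1) x(1) xl by (metis id_take_nth_drop)
  ultimately have "filter (\<lambda>x. x \<noteq> N) x = P0 # filter (\<lambda>x. x \<noteq> N) (drop (Suc l) x)"
    by (metis (mono_tags, lifting) append_Nil eis.distinct(1) filter.simps(2) filter_append)
  moreover have "A p (\<gamma> ! i) = z l * val (x ! i) * cnj (v i)" if "i < length \<gamma>" for i
  proof -
    have "z l * val (x ! i) * cnj (v i) = (z l * cnj (z l)) * A p (\<gamma> ! i) * (v i * cnj (v i))"
      unfolding x(2)[OF that] by (simp add: z_def mult_ac)
    then show ?thesis unfolding unit_cnj_mult(1)[OF a] unit_cnj_mult(1)[OF R(2)[OF that]] by simp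
  qed
  then have "realizes (M @ [x]) (\<rho> @ [p]) \<gamma> (u(length \<rho> := z l)) v"
    using r p x(1) a unfolding realizes_def by (auto simp: nth_append less_Suc_eq)
  ultimately show ?thesis using that x(1) by simp
qed

text \<open>The row of an actual vertex survives every test. Closed and full columns have no
  unlisted neighbour, the orthogonality tests follow from \<open>realizes_eip\<close>, and the final
  tests apply \<open>realizes_ok\<close> to the enlarged array and to its adjoint.\<close>

lemma newrows_complete:
  assumes r: "realizes (M @ [x]) (\<rho> @ [p]) \<gamma> u v" and r0: "realizes M \<rho> \<gamma> u0 v0"
    and norm: "case filter (\<lambda>x. x \<noteq> N) x of [] \<Rightarrow> True | y # _ \<Rightarrow> y = P0"
    and j: "j < length \<gamma>" "A p (\<gamma> ! j) \<noteq> 0" and mk: "length mk = length \<gamma>" "\<And>i. i < length \<gamma> \<Longrightarrow> mk ! i \<longleftrightarrow> i = j"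
    and bc: "length bc = length \<gamma>" "\<And>i. i < length \<gamma> \<Longrightarrow> bc ! i \<Longrightarrow> nb (\<gamma> ! i) \<subseteq> set \<rho>"
  shows "x \<in> set (newrows M bc mk)"
proof -
  have R: "length M = length \<rho>" "length x = length \<gamma>" "p \<in> V" "p \<notin> set \<rho>" "set \<gamma> \<subseteq> V" "M \<noteq> []" "\<And>r. r \<in> set M \<Longrightarrow> length r = length \<gamma>"
    using r r0 unfolding realizes_def by auto
  have xi: "x ! i \<noteq> N \<longleftrightarrow> A p (\<gamma> ! i) \<noteq> 0" if "i < length \<gamma>" for i
    using realizes_nz[OF r, of "length \<rho>" i] that R(1) by (simp add: nth_append)
  have wx: "wgt x \<le> 4" using wgt4(1)[OF r, of "length \<rho>"] R(1) by (simp add: nth_append)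
  define os where "os = map2 (\<lambda>c (b, m). opts c b m) (eadj M) (zip bc mk)"
  define sat where "sat = filter (\<lambda>r. wgt r = 4) M"
  have len: "length os = length \<gamma>" using eadj_nth(1)[OF R(6,7)] mk bc by (simp add: os_def)
  have osi: "os ! i = opts (eadj M ! i) (bc ! i) (mk ! i)" if "i < length \<gamma>" for i
    using that eadj_nth(1)[OF R(6,7)] mk bc by (simp add: os_def)
  have all7: "y \<in> {N, P0, P1, P2, P3, P4, P5}" for y by (cases y) auto
  have x_os: "x ! i \<in> set (os ! i)" if i: "i < length \<gamma>" for i
  proof (cases "i = j")
    case True
    then have "x ! i \<noteq> N" using xi j by simp
    then show ?thesis unfolding osi[OF i] opts_def using mk(2)[OF i] True all7[of "x ! i"] by auto
  next
    case False
    have "x ! i = N" if "bc ! i \<or> wgt (eadj M ! i) = 4"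
    proof -
      have "nb (\<gamma> ! i) \<subseteq> set \<rho>" using that bc(2)[OF i] wgt4(2)[OF realizes_adj[OF r0], of i] i by auto
      then have "p \<notin> nb (\<gamma> ! i)" using R(4) by blast
      then have "A p (\<gamma> ! i) = 0" using nb_sym[OF R(3), of "\<gamma> ! i"] subsetD[OF R(5) nth_mem[OF i]] unfolding nb_def by auto
      then show ?thesis using xi[OF i] by blast
    qed
    then show ?thesis unfolding osi[OF i] opts_def using mk(2)[OF i] False all7[of "x ! i"] by auto
  qed
  have "[] @ x \<in> set (gen (positions sat os) [])"
  proof (rule gen_complete)
    show "length x = length (positions sat os)" using R(2) len by (simp add: positions_def)
    fix k assume "k < length (positions sat os)"
    then have k: "k < length \<gamma>" using len by (simp add: positions_def)
    have fst: "fst (positions sat os ! k) = os ! k"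
      and snd: "snd (positions sat os ! k) = filter (\<lambda>r. r ! k \<noteq> N \<and> list_all (\<lambda>x. x = N) (drop (Suc k) r)) sat"
      using k len by (simp_all add: positions_def)
    have "eip s (take (Suc k) x) = (0, 0)" if "s \<in> set (snd (positions sat os ! k))" for s
    proof -
      have s: "s \<in> set M" "wgt s = 4" "list_all (\<lambda>x. x = N) (drop (Suc k) s)" using that unfolding snd unfolding sat_def by auto
      then obtain i where i: "i < length \<rho>" "s = M ! i" using R(1) by (metis in_set_conv_nth)
      have "eip ((M @ [x]) ! i) ((M @ [x]) ! length \<rho>) = (0, 0)"
        using i s(2) R(1) by (intro realizes_eip(1)[OF r]) (auto simp: nth_append)
      then show ?thesis using eip_take[OF s(3)] i R(1) by (simp add: nth_append)
    qed
    moreover have "wgt (take (Suc k) x) \<le> 4" using wgt_take[of "Suc k" x] wx by linarith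
    moreover have "case filter (\<lambda>x. x \<noteq> N) (take (Suc k) x) of [] \<Rightarrow> True | y # _ \<Rightarrow> y = P0"
    proof (cases "filter (\<lambda>x. x \<noteq> N) (take (Suc k) x)")
      case (Cons y ys)
      have "filter (\<lambda>x. x \<noteq> N) x = filter (\<lambda>x. x \<noteq> N) (take (Suc k) x) @ filter (\<lambda>x. x \<noteq> N) (drop (Suc k) x)"
        by (metis append_take_drop_id filter_append)
      then show ?thesis using norm Cons by simp
    qed simp
    ultimately have "chk (snd (positions sat os ! k)) ([] @ take (Suc k) x)"
      unfolding chk_def list_all_iff by simp
    then show "x ! k \<in> set (fst (positions sat os ! k)) \<and> chk (snd (positions sat os ! k)) ([] @ take (Suc k) x)"
      using x_os[OF k] fst by simp
  qed
  then show ?thesis unfolding newrows_def os_def[symmetric] sat_def[symmetric]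
    using realizes_ok[OF r] realizes_ok[OF realizes_adj[OF r]] by simp
qed

text \<open>In the double cover such a pair is a union of components.\<close>

definition closed_pair :: "'v list \<Rightarrow> 'v list \<Rightarrow> bool"
  where "closed_pair \<rho> \<gamma> \<longleftrightarrow> (\<forall>r\<in>set \<rho>. nb r \<subseteq> set \<gamma>) \<and> (\<forall>c\<in>set \<gamma>. nb c \<subseteq> set \<rho>)"

text \<open>Some branch always follows the actual graph. A line of weight 3 has an unlisted
  neighbour because degrees are 1, 2 or 4. For another open line either the neighbourhood is
  complete, which permits closing it, or a missing neighbour provides the next row. Passing to the
  adjoint exchanges the two sides.\<close>

lemma search_complete:
  assumes "realizes M \<rho> \<gamma> u v" "length br = length \<rho>" "length bc = length \<gamma>"
    "\<And>i. i < length \<rho> \<Longrightarrow> br ! i \<Longrightarrow> nb (\<rho> ! i) \<subseteq> set \<gamma>"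
    "\<And>j. j < length \<gamma> \<Longrightarrow> bc ! j \<Longrightarrow> nb (\<gamma> ! j) \<subseteq> set \<rho>"
  shows "[] \<in> set (search f M br bc) \<or>
    (\<exists>M'\<in>set (search f M br bc). \<exists>\<rho> \<gamma> u v. realizes M' \<rho> \<gamma> u v \<and> closed_pair \<rho> \<gamma>)"
  using assms
proof (induction f arbitrary: M \<rho> \<gamma> u v br bc)
  case (Suc f)
  note r = Suc.prems(1) and br = Suc.prems(2,4) and bc = Suc.prems(3,5)
  have ra: "realizes (eadj M) \<gamma> \<rho> v u" by (rule realizes_adj[OF r])
  have lM: "length M = length \<rho>" "length (eadj M) = length \<gamma>" "set \<gamma> \<subseteq> V" "set \<rho> \<subseteq> V"
    using r ra unfolding realizes_def by auto
  define rws where "rws = zip (map wgt M) br"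
  define cws where "cws = zip (map wgt (eadj M)) bc"
  have rws: "length rws = length \<rho>" "\<And>i. i < length \<rho> \<Longrightarrow> rws ! i = (card (nb (\<rho> ! i) \<inter> set \<gamma>), br ! i)"
    using br lM realizes_wgt[OF r] by (simp_all add: rws_def)
  have cws: "length cws = length \<gamma>" "\<And>i. i < length \<gamma> \<Longrightarrow> cws ! i = (card (nb (\<gamma> ! i) \<inter> set \<rho>), bc ! i)"
    using bc lM realizes_wgt[OF ra] by (simp_all add: cws_def)
  \<comment> \<open>Any unlisted neighbour of the marked column may serve as the new row, since
    \<open>newrows\<close> contains the normalised rows of all of them.\<close>
  have row: "[] \<in> set (concat (map (\<lambda>x. search f (M @ [x]) (br @ [False]) bc) (newrows M bc mk))) \<or>
      (\<exists>M'\<in>set (concat (map (\<lambda>x. search f (M @ [x]) (br @ [False]) bc) (newrows M bc mk))).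
        \<exists>\<rho> \<gamma> u v. realizes M' \<rho> \<gamma> u v \<and> closed_pair \<rho> \<gamma>)"
    if j: "j < length \<gamma>" and mk: "length mk = length \<gamma>" "\<And>i. i < length \<gamma> \<Longrightarrow> mk ! i \<longleftrightarrow> i = j"
      and nsub: "\<not> nb (\<gamma> ! j) \<subseteq> set \<rho>" for j mk
  proof -
    obtain p where p: "p \<in> nb (\<gamma> ! j)" "p \<notin> set \<rho>" using nsub by blast
    have pV: "p \<in> V" and pj: "A p (\<gamma> ! j) \<noteq> 0"
      using p nb_sym[OF subsetD[OF lM(3) nth_mem[OF j]], of p] unfolding nb_def by auto
    obtain x a where x: "realizes (M @ [x]) (\<rho> @ [p]) \<gamma> (u(length \<rho> := a)) v"
      "case filter (\<lambda>x. x \<noteq> N) x of [] \<Rightarrow> True | y # _ \<Rightarrow> y = P0"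
      using realizes_new_row[OF r pV p(2) j pj] by metis
    have "x \<in> set (newrows M bc mk)" by (rule newrows_complete[OF x(1) r x(2) j pj mk bc])
    moreover have "[] \<in> set (search f (M @ [x]) (br @ [False]) bc) \<or>
      (\<exists>M'\<in>set (search f (M @ [x]) (br @ [False]) bc). \<exists>\<rho> \<gamma> u v. realizes M' \<rho> \<gamma> u v \<and> closed_pair \<rho> \<gamma>)"
      by (rule Suc.IH[OF x(1)]) (use br bc in \<open>auto simp: nth_append less_Suc_eq\<close>)
    ultimately show ?thesis unfolding set_concat set_map by blast
  qed
  have swap: "[] \<in> set (search f (eadj M) bc br) \<or>
      (\<exists>M'\<in>set (search f (eadj M) bc br). \<exists>\<rho> \<gamma> u v. realizes M' \<rho> \<gamma> u v \<and> closed_pair \<rho> \<gamma>)"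
    by (rule Suc.IH[OF ra bc(1) br(1) bc(2) br(2)])
  have no3: "\<not> nb i \<subseteq> W" if "card (nb i \<inter> W) = 3" "i \<in> V" for i W
    using that nb_card[of i] by (auto simp: Int_absorb2)
  let ?m3 = "mark (\<lambda>(w, b). w = 3) cws"
  let ?m = "mark (\<lambda>(w, b). w < 4 \<and> \<not> b) cws"
  have S: "search (Suc f) M br bc =
    (if list_ex (\<lambda>(w, b). w = 3 \<and> b) cws then []
        else if list_ex (\<lambda>b. b) ?m3
          then concat (map (\<lambda>x. search f (M @ [x]) (br @ [False]) bc) (newrows M bc ?m3))
        else if list_ex (\<lambda>(w, b). w = 3) rws then search f (eadj M) bc br
        else (if list_ex (\<lambda>b. b) ?m
             then search f M br (map2 (\<or>) bc ?m) @
                  concat (map (\<lambda>x. search f (M @ [x]) (br @ [False]) bc) (newrows M bc ?m))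
             else if list_ex (\<lambda>(w, b). w < 4 \<and> \<not> b) rws then search f (eadj M) bc br
             else [M]))"
    by (simp add: Let_def rws_def cws_def)
  have ban3: "\<not> list_ex (\<lambda>(w, b). w = 3 \<and> b) cws"
  proof -
    have "\<not> (case cws ! i of (w, b) \<Rightarrow> w = 3 \<and> b)" if "i < length \<gamma>" for i
      using cws(2)[OF that] no3[OF _ subsetD[OF lM(3) nth_mem[OF that]]] bc(2)[OF that] by auto
    note n = this
    show ?thesis unfolding list_ex_length cws(1)
    proof (rule notI, elim exE conjE)
      fix i assume "i < length \<gamma>" "case cws ! i of (w, b) \<Rightarrow> w = 3 \<and> b"
      then show False by (rule n[THEN notE])
    qed
  qed
  show ?case
  proof (cases "list_ex (\<lambda>b. b) ?m3")
    case True
    then obtain j where "j < length \<gamma>" "card (nb (\<gamma> ! j) \<inter> set \<rho>) = 3" "\<And>i. i < length \<gamma> \<Longrightarrow> ?m3 ! i \<longleftrightarrow> i = j"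
      using mark_ex[OF True] cws by auto
    note j = this
    have "search (Suc f) M br bc = concat (map (\<lambda>x. search f (M @ [x]) (br @ [False]) bc) (newrows M bc ?m3))"
      unfolding S using ban3 True by simp
    moreover have "\<not> nb (\<gamma> ! j) \<subseteq> set \<rho>" using no3[OF j(2) subsetD[OF lM(3) nth_mem[OF j(1)]]] .
    ultimately show ?thesis using row[OF j(1) _ j(3)] cws(1) by simp
  next
    case m3: False
    show ?thesis
    proof (cases "list_ex (\<lambda>(w, b). w = 3) rws")
      case True
      then show ?thesis unfolding S using ban3 m3 swap by simp
    next
      case r3: False
      show ?thesis
      proof (cases "list_ex (\<lambda>b. b) ?m")
        case True
        obtain j where j: "j < length \<gamma>" "\<And>i. i < length \<gamma> \<Longrightarrow> ?m ! i \<longleftrightarrow> i = j"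
          using mark_ex[OF True] cws by auto
        have E: "search (Suc f) M br bc = search f M br (map2 (\<or>) bc ?m) @
                  concat (map (\<lambda>x. search f (M @ [x]) (br @ [False]) bc) (newrows M bc ?m))"
          unfolding S using ban3 m3 r3 True by simp
        show ?thesis
        proof (cases "nb (\<gamma> ! j) \<subseteq> set \<rho>")
          case sub: True
          have "[] \<in> set (search f M br (map2 (\<or>) bc ?m)) \<or>
            (\<exists>M'\<in>set (search f M br (map2 (\<or>) bc ?m)). \<exists>\<rho> \<gamma> u v. realizes M' \<rho> \<gamma> u v \<and> closed_pair \<rho> \<gamma>)"
            by (rule Suc.IH[OF r br(1) _ br(2)]) (use sub j bc cws in auto)
          then show ?thesis unfolding E set_append by blast
        next
          case False
          have "length ?m = length \<gamma>" using cws(1) by simp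
          from row[OF j(1) this j(2) False] show ?thesis unfolding E set_append by blast
        qed
      next
        case m: False
        show ?thesis
        proof (cases "list_ex (\<lambda>(w, b). w < 4 \<and> \<not> b) rws")
          case True
          then show ?thesis unfolding S using ban3 m3 r3 m swap by simp
        next
          case False
          have "nb (\<rho> ! i) \<subseteq> set \<gamma>" if "i < length \<rho>" for i
          proof (cases "br ! i")
            case nb: False
            have "card (nb (\<rho> ! i) \<inter> set \<gamma>) \<ge> 4"
              using False rws that nb unfolding list_ex_length by (metis (mono_tags, lifting) case_prod_conv not_less)
            then show ?thesis using wgt4(2)[OF r that] realizes_wgt[OF r that] by simp
          qed (use br that in blast)
          moreover have "nb (\<gamma> ! i) \<subseteq> set \<rho>" if "i < length \<gamma>" for i
          proof (cases "bc ! i")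
            case nb: False
            have "\<not> (case cws ! i of (w, b) \<Rightarrow> w < 4 \<and> \<not> b)"
              by (rule mark_not_ex[OF m]) (use that cws(1) in simp)
            then have "card (nb (\<gamma> ! i) \<inter> set \<rho>) \<ge> 4" using cws that nb by simp
            then show ?thesis using wgt4(2)[OF ra that] realizes_wgt[OF ra that] by simp
          qed (use bc that in blast)
          ultimately have "closed_pair \<rho> \<gamma>" unfolding closed_pair_def by (metis in_set_conv_nth)
          then show ?thesis unfolding S using ban3 m3 r3 m False r by auto
        qed
      qed
    qed
  qed
qed simp

end

subsection \<open>Embeddings into complete graphs\<close>

text \<open>Scaling by \<open>u\<close> is conjugation with a diagonal unitary matrix;
  \<open>f\<close> combines the permutation with the choice of a principal submatrix.\<close>

definition embeds :: "'v set \<Rightarrow> ('v \<Rightarrow> 'v \<Rightarrow> complex) \<Rightarrow> 'w set \<Rightarrow> ('w \<Rightarrow> 'w \<Rightarrow> complex) \<Rightarrow> bool"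
  where "embeds V A S w \<longleftrightarrow> (\<exists>f u s \<sigma>. inj_on f V \<and> f ` V \<subseteq> S \<and> (\<forall>i\<in>V. u i \<in> eisenstein_units) \<and>
    s \<in> {1, -1} \<and> \<sigma> \<in> {id, cnj} \<and>
    (\<forall>i\<in>V. \<forall>j\<in>V. A i j = s * \<sigma> (u i * w (f i) (f j) * cnj (u j))))"

text \<open>The injection is prolonged to a numbering of all of \<open>S\<close>, with scaling 1 on
  the new vertices. The given weights remain the leading block, and the whole is equivalent to the
  graph through a diagonal unitary matrix.\<close>

lemma embeds_complete:
  fixes A :: "nat \<Rightarrow> nat \<Rightarrow> complex" and S :: "'w set"
  assumes e: "embeds {..<n} A S w" and c: "complete_on S w"
  shows "\<exists>N B. n \<le> N \<and> (\<forall>i<n. \<forall>j<n. B i j = A i j) \<and> complete_on {..<N} B \<and>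
    equivalent_to_graph (mat N N (\<lambda>(i, j). B i j)) (S, w)"
proof -
  obtain f u s \<sigma> where f: "inj_on f {..<n}" "f ` {..<n} \<subseteq> S" and u0: "\<forall>i\<in>{..<n}. u i \<in> eisenstein_units"
    and s: "s \<in> {1, -1}" and \<sigma>: "\<sigma> \<in> {id, cnj}"
    and A0: "\<forall>i\<in>{..<n}. \<forall>j\<in>{..<n}. A i j = s * \<sigma> (u i * w (f i) (f j) * cnj (u j))"
    using e unfolding embeds_def by (elim exE conjE)
  have u: "u i \<in> eisenstein_units" if "i < n" for i using u0 that by simp
  have A: "A i j = s * \<sigma> (u i * w (f i) (f j) * cnj (u j))" if "i < n" "j < n" for i j using A0 that by simp
  have fin: "finite S" and h: "herm S w" and con: "connected_on S w"
    and sq: "\<And>i j. i \<in> S \<Longrightarrow> j \<in> S \<Longrightarrow> (\<Sum>k\<in>S. w i k * cnj (w j k)) = (if i = j then 4 else 0)"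
    using c unfolding complete_on_def by auto
  define N where "N = card S"
  have nN: "n \<le> N" using f fin card_mono[OF fin f(2)] by (simp add: N_def card_image)
  have "card (S - f ` {..<n}) = card {n..<N}"
    using f fin by (simp add: N_def card_Diff_subset card_image finite_subset)
  then obtain f' where f': "bij_betw f' {n..<N} (S - f ` {..<n})"
    using fin finite_same_card_bij[of "{n..<N}"] by (metis finite_Diff finite_atLeastLessThan)
  define g where "g i = (if i < n then f i else f' i)" for i
  have "bij_betw g ({..<n} \<union> {n..<N}) (f ` {..<n} \<union> (S - f ` {..<n}))"
  proof (rule bij_betw_combine)
    show "bij_betw g {..<n} (f ` {..<n})" using f(1) by (auto simp: bij_betw_def g_def inj_on_def)
    show "bij_betw g {n..<N} (S - f ` {..<n})" using f' by (subst bij_betw_cong[of _ _ f']) (auto simp: g_def)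
  qed auto
  moreover have "{..<n} \<union> {n..<N} = {..<N}" "f ` {..<n} \<union> (S - f ` {..<n}) = S" using nN f(2) by auto
  ultimately have g: "bij_betw g {..<N} S" by simp
  have gS: "g i \<in> S" if "i < N" for i using g that by (auto simp: bij_betw_def)
  have ginj: "g i = g j \<longleftrightarrow> i = j" if "i < N" "j < N" for i j
    using g that by (auto simp: bij_betw_def inj_on_def)
  define v where "v i = (if i < n then u i else 1)" for i
  have v: "v i \<in> eisenstein_units" for i using u by (simp add: v_def)
  define B where "B i j = s * \<sigma> (v i * w (g i) (g j) * cnj (v j))" for i j
  have BA: "B i j = A i j" if "i < n" "j < n" for i j using A that by (simp add: B_def v_def g_def)
  have ss: "cnj s = s" "s * s = 1" "s \<in> eisenstein_ints" "s \<noteq> 0" using s R_of_int[of "-1"] by auto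
  have \<sigma>R: "\<sigma> x \<in> eisenstein_ints" if "x \<in> eisenstein_ints" for x using \<sigma> that R_cnj by auto
  have \<sigma>m: "\<sigma> (x * y) = \<sigma> x * \<sigma> y" "\<sigma> (cnj x) = cnj (\<sigma> x)" "\<sigma> x = 0 \<longleftrightarrow> x = 0" for x y
    using \<sigma> by auto
  have \<sigma>s: "\<sigma> (sum F I) = (\<Sum>i\<in>I. \<sigma> (F i))" for F :: "nat \<Rightarrow> complex" and I using \<sigma> by auto
  have hB: "herm {..<N} B"
    unfolding herm_def
  proof (intro ballI conjI)
    fix i j assume "i \<in> {..<N}" "j \<in> {..<N}"
    then have gij: "g i \<in> S" "g j \<in> S" using gS by auto
    show "B i j \<in> eisenstein_ints"
      unfolding B_def by (intro R_mult \<sigma>R R_cnj hermD(1)[OF h gij] unit_R v ss(3))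
    have "w (g j) (g i) = cnj (w (g i) (g j))" by (rule hermD(2)[OF h gij])
    then show "B j i = cnj (B i j)" unfolding B_def by (simp add: \<sigma>m ss mult_ac)
  qed
  have sqB: "(\<Sum>k<N. B i k * cnj (B j k)) = (if i = j then 4 else 0)" if "i < N" "j < N" for i j
  proof -
    have "(\<Sum>k<N. B i k * cnj (B j k)) = (\<Sum>k<N. \<sigma> (v i * cnj (v j) * (w (g i) (g k) * cnj (w (g j) (g k)))))"
    proof (rule sum.cong[OF refl])
      fix k
      have vk: "\<sigma> (v k) * cnj (\<sigma> (v k)) = 1" using unit_cnj_mult(1)[OF v, of k] \<sigma>m by (metis \<sigma> id_apply insertE complex_cnj_one singletonD)
      have "B i k * cnj (B j k) = (s * s) * (\<sigma> (v k) * cnj (\<sigma> (v k))) * \<sigma> (v i * cnj (v j) * (w (g i) (g k) * cnj (w (g j) (g k))))"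
        unfolding B_def by (simp add: \<sigma>m ss(1) mult_ac)
      then show "B i k * cnj (B j k) = \<sigma> (v i * cnj (v j) * (w (g i) (g k) * cnj (w (g j) (g k))))"
        using ss(2) vk by simp
    qed
    also have "\<dots> = \<sigma> (v i * cnj (v j) * (\<Sum>k<N. w (g i) (g k) * cnj (w (g j) (g k))))"
      by (simp add: \<sigma>s sum_distrib_left)
    also have "(\<Sum>k<N. w (g i) (g k) * cnj (w (g j) (g k))) = (\<Sum>k\<in>S. w (g i) k * cnj (w (g j) k))"
      using g by (rule sum.reindex_bij_betw)
    also have "\<dots> = (if i = j then 4 else 0)" using sq[OF gS gS] that ginj[OF that] by simp
    finally show ?thesis using unit_cnj_mult(1)[OF v, of j] \<sigma> by auto
  qed
  have conB: "connected_on {..<N} B"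
    unfolding connected_on_def
  proof (intro conjI allI impI)
    show "{..<N} \<noteq> {}" using con g unfolding connected_on_def bij_betw_def by auto
    fix X assume X: "X \<subseteq> {..<N}" "X \<noteq> {}" "\<forall>i\<in>X. \<forall>j\<in>{..<N}. B i j \<noteq> 0 \<longrightarrow> j \<in> X"
    have nz: "B i j \<noteq> 0 \<longleftrightarrow> w (g i) (g j) \<noteq> 0" for i j
      unfolding B_def using ss(4) unit_nz[OF v] by (simp add: \<sigma>m)
    have "\<forall>i\<in>g ` X. \<forall>j\<in>S. w i j \<noteq> 0 \<longrightarrow> j \<in> g ` X"
    proof (intro ballI impI)
      fix i j assume "i \<in> g ` X" "j \<in> S" "w i j \<noteq> 0"
      then obtain i' j' where "i' \<in> X" "i = g i'" "j' < N" "j = g j'"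
        using g unfolding bij_betw_def by auto
      then show "j \<in> g ` X" using X(3) nz \<open>w i j \<noteq> 0\<close> by auto
    qed
    moreover have "g ` X \<subseteq> S" "g ` X \<noteq> {}" using X gS by auto
    ultimately have "g ` X = S" using con unfolding connected_on_def by blast
    then show "X = {..<N}" using g X(1) unfolding bij_betw_def
      by (metis inj_on_image_eq_iff order_refl)
  qed
  have cB: "complete_on {..<N} B" unfolding complete_on_def using hB conB sqB by simp
  define M where "M = mat N N (\<lambda>(i, j). w (g i) (g j))"
  define Q where "Q = mat_diag N v"
  have Qc: "Q \<in> carrier_mat N N" "M \<in> carrier_mat N N" by (auto simp: Q_def M_def)
  have Qa: "mat_adjoint Q = mat_diag N (\<lambda>i. cnj (v i))"
  proof (rule eq_matI)
    fix i j assume "i < dim_row (mat_diag N (\<lambda>i. cnj (v i)))" "j < dim_col (mat_diag N (\<lambda>i. cnj (v i)))"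
    then have "i < N" "j < N" by (simp_all add: mat_diag_def)
    then show "mat_adjoint Q $$ (i, j) = mat_diag N (\<lambda>i. cnj (v i)) $$ (i, j)"
      using mat_adjoint_index[OF Qc(1), of i j] by (auto simp: Q_def mat_diag_def)
  qed (use mat_adjoint_carrier[OF Qc(1)] in \<open>auto simp: mat_diag_def\<close>)
  have "R_unitary N Q"
  proof -
    have "Q * mat_adjoint Q = 1\<^sub>m N" "mat_adjoint Q * Q = 1\<^sub>m N"
      unfolding Qa unfolding Q_def mat_diag_diag by (simp_all add: unit_cnj_mult[OF v])
    moreover have "R_matrix Q" unfolding R_matrix_def elements_mat_def Q_def mat_diag_def using unit_R[OF v] by auto
    ultimately show ?thesis unfolding R_unitary_def using Qc by blast
  qed
  moreover have "mat N N (\<lambda>(i, j). B i j) = s \<cdot>\<^sub>m map_mat \<sigma> (Q * M * mat_adjoint Q)"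
    unfolding Qa unfolding Q_def
    by (rule eq_matI) (auto simp: M_def B_def mat_diag_mult_left[of _ N N] mat_diag_mult_right[of _ N N])
  moreover have "R_matrix (mat N N (\<lambda>(i, j). B i j))" "R_matrix M"
    using complete_cyclotomic[OF cB] hermD(1)[OF h gS gS]
    by (auto simp: cyclotomic_def R_matrix_def elements_mat_def M_def)
  ultimately have eq: "R_equivalent (mat N N (\<lambda>(i, j). B i j)) M"
    unfolding R_equivalent_def using s \<sigma> Qc by (metis (no_types, lifting) mat_carrier)
  have "is_adjacency_matrix M (S, w)"
    unfolding is_adjacency_matrix_def
  proof (intro exI conjI)
    show "distinct (map g [0..<N])" using g by (auto simp: distinct_map bij_betw_def atLeast0LessThan lessThan_def)
    show "set (map g [0..<N]) = fst (S, w)" using g by (auto simp: bij_betw_def)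
    show "M = mat (length (map g [0..<N])) (length (map g [0..<N])) (\<lambda>(i, j). snd (S, w) (map g [0..<N] ! i) (map g [0..<N] ! j))"
      by (rule eq_matI) (auto simp: M_def)
  qed
  then have "equivalent_to_graph (mat N N (\<lambda>(i, j). B i j)) (S, w)"
    unfolding equivalent_to_graph_def using eq by blast
  then show ?thesis using nN BA cB by blast
qed

subsection \<open>Hermitian structures on a frame\<close>

definition emap :: "eis \<Rightarrow> eis list \<Rightarrow> eis list" where "emap t c = map (emul t) c"

text \<open>\<open>acc\<close> holds the preceding columns; their entries in the current row
  prescribe the upper part of the new column.\<close>

definition herm_col :: "eis list list \<Rightarrow> eis list \<Rightarrow> bool"
  where "herm_col acc c \<longleftrightarrow> map (\<lambda>r. ecnj (r ! length acc)) acc = take (length acc) c \<and> ecnj (c ! length acc) = c ! length acc"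

text \<open>Units do not change the zero pattern, so this necessary condition is tested once before
  six scalings are tried.\<close>

definition supp_col :: "eis list list \<Rightarrow> eis list \<Rightarrow> bool"
  where "supp_col acc c \<longleftrightarrow> map (\<lambda>r. r ! length acc = N) acc = map (\<lambda>x. x = N) (take (length acc) c)"

text \<open>\<open>hs n W []\<close> lists the Hermitian matrices, given by their columns, that arise from the list
  of columns \<open>W\<close> by permuting and multiplying with units.\<close>

fun hs :: "nat \<Rightarrow> eis list list \<Rightarrow> eis list list \<Rightarrow> eis list list list" where
  "hs 0 av acc = [acc]"
| "hs (Suc n) av acc = concat (map (\<lambda>c. if supp_col acc c then
      concat (map (\<lambda>t. if herm_col acc (emap t c) then hs n (remove1 c av) (acc @ [emap t c]) else [])
        [P0, P1, P2, P3, P4, P5]) else []) av)"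

lemma hs_complete:
  assumes "distinct av" "distinct (map fst ds)" "set (map fst ds) \<subseteq> set av" "\<And>d. d \<in> set ds \<Longrightarrow> snd d \<noteq> N"
    and "\<And>k. k < length ds \<Longrightarrow> herm_col (acc @ map (\<lambda>(c, t). emap t c) (take k ds)) (emap (snd (ds ! k)) (fst (ds ! k)))"
  shows "acc @ map (\<lambda>(c, t). emap t c) ds \<in> set (hs (length ds) av acc)"
  using assms
proof (induction ds arbitrary: av acc)
  case (Cons d ds)
  obtain c t where d: "d = (c, t)" by (cases d)
  have h: "herm_col acc (emap t c)" using Cons.prems(5)[of 0] d by simp
  have t: "t \<in> {P0, P1, P2, P3, P4, P5}" using Cons.prems(4)[of d] d by (cases t) auto
  have em0: "emul t x = N \<longleftrightarrow> x = N" for x using t by (cases x) auto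
  have ec0: "ecnj x = N \<longleftrightarrow> x = N" for x by (cases x) auto
  have "map (\<lambda>x. x = N) (map (\<lambda>r. ecnj (r ! length acc)) acc) = map (\<lambda>x. x = N) (take (length acc) (emap t c))"
    using h unfolding herm_col_def by simp
  then have s: "supp_col acc c" unfolding supp_col_def emap_def by (simp add: take_map comp_def em0 ec0)
  have "(acc @ [emap t c]) @ map (\<lambda>(c, t). emap t c) ds \<in> set (hs (length ds) (remove1 c av) (acc @ [emap t c]))"
  proof (rule Cons.IH)
    show "distinct (remove1 c av)" using Cons.prems(1) by simp
    show "distinct (map fst ds)" using Cons.prems(2) by simp
    show "set (map fst ds) \<subseteq> set (remove1 c av)" using Cons.prems(1-3) d by auto
    show "snd d \<noteq> N" if "d \<in> set ds" for d using Cons.prems(4) that by auto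
    fix k assume "k < length ds"
    then show "herm_col ((acc @ [emap t c]) @ map (\<lambda>(c, t). emap t c) (take k ds)) (emap (snd (ds ! k)) (fst (ds ! k)))"
      using Cons.prems(5)[of "Suc k"] d by simp
  qed
  moreover have "c \<in> set av" using Cons.prems(3) d by simp
  ultimately show ?case using s h t d by auto
qed simp

text \<open>An explicit embedding: a sign, and for each index its image in \<open>G\<close> with a
  unit. The target index is the outer one because \<open>B\<close> is given by columns.\<close>

definition hcert :: "eis list list \<Rightarrow> eis list list \<Rightarrow> eis \<times> (nat \<times> eis) list \<Rightarrow> bool"
  where "hcert B G q = (case q of (s, fp) \<Rightarrow> (s = P0 \<or> s = P3) \<and> length fp = length B \<and> distinct (map fst fp) \<and>
    list_all (\<lambda>(x, p). x < length G \<and> p \<noteq> N) fp \<and>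
    map (\<lambda>(y, p'). map (\<lambda>(x, p). emul s (emul p (emul (G ! x ! y) (ecnj p')))) fp) fp = B)"

text \<open>The columns of the block matrix with diagonal blocks 0 and off-diagonal blocks
  \<open>M\<close> and its adjoint.\<close>

definition dblc :: "eis list list \<Rightarrow> eis list list"
  where "dblc M = map (\<lambda>r. replicate (length M) N @ map ecnj r) M @
    map (\<lambda>c. c @ replicate (length (tr M)) N) (tr M)"

definition wcert :: "eis list list \<Rightarrow> eis list list \<Rightarrow> (nat \<times> eis) list \<times> (nat \<times> eis) list \<Rightarrow> bool"
  where "wcert M W q = (case q of (rp, cp) \<Rightarrow> length rp = length M \<and> length cp = length (hd M) \<and> distinct (map fst rp) \<and>
    distinct (map fst cp) \<and>
    list_all (\<lambda>(x, p). x < length M \<and> p \<noteq> N) rp \<and> list_all (\<lambda>(x, p). x < length (hd M) \<and> p \<noteq> N) cp \<and>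
    W = map (\<lambda>(x, p). map (\<lambda>(y, q). emul p (emul (M ! x ! y) q)) cp) rp)"

section \<open>The two ways in which a closed pair covers the graph\<close>

context frame
begin

text \<open>Union and intersection of the two sides are both closed under neighbours, so the union
  is \<open>V\<close> and the intersection is empty or \<open>V\<close>.\<close>

lemma closed_pair_cases:
  assumes con: "connected_on V A" and r: "realizes M \<rho> \<gamma> u v" and c: "closed_pair \<rho> \<gamma>"
  shows "(set \<rho> \<inter> set \<gamma> = {} \<and> set \<rho> \<union> set \<gamma> = V) \<or> (set \<rho> = V \<and> set \<gamma> = V)"
proof -
  have V: "set \<rho> \<subseteq> V" "set \<gamma> \<subseteq> V" "\<rho> \<noteq> []" using r unfolding realizes_def by auto
  have cl: "X = V" if "X \<subseteq> V" "X \<noteq> {}" "\<And>i. i \<in> X \<Longrightarrow> nb i \<subseteq> X" for X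
    using con that unfolding connected_on_def nb_def by blast
  have "set \<rho> \<union> set \<gamma> = V" using V c unfolding closed_pair_def by (intro cl) auto
  moreover have "set \<rho> \<inter> set \<gamma> = V" if "set \<rho> \<inter> set \<gamma> \<noteq> {}"
    using V c that unfolding closed_pair_def by (intro cl) auto
  ultimately show ?thesis by blast
qed

text \<open>The indices of \<open>B\<close> are exchanged because \<open>hs\<close> and
  \<open>dblc\<close> produce columns.\<close>

definition hrealizes :: "eis list list \<Rightarrow> 'v list \<Rightarrow> (nat \<Rightarrow> complex) \<Rightarrow> bool"
  where "hrealizes B xs w \<longleftrightarrow> distinct xs \<and> set xs = V \<and> length B = length xs \<and> (\<forall>i<length xs. w i \<in> eisenstein_units) \<and>
    (\<forall>i<length xs. \<forall>k<length xs. A (xs ! i) (xs ! k) = w i * val (B ! k ! i) * cnj (w k))"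

lemma hcert_embeds:
  assumes h: "hrealizes B xs w" and c: "hcert B G (s, fp)"
  shows "embeds V A {..<length G} (\<lambda>i j. val (G ! i ! j))"
proof -
  have H: "distinct xs" "set xs = V" "length B = length xs" "\<And>i. i < length xs \<Longrightarrow> w i \<in> eisenstein_units"
    "\<And>i k. i < length xs \<Longrightarrow> k < length xs \<Longrightarrow> A (xs ! i) (xs ! k) = w i * val (B ! k ! i) * cnj (w k)"
    using h unfolding hrealizes_def by auto
  have C: "s = P0 \<or> s = P3" "length fp = length xs" "distinct (map fst fp)"
    "\<And>i. i < length xs \<Longrightarrow> fst (fp ! i) < length G \<and> snd (fp ! i) \<noteq> N"
    "B = map (\<lambda>(y, p'). map (\<lambda>(x, p). emul s (emul p (emul (G ! x ! y) (ecnj p')))) fp) fp"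
    using c H(3) unfolding hcert_def by (auto simp: list_all_length split_beta)
  have Bki: "val (B ! k ! i) = val s * (val (snd (fp ! i)) * val (G ! fst (fp ! i) ! fst (fp ! k)) * cnj (val (snd (fp ! k))))"
    if "i < length xs" "k < length xs" for i k
    unfolding C(5) using that C(2) by (simp add: split_beta val_emul val_ecnj mult.assoc)
  define idx where "idx x = (THE i. i < length xs \<and> xs ! i = x)" for x
  have idx: "idx (xs ! i) = i" if "i < length xs" for i
    unfolding idx_def using H(1) that by (intro the_equality) (auto simp: nth_eq_iff_index_eq)
  have ex: "\<exists>i<length xs. x = xs ! i" if "x \<in> V" for x using that H(2) by (metis in_set_conv_nth)
  show ?thesis
    unfolding embeds_def
  proof (intro exI conjI ballI)
    show "inj_on (\<lambda>x. fst (fp ! idx x)) V"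
    proof (rule inj_onI)
      fix x y assume "x \<in> V" "y \<in> V" and eq: "fst (fp ! idx x) = fst (fp ! idx y)"
      then obtain i j where ij: "i < length xs" "x = xs ! i" "j < length xs" "y = xs ! j" using ex by metis
      then have "map fst fp ! i = map fst fp ! j" using eq idx C(2) by simp
      then have "i = j" using nth_eq_iff_index_eq[OF C(3), of i j] ij(1,3) C(2) by (simp only: length_map)
      then show "x = y" using ij by simp
    qed
    show "(\<lambda>x. fst (fp ! idx x)) ` V \<subseteq> {..<length G}" using ex idx C(4) by fastforce
    show "w (idx x) * val (snd (fp ! idx x)) \<in> eisenstein_units" if "x \<in> V" for x
      using ex[OF that] idx C(4) H(4) val_units unit_mult by auto
    show "val s \<in> {1, -1}" using C(1) by auto
    show "id \<in> {id, cnj}" by simp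
    fix x y assume "x \<in> V" "y \<in> V"
    then obtain i j where ij: "i < length xs" "x = xs ! i" "j < length xs" "y = xs ! j" using ex by metis
    show "A x y = val s * id (w (idx x) * val (snd (fp ! idx x)) * val (G ! fst (fp ! idx x) ! fst (fp ! idx y)) *
        cnj (w (idx y) * val (snd (fp ! idx y))))"
      unfolding ij idx[OF ij(1)] idx[OF ij(3)] H(5)[OF ij(1,3)] Bki[OF ij(1,3)] by (simp add: mult_ac)
  qed
qed

lemma realizes_perm:
  assumes r: "realizes M \<rho> \<gamma> u v" and c: "closed_pair \<rho> \<gamma>" and w: "wcert M W q"
  shows "\<exists>\<rho>' \<gamma>' u' v'. realizes W \<rho>' \<gamma>' u' v' \<and> closed_pair \<rho>' \<gamma>'"
proof -
  obtain rp cp where q: "q = (rp, cp)" by (cases q)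
  have R: "distinct \<rho>" "distinct \<gamma>" "set \<rho> \<subseteq> V" "set \<gamma> \<subseteq> V" "\<rho> \<noteq> []" "\<gamma> \<noteq> []" "length M = length \<rho>"
      "\<And>x. x \<in> set M \<Longrightarrow> length x = length \<gamma>"
      "\<And>i. i < length \<rho> \<Longrightarrow> u i \<in> eisenstein_units"  "\<And>j. j < length \<gamma> \<Longrightarrow> v j \<in> eisenstein_units"
      "\<And>i j. i < length \<rho> \<Longrightarrow> j < length \<gamma> \<Longrightarrow> A (\<rho> ! i) (\<gamma> ! j) = u i * val (M ! i ! j) * cnj (v j)"
    using r unfolding realizes_def by auto
  have hd: "length (hd M) = length \<gamma>" using R(5,7,8) by (metis length_0_conv list.set_sel(1))
  have C: "length rp = length \<rho>" "length cp = length \<gamma>" "distinct (map fst rp)" "distinct (map fst cp)"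
    "\<And>i. i < length \<rho> \<Longrightarrow> fst (rp ! i) < length \<rho> \<and> snd (rp ! i) \<noteq> N"
    "\<And>i. i < length \<gamma> \<Longrightarrow> fst (cp ! i) < length \<gamma> \<and> snd (cp ! i) \<noteq> N"
    "W = map (\<lambda>(x, p). map (\<lambda>(y, q). emul p (emul (M ! x ! y) q)) cp) rp"
    using w R(7) hd unfolding wcert_def q by (auto simp: list_all_length split_beta)
  define \<rho>' where "\<rho>' = map (\<lambda>x. \<rho> ! fst x) rp"
  define \<gamma>' where "\<gamma>' = map (\<lambda>x. \<gamma> ! fst x) cp"
  have perm: "distinct (map (\<lambda>x. l ! fst x) ps) \<and> set (map (\<lambda>x. l ! fst x) ps) = set l"
    if "distinct l" "length ps = length l" "distinct (map fst ps)" "\<And>i. i < length l \<Longrightarrow> fst (ps ! i) < length l"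
    for l :: "'v list" and ps :: "(nat \<times> eis) list"
  proof -
    have sub: "set (map fst ps) \<subseteq> {..<length l}" using that(2,4)
      by (metis (no_types) in_set_conv_nth length_map lessThan_iff nth_map subsetI)
    have "card (set (map fst ps)) = length l" using that(2,3) by (metis distinct_card length_map)
    then have eq: "set (map fst ps) = {..<length l}" using sub by (intro card_subset_eq) auto
    have m: "map (\<lambda>x. l ! fst x) ps = map (\<lambda>i. l ! i) (map fst ps)" by simp
    have "distinct (map (\<lambda>i. l ! i) (map fst ps))"
      using that(1,3) eq by (subst distinct_map) (auto simp: inj_on_def nth_eq_iff_index_eq)
    moreover have "set (map (\<lambda>i. l ! i) (map fst ps)) = set l"
      unfolding set_map[of _ "map fst ps"] eq by (auto simp: set_conv_nth)
    ultimately show ?thesis unfolding m by blast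
  qed
  have \<rho>': "distinct \<rho>'" "set \<rho>' = set \<rho>" "length \<rho>' = length \<rho>"
    using perm[OF R(1) C(1,3)] C(1,5) unfolding \<rho>'_def by auto
  have \<gamma>': "distinct \<gamma>'" "set \<gamma>' = set \<gamma>" "length \<gamma>' = length \<gamma>"
    using perm[OF R(2) C(2,4)] C(2,6) unfolding \<gamma>'_def by auto
  define u' where "u' i = u (fst (rp ! i)) * cnj (val (snd (rp ! i)))" for i
  define v' where "v' j = v (fst (cp ! j)) * val (snd (cp ! j))" for j
  have val1: "cnj (val x) * val x = 1" if "x \<noteq> N" for x using unit_cnj_mult(2)[OF val_units[OF that]] .
  have "A (\<rho>' ! i) (\<gamma>' ! j) = u' i * val (W ! i ! j) * cnj (v' j)" if "i < length \<rho>" "j < length \<gamma>" for i j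
  proof -
    have "u' i * val (W ! i ! j) * cnj (v' j) = (cnj (val (snd (rp ! i))) * val (snd (rp ! i))) *
        (cnj (val (snd (cp ! j))) * val (snd (cp ! j))) *
        (u (fst (rp ! i)) * val (M ! fst (rp ! i) ! fst (cp ! j)) * cnj (v (fst (cp ! j))))"
      unfolding u'_def v'_def C(7) using that C(1,2) by (simp add: split_beta val_emul mult_ac)
    then show ?thesis using val1 C(5)[OF that(1)] C(6)[OF that(2)] R(11) C(1,2) that
      unfolding \<rho>'_def \<gamma>'_def by simp
  qed
  moreover have "u' i \<in> eisenstein_units" if "i < length \<rho>" for i
    using C(5)[OF that] R(9) val_units unit_mult unit_cnj unfolding u'_def by blast
  moreover have "v' j \<in> eisenstein_units" if "j < length \<gamma>" for j
    using C(6)[OF that] R(10) val_units unit_mult unfolding v'_def by blast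
  moreover have "length W = length \<rho>" "\<forall>x\<in>set W. length x = length \<gamma>" using C by auto
  moreover have "\<rho>' \<noteq> []" "\<gamma>' \<noteq> []" using \<rho>'(3) \<gamma>'(3) R(5,6) by auto
  ultimately have "realizes W \<rho>' \<gamma>' u' v'"
    unfolding realizes_def \<rho>'(2,3) \<gamma>'(2,3) using \<rho>'(1) \<gamma>'(1) R(3,4) by simp
  moreover have "closed_pair \<rho>' \<gamma>'" using c \<rho>'(2) \<gamma>'(2) unfolding closed_pair_def by simp
  ultimately show ?thesis by blast
qed

lemma realizes_double:
  assumes r: "realizes M \<rho> \<gamma> u v" and c: "closed_pair \<rho> \<gamma>" and d: "set \<rho> \<inter> set \<gamma> = {}" "set \<rho> \<union> set \<gamma> = V"
  shows "\<exists>xs w. hrealizes (dblc M) xs w"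
proof -
  have R: "distinct \<rho>" "distinct \<gamma>" "set \<rho> \<subseteq> V" "set \<gamma> \<subseteq> V" "\<rho> \<noteq> []" "\<gamma> \<noteq> []" "length M = length \<rho>"
      "\<And>x. x \<in> set M \<Longrightarrow> length x = length \<gamma>"
      "\<And>i. i < length \<rho> \<Longrightarrow> u i \<in> eisenstein_units"  "\<And>j. j < length \<gamma> \<Longrightarrow> v j \<in> eisenstein_units"
      "\<And>i j. i < length \<rho> \<Longrightarrow> j < length \<gamma> \<Longrightarrow> A (\<rho> ! i) (\<gamma> ! j) = u i * val (M ! i ! j) * cnj (v j)"
    using r unfolding realizes_def by auto
  have "M \<noteq> []" using R(5,7) by auto
  from tr_nth[OF this R(8)]
  have T: "length (tr M) = length \<gamma>" "\<And>j. j < length \<gamma> \<Longrightarrow> tr M ! j = map (\<lambda>r. r ! j) M" by auto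
  define w where "w i = (if i < length \<rho> then u i else v (i - length \<rho>))" for i
  have z: "A x y = 0" if "x \<in> set \<rho> \<and> y \<in> set \<rho> \<or> x \<in> set \<gamma> \<and> y \<in> set \<gamma>" for x y
    using that c d R(3,4) unfolding closed_pair_def nb_def by blast
  have D1: "dblc M ! k ! i = N" if "k < length \<rho>" "i < length \<rho>" for k i
    using that R(7) by (simp add: dblc_def nth_append)
  have D2: "dblc M ! k ! (length \<rho> + i) = ecnj (M ! k ! i)" if "k < length \<rho>" "i < length \<gamma>" for k i
    using that R(7,8) by (simp add: dblc_def nth_append)
  have D3: "dblc M ! (length \<rho> + k) ! i = M ! i ! k" if "k < length \<gamma>" "i < length \<rho>" for k i
    using that R(7) T by (simp add: dblc_def nth_append)
  have D4: "dblc M ! (length \<rho> + k) ! (length \<rho> + i) = N" if "k < length \<gamma>" "i < length \<gamma>" for k i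
    using that R(7) T by (simp add: dblc_def nth_append)
  have "A ((\<rho> @ \<gamma>) ! i) ((\<rho> @ \<gamma>) ! k) = w i * val (dblc M ! k ! i) * cnj (w k)"
    if ik: "i < length \<rho> + length \<gamma>" "k < length \<rho> + length \<gamma>" for i k
  proof (cases "i < length \<rho>"; cases "k < length \<rho>")
    assume "i < length \<rho>" "k < length \<rho>"
    then show ?thesis using D1 z by (simp add: nth_append w_def)
  next
    assume a: "i < length \<rho>" "\<not> k < length \<rho>"
    then obtain l where "k = length \<rho> + l" "l < length \<gamma>" using ik by (metis add_less_cancel_left le_Suc_ex not_less)
    then show ?thesis using D3 R(11) a by (simp add: nth_append w_def)
  next
    assume a: "\<not> i < length \<rho>" "k < length \<rho>"
    then obtain l where l: "i = length \<rho> + l" "l < length \<gamma>" using ik by (metis add_less_cancel_left le_Suc_ex not_less)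
    have "A (\<gamma> ! l) (\<rho> ! k) = cnj (A (\<rho> ! k) (\<gamma> ! l))"
      using R(3,4) a(2) l(2) by (intro hermD(2)[OF herm_A]) auto
    then show ?thesis using D2 R(11) a l by (simp add: nth_append w_def val_ecnj mult_ac)
  next
    assume a: "\<not> i < length \<rho>" "\<not> k < length \<rho>"
    then obtain l m where "i = length \<rho> + l" "l < length \<gamma>" "k = length \<rho> + m" "m < length \<gamma>" using ik by (metis add_less_cancel_left le_Suc_ex not_less)
    then show ?thesis using D4 z by (simp add: nth_append w_def)
  qed
  moreover have "length (dblc M) = length \<rho> + length \<gamma>" using R(7) T by (simp add: dblc_def)
  ultimately have "hrealizes (dblc M) (\<rho> @ \<gamma>) w"
    unfolding hrealizes_def using R(1,2,9,10) d by (auto simp: w_def)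
  then show ?thesis by blast
qed

lemma realizes_hs:
  assumes r: "realizes M \<rho> \<gamma> u v" and V: "set \<rho> = V" "set \<gamma> = V" and dis: "distinct (tr M)"
  shows "\<exists>B\<in>set (hs (length M) (tr M) []). \<exists>xs w. hrealizes B xs w"
proof -
  have R: "distinct \<rho>" "distinct \<gamma>" "\<rho> \<noteq> []" "\<gamma> \<noteq> []" "length M = length \<rho>"
      "\<And>x. x \<in> set M \<Longrightarrow> length x = length \<gamma>"
      "\<And>i. i < length \<rho> \<Longrightarrow> u i \<in> eisenstein_units"  "\<And>j. j < length \<gamma> \<Longrightarrow> v j \<in> eisenstein_units"
      "\<And>i j. i < length \<rho> \<Longrightarrow> j < length \<gamma> \<Longrightarrow> A (\<rho> ! i) (\<gamma> ! j) = u i * val (M ! i ! j) * cnj (v j)"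
    using r unfolding realizes_def by auto
  define n where "n = length \<rho>"
  have n: "length \<rho> = n" "length \<gamma> = n" using R(1,2) V by (auto simp: n_def) (metis distinct_card)
  have "M \<noteq> []" using R(3,5) by auto
  from tr_nth[OF this R(6)]
  have T: "length (tr M) = n" "\<And>j. j < n \<Longrightarrow> tr M ! j = map (\<lambda>r. r ! j) M" using n by auto
  have "\<exists>j<n. \<gamma> ! j = \<rho> ! k" if "k < n" for k
    using V n that by (metis in_set_conv_nth nth_mem)
  \<comment> \<open>Both lists enumerate \<open>V\<close>; \<open>\<pi>\<close> finds the column
    that belongs to the vertex of a given row.\<close>
  then obtain \<pi> where \<pi>: "\<And>k. k < n \<Longrightarrow> \<pi> k < n \<and> \<gamma> ! \<pi> k = \<rho> ! k" by metis
  \<comment> \<open>This factor replaces the column unit at a vertex by its row unit; with equal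
    units on both sides the array is Hermitian.\<close>
  have "\<exists>t. val t = cnj (v (\<pi> k)) * u k" if "k < n" for k
    using R(7,8) \<pi> that n unit_mult unit_cnj by (intro val_surj) auto
  then obtain t where t: "\<And>k. k < n \<Longrightarrow> val (t k) = cnj (v (\<pi> k)) * u k" by metis
  have tN: "t k \<noteq> N" if "k < n" for k
    using t[OF that] R(7,8) \<pi>[OF that] n that unit_nz[of "u k"] unit_nz[of "v (\<pi> k)"] val_0_iff by fastforce
  define ds where "ds = map (\<lambda>k. (tr M ! \<pi> k, t k)) [0..<n]"
  define B where "B = map (\<lambda>(c, t). emap t c) ds"
  have Bk: "B ! k = map (\<lambda>r. emul (t k) (r ! \<pi> k)) M" if "k < n" for k
    using that T(2)[of "\<pi> k"] \<pi>[OF that] by (simp add: B_def ds_def emap_def comp_def)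
  have AB: "A (\<rho> ! i) (\<rho> ! k) = u i * val (B ! k ! i) * cnj (u k)" if "i < n" "k < n" for i k
  proof -
    have "u i * val (B ! k ! i) * cnj (u k) = (u k * cnj (u k)) * (u i * val (M ! i ! \<pi> k) * cnj (v (\<pi> k)))"
      using that Bk R(5) n by (simp add: val_emul t mult_ac)
    also have "\<dots> = A (\<rho> ! i) (\<gamma> ! \<pi> k)" using that R(9)[of i "\<pi> k"] \<pi>[OF that(2)] n unit_cnj_mult(1)[OF R(7)[of k]] by simp
    finally show ?thesis using \<pi> that by simp
  qed
  have lB: "length B = n" "\<And>k. k < n \<Longrightarrow> length (B ! k) = n" using Bk R(5) n by (auto simp: B_def ds_def)
  have val_inj: "x = y" if "val x = val y" for x y
    using that by (cases x; cases y) (auto simp: omega_def complex_eq_iff)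
  have herm: "B ! k ! i = ecnj (B ! i ! k)" if "i < n" "k < n" for i k
  proof (rule val_inj)
    have "\<rho> ! i \<in> V" "\<rho> ! k \<in> V" using nth_mem[of i \<rho>] nth_mem[of k \<rho>] V(1) n(1) that by simp_all
    then have "A (\<rho> ! i) (\<rho> ! k) = cnj (A (\<rho> ! k) (\<rho> ! i))" by (intro hermD(2)[OF herm_A])
    then have "u i * val (B ! k ! i) * cnj (u k) = cnj (u k * val (B ! i ! k) * cnj (u i))"
      by (simp only: AB[OF that] AB[OF that(2,1)])
    also have "\<dots> = u i * cnj (val (B ! i ! k)) * cnj (u k)" by simp
    finally have "u i * val (B ! k ! i) * cnj (u k) = u i * cnj (val (B ! i ! k)) * cnj (u k)" .
    moreover have "u i \<noteq> 0" "cnj (u k) \<noteq> 0" using R(7) n that unit_nz by simp_all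
    ultimately show "val (B ! k ! i) = val (ecnj (B ! i ! k))" unfolding val_ecnj by simp
  qed
  have "[] @ map (\<lambda>(c, t). emap t c) ds \<in> set (hs (length ds) (tr M) [])"
  proof (rule hs_complete[OF dis])
    have "\<pi> i = \<pi> j \<Longrightarrow> i = j" if "i < n" "j < n" for i j
      using \<pi>[OF that(1)] \<pi>[OF that(2)] that R(1) n by (metis nth_eq_iff_index_eq)
    then show "distinct (map fst ds)"
      using \<pi> dis T(1) by (auto simp: ds_def distinct_map inj_on_def comp_def nth_eq_iff_index_eq)
    show "set (map fst ds) \<subseteq> set (tr M)" using \<pi> T(1) by (auto simp: ds_def)
    show "snd d \<noteq> N" if "d \<in> set ds" for d using that tN by (auto simp: ds_def)
    fix k assume "k < length ds"
    then have k: "k < n" by (simp add: ds_def)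
    have tk: "map (\<lambda>(c, t). emap t c) (take k ds) = take k B" by (simp add: B_def take_map)
    have ek: "emap (snd (ds ! k)) (fst (ds ! k)) = B ! k" using k by (simp add: B_def ds_def split_beta)
    have "map (\<lambda>r. ecnj (r ! k)) (take k B) = take k (B ! k)"
    proof (rule nth_equalityI)
      fix i assume "i < length (map (\<lambda>r. ecnj (r ! k)) (take k B))"
      then have i: "i < k" "i < n" using k by auto
      have "B ! k ! i = ecnj (B ! i ! k)" by (rule herm[OF i(2) k])
      then show "map (\<lambda>r. ecnj (r ! k)) (take k B) ! i = take k (B ! k) ! i" using i k lB(1) by simp
    qed (use k lB in simp)
    moreover have "length (take k B) = k" using k lB(1) by simp
    ultimately show "herm_col ([] @ map (\<lambda>(c, t). emap t c) (take k ds)) (emap (snd (ds ! k)) (fst (ds ! k)))"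
      unfolding tk ek herm_col_def append_Nil using herm[OF k k, symmetric] by simp
  qed
  then have "B \<in> set (hs (length M) (tr M) [])" using R(5) n by (simp add: B_def ds_def)
  moreover have "hrealizes B \<rho> u" unfolding hrealizes_def using R(1,7) V n lB AB by auto
  ultimately show ?thesis by blast
qed

end

section \<open>Coded graphs, normal forms of arrays, and evaluated enumerations\<close>

definition gS5 :: "eis list list" where
  "gS5 = [[N,P0,P4,P0,P2],[P0,N,P0,P4,P2],[P2,P0,P0,N,P0],[P0,P2,N,P0,P0],[P4,P4,P0,P0,N]]"

definition gS6 :: "eis list list" where
  "gS6 = [[P3,P2,N,P4,N,P0],[P4,P0,P0,N,P0,N],[N,P0,P3,P0,N,P0],[P2,N,P0,P0,P2,N],[N,P0,N,P4,P3,P2],[P0,N,P0,N,P4,P0]]"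

definition gS6d :: "eis list list" where
  "gS6d = [[N,P2,N,P4,P3,P0],[P4,N,P0,N,P0,P0],[N,P0,P3,P0,N,P0],[P2,N,P0,P0,P2,N],[P3,P0,N,P4,N,P2],[P0,P0,P0,N,P4,N]]"

definition gS7 :: "eis list list" where
  "gS7 = [[P0,P0,P3,P0,N,N,N],[P0,N,P0,N,P3,N,P0],[P3,P0,N,N,N,P0,P0],[P0,N,N,P3,P0,P0,N],[N,P3,N,P0,P0,N,P0],[N,N,P0,P0,N,P0,P3],[N,P0,P0,N,P0,P3,N]]"

definition gS8 :: "eis list list" where
  "gS8 = [[P3,P0,P3,N,P0,N,N,N],[P0,P0,N,P0,N,P3,N,N],[P3,N,P0,P0,N,N,P0,N],[N,P0,P0,P3,N,N,N,P0],[P0,N,N,N,P0,P0,P0,N],[N,P3,N,N,P0,P3,N,P0],[N,N,P0,N,P0,N,P3,P3],[N,N,N,P0,N,P0,P3,P0]]"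

definition gS8p :: "eis list list" where
  "gS8p = [[P3,P0,P0,N,P0,N,N,N],[P0,P0,N,P0,N,P3,N,N],[P0,N,N,P3,P0,N,P0,N],[N,P0,P3,N,N,P0,N,P0],[P0,N,P0,N,N,P0,P3,N],[N,P3,N,P0,P0,N,N,P0],[N,N,P0,N,P3,N,P0,P0],[N,N,N,P0,N,P0,P0,P3]]"

definition gS10 :: "eis list list" where
  "gS10 = [[N,P0,N,N,N,P4,N,N,P4,P0],[P0,N,P0,P2,P2,N,N,N,N,N],[N,P0,N,N,N,P0,N,P4,N,P4],[N,P4,N,N,N,P0,N,P0,P4,N],[N,P4,N,N,N,N,N,P4,P0,P0],[P2,N,P0,P0,N,N,P2,N,N,N],[N,N,N,N,N,P4,N,P0,P0,P4],[N,N,P2,P0,P2,N,P0,N,N,N],[P2,N,N,P2,P0,N,P0,N,N,N],[P0,N,P2,N,P0,N,P2,N,N,N]]"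

definition gS12 :: "eis list list" where
  "gS12 = [[N,P0,N,N,N,P1,N,N,N,P3,N,P3],[P0,N,P4,P0,P0,N,N,N,N,N,N,N],[N,P2,N,N,N,P0,N,N,P0,N,P0,N],[N,P0,N,N,N,N,N,N,P2,P0,P0,N],[N,P0,N,N,N,N,N,N,P0,N,P2,P0],[P5,N,P0,N,N,N,P3,P3,N,N,N,N],[N,N,N,N,N,P3,N,N,P0,P1,N,P3],[N,N,N,N,N,P3,N,N,N,P3,P0,P1],[N,N,P0,P4,P0,N,P0,N,N,N,N,N],[P3,N,N,P0,N,N,P5,P3,N,N,N,N],[N,N,P0,P0,P4,N,N,P0,N,N,N,N],[P3,N,N,N,P0,N,P3,P5,N,N,N,N]]"

definition gS14 :: "eis list list" where
  "gS14 = [[N,P0,N,N,N,P0,N,N,N,N,P0,N,N,P3],[P0,N,P3,P0,P0,N,N,N,N,N,N,N,N,N],[N,P3,N,N,N,P0,N,N,P0,N,N,P0,N,N],[N,P0,N,N,N,N,N,N,N,N,P3,P0,P0,N],[N,P0,N,N,N,N,N,N,P0,N,N,N,P3,P0],[P0,N,P0,N,N,N,P3,P0,N,N,N,N,N,N],[N,N,N,N,N,P3,N,N,P0,N,P0,N,P0,N],[N,N,N,N,N,P0,N,N,N,N,N,P3,P0,P0],[N,N,P0,N,P0,N,P0,N,N,P3,N,N,N,N],[N,N,N,N,N,N,N,N,P3,N,P0,P0,N,P0],[P0,N,N,P3,N,N,P0,N,N,P0,N,N,N,N],[N,N,P0,P0,N,N,N,P3,N,P0,N,N,N,N],[N,N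,N,P0,P3,N,P0,P0,N,N,N,N,N,N],[P3,N,N,N,P0,N,N,P0,N,P0,N,N,N,N]]"

definition gS16 :: "eis list list" where
  "gS16 = [[N,P0,N,N,N,N,N,P0,N,P3,N,N,N,N,N,P0],[P0,N,P0,N,N,N,N,N,P0,N,P3,N,N,N,N,N],[N,P0,N,P0,N,N,N,N,N,P0,N,P3,N,N,N,N],[N,N,P0,N,P0,N,N,N,N,N,P0,N,P3,N,N,N],[N,N,N,P0,N,P0,N,N,N,N,N,P0,N,P3,N,N],[N,N,N,N,P0,N,P0,N,N,N,N,N,P0,N,P3,N],[N,N,N,N,N,P0,N,P0,N,N,N,N,N,P0,N,P3],[P0,N,N,N,N,N,P0,N,P3,N,N,N,N,N,P0,N],[N,P0,N,N,N,N,N,P3,N,N,N,P0,N,P0,N,N],[P3,N,P0,N,N,N,N,N,N,N,N,N,P0,N,P0,N],[N,P3,N,P0,N,N,N,N,N,N,N,N,N,P0,N,P0],[N,N,P3,N,P0,N,N,N,P0,N,N,N,N,N,P0,N],[N,N,N,P3,N,P0,N,N,N,P0,N,N,N,N,N,P0],[N,N,N,N,P3,N,P0,N,P0,N,P0,N,N,N,N,N],[N,N,N,N,N,P3,N,P0,N,P0,N,P0,N,N,N,N],[P0,N,N,N,N,N,P3,N,N,N,P0,N,P0,N,N,N]]"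

text \<open>\<open>gC0\<close> and \<open>gC1\<close> are C_4^++ and C_4^+-, \<open>gT0\<close> and
  \<open>gT1\<close> are T_8 and T_8^(\<omega>), with the vertices ordered t_1, b_1, t_2, b_2 and so
  on.\<close>

definition gC0 :: "eis list list" where
  "gC0 = [[P0,P0,P0,P0],[P0,P0,P3,P3],[P0,P3,P0,P3],[P0,P3,P3,P0]]"

definition gC1 :: "eis list list" where
  "gC1 = [[P0,P0,P0,P0],[P0,P0,P3,P3],[P0,P3,P3,P0],[P0,P3,P0,P3]]"

definition gT0 :: "eis list list" where
  "gT0 = [[N,N,P0,P0,N,N,P0,P3],[N,N,P3,P3,N,N,P0,P3],[P0,P3,N,N,P0,P0,N,N],[P0,P3,N,N,P3,P3,N,N],[N,N,P0,P3,N,N,P0,P0],[N,N,P0,P3,N,N,P3,P3],[P0,P0,N,N,P0,P3,N,N],[P3,P3,N,N,P0,P3,N,N]]"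

definition gT1 :: "eis list list" where
  "gT1 = [[N,N,P0,P0,N,N,P5,P2],[N,N,P3,P3,N,N,P5,P2],[P0,P3,N,N,P0,P0,N,N],[P0,P3,N,N,P3,P3,N,N],[N,N,P0,P3,N,N,P0,P0],[N,N,P0,P3,N,N,P3,P3],[P1,P1,N,N,P0,P3,N,N],[P4,P4,N,N,P0,P3,N,N]]"

text \<open>Lines of weight 2 remain here, so this array is only part of a complete one: its double
  lies in S_12 and its Hermitian forms lie in S_6 or S_6^dagger.\<close>

definition E4 :: "eis list list" where
  "E4 = [[P0,P0,P0,P0],[P0,P3,N,N],[P0,N,P3,N],[P0,N,N,P3]]"

text \<open>\<open>W5\<close> to \<open>W8\<close> are weighing matrices of weight 4 over the sixth
  roots of unity; \<open>W7\<close> and \<open>W8\<close> have real entries.\<close>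

definition W5 :: "eis list list" where
  "W5 = [[P0,P0,P0,P0,N],[P0,P2,P4,N,P0],[P0,N,P2,P4,P2],[P0,P4,N,P2,P4],[N,P0,P4,P2,P2]]"

definition W6 :: "eis list list" where
  "W6 = [[P0,P0,P0,P0,N,N],[P0,P4,N,P2,P0,N],[P0,P2,N,P4,N,P0],[P0,N,P3,N,P3,P3],[N,P0,P3,N,P5,P1],[N,N,P0,P3,P4,P2]]"

definition W7 :: "eis list list" where
  "W7 = [[P0,P0,P0,P0,N,N,N],[P0,P3,N,N,P0,P0,N],[P0,N,P3,N,N,P3,P0],[P0,N,N,P3,P3,N,P3],[N,P0,N,P3,N,P0,P0],[N,P0,P3,N,P0,N,P3],[N,N,P0,P3,P0,P3,N]]"

definition W8 :: "eis list list" where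
  "W8 = [[P0,P0,P0,P0,N,N,N,N],[P0,P3,N,N,P0,P0,N,N],[P0,N,P3,N,N,P3,P0,N],[P0,N,N,P3,P3,N,P3,N],[N,P0,N,P3,P0,N,N,P0],[N,P0,P3,N,N,P0,N,P3],[N,N,P0,P3,N,N,P0,P3],[N,N,N,N,P0,P3,P3,P3]]"

text \<open>\<open>H0\<close> is the real Hadamard matrix of order 4; \<open>H1\<close> is a complex
  one that also uses \<omega> and -\<omega>.\<close>

definition H0 :: "eis list list" where
  "H0 = [[P0,P0,P0,P0],[P0,P0,P3,P3],[P0,P3,P0,P3],[P0,P3,P3,P0]]"

definition H1 :: "eis list list" where
  "H1 = [[P0,P0,P0,P0],[P0,P0,P3,P3],[P0,P3,P1,P4],[P0,P3,P4,P1]]"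

text \<open>A completed array \<open>M\<close> is certified either by a normal form \<open>W\<close> to which it can be permuted and
  scaled, or, if it is not square, by an embedding of its bipartite double into a listed graph.\<close>

definition chk_final :: "eis list list \<Rightarrow>
    (eis list list \<times> (nat \<times> eis) list \<times> (nat \<times> eis) list) + (eis list list \<times> eis \<times> (nat \<times> eis) list) \<Rightarrow> bool"
  where "chk_final M q = (case q of Inl (W, rc) \<Rightarrow> wcert M W rc
    | Inr (G, fp) \<Rightarrow> hcert (dblc M) G fp \<and> length M \<noteq> length (hd M))"

text \<open>The start is a full row and a second row that shares three of its neighbours; three
  units with sum 0 are the cube roots of unity up to scaling.\<close>

lemma finals_1: "list_all2 chk_final (search 60 [[P0,P0,P0,P0],[P0,P2,P4,N]] [False,False] [False,False,False,False])
  [Inr (gS10, P0, [(0,P0),(2,P0),(1,P0),(5,P4),(9,P0),(8,P4),(7,P4)]),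
   Inl (W6, [(0,P0),(1,P0),(2,P0),(3,P0),(4,P0),(5,P0)], [(0,P0),(1,P0),(2,P0),(3,P0),(4,P0),(5,P0)]),
   Inl (W5, [(0,P0),(1,P0),(2,P0),(3,P0),(4,P0)], [(0,P0),(1,P0),(2,P0),(3,P0),(4,P0)]),
   Inl (W5, [(0,P0),(1,P4),(2,P2),(4,P0),(3,P4)], [(1,P0),(2,P0),(0,P0),(3,P0),(4,P2)]),
   Inl (W6, [(0,P0),(1,P0),(2,P0),(3,P0),(4,P0),(5,P3)], [(0,P0),(1,P0),(3,P0),(2,P0),(4,P0),(5,P0)])]"
  by code_simp

text \<open>The same overlap with the two primitive cube roots exchanged.\<close>

lemma finals_2: "list_all2 chk_final (search 60 [[P0,P0,P0,P0],[P0,P4,P2,N]] [False,False] [False,False,False,False])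
  [Inr (gS10, P0, [(0,P0),(2,P0),(1,P0),(9,P0),(5,P4),(8,P4),(7,P4)]),
   Inl (W6, [(0,P0),(1,P0),(2,P0),(3,P0),(5,P3),(4,P3)], [(0,P0),(3,P0),(2,P0),(1,P0),(4,P0),(5,P0)]),
   Inl (W5, [(0,P0),(1,P4),(2,P2),(4,P4),(3,P4)], [(2,P0),(1,P0),(0,P0),(3,P0),(4,P2)]),
   Inl (W5, [(0,P0),(1,P0),(2,P0),(3,P0),(4,P4)], [(0,P0),(2,P0),(1,P0),(3,P0),(4,P0)]),
   Inl (W6, [(0,P0),(1,P0),(2,P0),(3,P0),(5,P0),(4,P3)], [(0,P0),(2,P0),(3,P0),(1,P0),(4,P0),(5,P0)])]"
  by code_simp

text \<open>The start is a full row with two overlaps of size two that have exactly one vertex in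
  common.\<close>

lemma finals_3: "list_all2 chk_final (search 60 [[P0,P0,P0,P0],[P0,P3,N,N],[P0,N,P3,N]] [False,False,False] [False,False,False,False])
  [Inl (E4, [(0,P0),(1,P0),(2,P0),(3,P0)], [(0,P0),(1,P0),(2,P0),(3,P0)]),
   Inr (gS14, P0, [(0,P0),(2,P3),(3,P0),(4,P0),(1,P0),(5,P0),(10,P0),(13,P3),(8,P3),(11,P3),(12,P0)]),
   Inr (gS14, P0, [(0,P0),(2,P3),(3,P0),(4,P0),(1,P0),(5,P0),(10,P0),(13,P3),(11,P3),(8,P3),(12,P0)]),
   Inr (gS14, P0, [(0,P0),(2,P3),(3,P0),(4,P0),(1,P0),(5,P0),(10,P0),(13,P3),(8,P3),(11,P3),(12,P0)]),
   Inl (W7, [(0,P0),(1,P0),(2,P0),(3,P0),(4,P0),(5,P0),(6,P0)], [(0,P0),(1,P0),(2,P0),(3,P0),(4,P0),(5,P0),(6,P0)]),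
   Inl (W8, [(0,P0),(1,P0),(2,P0),(3,P0),(4,P0),(5,P0),(6,P0),(7,P0)], [(0,P0),(1,P0),(2,P0),(3,P0),(4,P0),(5,P0),(6,P0),(7,P0)]),
   Inl (W8, [(0,P0),(1,P0),(2,P0),(3,P0),(4,P0),(5,P0),(6,P0),(7,P3)], [(0,P0),(1,P0),(2,P0),(3,P0),(5,P0),(4,P0),(6,P0),(7,P0)]),
   Inl (W7, [(0,P0),(1,P0),(2,P0),(3,P0),(5,P0),(4,P0),(6,P0)], [(0,P0),(1,P0),(2,P0),(3,P0),(4,P0),(5,P0),(6,P0)]),
   Inl (W6, [(0,P0),(4,P0),(5,P0),(1,P3),(3,P3),(2,P0)], [(1,P0),(3,P0),(0,P0),(2,P0),(4,P0),(5,P0)]),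
   Inr (gS14, P0, [(0,P0),(2,P3),(3,P0),(4,P0),(1,P0),(5,P0),(10,P0),(13,P3),(11,P3),(8,P3),(12,P0)]),
   Inl (W8, [(0,P0),(1,P0),(2,P0),(3,P0),(5,P0),(4,P0),(6,P0),(7,P0)], [(0,P0),(1,P0),(2,P0),(3,P0),(4,P0),(5,P0),(6,P0),(7,P3)]),
   Inl (W7, [(0,P0),(1,P0),(2,P0),(3,P0),(4,P0),(5,P0),(6,P0)], [(0,P0),(1,P0),(2,P0),(3,P0),(5,P0),(4,P0),(6,P0)]),
   Inl (W7, [(0,P0),(1,P0),(2,P0),(3,P0),(5,P0),(4,P0),(6,P0)], [(0,P0),(1,P0),(2,P0),(3,P0),(5,P0),(4,P0),(6,P0)]),
   Inl (W8, [(0,P0),(1,P0),(2,P0),(3,P0),(5,P0),(4,P0),(6,P0),(7,P3)], [(0,P0),(1,P0),(2,P0),(3,P0),(5,P0),(4,P0),(6,P0),(7,P3)]),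
   Inl (W6, [(0,P0),(4,P0),(5,P0),(1,P3),(2,P3),(3,P0)], [(1,P0),(2,P0),(0,P0),(3,P0),(4,P0),(5,P0)])]"
  by code_simp

text \<open>These arrays describe four vertices with the same four neighbours. The opposite pairs in
  the second row come from a suitable order of the neighbours.\<close>

definition small_rows :: "eis \<Rightarrow> eis list list list" where
  "small_rows t = (let M = [[P0,P0,P0,P0],[P0,P3,t,emul P3 t]]; b = [False,False,False,False]; m = [True,False,False,False]
    in concat (map (\<lambda>x. map (\<lambda>y. M @ [x, y]) (filter (\<lambda>y. N \<notin> set y) (newrows (M @ [x]) b m)))
      (filter (\<lambda>x. N \<notin> set x) (newrows M b m))))"

lemma finals_4: "list_all2 chk_final (concat (map small_rows [P0,P1,P2,P3,P4,P5]))
  [Inl (H0, [(0,P0),(1,P0),(2,P0),(3,P0)], [(0,P0),(2,P0),(1,P0),(3,P0)]),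
   Inl (H1, [(0,P0),(1,P0),(2,P0),(3,P0)], [(0,P0),(2,P0),(1,P0),(3,P0)]),
   Inl (H1, [(0,P0),(1,P3),(2,P4),(3,P1)], [(1,P0),(3,P0),(2,P0),(0,P0)]),
   Inl (H0, [(0,P0),(1,P0),(2,P0),(3,P0)], [(0,P0),(2,P0),(3,P0),(1,P0)]),
   Inl (H1, [(0,P0),(1,P0),(2,P0),(3,P0)], [(0,P0),(2,P0),(3,P0),(1,P0)]),
   Inl (H1, [(0,P0),(1,P3),(2,P1),(3,P4)], [(1,P0),(3,P0),(0,P0),(2,P0)]),
   Inl (H1, [(0,P0),(2,P0),(1,P0),(3,P0)], [(0,P0),(1,P0),(2,P0),(3,P0)]),
   Inl (H1, [(0,P0),(3,P0),(1,P0),(2,P0)], [(0,P0),(1,P0),(2,P0),(3,P0)]),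
   Inl (H1, [(0,P0),(2,P3),(1,P4),(3,P1)], [(2,P0),(3,P0),(1,P0),(0,P0)]),
   Inl (H1, [(0,P0),(3,P3),(1,P4),(2,P1)], [(2,P0),(3,P0),(1,P0),(0,P0)]),
   Inl (H0, [(0,P0),(1,P0),(2,P0),(3,P0)], [(0,P0),(3,P0),(1,P0),(2,P0)]),
   Inl (H1, [(0,P0),(1,P0),(2,P0),(3,P0)], [(0,P0),(3,P0),(1,P0),(2,P0)]),
   Inl (H1, [(0,P0),(1,P3),(2,P4),(3,P1)], [(1,P0),(2,P0),(3,P0),(0,P0)]),
   Inl (H0, [(0,P0),(1,P0),(2,P0),(3,P0)], [(0,P0),(3,P0),(2,P0),(1,P0)]),
   Inl (H1, [(0,P0),(1,P0),(2,P0),(3,P0)], [(0,P0),(3,P0),(2,P0),(1,P0)]),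
   Inl (H1, [(0,P0),(1,P3),(2,P1),(3,P4)], [(1,P0),(2,P0),(0,P0),(3,P0)]),
   Inl (H1, [(0,P0),(2,P0),(1,P0),(3,P0)], [(0,P0),(1,P0),(3,P0),(2,P0)]),
   Inl (H1, [(0,P0),(3,P0),(1,P0),(2,P0)], [(0,P0),(1,P0),(3,P0),(2,P0)]),
   Inl (H1, [(0,P0),(2,P3),(1,P1),(3,P4)], [(2,P0),(3,P0),(0,P0),(1,P0)]),
   Inl (H1, [(0,P0),(3,P3),(1,P1),(2,P4)], [(2,P0),(3,P0),(0,P0),(1,P0)])]"
  by code_simp

text \<open>Certificates are matched with the enumeration by position, so the list has one entry for
  each Hermitian matrix that occurs.\<close>

lemma hs_E4: "list_all2 (\<lambda>B (G, q). hcert B G q) (hs 4 (tr E4) [])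
  [(gS6, P0, [(1,P0),(0,P4),(2,P0),(4,P0)]),
   (gS6d, P0, [(3,P0),(2,P0),(0,P2),(4,P2)]),
   (gS6d, P0, [(3,P0),(0,P2),(4,P2),(2,P0)]),
   (gS6d, P0, [(3,P0),(0,P2),(2,P0),(4,P2)]),
   (gS6, P0, [(0,P0),(1,P5),(3,P1),(5,P3)]),
   (gS6d, P0, [(2,P0),(3,P3),(1,P3),(5,P3)]),
   (gS6d, P0, [(2,P0),(1,P3),(5,P3),(3,P3)]),
   (gS6d, P0, [(2,P0),(1,P3),(3,P3),(5,P3)])]"
  by code_simp

lemma dbl_E4: "hcert (dblc E4) gS12 (P0, [(0,P0),(2,P4),(3,P0),(4,P0),(1,P0),(5,P1),(9,P3),(11,P3)])"
  by code_simp

lemma hs_W5: "list_all2 (\<lambda>B (G, q). hcert B G q) (hs 5 (tr W5) [])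
  [(gS5, P0, [(2,P0),(0,P2),(1,P0),(4,P0),(3,P4)]),
   (gS5, P3, [(2,P0),(0,P2),(1,P0),(4,P0),(3,P4)]),
   (gS5, P0, [(2,P0),(0,P4),(3,P0),(1,P4),(4,P0)]),
   (gS5, P3, [(2,P0),(0,P4),(3,P0),(1,P4),(4,P0)]),
   (gS5, P0, [(2,P0),(0,P0),(4,P2),(3,P4),(1,P4)]),
   (gS5, P3, [(2,P0),(0,P0),(4,P2),(3,P4),(1,P4)]),
   (gS5, P0, [(2,P0),(3,P4),(0,P0),(4,P2),(1,P2)]),
   (gS5, P3, [(2,P0),(3,P4),(0,P0),(4,P2),(1,P2)]),
   (gS5, P0, [(0,P0),(2,P4),(4,P4),(1,P4),(3,P2)]),
   (gS5, P0, [(0,P0),(1,P0),(3,P2),(2,P2),(4,P4)]),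
   (gS5, P3, [(0,P0),(2,P2),(1,P0),(3,P2),(4,P2)]),
   (gS5, P3, [(0,P0),(1,P4),(2,P4),(4,P4),(3,P0)]),
   (gS5, P0, [(0,P0),(2,P0),(3,P4),(4,P2),(1,P4)]),
   (gS5, P0, [(0,P0),(1,P2),(4,P0),(3,P0),(2,P2)]),
   (gS5, P3, [(0,P0),(2,P4),(4,P4),(1,P4),(3,P2)]),
   (gS5, P3, [(0,P0),(1,P0),(3,P2),(2,P2),(4,P4)]),
   (gS5, P0, [(0,P0),(2,P2),(1,P0),(3,P2),(4,P2)]),
   (gS5, P0, [(0,P0),(1,P4),(2,P4),(4,P4),(3,P0)]),
   (gS5, P3, [(0,P0),(2,P0),(3,P4),(4,P2),(1,P4)]),
   (gS5, P3, [(0,P0),(1,P2),(4,P0),(3,P0),(2,P2)])]"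
  by code_simp

lemma dbl_W5: "hcert (dblc W5) gS10 (P0, [(0,P0),(2,P0),(4,P2),(3,P2),(6,P0),(1,P0),(5,P4),(9,P0),(8,P4),(7,P4)])"
  by code_simp

lemma hs_W6: "list_all2 (\<lambda>B (G, q). hcert B G q) (hs 6 (tr W6) [])
  [(gS6, P0, [(1,P0),(3,P2),(5,P4),(0,P1),(4,P3),(2,P0)]),
   (gS6d, P0, [(3,P0),(1,P0),(5,P0),(2,P3),(0,P5),(4,P2)]),
   (gS6d, P0, [(3,P0),(1,P2),(5,P4),(0,P5),(4,P5),(2,P0)]),
   (gS6d, P0, [(3,P0),(5,P4),(1,P2),(0,P5),(2,P3),(4,P2)]),
   (gS6, P0, [(0,P0),(2,P2),(4,P2),(1,P2),(3,P4),(5,P3)]),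
   (gS6d, P0, [(2,P0),(0,P0),(4,P4),(1,P0),(3,P0),(5,P3)]),
   (gS6d, P0, [(2,P0),(0,P2),(4,P2),(3,P0),(5,P0),(1,P3)]),
   (gS6d, P0, [(2,P0),(4,P4),(0,P0),(1,P0),(5,P0),(3,P3)]),
   (gS6d, P0, [(1,P0),(5,P0),(3,P0),(2,P3),(0,P3),(4,P4)]),
   (gS6d, P0, [(0,P0),(4,P4),(2,P0),(1,P0),(3,P4),(5,P5)]),
   (gS6d, P0, [(1,P0),(5,P2),(3,P4),(0,P3),(4,P1),(2,P0)]),
   (gS6d, P0, [(0,P0),(4,P0),(2,P4),(3,P4),(5,P2),(1,P3)]),
   (gS6d, P0, [(1,P0),(5,P4),(3,P2),(4,P1),(2,P3),(0,P0)]),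
   (gS6d, P0, [(0,P0),(4,P2),(2,P2),(5,P2),(1,P0),(3,P1)]),
   (gS6d, P0, [(1,P0),(3,P0),(5,P0),(2,P3),(4,P1),(0,P0)]),
   (gS6d, P0, [(0,P0),(2,P0),(4,P4),(1,P0),(5,P2),(3,P1)]),
   (gS6d, P0, [(1,P0),(3,P4),(5,P2),(0,P3),(2,P3),(4,P4)]),
   (gS6d, P0, [(0,P0),(2,P4),(4,P0),(3,P4),(1,P0),(5,P5)]),
   (gS6d, P0, [(1,P0),(3,P2),(5,P4),(4,P1),(0,P3),(2,P0)]),
   (gS6d, P0, [(0,P0),(2,P2),(4,P2),(5,P2),(3,P4),(1,P3)])]"
  by code_simp

lemma dbl_W6: "hcert (dblc W6) gS12 (P0, [(0,P0),(6,P4),(7,P4),(2,P1),(4,P3),(3,P0),(5,P1),(11,P3),(1,P0),(9,P3),(8,P4),(10,P4)])"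
  by code_simp

lemma hs_W7: "list_all2 (\<lambda>B (G, q). hcert B G q) (hs 7 (tr W7) [])
  [(gS7, P3, [(3,P0),(0,P3),(4,P3),(5,P3),(2,P3),(1,P0),(6,P0)]),
   (gS7, P0, [(0,P0),(3,P0),(1,P0),(2,P3),(4,P0),(5,P0),(6,P3)]),
   (gS7, P0, [(0,P0),(1,P0),(2,P3),(3,P0),(5,P3),(6,P3),(4,P3)]),
   (gS7, P0, [(0,P0),(1,P0),(3,P0),(2,P3),(6,P3),(5,P3),(4,P0)]),
   (gS7, P0, [(3,P0),(0,P3),(4,P3),(5,P3),(2,P3),(1,P0),(6,P0)]),
   (gS7, P3, [(0,P0),(3,P0),(1,P0),(2,P3),(4,P0),(5,P0),(6,P3)]),
   (gS7, P3, [(0,P0),(1,P0),(2,P3),(3,P0),(5,P3),(6,P3),(4,P3)]),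
   (gS7, P3, [(0,P0),(1,P0),(3,P0),(2,P3),(6,P3),(5,P3),(4,P0)]),
   (gS7, P3, [(3,P0),(0,P0),(1,P0),(2,P3),(5,P3),(4,P3),(6,P0)]),
   (gS7, P0, [(0,P0),(3,P3),(4,P0),(5,P0),(1,P0),(2,P3),(6,P0)]),
   (gS7, P0, [(0,P0),(1,P3),(6,P3),(5,P3),(3,P0),(2,P3),(4,P3)]),
   (gS7, P0, [(0,P0),(1,P3),(5,P3),(6,P3),(2,P3),(3,P0),(4,P0)]),
   (gS7, P0, [(3,P0),(0,P0),(1,P0),(2,P3),(5,P3),(4,P3),(6,P0)]),
   (gS7, P3, [(0,P0),(3,P3),(4,P0),(5,P0),(1,P0),(2,P3),(6,P0)]),
   (gS7, P3, [(0,P0),(1,P3),(6,P3),(5,P3),(3,P0),(2,P3),(4,P3)]),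
   (gS7, P3, [(0,P0),(1,P3),(5,P3),(6,P3),(2,P3),(3,P0),(4,P0)]),
   (gS7, P0, [(0,P0),(5,P3),(1,P3),(6,P3),(4,P0),(3,P3),(2,P3)]),
   (gS7, P0, [(0,P0),(4,P0),(3,P3),(5,P0),(6,P0),(2,P0),(1,P0)]),
   (gS7, P0, [(0,P0),(6,P3),(1,P3),(5,P3),(4,P3),(2,P0),(3,P0)]),
   (gS7, P3, [(3,P0),(1,P0),(0,P0),(2,P3),(6,P0),(4,P0),(5,P3)]),
   (gS7, P3, [(0,P0),(5,P3),(1,P3),(6,P3),(4,P0),(3,P3),(2,P3)]),
   (gS7, P3, [(0,P0),(4,P0),(3,P3),(5,P0),(6,P0),(2,P0),(1,P0)]),
   (gS7, P0, [(3,P0),(1,P0),(0,P0),(2,P3),(6,P0),(4,P0),(5,P3)]),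
   (gS7, P3, [(0,P0),(6,P3),(1,P3),(5,P3),(4,P3),(2,P0),(3,P0)]),
   (gS7, P0, [(0,P0),(4,P0),(5,P0),(3,P3),(2,P0),(6,P0),(1,P3)]),
   (gS7, P0, [(0,P0),(5,P3),(6,P3),(1,P3),(3,P3),(4,P0),(2,P0)]),
   (gS7, P3, [(3,P0),(1,P0),(2,P3),(0,P0),(4,P0),(6,P0),(5,P0)]),
   (gS7, P0, [(0,P0),(6,P3),(5,P3),(1,P3),(2,P0),(4,P3),(3,P3)]),
   (gS7, P3, [(0,P0),(4,P0),(5,P0),(3,P3),(2,P0),(6,P0),(1,P3)]),
   (gS7, P3, [(0,P0),(5,P3),(6,P3),(1,P3),(3,P3),(4,P0),(2,P0)]),
   (gS7, P3, [(0,P0),(6,P3),(5,P3),(1,P3),(2,P0),(4,P3),(3,P3)]),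
   (gS7, P0, [(3,P0),(1,P0),(2,P3),(0,P0),(4,P0),(6,P0),(5,P0)]),
   (gS7, P0, [(1,P0),(0,P0),(3,P0),(2,P3),(5,P0),(6,P0),(4,P3)]),
   (gS7, P3, [(1,P0),(0,P3),(5,P0),(6,P0),(3,P0),(2,P3),(4,P0)]),
   (gS7, P0, [(1,P0),(2,P0),(5,P3),(4,P0),(3,P0),(0,P0),(6,P0)]),
   (gS7, P3, [(1,P0),(2,P3),(3,P0),(0,P0),(5,P3),(4,P0),(6,P3)]),
   (gS7, P3, [(1,P0),(0,P0),(3,P0),(2,P3),(5,P0),(6,P0),(4,P3)]),
   (gS7, P0, [(1,P0),(0,P3),(5,P0),(6,P0),(3,P0),(2,P3),(4,P0)]),
   (gS7, P3, [(1,P0),(2,P0),(5,P3),(4,P0),(3,P0),(0,P0),(6,P0)]),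
   (gS7, P0, [(1,P0),(2,P3),(3,P0),(0,P0),(5,P3),(4,P0),(6,P3)]),
   (gS7, P0, [(1,P0),(0,P0),(2,P3),(3,P0),(6,P0),(5,P0),(4,P0)]),
   (gS7, P3, [(1,P0),(0,P3),(6,P0),(5,P0),(2,P3),(3,P0),(4,P3)]),
   (gS7, P3, [(1,P0),(2,P3),(0,P0),(3,P0),(4,P0),(5,P3),(6,P0)]),
   (gS7, P0, [(1,P0),(2,P0),(4,P0),(5,P3),(0,P0),(3,P0),(6,P3)]),
   (gS7, P3, [(1,P0),(0,P0),(2,P3),(3,P0),(6,P0),(5,P0),(4,P0)]),
   (gS7, P0, [(1,P0),(0,P3),(6,P0),(5,P0),(2,P3),(3,P0),(4,P3)]),
   (gS7, P0, [(1,P0),(2,P3),(0,P0),(3,P0),(4,P0),(5,P3),(6,P0)]),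
   (gS7, P3, [(1,P0),(2,P0),(4,P0),(5,P3),(0,P0),(3,P0),(6,P3)]),
   (gS7, P3, [(1,P0),(3,P0),(2,P3),(0,P0),(6,P3),(4,P3),(5,P3)]),
   (gS7, P3, [(1,P0),(5,P0),(0,P3),(6,P0),(4,P0),(2,P0),(3,P0)]),
   (gS7, P0, [(1,P0),(5,P3),(2,P0),(4,P0),(6,P0),(0,P3),(3,P0)]),
   (gS7, P0, [(1,P0),(3,P0),(0,P0),(2,P3),(4,P3),(6,P3),(5,P0)]),
   (gS7, P0, [(1,P0),(5,P0),(0,P3),(6,P0),(4,P0),(2,P0),(3,P0)]),
   (gS7, P0, [(1,P0),(3,P0),(2,P3),(0,P0),(6,P3),(4,P3),(5,P3)]),
   (gS7, P3, [(1,P0),(3,P0),(0,P0),(2,P3),(4,P3),(6,P3),(5,P0)]),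
   (gS7, P3, [(1,P0),(5,P3),(2,P0),(4,P0),(6,P0),(0,P3),(3,P0)])]"
  by code_simp

lemma dbl_W7: "hcert (dblc W7) gS14 (P0, [(0,P0),(2,P3),(3,P0),(4,P0),(7,P0),(6,P3),(9,P0),(1,P0),(5,P0),(10,P0),(13,P3),(8,P3),(11,P3),(12,P0)])"
  by code_simp

lemma hs_W8: "list_all2 (\<lambda>B (G, q). hcert B G q) (hs 8 (tr W8) [])
  [(gS8, P0, [(1,P0),(0,P0),(3,P0),(5,P3),(4,P0),(2,P3),(7,P0),(6,P0)]),
   (gS8p, P0, [(1,P0),(0,P0),(3,P0),(5,P3),(2,P0),(4,P0),(7,P3),(6,P3)]),
   (gS8p, P0, [(1,P0),(3,P0),(5,P3),(0,P0),(4,P3),(7,P3),(2,P3),(6,P3)]),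
   (gS8p, P0, [(1,P0),(3,P0),(0,P0),(5,P3),(7,P3),(4,P3),(2,P0),(6,P0)]),
   (gS8, P0, [(0,P0),(1,P3),(2,P0),(4,P3),(5,P3),(3,P0),(6,P3),(7,P0)]),
   (gS8p, P0, [(0,P0),(1,P3),(2,P3),(4,P3),(3,P0),(5,P3),(6,P3),(7,P0)]),
   (gS8p, P0, [(0,P0),(2,P3),(4,P3),(1,P3),(5,P0),(6,P3),(3,P3),(7,P0)]),
   (gS8p, P0, [(0,P0),(2,P3),(1,P3),(4,P3),(6,P3),(5,P0),(3,P0),(7,P3)]),
   (gS8p, P0, [(1,P0),(0,P3),(2,P0),(4,P0),(3,P0),(5,P3),(7,P0),(6,P3)]),
   (gS8, P0, [(1,P0),(0,P3),(2,P3),(4,P0),(5,P3),(3,P0),(7,P0),(6,P3)]),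
   (gS8p, P0, [(1,P0),(3,P3),(7,P3),(4,P3),(0,P0),(5,P3),(2,P3),(6,P0)]),
   (gS8p, P0, [(1,P0),(3,P3),(4,P3),(7,P3),(5,P3),(0,P0),(2,P0),(6,P3)]),
   (gS8p, P0, [(0,P0),(1,P0),(3,P0),(5,P3),(2,P3),(4,P3),(6,P0),(7,P0)]),
   (gS8, P0, [(0,P0),(1,P0),(3,P0),(5,P3),(4,P3),(2,P0),(6,P3),(7,P3)]),
   (gS8p, P0, [(0,P0),(2,P0),(6,P3),(5,P0),(1,P3),(4,P3),(3,P3),(7,P3)]),
   (gS8p, P0, [(0,P0),(2,P0),(5,P0),(6,P3),(4,P3),(1,P3),(3,P0),(7,P0)]),
   (gS8, P0, [(1,P0),(2,P3),(0,P3),(4,P0),(7,P0),(3,P3),(5,P3),(6,P0)]),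
   (gS8p, P0, [(1,P0),(7,P3),(3,P3),(4,P3),(2,P3),(5,P0),(0,P0),(6,P3)]),
   (gS8p, P0, [(1,P0),(2,P0),(0,P3),(4,P0),(7,P0),(5,P0),(3,P0),(6,P0)]),
   (gS8p, P0, [(1,P0),(4,P3),(3,P3),(7,P3),(2,P0),(0,P3),(5,P3),(6,P0)]),
   (gS8p, P0, [(0,P0),(6,P3),(2,P0),(5,P0),(3,P3),(4,P0),(1,P3),(7,P0)]),
   (gS8, P0, [(0,P0),(3,P0),(1,P0),(5,P3),(6,P3),(2,P3),(4,P3),(7,P0)]),
   (gS8p, P0, [(0,P0),(3,P0),(1,P0),(5,P3),(6,P0),(4,P0),(2,P3),(7,P3)]),
   (gS8p, P0, [(0,P0),(5,P0),(2,P0),(6,P3),(3,P0),(1,P0),(4,P3),(7,P3)]),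
   (gS8, P0, [(1,P0),(2,P3),(4,P0),(0,P3),(3,P3),(7,P0),(5,P0),(6,P3)]),
   (gS8p, P0, [(1,P0),(7,P3),(4,P3),(3,P3),(5,P0),(2,P3),(0,P3),(6,P0)]),
   (gS8p, P0, [(1,P0),(2,P0),(4,P0),(0,P3),(5,P0),(7,P0),(3,P3),(6,P3)]),
   (gS8p, P0, [(1,P0),(4,P3),(7,P3),(3,P3),(0,P3),(2,P0),(5,P0),(6,P3)]),
   (gS8p, P0, [(0,P0),(6,P3),(5,P0),(2,P0),(4,P0),(3,P3),(1,P0),(7,P3)]),
   (gS8, P0, [(0,P0),(3,P0),(5,P3),(1,P0),(2,P3),(6,P3),(4,P0),(7,P3)]),
   (gS8p, P0, [(0,P0),(3,P0),(5,P3),(1,P0),(4,P0),(6,P0),(2,P0),(7,P0)]),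
   (gS8p, P0, [(0,P0),(5,P0),(6,P3),(2,P0),(1,P0),(3,P0),(4,P0),(7,P0)]),
   (gS8p, P0, [(2,P0),(6,P0),(7,P0),(4,P3),(0,P0),(5,P0),(1,P3),(3,P3)]),
   (gS8p, P0, [(2,P0),(0,P0),(5,P0),(6,P3),(4,P0),(1,P0),(7,P3),(3,P3)]),
   (gS8p, P0, [(2,P0),(4,P0),(1,P0),(0,P3),(6,P0),(7,P0),(5,P3),(3,P3)]),
   (gS8p, P0, [(2,P0),(0,P3),(1,P0),(4,P0),(6,P3),(5,P0),(7,P3),(3,P0)]),
   (gS8p, P0, [(2,P0),(6,P3),(5,P0),(0,P0),(4,P3),(7,P0),(1,P3),(3,P0)]),
   (gS8p, P0, [(2,P0),(4,P3),(7,P0),(6,P0),(0,P3),(1,P0),(5,P3),(3,P0)]),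
   (gS8p, P0, [(2,P0),(6,P0),(4,P3),(7,P0),(5,P0),(0,P0),(1,P0),(3,P0)]),
   (gS8p, P0, [(2,P0),(0,P0),(6,P3),(5,P0),(1,P0),(4,P0),(7,P0),(3,P0)]),
   (gS8p, P0, [(2,P0),(4,P0),(0,P3),(1,P0),(7,P0),(6,P0),(5,P0),(3,P0)]),
   (gS8p, P0, [(2,P0),(0,P3),(4,P0),(1,P0),(5,P0),(6,P3),(7,P0),(3,P3)]),
   (gS8p, P0, [(2,P0),(6,P3),(0,P0),(5,P0),(7,P0),(4,P3),(1,P0),(3,P3)]),
   (gS8p, P0, [(2,P0),(4,P3),(6,P0),(7,P0),(1,P0),(0,P3),(5,P0),(3,P3)]),
   (gS8p, P0, [(2,P0),(1,P0),(4,P0),(0,P3),(5,P3),(7,P3),(6,P0),(3,P0)]),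
   (gS8p, P0, [(2,P0),(7,P0),(6,P0),(4,P3),(1,P3),(5,P3),(0,P0),(3,P0)]),
   (gS8p, P0, [(2,P0),(5,P0),(0,P0),(6,P3),(7,P3),(1,P3),(4,P0),(3,P0)]),
   (gS8p, P0, [(2,P0),(7,P0),(4,P3),(6,P0),(5,P3),(1,P3),(0,P3),(3,P3)]),
   (gS8p, P0, [(2,P0),(1,P0),(0,P3),(4,P0),(7,P3),(5,P3),(6,P3),(3,P3)]),
   (gS8p, P0, [(2,P0),(5,P0),(6,P3),(0,P0),(1,P3),(7,P3),(4,P3),(3,P3)]),
   (gS8p, P0, [(2,P0),(7,P3),(1,P3),(5,P3),(6,P0),(4,P3),(0,P3),(3,P0)]),
   (gS8p, P0, [(2,P0),(1,P3),(5,P3),(7,P3),(4,P0),(0,P3),(6,P3),(3,P0)]),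
   (gS8p, P0, [(2,P0),(5,P3),(7,P3),(1,P3),(0,P0),(6,P3),(4,P3),(3,P0)]),
   (gS8p, P0, [(2,P0),(1,P3),(7,P3),(5,P3),(0,P3),(4,P0),(6,P0),(3,P3)]),
   (gS8p, P0, [(2,P0),(7,P3),(5,P3),(1,P3),(4,P3),(6,P0),(0,P0),(3,P3)]),
   (gS8p, P0, [(2,P0),(5,P3),(1,P3),(7,P3),(6,P3),(0,P0),(4,P0),(3,P3)])]"
  by code_simp

lemma dbl_W8: "hcert (dblc W8) gS16 (P0, [(0,P0),(2,P0),(8,P0),(10,P3),(12,P3),(14,P3),(6,P0),(4,P0),(1,P0),(9,P3),(7,P0),(15,P0),(3,P0),(11,P3),(13,P0),(5,P3)])"
  by code_simp

lemma hs_H0: "list_all2 (\<lambda>B (G, q). hcert B G q) (hs 4 (tr H0) [])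
  [(gC0, P0, [(0,P0),(1,P0),(2,P0),(3,P0)]),
   (gC1, P0, [(0,P0),(1,P0),(2,P0),(3,P0)]),
   (gC1, P0, [(0,P0),(2,P0),(3,P0),(1,P0)]),
   (gC1, P0, [(0,P0),(2,P0),(1,P0),(3,P0)]),
   (gC0, P3, [(0,P0),(1,P0),(2,P0),(3,P0)]),
   (gC1, P0, [(2,P0),(3,P3),(0,P3),(1,P0)]),
   (gC1, P0, [(2,P0),(0,P3),(1,P0),(3,P3)]),
   (gC1, P0, [(2,P0),(0,P3),(3,P3),(1,P0)]),
   (gC1, P0, [(0,P0),(1,P0),(2,P3),(3,P3)]),
   (gC0, P0, [(0,P0),(1,P0),(2,P3),(3,P3)]),
   (gC1, P0, [(0,P0),(2,P0),(1,P3),(3,P3)]),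
   (gC1, P0, [(0,P0),(2,P0),(3,P3),(1,P3)]),
   (gC1, P0, [(2,P0),(3,P3),(0,P0),(1,P3)]),
   (gC0, P3, [(0,P0),(1,P0),(2,P3),(3,P3)]),
   (gC1, P0, [(2,P0),(0,P3),(3,P0),(1,P3)]),
   (gC1, P0, [(2,P0),(0,P3),(1,P3),(3,P0)]),
   (gC1, P0, [(0,P0),(2,P3),(3,P0),(1,P3)]),
   (gC1, P0, [(0,P0),(2,P3),(1,P0),(3,P3)]),
   (gC0, P0, [(0,P0),(1,P3),(2,P0),(3,P3)]),
   (gC1, P0, [(0,P0),(1,P3),(2,P0),(3,P3)]),
   (gC1, P0, [(2,P0),(0,P0),(1,P0),(3,P0)]),
   (gC1, P0, [(2,P0),(0,P0),(3,P3),(1,P3)]),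
   (gC0, P3, [(0,P0),(1,P3),(2,P0),(3,P3)]),
   (gC1, P0, [(2,P0),(3,P0),(0,P3),(1,P3)]),
   (gC1, P0, [(0,P0),(2,P3),(1,P3),(3,P0)]),
   (gC1, P0, [(0,P0),(2,P3),(3,P3),(1,P0)]),
   (gC1, P0, [(0,P0),(1,P3),(2,P3),(3,P0)]),
   (gC0, P0, [(0,P0),(1,P3),(2,P3),(3,P0)]),
   (gC1, P0, [(2,P0),(0,P0),(3,P0),(1,P0)]),
   (gC1, P0, [(2,P0),(0,P0),(1,P3),(3,P3)]),
   (gC1, P0, [(2,P0),(3,P0),(0,P0),(1,P0)]),
   (gC0, P3, [(0,P0),(1,P3),(2,P3),(3,P0)])]"
  by code_simp

lemma dbl_H0: "hcert (dblc H0) gT0 (P0, [(0,P0),(1,P3),(4,P0),(5,P0),(2,P0),(3,P0),(6,P0),(7,P3)])"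
  by code_simp

text \<open>No matching of columns with rows makes \<open>H1\<close> Hermitian; it occurs only
  through its double cover.\<close>

lemma hs_H1: "list_all2 (\<lambda>B (G, q). hcert B G q) (hs 4 (tr H1) [])
  []"
  by code_simp

lemma dbl_H1: "hcert (dblc H1) gT1 (P0, [(0,P0),(1,P3),(4,P0),(5,P0),(2,P0),(3,P0),(6,P5),(7,P2)])"
  by code_simp

subsection \<open>The listed graphs are complete\<close>

text \<open>The earlier neighbours form a spanning tree: walking back from any vertex of a closed
  set reaches the first vertex, and walking forward from there reaches all.\<close>

lemma connected_onI:
  assumes V: "V = set vs" "vs \<noteq> []" and sym: "\<And>i j. i \<in> V \<Longrightarrow> j \<in> V \<Longrightarrow> A i j \<noteq> 0 \<Longrightarrow> A j i \<noteq> 0"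
    and prec: "\<And>k. k < length vs \<Longrightarrow> k > 0 \<Longrightarrow> \<exists>l<k. A (vs ! k) (vs ! l) \<noteq> 0"
  shows "connected_on V A"
  unfolding connected_on_def
proof (intro conjI allI impI)
  show "V \<noteq> {}" using V by simp
  fix X assume X: "X \<subseteq> V" "X \<noteq> {}" "\<forall>i\<in>X. \<forall>j\<in>V. A i j \<noteq> 0 \<longrightarrow> j \<in> X"
  have in_V: "vs ! k \<in> V" if "k < length vs" for k using that V(1) by simp
  obtain k where "k < length vs" "vs ! k \<in> X" using X(1,2) V(1) by (metis in_set_conv_nth equals0I subsetD)
  then have "vs ! 0 \<in> X"
  proof (induction k rule: less_induct)
    case (less k)
    show ?case
    proof (cases "k = 0")
      case False
      then obtain l where "l < k" "A (vs ! k) (vs ! l) \<noteq> 0" using prec less.prems by blast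
      then show ?thesis using less X(3) in_V[of l] by auto
    qed (use less in simp)
  qed
  have "vs ! k \<in> X" if "k < length vs" for k
    using that
  proof (induction k rule: less_induct)
    case (less k)
    show ?case
    proof (cases "k = 0")
      case False
      then obtain l where "l < k" "A (vs ! k) (vs ! l) \<noteq> 0" using prec less.prems by blast
      moreover from this have "A (vs ! l) (vs ! k) \<noteq> 0" using sym in_V less.prems by auto
      ultimately show ?thesis using less X(3) in_V[of k] by auto
    qed (use \<open>vs ! 0 \<in> X\<close> in simp)
  qed
  then have "V \<subseteq> X" unfolding V(1) set_conv_nth by auto
  then show "X = V" using X(1) by simp
qed

lemma complete_on_bij:
  assumes g: "bij_betw g V S" and c: "complete_on V A" and w: "\<And>i j. i \<in> V \<Longrightarrow> j \<in> V \<Longrightarrow> w (g i) (g j) = A i j"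
  shows "complete_on S w"
proof -
  have C: "finite V" "herm V A" "connected_on V A"
      "\<And>i j. i \<in> V \<Longrightarrow> j \<in> V \<Longrightarrow> (\<Sum>k\<in>V. A i k * cnj (A j k)) = (if i = j then 4 else 0)"
    using c unfolding complete_on_def by auto
  have S: "S = g ` V" "inj_on g V" using g by (auto simp: bij_betw_def)
  have "herm S w" unfolding herm_def S(1)
  proof (intro ballI conjI)
    fix i j assume "i \<in> g ` V" "j \<in> g ` V"
    then obtain a b where ab: "a \<in> V" "b \<in> V" "i = g a" "j = g b" by auto
    show "w i j \<in> eisenstein_ints" using hermD(1)[OF C(2) ab(1,2)] w[OF ab(1,2)] ab by simp
    have "A b a = cnj (A a b)" by (rule hermD(2)[OF C(2) ab(1,2)])
    then show "w j i = cnj (w i j)" unfolding ab(3,4) w[OF ab(1,2)] w[OF ab(2,1)] .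
  qed
  moreover have "connected_on S w" unfolding connected_on_def
  proof (intro conjI allI impI)
    show "S \<noteq> {}" using C(3) S(1) unfolding connected_on_def by auto
    fix X assume X: "X \<subseteq> S" "X \<noteq> {}" "\<forall>i\<in>X. \<forall>j\<in>S. w i j \<noteq> 0 \<longrightarrow> j \<in> X"
    have "{v \<in> V. g v \<in> X} = V"
      using C(3) X w unfolding connected_on_def S(1) by (elim conjE allE[of _ "{v \<in> V. g v \<in> X}"]) auto
    then show "X = S" using X(1) S(1) by auto
  qed
  moreover have "(\<Sum>k\<in>S. w i k * cnj (w j k)) = (if i = j then 4 else 0)" if "i \<in> S" "j \<in> S" for i j
  proof -
    obtain a b where ab: "a \<in> V" "b \<in> V" "i = g a" "j = g b" using \<open>i \<in> S\<close> \<open>j \<in> S\<close> S(1) by auto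
    have "(\<Sum>k\<in>S. w i k * cnj (w j k)) = (\<Sum>k\<in>V. w i (g k) * cnj (w j (g k)))"
      using sum.reindex_bij_betw[OF g, of "\<lambda>k. w i k * cnj (w j k)"] by simp
    also have "\<dots> = (\<Sum>k\<in>V. A a k * cnj (A b k))" using ab w by (intro sum.cong refl) simp
    finally show ?thesis using C(4)[OF ab(1,2)] ab S(2) by (auto simp: inj_on_eq_iff)
  qed
  ultimately show ?thesis using C(1) S(1) unfolding complete_on_def by simp
qed

lemma embeds_bij:
  assumes g: "inj_on g V'" "g ` V' \<subseteq> S" and w: "\<And>i j. i \<in> V' \<Longrightarrow> j \<in> V' \<Longrightarrow> w (g i) (g j) = B i j"
    and e: "embeds V A V' B"
  shows "embeds V A S w"
proof -
  obtain f u s \<sigma> where f: "inj_on f V" "f ` V \<subseteq> V'" and r: "\<forall>i\<in>V. u i \<in> eisenstein_units" "s \<in> {1, -1}" "\<sigma> \<in> {id, cnj}"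
    and A: "\<forall>i\<in>V. \<forall>j\<in>V. A i j = s * \<sigma> (u i * B (f i) (f j) * cnj (u j))"
    using e unfolding embeds_def by (elim exE conjE)
  have "inj_on (\<lambda>x. g (f x)) V" using comp_inj_on[OF f(1) inj_on_subset[OF g(1) f(2)]] by (simp add: comp_def)
  moreover have "(\<lambda>x. g (f x)) ` V \<subseteq> S" using f(2) g(2) by auto
  moreover have "\<forall>i\<in>V. \<forall>j\<in>V. A i j = s * \<sigma> (u i * w (g (f i)) (g (f j)) * cnj (u j))"
  proof (intro ballI)
    fix i j assume ij: "i \<in> V" "j \<in> V"
    then have "w (g (f i)) (g (f j)) = B (f i) (f j)" using f(2) by (intro w) auto
    then show "A i j = s * \<sigma> (u i * w (g (f i)) (g (f j)) * cnj (u j))" using A ij by simp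
  qed
  ultimately show ?thesis unfolding embeds_def using r by blast
qed

text \<open>The last condition supplies the earlier neighbours for \<open>connected_onI\<close>; the
  vertex orders of the cyclic graphs below are arranged accordingly.\<close>

definition good_code :: "eis list list \<Rightarrow> bool"
  where "good_code G \<longleftrightarrow> G \<noteq> [] \<and> list_all (\<lambda>r. length r = length G \<and> wgt r = 4) G \<and> eadj G = G \<and> ok G \<and>
    list_all (\<lambda>k. list_ex (\<lambda>x. x \<noteq> N) (take k (G ! k))) [1..<length G]"

lemma good_code_complete:
  assumes "good_code G"
  shows "complete_on {..<length G} (\<lambda>i j. val (G ! i ! j))"
proof -
  have G: "G \<noteq> []" "\<And>r. r \<in> set G \<Longrightarrow> length r = length G" "\<And>r. r \<in> set G \<Longrightarrow> wgt r = 4" "eadj G = G" "ok G"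
    "\<And>k. 0 < k \<Longrightarrow> k < length G \<Longrightarrow> \<exists>x\<in>set (take k (G ! k)). x \<noteq> N"
    using assms unfolding good_code_def list_all_iff list_ex_iff by auto
  have len: "length (G ! i) = length G" if "i < length G" for i using G(2) that by simp
  have sym: "G ! j ! i = ecnj (G ! i ! j)" if "i < length G" "j < length G" for i j
    using eadj_nth(2)[OF G(1,2) that(2)] G(4) that by simp
  have h: "herm {..<length G} (\<lambda>i j. val (G ! i ! j))"
    unfolding herm_def
  proof (intro ballI conjI)
    fix i j assume ij: "i \<in> {..<length G}" "j \<in> {..<length G}"
    show "val (G ! i ! j) \<in> eisenstein_ints" by (cases "G ! i ! j") (auto intro: R_diff R_uminus)
    have "G ! j ! i = ecnj (G ! i ! j)" using ij by (intro sym) auto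
    then show "val (G ! j ! i) = cnj (val (G ! i ! j))" by (simp only: val_ecnj)
  qed
  have sq: "(\<Sum>k<length G. val (G ! i ! k) * cnj (val (G ! j ! k))) = (if i = j then 4 else 0)"
    if ij: "i < length G" "j < length G" for i j
  proof -
    have eq: "(\<Sum>k<length G. val (G ! i ! k) * cnj (val (G ! j ! k))) = pair_val (eip (G ! i) (G ! j))" if "i < length G" "j < length G" for i j
      using len that by (simp add: pair_val_eip)
    have lt: "pair_val (eip (G ! i) (G ! j)) = 0" if "i < j" "j < length G" for i j
      using G(5) G(3)[of "G ! i"] that unfolding ok_iff by (simp add: pair_val_0)
    consider "i < j" | "j < i" | "i = j" by linarith
    then show ?thesis
    proof cases
      case 2
      have "(\<Sum>k<length G. val (G ! i ! k) * cnj (val (G ! j ! k))) = cnj (\<Sum>k<length G. val (G ! j ! k) * cnj (val (G ! i ! k)))"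
        by (simp add: mult.commute)
      then show ?thesis using eq[OF ij(2,1)] lt[OF 2 ij(1)] 2 by simp
    next
      case 3
      have "val x * cnj (val x) = (if x \<noteq> N then 1 else 0)" for x
        using unit_cnj_mult(1)[OF val_units[of x]] by simp
      then have "(\<Sum>k<length G. val (G ! i ! k) * cnj (val (G ! i ! k))) = of_nat (card {k \<in> {..<length G}. G ! i ! k \<noteq> N})"
        by (simp add: sum.If_cases Int_def)
      also have "{k \<in> {..<length G}. G ! i ! k \<noteq> N} = {k. k < length (G ! i) \<and> G ! i ! k \<noteq> N}" using len[OF ij(1)] by auto
      finally show ?thesis using G(3)[of "G ! i"] ij(1) 3 unfolding wgt_card by simp
    qed (use eq[OF ij] lt ij in simp)
  qed
  have "connected_on {..<length G} (\<lambda>i j. val (G ! i ! j))"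
  proof (rule connected_onI[of _ "[0..<length G]"])
    fix i j assume ij: "i \<in> {..<length G}" "j \<in> {..<length G}" "val (G ! i ! j) \<noteq> 0"
    have "val (G ! j ! i) = cnj (val (G ! i ! j))" using hermD(2)[OF h ij(1,2)] .
    then show "val (G ! j ! i) \<noteq> 0" using ij(3) by simp
  next
    fix k assume k: "k < length [0..<length G]" "0 < k"
    then obtain x where "x \<in> set (take k (G ! k))" "x \<noteq> N" using G(6) by auto
    then show "\<exists>l<k. val (G ! ([0..<length G] ! k) ! ([0..<length G] ! l)) \<noteq> 0"
      using k by (auto simp: in_set_conv_nth val_0_iff)
  qed (use G(1) in auto)
  then show ?thesis unfolding complete_on_def using h sq by simp
qed

text \<open>The counterpart of \<open>weight_of\<close> over the coded alphabet, by which an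
  adjacency matrix can be computed from the edge list.\<close>

definition cweight :: "(('v \<times> 'v) \<times> eis) list \<Rightarrow> 'v \<Rightarrow> 'v \<Rightarrow> eis"
  where "cweight ws u v = (case map_of ws (u, v) of Some x \<Rightarrow> x
    | None \<Rightarrow> (case map_of ws (v, u) of Some x \<Rightarrow> ecnj x | None \<Rightarrow> N))"

definition cgraph :: "'v list \<Rightarrow> (('v \<times> 'v) \<times> eis) list \<Rightarrow> eis list list"
  where "cgraph vs ws = map (\<lambda>u. map (\<lambda>v. cweight ws u v) vs) vs"

lemma weight_of_code: "weight_of (map (\<lambda>(p, x). (p, val x)) ws) u v = val (cweight ws u v)"
  by (simp add: weight_of_def cweight_def map_of_map val_ecnj split: option.split)

lemma model_code:
  assumes S: "S = (set vs, weight_of (map (\<lambda>(p, x). (p, val x)) ws))" and G: "cgraph vs ws = G" "distinct vs" "good_code G"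
  shows "complete_on (fst S) (snd S)"
    and "embeds V A {..<length G} (\<lambda>i j. val (G ! i ! j)) \<Longrightarrow> embeds V A (fst S) (snd S)"
proof -
  have len: "length G = length vs" using G(1) by (auto simp: cgraph_def)
  have bij: "bij_betw (\<lambda>i. vs ! i) {..<length G} (set vs)" unfolding len using G(2) by (intro bij_betw_nth) auto
  have w: "snd S (vs ! i) (vs ! j) = val (G ! i ! j)" if "i \<in> {..<length G}" "j \<in> {..<length G}" for i j
    using that len unfolding S G(1)[symmetric] by (simp add: weight_of_code cgraph_def)
  show "complete_on (fst S) (snd S)"
    using complete_on_bij[OF bij good_code_complete[OF G(3)], of "snd S"] w unfolding S by simp
  show "embeds V A {..<length G} (\<lambda>i j. val (G ! i ! j)) \<Longrightarrow> embeds V A (fst S) (snd S)"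
    using embeds_bij[of "\<lambda>i. vs ! i" "{..<length G}" "set vs" "snd S" "\<lambda>i j. val (G ! i ! j)" V A] bij w
    unfolding bij_betw_def S by simp
qed

section \<open>Codes of the sporadic graphs\<close>

definition cwt :: "eis \<Rightarrow> string list \<Rightarrow> ((char \<times> char) \<times> eis) list" where
  "cwt x es = map (\<lambda>e. ((e ! 0, e ! 1), x)) es"

definition lS5 :: "((char \<times> char) \<times> eis) list" where
  "lS5 = cwt P0 [''cc'', ''dd''] @
     cwt P0 [''ce'', ''de'', ''ad'', ''bc'', ''ab''] @
     cwt P4 [''ac'', ''bd'', ''eb'', ''ea'']"

lemma S5_code: "S5 = (set ''abcde'', weight_of (map (\<lambda>(p, x). (p, val x)) lS5))"
  by (simp add: S5_def letter_graph_def wt_def lS5_def cwt_def)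

lemma S5_graph: "cgraph ''abcde'' lS5 = gS5" "distinct ''abcde''" "good_code gS5"
  by code_simp+

lemmas S5_model = model_code[OF S5_code S5_graph]

definition lS6 :: "((char \<times> char) \<times> eis) list" where
  "lS6 = cwt P0 [''bb'', ''dd'', ''ff''] @ cwt P3 [''aa'', ''cc'', ''ee''] @
     cwt P0 [''bc'', ''cf'', ''cd'', ''af'', ''be''] @
     cwt P4 [''ba'', ''ad'', ''fe'', ''ed'']"

lemma S6_code: "S6 = (set ''abcdef'', weight_of (map (\<lambda>(p, x). (p, val x)) lS6))"
  by (simp add: S6_def letter_graph_def wt_def lS6_def cwt_def)

lemma S6_graph: "cgraph ''abcdef'' lS6 = gS6" "distinct ''abcdef''" "good_code gS6"
  by code_simp+

lemmas S6_model = model_code[OF S6_code S6_graph]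

definition lS6d :: "((char \<times> char) \<times> eis) list" where
  "lS6d = cwt P0 [''dd''] @ cwt P3 [''cc''] @
     cwt P0 [''bc'', ''cf'', ''cd'', ''bf'', ''af'', ''be''] @
     cwt P3 [''ae''] @
     cwt P4 [''ba'', ''ad'', ''fe'', ''ed'']"

lemma S6d_code: "S6_dagger = (set ''abcdef'', weight_of (map (\<lambda>(p, x). (p, val x)) lS6d))"
  by (simp add: S6_dagger_def letter_graph_def wt_def lS6d_def cwt_def)

lemma S6d_graph: "cgraph ''abcdef'' lS6d = gS6d" "distinct ''abcdef''" "good_code gS6d"
  by code_simp+

lemmas S6d_model = model_code[OF S6d_code S6d_graph]

definition lS7 :: "((char \<times> char) \<times> eis) list" where
  "lS7 = cwt P0 [''aa'', ''ee'', ''ff''] @ cwt P3 [''dd''] @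
     cwt P0 [''ab'', ''ad'', ''cf'', ''bg'', ''de'', ''df'', ''cg'', ''eg'', ''bc''] @
     cwt P3 [''ac'', ''fg'', ''be'']"

lemma S7_code: "S7 = (set ''abcdefg'', weight_of (map (\<lambda>(p, x). (p, val x)) lS7))"
  by (simp add: S7_def letter_graph_def wt_def lS7_def cwt_def)

lemma S7_graph: "cgraph ''abcdefg'' lS7 = gS7" "distinct ''abcdefg''" "good_code gS7"
  by code_simp+

lemmas S7_model = model_code[OF S7_code S7_graph]

definition lS8 :: "((char \<times> char) \<times> eis) list" where
  "lS8 = cwt P0 [''bb'', ''cc'', ''ee'', ''hh''] @ cwt P3 [''aa'', ''dd'', ''ff'', ''gg''] @
     cwt P0 [''ab'', ''ae'', ''cg'', ''cd'', ''bd'', ''ef'', ''eg'', ''fh'', ''dh''] @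
     cwt P3 [''ac'', ''bf'', ''gh'']"

lemma S8_code: "S8 = (set ''abcdefgh'', weight_of (map (\<lambda>(p, x). (p, val x)) lS8))"
  by (simp add: S8_def letter_graph_def wt_def lS8_def cwt_def)

lemma S8_graph: "cgraph ''abcdefgh'' lS8 = gS8" "distinct ''abcdefgh''" "good_code gS8"
  by code_simp+

lemmas S8_model = model_code[OF S8_code S8_graph]

definition lS8p :: "((char \<times> char) \<times> eis) list" where
  "lS8p = cwt P0 [''bb'', ''gg''] @ cwt P3 [''aa'', ''hh''] @
     cwt P0 [''ab'', ''ac'', ''ae'', ''cg'', ''bd'', ''ef'', ''gh'', ''fh'', ''dh'', ''df'', ''ce''] @
     cwt P3 [''cd'', ''bf'', ''eg'']"

lemma S8p_code: "S8_prime = (set ''abcdefgh'', weight_of (map (\<lambda>(p, x). (p, val x)) lS8p))"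
  by (simp add: S8_prime_def letter_graph_def wt_def lS8p_def cwt_def)

lemma S8p_graph: "cgraph ''abcdefgh'' lS8p = gS8p" "distinct ''abcdefgh''" "good_code gS8p"
  by code_simp+

lemmas S8p_model = model_code[OF S8p_code S8p_graph]

definition lS10 :: "((cyclic_vertex \<times> cyclic_vertex) \<times> eis) list" where
  "lS10 = concat (map (\<lambda>j.
     [((Out j, Inn j), P0), ((Out j, Inn ((j - 1) mod 5)), P0),
      ((Out j, Inn ((j + 1) mod 5)), P4), ((Out j, Inn ((j + 3) mod 5)), P4)]) [0..4])"

lemma S10_code: "S10 = (set [Out 0,Inn 0,Out 1,Out 2,Out 4,Inn 1,Out 3,Inn 2,Inn 3,Inn 4], weight_of (map (\<lambda>(p, x). (p, val x)) lS10))"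
proof -
  have "{0..<5::int} = {0,1,2,3,4}" by auto
  then have "cyclic_verts 5 = set [Out 0,Inn 0,Out 1,Out 2,Out 4,Inn 1,Out 3,Inn 2,Inn 3,Inn 4]" unfolding cyclic_verts_def by auto
  then show ?thesis unfolding S10_def lS10_def map_concat map_map comp_def
    by (simp add: if_distrib[of "map _"] cong: if_cong)
qed

lemma S10_graph: "cgraph [Out 0,Inn 0,Out 1,Out 2,Out 4,Inn 1,Out 3,Inn 2,Inn 3,Inn 4] lS10 = gS10" "distinct [Out 0,Inn 0,Out 1,Out 2,Out 4,Inn 1,Out 3,Inn 2,Inn 3,Inn 4]" "good_code gS10"
  by code_simp+

lemmas S10_model = model_code[OF S10_code S10_graph]

definition lS12 :: "((cyclic_vertex \<times> cyclic_vertex) \<times> eis) list" where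
  "lS12 = concat (map (\<lambda>j.
     if even j then
       [((Out j, Inn j), P0),
        ((Out j, Inn ((j - 1) mod 6)), P3), ((Out j, Inn ((j + 3) mod 6)), P3),
        ((Out j, Inn ((j + 1) mod 6)), P1)]
     else
       [((Out j, Inn j), P0),
        ((Out j, Inn ((j + 1) mod 6)), P0), ((Out j, Inn ((j + 3) mod 6)), P0),
        ((Inn ((j - 1) mod 6), Out j), P4)]) [0..5])"

lemma S12_code: "S12 = (set [Out 0,Inn 0,Out 1,Out 3,Out 5,Inn 1,Out 2,Out 4,Inn 2,Inn 3,Inn 4,Inn 5], weight_of (map (\<lambda>(p, x). (p, val x)) lS12))"
proof -
  have "{0..<6::int} = {0,1,2,3,4,5}" by auto
  then have "cyclic_verts 6 = set [Out 0,Inn 0,Out 1,Out 3,Out 5,Inn 1,Out 2,Out 4,Inn 2,Inn 3,Inn 4,Inn 5]" unfolding cyclic_verts_def by auto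
  then show ?thesis unfolding S12_def lS12_def map_concat map_map comp_def
    by (simp add: if_distrib[of "map _"] cong: if_cong)
qed

lemma S12_graph: "cgraph [Out 0,Inn 0,Out 1,Out 3,Out 5,Inn 1,Out 2,Out 4,Inn 2,Inn 3,Inn 4,Inn 5] lS12 = gS12" "distinct [Out 0,Inn 0,Out 1,Out 3,Out 5,Inn 1,Out 2,Out 4,Inn 2,Inn 3,Inn 4,Inn 5]" "good_code gS12"
  by code_simp+

lemmas S12_model = model_code[OF S12_code S12_graph]

definition lS14 :: "((cyclic_vertex \<times> cyclic_vertex) \<times> eis) list" where
  "lS14 = concat (map (\<lambda>j.
     [((Out j, Inn j), P0), ((Out j, Inn ((j + 1) mod 7)), P0),
      ((Out j, Inn ((j + 3) mod 7)), P0), ((Out j, Inn ((j - 1) mod 7)), P3)]) [0..6])"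

lemma S14_code: "S14 = (set [Out 0,Inn 0,Out 1,Out 4,Out 6,Inn 1,Out 2,Out 5,Inn 2,Out 3,Inn 3,Inn 4,Inn 5,Inn 6], weight_of (map (\<lambda>(p, x). (p, val x)) lS14))"
proof -
  have "{0..<7::int} = {0,1,2,3,4,5,6}" by auto
  then have "cyclic_verts 7 = set [Out 0,Inn 0,Out 1,Out 4,Out 6,Inn 1,Out 2,Out 5,Inn 2,Out 3,Inn 3,Inn 4,Inn 5,Inn 6]" unfolding cyclic_verts_def by auto
  then show ?thesis unfolding S14_def lS14_def map_concat map_map comp_def
    by (simp add: if_distrib[of "map _"] cong: if_cong)
qed

lemma S14_graph: "cgraph [Out 0,Inn 0,Out 1,Out 4,Out 6,Inn 1,Out 2,Out 5,Inn 2,Out 3,Inn 3,Inn 4,Inn 5,Inn 6] lS14 = gS14" "distinct [Out 0,Inn 0,Out 1,Out 4,Out 6,Inn 1,Out 2,Out 5,Inn 2,Out 3,Inn 3,Inn 4,Inn 5,Inn 6]" "good_code gS14"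
  by code_simp+

lemmas S14_model = model_code[OF S14_code S14_graph]

definition lS16 :: "((cyclic_vertex \<times> cyclic_vertex) \<times> eis) list" where
  "lS16 = concat (map (\<lambda>j.
     [((Out j, Out ((j + 1) mod 8)), P0), ((Inn j, Inn ((j + 3) mod 8)), P0),
      ((Out j, Inn ((j + 1) mod 8)), P3), ((Out j, Inn ((j - 1) mod 8)), P0)]) [0..7])"

lemma S16_code: "S16 = (set [Out 0,Out 1,Out 2,Out 3,Out 4,Out 5,Out 6,Out 7,Inn 0,Inn 1,Inn 2,Inn 3,Inn 4,Inn 5,Inn 6,Inn 7], weight_of (map (\<lambda>(p, x). (p, val x)) lS16))"
proof -
  have "{0..<8::int} = {0,1,2,3,4,5,6,7}" by auto
  then have "cyclic_verts 8 = set [Out 0,Out 1,Out 2,Out 3,Out 4,Out 5,Out 6,Out 7,Inn 0,Inn 1,Inn 2,Inn 3,Inn 4,Inn 5,Inn 6,Inn 7]" unfolding cyclic_verts_def by auto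
  then show ?thesis unfolding S16_def lS16_def map_concat map_map comp_def
    by (simp add: if_distrib[of "map _"] cong: if_cong)
qed

lemma S16_graph: "cgraph [Out 0,Out 1,Out 2,Out 3,Out 4,Out 5,Out 6,Out 7,Inn 0,Inn 1,Inn 2,Inn 3,Inn 4,Inn 5,Inn 6,Inn 7] lS16 = gS16" "distinct [Out 0,Out 1,Out 2,Out 3,Out 4,Out 5,Out 6,Out 7,Inn 0,Inn 1,Inn 2,Inn 3,Inn 4,Inn 5,Inn 6,Inn 7]" "good_code gS16"
  by code_simp+

lemmas S16_model = model_code[OF S16_code S16_graph]

subsection \<open>Ladders\<close>

text \<open>The outer scaling has to be moved inside the second conjugation. As that is an
  involution, the combined unit is \<open>\<sigma>' (u i) * u' (f i)\<close>.\<close>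

lemma embeds_trans:
  assumes "embeds V A V' B" "embeds V' B S w"
  shows "embeds V A S w"
proof -
  obtain f u s \<sigma> where f: "inj_on f V" "f ` V \<subseteq> V'" and u: "\<forall>i\<in>V. u i \<in> eisenstein_units"
    and s: "s \<in> {1, -1}" and \<sigma>: "\<sigma> \<in> {id, cnj}"
    and A: "\<forall>i\<in>V. \<forall>j\<in>V. A i j = s * \<sigma> (u i * B (f i) (f j) * cnj (u j))"
    using assms(1) unfolding embeds_def by (elim exE conjE)
  obtain f' u' s' \<sigma>' where f': "inj_on f' V'" "f' ` V' \<subseteq> S" and u': "\<forall>i\<in>V'. u' i \<in> eisenstein_units"
    and s': "s' \<in> {1, -1}" and \<sigma>': "\<sigma>' \<in> {id, cnj}"
    and B: "\<forall>i\<in>V'. \<forall>j\<in>V'. B i j = s' * \<sigma>' (u' i * w (f' i) (f' j) * cnj (u' j))"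
    using assms(2) unfolding embeds_def by (elim exE conjE)
  have fV: "f i \<in> V'" if "i \<in> V" for i using f(2) that by auto
  show ?thesis unfolding embeds_def
  proof (intro exI conjI ballI)
    show "inj_on (\<lambda>x. f' (f x)) V" using comp_inj_on[OF f(1) inj_on_subset[OF f'(1) f(2)]] by (simp add: comp_def)
    show "(\<lambda>x. f' (f x)) ` V \<subseteq> S" using fV f'(2) by auto
    show "\<sigma>' (u i) * u' (f i) \<in> eisenstein_units" if "i \<in> V" for i
      using u u' \<sigma>' fV[OF that] that unit_mult unit_cnj by auto
    show "s * s' \<in> {1, -1}" using s s' by auto
    show "(\<lambda>x. \<sigma> (\<sigma>' x)) \<in> {id, cnj}" using \<sigma> \<sigma>' by (auto simp: fun_eq_iff)
    fix i j assume ij: "i \<in> V" "j \<in> V"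
    have "A i j = s * \<sigma> (u i * (s' * \<sigma>' (u' (f i) * w (f' (f i)) (f' (f j)) * cnj (u' (f j)))) * cnj (u j))"
      using A B ij fV by simp
    then show "A i j = s * s' * \<sigma> (\<sigma>' (\<sigma>' (u i) * u' (f i) * w (f' (f i)) (f' (f j)) * cnj (\<sigma>' (u j) * u' (f j))))"
      using s' \<sigma> \<sigma>' by auto
  qed
qed

definition sg :: "bool \<Rightarrow> complex" where "sg b = (if b then 1 else -1)"

lemma sg_simps [simp]: "sg True = 1" "sg False = -1" "cnj (sg b) = sg b" "sg b * sg b = 1" "sg b \<noteq> 0" "sg (\<not> b) = - sg b"
  by (auto simp: sg_def)

text \<open>\<open>lad k \<alpha> \<beta> \<zeta>\<close> is the ladder on \<open>k\<close> rungs with charges \<open>\<alpha>\<close> and \<open>\<beta>\<close> on its first and last rung,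
  closed up to a cycle by weights \<open>\<zeta>\<close>; the Boolean is true for top vertices.\<close>

definition lad :: "nat \<Rightarrow> complex \<Rightarrow> complex \<Rightarrow> complex \<Rightarrow> nat \<times> bool \<Rightarrow> nat \<times> bool \<Rightarrow> complex"
  where "lad k \<alpha> \<beta> \<zeta> p q = (case (p, q) of ((i, b), (j, c)) \<Rightarrow>
    (if Suc i = j then sg b else 0) + (if i = Suc j then sg c else 0) +
    (if i = 0 \<and> j = 0 then \<alpha> else 0) + (if Suc i = k \<and> Suc j = k then \<beta> * sg b * sg c else 0) +
    (if Suc i = k \<and> j = 0 then \<zeta> * sg b else 0) + (if i = 0 \<and> Suc j = k then cnj \<zeta> * sg c else 0))"

definition lad_verts :: "nat \<Rightarrow> (nat \<times> bool) set" where "lad_verts k = {..<k} \<times> UNIV"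

text \<open>For half rows of a ladder, each of which lives on at most two rungs.\<close>

lemma sum_two_deltas:
  fixes a e a' e' :: complex
  assumes "p \<noteq> q" "p' \<noteq> q"
  shows "(\<Sum>l<(k::nat). ((if l = p then a else 0) + (if l = q then e else 0)) * cnj ((if l = p' then a' else 0) + (if l = q then e' else 0)))
    = (if p = p' \<and> p < k then a * cnj a' else 0) + (if q < k then e * cnj e' else 0)"
proof -
  have "((if l = p then a else 0) + (if l = q then e else 0)) * cnj ((if l = p' then a' else 0) + (if l = q then e' else 0))
    = (if l = p then (if p = p' then a * cnj a' else 0) else 0) + (if l = q then e * cnj e' else 0)" for l
    using assms by auto
  then show ?thesis by (simp add: sum.distrib)
qed

lemma lad_complete:
  assumes "(2 \<le> k \<and> \<alpha> \<in> {1, -1} \<and> \<beta> \<in> {1, -1} \<and> \<zeta> = 0) \<or> (3 \<le> k \<and> \<alpha> = 0 \<and> \<beta> = 0 \<and> \<zeta> \<in> eisenstein_units)"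
  shows "complete_on (lad_verts k) (lad k \<alpha> \<beta> \<zeta>)"
proof -
  have k: "2 \<le> k" using assms by auto
  have R: "\<alpha> \<in> eisenstein_ints" "\<beta> \<in> eisenstein_ints" "\<zeta> \<in> eisenstein_ints" "cnj \<alpha> = \<alpha>" "cnj \<beta> = \<beta>"
    using assms unit_R R_of_int[of "-1"] by auto
  have sgR: "sg b \<in> eisenstein_ints" for b using R_of_int[of "-1"] by (cases b) auto
  have herm: "herm (lad_verts k) (lad k \<alpha> \<beta> \<zeta>)"
    unfolding herm_def
  proof (intro ballI conjI)
    fix p q :: "nat \<times> bool"
    obtain i b j c where pq: "p = (i, b)" "q = (j, c)" by (cases p; cases q)
    show "lad k \<alpha> \<beta> \<zeta> p q \<in> eisenstein_ints"
      unfolding pq lad_def using R sgR by (auto intro!: R_add R_mult R_cnj)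
    show "lad k \<alpha> \<beta> \<zeta> q p = cnj (lad k \<alpha> \<beta> \<zeta> p q)"
      unfolding pq lad_def using R(4,5) by (auto simp: mult.commute)
  qed
  \<comment> \<open>A row splits into a part that agrees on top and bottom of every rung,
    \<open>x\<close>, and a part that changes sign there, \<open>y\<close>. Mixed products cancel on
    each rung, and each part lives on at most two rungs: the next and the first for
    \<open>x\<close>, the previous and the last for \<open>y\<close>.\<close>
  define e where "e i b = (if i = 0 then \<alpha> else 0) + (if Suc i = k then \<zeta> * sg b else 0)" for i b
  define h where "h i b = (if Suc i = k then \<beta> * sg b else 0) + (if i = 0 then cnj \<zeta> else 0)" for i b
  define x where "x i b l = (if l = Suc i then sg b else 0) + (if l = 0 then e i b else 0)" for i l :: nat and b
  \<comment> \<open>The first rung has no predecessor; \<open>k\<close> is out of range and so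
    contributes nothing.\<close>
  define m where "m i = (if i = 0 then k else i - 1)" for i
  define y where "y i b l = (if l = m i then 1 else 0) + (if l = k - 1 then h i b else 0)" for i l :: nat and b
  have xy: "lad k \<alpha> \<beta> \<zeta> (i, b) (l, c) = x i b l + sg c * y i b l" if "l < k" for i b l c
  proof -
    have "l = m i \<longleftrightarrow> i = Suc l" "l = k - 1 \<longleftrightarrow> Suc l = k" using that by (auto simp: m_def)
    then show ?thesis unfolding lad_def x_def y_def e_def h_def by (auto simp: algebra_simps)
  qed
  have sq: "(\<Sum>v\<in>lad_verts k. lad k \<alpha> \<beta> \<zeta> (i, b) v * cnj (lad k \<alpha> \<beta> \<zeta> (j, d) v)) = (if (i, b) = (j, d) then 4 else 0)"
    if ij: "i < k" "j < k" for i b j d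
  proof -
    have "(\<Sum>v\<in>lad_verts k. lad k \<alpha> \<beta> \<zeta> (i, b) v * cnj (lad k \<alpha> \<beta> \<zeta> (j, d) v))
      = (\<Sum>l<k. \<Sum>c\<in>UNIV. lad k \<alpha> \<beta> \<zeta> (i, b) (l, c) * cnj (lad k \<alpha> \<beta> \<zeta> (j, d) (l, c)))"
      unfolding lad_verts_def by (simp add: sum.cartesian_product split_beta)
    also have "\<dots> = (\<Sum>l<k. 2 * (x i b l * cnj (x j d l)) + 2 * (y i b l * cnj (y j d l)))"
      by (rule sum.cong[OF refl]) (simp add: UNIV_bool xy algebra_simps)
    also have "\<dots> = 2 * (\<Sum>l<k. x i b l * cnj (x j d l)) + 2 * (\<Sum>l<k. y i b l * cnj (y j d l))"
      by (simp add: sum.distrib sum_distrib_left)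
    also have "(\<Sum>l<k. x i b l * cnj (x j d l)) = (if Suc i = Suc j \<and> Suc i < k then sg b * cnj (sg d) else 0) + (if 0 < k then e i b * cnj (e j d) else 0)"
      unfolding x_def by (rule sum_two_deltas) auto
    also have "(\<Sum>l<k. y i b l * cnj (y j d l)) = (if m i = m j \<and> m i < k then 1 * cnj 1 else 0) + (if k - 1 < k then h i b * cnj (h j d) else 0)"
      unfolding y_def by (rule sum_two_deltas) (use ij k in \<open>auto simp: m_def\<close>)
    also have "m i = m j \<and> m i < k \<longleftrightarrow> i = j \<and> i > 0" using ij by (auto simp: m_def)
    finally have eq: "(\<Sum>v\<in>lad_verts k. lad k \<alpha> \<beta> \<zeta> (i, b) v * cnj (lad k \<alpha> \<beta> \<zeta> (j, d) v))
      = 2 * ((if i = j \<and> Suc i < k then sg b * sg d else 0) + e i b * cnj (e j d)) +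
        2 * ((if i = j \<and> i > 0 then 1 else 0) + h i b * cnj (h j d))" using k by simp
    from assms show ?thesis
    proof
      assume a: "2 \<le> k \<and> \<alpha> \<in> {1, -1} \<and> \<beta> \<in> {1, -1} \<and> \<zeta> = 0"
      have "e i b * cnj (e j d) = (if i = 0 \<and> j = 0 then 1 else 0)" using a by (auto simp: e_def)
      moreover have "h i b * cnj (h j d) = (if Suc i = k \<and> Suc j = k then sg b * sg d else 0)" using a by (auto simp: h_def)
      ultimately show ?thesis unfolding eq using ij by (cases b; cases d) auto
    next
      assume a: "3 \<le> k \<and> \<alpha> = 0 \<and> \<beta> = 0 \<and> \<zeta> \<in> eisenstein_units"
      then have z: "\<zeta> * cnj \<zeta> = 1" using unit_cnj_mult by blast
      have "e i b * cnj (e j d) = (if Suc i = k \<and> Suc j = k then sg b * sg d else 0)" using a z by (auto simp: e_def)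
      moreover have "h i b * cnj (h j d) = (if i = 0 \<and> j = 0 then 1 else 0)" using a z by (auto simp: h_def mult.commute)
      ultimately show ?thesis unfolding eq using ij by (cases b; cases d) auto
    qed
  qed
  have nz: "lad k \<alpha> \<beta> \<zeta> (i, b) (j, c) \<noteq> 0" if "Suc i = j \<or> i = Suc j" "i < k" "j < k" for i b j c
    using that assms by (auto simp: lad_def)
  have "connected_on (lad_verts k) (lad k \<alpha> \<beta> \<zeta>)"
    unfolding connected_on_def
  proof (intro conjI allI impI)
    have "(0, True) \<in> lad_verts k" using k by (simp add: lad_verts_def)
    then show "lad_verts k \<noteq> {}" by blast
    fix X assume X: "X \<subseteq> lad_verts k" "X \<noteq> {}" "\<forall>p\<in>X. \<forall>q\<in>lad_verts k. lad k \<alpha> \<beta> \<zeta> p q \<noteq> 0 \<longrightarrow> q \<in> X"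
    have st: "(j, c) \<in> X" if "(i, b) \<in> X" "Suc i = j \<or> i = Suc j" "j < k" for i b j c
      using that X(1) nz[of i j b c] X(3) by (auto simp: lad_verts_def)
    obtain i b where ib: "(i, b) \<in> X" "i < k" using X(1,2) by (auto simp: lad_verts_def)
    have "\<exists>j<k. \<forall>c. (j, c) \<in> X"
    proof (cases "i = 0")
      case True
      then show ?thesis using st[OF ib(1), of 1] k by (intro exI[of _ 1]) auto
    next
      case False
      then show ?thesis using st[OF ib(1), of "i - 1"] ib(2) by (intro exI[of _ "i - 1"]) auto
    qed
    then obtain j where j: "j < k" "\<forall>c. (j, c) \<in> X" by blast
    have "\<forall>c. (0, c) \<in> X" using j
    proof (induction j)
      case (Suc j)
      then show ?case using st[of "Suc j" True j] by auto
    qed simp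
    then have "\<forall>c. (l, c) \<in> X" if "l < k" for l using that
    proof (induction l)
      case (Suc l)
      then show ?case using st[of l True "Suc l"] by auto
    qed simp
    then show "X = lad_verts k" using X(1) by (auto simp: lad_verts_def)
  qed
  then show ?thesis unfolding complete_on_def using herm sq by (auto simp: lad_verts_def)
qed

lemma embedsI:
  assumes "inj_on f V" "\<And>i. i \<in> V \<Longrightarrow> f i \<in> S" "\<And>i. i \<in> V \<Longrightarrow> u i \<in> eisenstein_units" "s \<in> {1, -1}" "\<sigma> \<in> {id, cnj}"
    "\<And>i j. i \<in> V \<Longrightarrow> j \<in> V \<Longrightarrow> A i j = s * \<sigma> (u i * w (f i) (f j) * cnj (u j))"
  shows "embeds V A S w"
  unfolding embeds_def using assms by blast

text \<open>Negating everything and then switching signs on every second rung preserves the edges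
  between rungs and negates the blocks on the end rungs.\<close>

lemma lad_neg: "embeds (lad_verts k) (lad k \<alpha> \<beta> 0) (lad_verts k) (lad k (- \<alpha>) (- \<beta>) 0)"
proof (rule embedsI[of "\<lambda>p. p" _ _ "\<lambda>p. (- 1) ^ fst p" "-1" id])
  show "(- 1) ^ fst p \<in> eisenstein_units" for p :: "nat \<times> bool"
    using unit_uminus[OF unit_1] by (cases "even (fst p)") auto
  fix p q :: "nat \<times> bool"
  obtain i b j c where pq: "p = (i, b)" "q = (j, c)" by (cases p; cases q)
  have "(- 1) ^ i * (- 1) ^ i = (1 :: complex)" for i :: nat by (simp flip: power_add add: power_mult_distrib)
  then show "lad k \<alpha> \<beta> 0 p q = - 1 * id ((- 1) ^ fst p * lad k (- \<alpha>) (- \<beta>) 0 p q * cnj ((- 1) ^ fst q))"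
    unfolding pq lad_def by auto
qed auto

lemma lad_cnj: "embeds (lad_verts k) (lad k 0 0 \<zeta>) (lad_verts k) (lad k 0 0 (cnj \<zeta>))"
  by (rule embedsI[of "\<lambda>p. p" _ _ "\<lambda>_. 1" 1 cnj]) (auto simp: lad_def)

text \<open>Exchanging top and bottom on the first rung negates its weights to the second. The sign
  on all other rungs repairs this and moves the sign to the closing edges.\<close>

lemma lad_flip: "3 \<le> k \<Longrightarrow> embeds (lad_verts k) (lad k 0 0 \<zeta>) (lad_verts k) (lad k 0 0 (- \<zeta>))"
proof (rule embedsI[of "\<lambda>(i, b). (i, if i = 0 then \<not> b else b)" _ _ "\<lambda>p. if fst p = 0 then 1 else - 1" 1 id])
  show "inj_on (\<lambda>(i, b). (i, if i = 0 then \<not> b else b)) (lad_verts k)" by (auto simp: inj_on_def split: if_splits)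
  fix p q :: "nat \<times> bool"
  obtain i b j c where pq: "p = (i, b)" "q = (j, c)" by (cases p; cases q)
  assume "3 \<le> k"
  then show "lad k 0 0 \<zeta> p q = 1 * id ((if fst p = 0 then 1 else - 1) *
      lad k 0 0 (- \<zeta>) (case p of (i, b) \<Rightarrow> (i, if i = 0 then \<not> b else b)) (case q of (i, b) \<Rightarrow> (i, if i = 0 then \<not> b else b)) *
      cnj (if fst q = 0 then 1 else - 1))"
    unfolding pq lad_def by auto
qed (use unit_uminus[OF unit_1] in \<open>auto simp: lad_verts_def\<close>)

text \<open>An uncharged end is continued by one rung that carries a charge. On a single rung both
  ends coincide, so its charge must be counted by \<alpha> alone.\<close>

lemma lad_pad:
  assumes "\<alpha> \<in> {0, 1, -1}" "\<beta> \<in> {0, 1, -1}" "k \<ge> 1" "k = 1 \<Longrightarrow> \<beta> = 0"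
  shows "\<exists>k' \<alpha>' \<beta>'. 2 \<le> k' \<and> \<alpha>' \<in> {1, -1} \<and> \<beta>' \<in> {1, -1} \<and>
    embeds (lad_verts k) (lad k \<alpha> \<beta> 0) (lad_verts k') (lad k' \<alpha>' \<beta>' 0)"
proof -
  define s where "s = (if \<alpha> = 0 then 1 else 0 :: nat)"
  define k' where "k' = k + s + (if \<beta> = 0 then 1 else 0)"
  define \<alpha>' where "\<alpha>' = (if \<alpha> = 0 then 1 else \<alpha>)"
  define \<beta>' where "\<beta>' = (if \<beta> = 0 then 1 else \<beta>)"
  have "embeds (lad_verts k) (lad k \<alpha> \<beta> 0) (lad_verts k') (lad k' \<alpha>' \<beta>' 0)"
  proof (rule embedsI[of "\<lambda>(i, b). (i + s, b)" _ _ "\<lambda>_. 1" 1 id])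
    show "inj_on (\<lambda>(i, b). (i + s, b)) (lad_verts k)" by (auto simp: inj_on_def)
    fix p q assume v: "p \<in> lad_verts k" "q \<in> lad_verts k"
    obtain i b j c where pq: "p = (i, b)" "q = (j, c)" by (cases p; cases q)
    then show "lad k \<alpha> \<beta> 0 p q = 1 * id (1 * lad k' \<alpha>' \<beta>' 0 (case p of (i, b) \<Rightarrow> (i + s, b)) (case q of (i, b) \<Rightarrow> (i + s, b)) * cnj 1)"
      using v unfolding pq lad_def lad_verts_def s_def k'_def \<alpha>'_def \<beta>'_def by auto
  qed (auto simp: lad_verts_def k'_def s_def)
  moreover have "2 \<le> k'" using assms by (cases "k = 1") (auto simp: k'_def s_def)
  ultimately show ?thesis using assms(1,2) by (intro exI[of _ k'] exI[of _ \<alpha>'] exI[of _ \<beta>']) (auto simp: \<alpha>'_def \<beta>'_def)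
qed

text \<open>Rungs are numbered from 0 in \<open>lad\<close> and from 1 in
  \<open>ladder_verts\<close>.\<close>

definition vert :: "nat \<times> bool \<Rightarrow> ladder_vertex"
  where "vert p = (if snd p then Top (Suc (fst p)) else Bot (Suc (fst p)))"

lemma vert_bij: "bij_betw vert (lad_verts k) (ladder_verts k)"
proof -
  have "inj_on vert (lad_verts k)" by (auto simp: inj_on_def vert_def split: if_splits)
  moreover have "vert ` lad_verts k = ladder_verts k"
  proof
    show "vert ` lad_verts k \<subseteq> ladder_verts k" by (auto simp: lad_verts_def ladder_verts_def vert_def)
    show "ladder_verts k \<subseteq> vert ` lad_verts k"
    proof
      fix x assume "x \<in> ladder_verts k"
      then obtain j where j: "1 \<le> j" "j \<le> k" "x = Top j \<or> x = Bot j" by (auto simp: ladder_verts_def)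
      then have "x = vert (j - 1, True) \<or> x = vert (j - 1, False)" by (auto simp: vert_def)
      moreover have "(j - 1, b) \<in> lad_verts k" for b using j by (auto simp: lad_verts_def)
      ultimately show "x \<in> vert ` lad_verts k" by blast
    qed
  qed
  ultimately show ?thesis by (simp add: bij_betw_def)
qed

lemma ladder_Suc: "ladder (Suc k) = ladder k @ (if k = 0 then [] else
  [((Top k, Top (k + 1)), 1), ((Top k, Bot (k + 1)), 1), ((Bot k, Top (k + 1)), -1), ((Bot k, Bot (k + 1)), -1)])"
  by (simp add: ladder_def)

lemma map_of_ladder: "map_of (ladder k) (vert (i, b), vert (j, c)) = (if j = Suc i \<and> j < k then Some (sg b) else None)"
proof (induction k)
  case 0
  show ?case by (simp add: ladder_def)
next
  case (Suc k)
  show ?case unfolding ladder_Suc map_of_append map_add_def Suc.IH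
    by (cases b; cases c) (auto simp: vert_def)
qed

lemma graph_T_lad: "3 \<le> k \<Longrightarrow> p \<in> lad_verts k \<Longrightarrow> q \<in> lad_verts k \<Longrightarrow> snd (graph_T \<zeta> k) (vert p) (vert q) = lad k 0 0 \<zeta> p q"
proof -
  assume a: "3 \<le> k" "p \<in> lad_verts k" "q \<in> lad_verts k"
  obtain i b j c where pq: "p = (i, b)" "q = (j, c)" by (cases p; cases q)
  have ij: "i < k" "j < k" using a pq by (auto simp: lad_verts_def)
  show ?thesis
    unfolding graph_T_def snd_conv weight_of_def pq map_of_append map_add_def map_of_ladder lad_def
    using a(1) ij by (cases b; cases c) (auto simp: vert_def)
qed

lemma C2k_pp_lad: "2 \<le> k \<Longrightarrow> p \<in> lad_verts k \<Longrightarrow> q \<in> lad_verts k \<Longrightarrow> snd (C2k_pp k) (vert p) (vert q) = lad k 1 1 0 p q"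
proof -
  assume a: "2 \<le> k" "p \<in> lad_verts k" "q \<in> lad_verts k"
  obtain i b j c where pq: "p = (i, b)" "q = (j, c)" by (cases p; cases q)
  have ij: "i < k" "j < k" using a pq by (auto simp: lad_verts_def)
  show ?thesis
    unfolding C2k_pp_def snd_conv weight_of_def pq map_of_append map_add_def map_of_ladder lad_def
    using a(1) ij by (cases b; cases c) (auto simp: vert_def)
qed

lemma C2k_pm_lad: "2 \<le> k \<Longrightarrow> p \<in> lad_verts k \<Longrightarrow> q \<in> lad_verts k \<Longrightarrow> snd (C2k_pm k) (vert p) (vert q) = lad k 1 (-1) 0 p q"
proof -
  assume a: "2 \<le> k" "p \<in> lad_verts k" "q \<in> lad_verts k"
  obtain i b j c where pq: "p = (i, b)" "q = (j, c)" by (cases p; cases q)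
  have ij: "i < k" "j < k" using a pq by (auto simp: lad_verts_def)
  show ?thesis
    unfolding C2k_pm_def snd_conv weight_of_def pq map_of_append map_add_def map_of_ladder lad_def
    using a(1) ij by (cases b; cases c) (auto simp: vert_def)
qed

definition in_ladder :: "'v set \<Rightarrow> ('v \<Rightarrow> 'v \<Rightarrow> complex) \<Rightarrow> bool"
  where "in_ladder V A \<longleftrightarrow> (\<exists>k\<ge>3. \<exists>G\<in>{T2k k, T2k_omega k}. complete_on (fst G) (snd G) \<and> embeds V A (fst G) (snd G)) \<or>
    (\<exists>k\<ge>2. \<exists>G\<in>{C2k_pp k, C2k_pm k}. complete_on (fst G) (snd G) \<and> embeds V A (fst G) (snd G))"

lemma lad_model:
  assumes c: "complete_on (lad_verts k) (lad k \<alpha> \<beta> \<zeta>)" and e: "embeds V A (lad_verts k) (lad k \<alpha> \<beta> \<zeta>)"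
    and G: "fst G = ladder_verts k" "\<And>p q. p \<in> lad_verts k \<Longrightarrow> q \<in> lad_verts k \<Longrightarrow> snd G (vert p) (vert q) = lad k \<alpha> \<beta> \<zeta> p q"
  shows "complete_on (fst G) (snd G) \<and> embeds V A (fst G) (snd G)"
  using complete_on_bij[OF vert_bij c G(2)] embeds_bij[of vert "lad_verts k" "ladder_verts k" "snd G", OF _ _ G(2) e] vert_bij[of k]
  unfolding G(1) bij_betw_def by simp

text \<open>Sign change and conjugation act on the six units with two orbits, represented by 1 and
  \<omega>.\<close>

lemma in_ladder_closed:
  assumes k: "3 \<le> k" and z: "\<zeta> \<in> eisenstein_units" and e: "embeds V A (lad_verts k) (lad k 0 0 \<zeta>)"
  shows "in_ladder V A"
proof -
  have fl: "embeds V A (lad_verts k) (lad k 0 0 (- z))" if "embeds V A (lad_verts k) (lad k 0 0 z)" for z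
    using embeds_trans[OF that lad_flip[OF k]] .
  have cj: "embeds V A (lad_verts k) (lad k 0 0 (cnj z))" if "embeds V A (lad_verts k) (lad k 0 0 z)" for z
    using embeds_trans[OF that lad_cnj] .
  have "embeds V A (lad_verts k) (lad k 0 0 1) \<or> embeds V A (lad_verts k) (lad k 0 0 \<omega>)"
    using z e fl[OF e] cj[OF e] fl[OF cj[OF e]] unfolding eisenstein_units_def by (auto simp: cnj_omega)
  moreover have "\<omega> \<in> eisenstein_units" by (simp add: eisenstein_units_def)
  then have "complete_on (lad_verts k) (lad k 0 0 1)" "complete_on (lad_verts k) (lad k 0 0 \<omega>)"
    using k lad_complete[of k 0 0] by auto
  ultimately have "complete_on (fst (T2k k)) (snd (T2k k)) \<and> embeds V A (fst (T2k k)) (snd (T2k k)) \<or>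
      complete_on (fst (T2k_omega k)) (snd (T2k_omega k)) \<and> embeds V A (fst (T2k_omega k)) (snd (T2k_omega k))"
    using lad_model[of k 0 0 1 V A "T2k k"] lad_model[of k 0 0 \<omega> V A "T2k_omega k"] graph_T_lad[OF k]
    by (auto simp: graph_T_def)
  then show ?thesis using k unfolding in_ladder_def by blast
qed

text \<open>After padding both ends are charged by 1 or -1, and the global sign makes the first
  charge 1.\<close>

lemma in_ladder_open:
  assumes k: "1 \<le> k" and a: "\<alpha> \<in> {0, 1, -1}" "\<beta> \<in> {0, 1, -1}" "k = 1 \<Longrightarrow> \<beta> = 0"
    and e: "embeds V A (lad_verts k) (lad k \<alpha> \<beta> 0)"
  shows "in_ladder V A"
proof -
  obtain l \<alpha>' \<beta>' where l: "2 \<le> l" "\<alpha>' \<in> {1, -1}" "\<beta>' \<in> {1, -1}" "embeds V A (lad_verts l) (lad l \<alpha>' \<beta>' 0)"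
    using lad_pad[OF a(1,2) k a(3)] embeds_trans[OF e] by blast
  have ng: "embeds V A (lad_verts l) (lad l (- \<alpha>') (- \<beta>') 0)" using embeds_trans[OF l(4) lad_neg] .
  have "embeds V A (lad_verts l) (lad l 1 1 0) \<or> embeds V A (lad_verts l) (lad l 1 (-1) 0)"
    using l(2,3,4) ng by auto
  moreover have "complete_on (lad_verts l) (lad l 1 1 0)" "complete_on (lad_verts l) (lad l 1 (-1) 0)"
    using l(1) by (auto intro!: lad_complete)
  ultimately have "complete_on (fst (C2k_pp l)) (snd (C2k_pp l)) \<and> embeds V A (fst (C2k_pp l)) (snd (C2k_pp l)) \<or>
      complete_on (fst (C2k_pm l)) (snd (C2k_pm l)) \<and> embeds V A (fst (C2k_pm l)) (snd (C2k_pm l))"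
    using lad_model[of l 1 1 0 V A "C2k_pp l"] lad_model[of l 1 "-1" 0 V A "C2k_pm l"] C2k_pp_lad[OF l(1)] C2k_pm_lad[OF l(1)]
    by (auto simp: C2k_pp_def C2k_pm_def)
  then show ?thesis using l(1) unfolding in_ladder_def by blast
qed

subsection \<open>Paths and cycles\<close>

text \<open>A path of maximal length: its ends have no neighbours outside it, and its inner vertices
  have none beyond their two path neighbours, so by connectedness it is everything. Loops count
  towards the degree and survive only at the ends.\<close>

lemma path_or_cycle:
  fixes E :: "'a \<Rightarrow> 'a \<Rightarrow> bool"
  assumes fin: "finite V" "V \<noteq> {}" and sym: "\<And>u v. u \<in> V \<Longrightarrow> v \<in> V \<Longrightarrow> E u v \<Longrightarrow> E v u"
    and deg: "\<And>v. v \<in> V \<Longrightarrow> card {u \<in> V. E v u} \<le> 2"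
    and con: "\<And>X. X \<subseteq> V \<Longrightarrow> X \<noteq> {} \<Longrightarrow> (\<And>u v. u \<in> X \<Longrightarrow> v \<in> V \<Longrightarrow> E u v \<Longrightarrow> v \<in> X) \<Longrightarrow> X = V"
  obtains xs where "distinct xs" "set xs = V" "\<And>i. Suc i < length xs \<Longrightarrow> E (xs ! i) (xs ! Suc i)"
    "\<And>i j. i < length xs \<Longrightarrow> j < length xs \<Longrightarrow> E (xs ! i) (xs ! j) \<Longrightarrow> Suc i = j \<or> i = Suc j \<or>
      (i = 0 \<or> Suc i = length xs) \<and> (j = 0 \<or> Suc j = length xs)"
proof -
  define Q where "Q xs \<longleftrightarrow> xs \<noteq> [] \<and> distinct xs \<and> set xs \<subseteq> V \<and> (\<forall>i. Suc i < length xs \<longrightarrow> E (xs ! i) (xs ! Suc i))" for xs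
  obtain v0 where "v0 \<in> V" using fin by blast
  then have "Q [v0]" by (simp add: Q_def)
  moreover have "length xs < Suc (card V)" if "Q xs" for xs
    using that fin card_mono[of V "set xs"] distinct_card[of xs] unfolding Q_def by (metis less_Suc_eq_le)
  ultimately obtain xs where xs: "Q xs" "\<And>ys. Q ys \<Longrightarrow> length ys \<le> length xs"
    using ex_has_greatest_nat[of Q "[v0]" length "Suc (card V)"] by blast
  have X: "xs \<noteq> []" "distinct xs" "set xs \<subseteq> V" "\<And>i. Suc i < length xs \<Longrightarrow> E (xs ! i) (xs ! Suc i)"
    using xs(1) by (auto simp: Q_def)
  have inV: "xs ! i \<in> V" if "i < length xs" for i using X(3) nth_mem[OF that] by blast
  have three: False if "v \<in> V" "{a, b, c} \<subseteq> V" "E v a" "E v b" "E v c" "a \<noteq> b" "a \<noteq> c" "b \<noteq> c" for v a b c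
  proof -
    have "card {a, b, c} \<le> card {u \<in> V. E v u}" using that fin by (intro card_mono) auto
    then show False using deg[OF that(1)] that by simp
  qed
  have inner: "y = xs ! (i - 1) \<or> y = xs ! Suc i" if "0 < i" "Suc i < length xs" "y \<in> V" "E (xs ! i) y" for i y
  proof (rule ccontr)
    assume n: "\<not> ?thesis"
    have "E (xs ! (i - 1)) (xs ! i)" using X(4)[of "i - 1"] that by simp
    then have "E (xs ! i) (xs ! (i - 1))" using sym inV that by simp
    moreover have "xs ! (i - 1) \<noteq> xs ! Suc i" using X(2) that by (simp add: nth_eq_iff_index_eq)
    ultimately show False
      using three[of "xs ! i" "xs ! (i - 1)" "xs ! Suc i" y] inV X(4)[of i] that n by auto
  qed
  have first: "y \<in> set xs" if "y \<in> V" "E (xs ! 0) y" for y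
  proof (rule ccontr)
    assume y: "y \<notin> set xs"
    have "E y (xs ! 0)" using sym that inV X(1) by simp
    then have "Q (y # xs)" using X y that unfolding Q_def by (auto simp: nth_Cons split: nat.split)
    then show False using xs(2) by fastforce
  qed
  have last: "y \<in> set xs" if "y \<in> V" "E (xs ! (length xs - 1)) y" for y
  proof (rule ccontr)
    assume y: "y \<notin> set xs"
    have "E ((xs @ [y]) ! i) ((xs @ [y]) ! Suc i)" if "Suc i < length (xs @ [y])" for i
    proof (cases "Suc i = length xs")
      case True
      then have "length xs - 1 = i" by simp
      then show ?thesis using \<open>E (xs ! (length xs - 1)) y\<close> True by (simp add: nth_append)
    qed (use that X(4)[of i] in \<open>auto simp: nth_append\<close>)
    then have "Q (xs @ [y])" using X(1-3) y that unfolding Q_def by auto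
    then show False using xs(2) by fastforce
  qed
  have "y \<in> set xs" if "i < length xs" "y \<in> V" "E (xs ! i) y" for i y
  proof (cases "i = 0 \<or> Suc i = length xs")
    case True
    then have "i = 0 \<or> i = length xs - 1" using that by auto
    then show ?thesis using first last that by auto
  next
    case False
    then have "y = xs ! (i - 1) \<or> y = xs ! Suc i" using inner[of i y] that by auto
    then show ?thesis using False that by auto
  qed
  then have "set xs = V" using X(1,3) by (intro con) (auto simp: in_set_conv_nth)
  moreover have "Suc i = j \<or> i = Suc j \<or> (i = 0 \<or> Suc i = length xs) \<and> (j = 0 \<or> Suc j = length xs)"
    if ij: "i < length xs" "j < length xs" "E (xs ! i) (xs ! j)" for i j
  proof -
    have half: "Suc i = j \<or> i = Suc j" if "i < length xs" "j < length xs" "E (xs ! i) (xs ! j)" "i \<noteq> 0" "Suc i \<noteq> length xs" for i j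
    proof -
      have "xs ! j = xs ! (i - 1) \<or> xs ! j = xs ! Suc i" using inner[of i "xs ! j"] that inV by auto
      then have "j = i - 1 \<or> j = Suc i" using X(2) that by (auto simp: nth_eq_iff_index_eq)
      then show ?thesis using that by auto
    qed
    show ?thesis using half[of i j] half[of j i] sym[OF inV inV] ij by blast
  qed
  ultimately show ?thesis using that X(2,4) by blast
qed

lemma real_unit: "z = 0 \<or> z \<in> eisenstein_units \<Longrightarrow> cnj z = z \<Longrightarrow> z \<in> {0, 1, -1}"
  by (auto simp: eisenstein_units_def omega_def complex_eq_iff)

context frame
begin

lemma entry_herm: "i \<in> V \<Longrightarrow> j \<in> V \<Longrightarrow> A j i = cnj (A i j)"
  by (rule hermD(2)[OF herm_A])

lemma entry_unit: "i \<in> V \<Longrightarrow> j \<in> nb i \<Longrightarrow> A i j \<in> eisenstein_units"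
  using unit_entries unfolding nb_def by auto

lemma charge: "i \<in> V \<Longrightarrow> A i i \<in> {0, 1, -1}"
  using real_unit[of "A i i"] unit_entries[of i i] entry_herm[of i i] by auto

lemma embeds_positions:
  fixes pos :: "'v \<Rightarrow> nat \<times> bool" and w :: "nat \<times> bool \<Rightarrow> complex"
  assumes "inj_on pos V" "\<And>x. x \<in> V \<Longrightarrow> fst (pos x) < k" "\<And>x. x \<in> V \<Longrightarrow> w (pos x) \<in> eisenstein_units"
    and "\<And>x y. x \<in> V \<Longrightarrow> y \<in> V \<Longrightarrow> A x y = w (pos x) * lad k \<alpha> \<beta> \<zeta> (pos x) (pos y) * cnj (w (pos y))"
  shows "embeds V A (lad_verts k) (lad k \<alpha> \<beta> \<zeta>)"
proof (rule embedsI[of pos V _ "\<lambda>x. w (pos x)" 1 id])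
  show "pos x \<in> lad_verts k" if "x \<in> V" for x using assms(2)[OF that] by (cases "pos x") (auto simp: lad_verts_def)
qed (use assms in auto)

text \<open>All degrees are at most 2, so the graph is a path or a cycle. It is placed on the top
  vertices of a ladder.\<close>

lemma unsaturated_in_ladder:
  assumes con: "connected_on V A" and small: "\<And>v. v \<in> V \<Longrightarrow> card (nb v) \<noteq> 4"
  shows "in_ladder V A"
proof -
  have V0: "V \<noteq> {}" using con unfolding connected_on_def by blast
  obtain xs where xs: "distinct xs" "set xs = V" "\<And>i. Suc i < length xs \<Longrightarrow> A (xs ! i) (xs ! Suc i) \<noteq> 0"
    "\<And>i j. i < length xs \<Longrightarrow> j < length xs \<Longrightarrow> A (xs ! i) (xs ! j) \<noteq> 0 \<Longrightarrow> Suc i = j \<or> i = Suc j \<or>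
      (i = 0 \<or> Suc i = length xs) \<and> (j = 0 \<or> Suc j = length xs)"
  proof (rule path_or_cycle[of V "\<lambda>u v. A u v \<noteq> 0"])
    show "A v u \<noteq> 0" if "u \<in> V" "v \<in> V" "A u v \<noteq> 0" for u v using entry_herm[OF that(1,2)] that(3) by simp
    show "card {u \<in> V. A v u \<noteq> 0} \<le> 2" if "v \<in> V" for v
      using nb_card[OF that] small[OF that] unfolding nb_def by auto
    show "X = V" if "X \<subseteq> V" "X \<noteq> {}" "\<And>u v. u \<in> X \<Longrightarrow> v \<in> V \<Longrightarrow> A u v \<noteq> 0 \<Longrightarrow> v \<in> X" for X
      using con that unfolding connected_on_def by blast
  qed (use finite_V V0 in auto)
  define n where "n = length xs"
  have n: "n \<ge> 1" using xs(2) V0 by (cases xs) (auto simp: n_def)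
  have inV: "xs ! i \<in> V" if "i < n" for i using xs(2) that by (auto simp: n_def)
  \<comment> \<open>A gauge along the path: with these units all consecutive weights become
    1.\<close>
  define w where "w = rec_nat (1 :: complex) (\<lambda>i x. x * cnj (A (xs ! i) (xs ! Suc i)))"
  have w0: "w 0 = 1" and wS: "w (Suc i) = w i * cnj (A (xs ! i) (xs ! Suc i))" for i by (simp_all add: w_def)
  have Au: "A (xs ! i) (xs ! Suc i) \<in> eisenstein_units" if "Suc i < n" for i
    using unit_entries[OF inV inV, of i "Suc i"] xs(3)[of i] that by (auto simp: n_def)
  have wu: "w i \<in> eisenstein_units" if "i < n" for i
    using that by (induction i) (auto simp: w0 wS intro!: unit_mult unit_cnj Au)
  have ww: "w i * cnj (w i) = 1" if "i < n" for i using unit_cnj_mult(1)[OF wu[OF that]] .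
  have fwd: "A (xs ! i) (xs ! Suc i) = w i * cnj (w (Suc i))" if "Suc i < n" for i
  proof -
    have "w i * cnj (w (Suc i)) = (w i * cnj (w i)) * A (xs ! i) (xs ! Suc i)" by (simp add: wS mult_ac)
    then show ?thesis using ww[of i] that by simp
  qed
  have bwd: "A (xs ! Suc i) (xs ! i) = w (Suc i) * cnj (w i)" if "Suc i < n" for i
    using entry_herm[OF inV inV, of i "Suc i"] fwd[OF that] that by (simp add: mult.commute)
  have ch: "A (xs ! i) (xs ! i) = w i * A (xs ! i) (xs ! i) * cnj (w i)" if "i < n" for i
    using ww[OF that] by (metis mult.assoc mult.commute mult_1)
  define pos where "pos x = (THE i. i < n \<and> xs ! i = x, True)" for x
  have pos: "pos (xs ! i) = (i, True)" if "i < n" for i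
    unfolding pos_def using xs(1) that by (auto simp: nth_eq_iff_index_eq n_def intro!: the_equality)
  have emb: "embeds V A (lad_verts n) (lad n \<alpha> \<beta> \<zeta>)"
    if val: "\<And>i j. i < n \<Longrightarrow> j < n \<Longrightarrow> A (xs ! i) (xs ! j) = w i * lad n \<alpha> \<beta> \<zeta> (i, True) (j, True) * cnj (w j)" for \<alpha> \<beta> \<zeta>
  proof (rule embeds_positions[of pos n "\<lambda>p. w (fst p)"])
    have ex: "\<exists>i<n. x = xs ! i" if "x \<in> V" for x using that xs(2) by (metis in_set_conv_nth n_def)
    show "inj_on pos V" using ex pos by (auto simp: inj_on_def) (metis Pair_inject)
    show "fst (pos x) < n" "w (fst (pos x)) \<in> eisenstein_units" if "x \<in> V" for x using ex[OF that] pos wu by auto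
    show "A x y = w (fst (pos x)) * lad n \<alpha> \<beta> \<zeta> (pos x) (pos y) * cnj (w (fst (pos y)))" if "x \<in> V" "y \<in> V" for x y
      using ex[OF that(1)] ex[OF that(2)] pos val by auto
  qed
  define l where "l = n - 1"
  have l: "l < n" "Suc l = n" using n by (auto simp: l_def)
  have only: "Suc i = j \<or> i = Suc j \<or> (i = 0 \<or> i = l) \<and> (j = 0 \<or> j = l)"
    if "i < n" "j < n" "A (xs ! i) (xs ! j) \<noteq> 0" for i j using xs(4)[of i j] that l by (auto simp: n_def)
  show ?thesis
  proof (cases "n \<ge> 3 \<and> A (xs ! l) (xs ! 0) \<noteq> 0")
    case True
    then have n3: "n \<ge> 3" and nz: "A (xs ! l) (xs ! 0) \<noteq> 0" by auto
    have nz': "A (xs ! 0) (xs ! l) \<noteq> 0" using entry_herm[OF inV inV, of l 0] nz l n by auto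
    \<comment> \<open>With the closing edge an end already has two neighbours.\<close>
    have noloop: "A (xs ! i) (xs ! i) = 0" if "i = 0 \<or> i = l" for i
    proof (rule ccontr)
      assume a: "A (xs ! i) (xs ! i) \<noteq> 0"
      obtain j m where jm: "j < n" "m < n" "j \<noteq> i" "m \<noteq> i" "j \<noteq> m" "A (xs ! i) (xs ! j) \<noteq> 0" "A (xs ! i) (xs ! m) \<noteq> 0"
      proof (cases "i = 0")
        case True
        then show ?thesis using that[of 1 l] xs(3)[of 0] nz' n3 l by (auto simp: n_def)
      next
        case False
        then have "i = l" using \<open>i = 0 \<or> i = l\<close> by simp
        have "A (xs ! l) (xs ! (l - 1)) \<noteq> 0"
          using bwd[of "l - 1"] unit_nz[OF wu[of l]] unit_nz[OF wu[of "l - 1"]] n3 l by simp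
        then show ?thesis using that[of 0 "l - 1"] nz n3 l \<open>i = l\<close> by auto
      qed
      have i: "i < n" using that l n by auto
      have "{xs ! i, xs ! j, xs ! m} \<subseteq> nb (xs ! i)" using a jm i inV unfolding nb_def by auto
      then have "card {xs ! i, xs ! j, xs ! m} \<le> card (nb (xs ! i))" by (rule card_mono[OF finite_nb])
      moreover have "card {xs ! i, xs ! j, xs ! m} = 3"
        using jm i xs(1) by (simp add: nth_eq_iff_index_eq n_def)
      ultimately show False using nb_card[OF inV[OF i]] small[OF inV[OF i]] by auto
    qed
    \<comment> \<open>The closing weight after the gauge, that is, the holonomy of the
      cycle.\<close>
    define z where "z = cnj (w l) * A (xs ! l) (xs ! 0)"
    have zu: "z \<in> eisenstein_units"
      using unit_entries[OF inV inV, of l 0] nz wu[OF l(1)] l n unfolding z_def by (auto intro: unit_mult unit_cnj)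
    have clos: "A (xs ! l) (xs ! 0) = w l * z" using ww[OF l(1)] unfolding z_def by (simp add: mult.assoc[symmetric])
    have clos': "A (xs ! 0) (xs ! l) = cnj z * cnj (w l)"
      using entry_herm[OF inV inV, of l 0] clos l n by (simp add: mult.commute)
    have "A (xs ! i) (xs ! j) = w i * lad n 0 0 z (i, True) (j, True) * cnj (w j)" if ij: "i < n" "j < n" for i j
    proof -
      have zero: "A (xs ! i) (xs ! j) = 0" if "Suc i \<noteq> j" "i \<noteq> Suc j" "\<not> (i = l \<and> j = 0)" "\<not> (i = 0 \<and> j = l)"
        using only[OF ij] noloop that by auto
      consider "j = Suc i" | "i = Suc j" | "i = l" "j = 0" | "i = 0" "j = l" | "Suc i \<noteq> j" "i \<noteq> Suc j" "\<not> (i = l \<and> j = 0)" "\<not> (i = 0 \<and> j = l)"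
        by blast
      then show ?thesis
      proof cases
        case 5
        then show ?thesis using zero ij l by (auto simp: lad_def)
      qed (use fwd bwd clos clos' ij l n3 w0 in \<open>auto simp: lad_def\<close>)
    qed
    from in_ladder_closed[OF n3 zu emb[OF this]] show ?thesis .
  next
    case False
    define \<alpha> where "\<alpha> = A (xs ! 0) (xs ! 0)"
    \<comment> \<open>If there is one vertex, both ends coincide and its charge must not be counted
      twice.\<close>
    define \<beta> where "\<beta> = (if n = 1 then 0 else A (xs ! l) (xs ! l))"
    have "A (xs ! i) (xs ! j) = w i * lad n \<alpha> \<beta> 0 (i, True) (j, True) * cnj (w j)" if ij: "i < n" "j < n" for i j
    proof -
      have nocl: "A (xs ! l) (xs ! 0) = 0 \<and> A (xs ! 0) (xs ! l) = 0" if "n \<ge> 3"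
        using False that entry_herm[OF inV inV, of l 0] l n by auto
      consider "j = Suc i" | "i = Suc j" | "i = j" "i = 0" | "i = j" "i = l" "i \<noteq> 0" | "Suc i \<noteq> j" "i \<noteq> Suc j" "\<not> (i = j \<and> (i = 0 \<or> i = l))"
        by blast
      then show ?thesis
      proof cases
        case 5
        have "A (xs ! i) (xs ! j) = 0"
        proof (rule ccontr)
          assume "\<not> ?thesis"
          moreover from only[OF ij this] 5 have "i = 0 \<and> j = l \<or> i = l \<and> j = 0" by auto
          moreover from this 5 have "n \<ge> 3" using l ij by auto
          ultimately show False using nocl by auto
        qed
        then show ?thesis using 5 ij l by (auto simp: lad_def)
      next
        case 3
        then show ?thesis using ch[of 0] ij l n by (auto simp: lad_def \<alpha>_def \<beta>_def)
      next
        case 4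
        then show ?thesis using ch[of l] ij l n by (auto simp: lad_def \<alpha>_def \<beta>_def)
      qed (use fwd bwd ij l in \<open>auto simp: lad_def\<close>)
    qed
    then have "embeds V A (lad_verts n) (lad n \<alpha> \<beta> 0)" by (rule emb)
    moreover have "\<alpha> \<in> {0, 1, -1}" "\<beta> \<in> {0, 1, -1}"
      using charge[OF inV[of 0]] charge[OF inV[of l]] n l(1) by (auto simp: \<alpha>_def \<beta>_def)
    moreover have "n = 1 \<Longrightarrow> \<beta> = 0" by (simp add: \<beta>_def)
    ultimately show ?thesis using in_ladder_open[OF n] by blast
  qed
qed

end

subsection \<open>Rungs\<close>

lemma units_sum_two:
  assumes "p \<in> eisenstein_units" "q \<in> eisenstein_units" "2 + p + q = 0"
  shows "p = -1 \<and> q = -1"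
  using assms by (auto simp: eisenstein_units_def omega_def complex_eq_iff)

lemma units_cube_roots:
  assumes "p \<in> eisenstein_units" "q \<in> eisenstein_units" "1 + p + q = 0"
  shows "p = \<omega> - 1 \<or> p = - \<omega>"
  using assms by (auto simp: eisenstein_units_def omega_def complex_eq_iff)

text \<open>If \<open>q\<close> and \<open>r\<close> are different, then 1 + q + r = 0 and
  \<open>p\<close> would vanish; if they agree, 1 + 2 q has norm 3 and is not the negative of a
  unit.\<close>

lemma units_no_sum:
  assumes "p \<in> eisenstein_units" "q = \<omega> - 1 \<or> q = - \<omega>" "r = \<omega> - 1 \<or> r = - \<omega>" "1 + p + q + r = 0"
  shows False
  using assms by (auto simp: eisenstein_units_def omega_def complex_eq_iff)

text \<open>The situation left over by the searches for overlaps of size three and for overlaps of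
  size two with one common vertex. \<open>no_kernel\<close> is the source of twins.\<close>

locale toral = frame +
  assumes con: "connected_on V A"
    and no_kernel: "\<nexists>c. (\<forall>i\<in>V. c i \<in> eisenstein_ints) \<and> (\<Sum>i\<in>V. (cmod (c i))\<^sup>2) = 4 \<and> (\<forall>i\<in>V. (\<Sum>j\<in>V. A i j * c j) = 0)"
    and no3: "r \<in> V \<Longrightarrow> card (nb r) = 4 \<Longrightarrow> s \<in> V \<Longrightarrow> s \<noteq> r \<Longrightarrow> card (nb s \<inter> nb r) \<noteq> 3"
    and pairs: "r \<in> V \<Longrightarrow> card (nb r) = 4 \<Longrightarrow> s \<in> V \<Longrightarrow> s \<noteq> r \<Longrightarrow> s' \<in> V \<Longrightarrow> s' \<noteq> r \<Longrightarrow> card (nb s \<inter> nb r) = 2 \<Longrightarrow>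
      card (nb s' \<inter> nb r) = 2 \<Longrightarrow> nb s \<inter> nb r = nb s' \<inter> nb r \<or> nb s \<inter> nb s' \<inter> nb r = {}"
begin

text \<open>The row of \<open>s\<close> relative to that of \<open>r\<close>: the entries of
  \<open>s\<close> on the neighbours of \<open>r\<close> once the row of \<open>r\<close> is
  switched to all ones.\<close>

definition h :: "'a \<Rightarrow> 'a \<Rightarrow> 'a \<Rightarrow> complex" where "h r s x = A s x * cnj (A r x)"

lemma nbV: "x \<in> nb r \<Longrightarrow> x \<in> V" using nb_V by blast

lemma nb_iff: "x \<in> V \<Longrightarrow> y \<in> V \<Longrightarrow> x \<in> nb y \<longleftrightarrow> y \<in> nb x" using nb_sym by blast

lemma h_unit: "r \<in> V \<Longrightarrow> s \<in> V \<Longrightarrow> x \<in> nb s \<Longrightarrow> x \<in> nb r \<Longrightarrow> h r s x \<in> eisenstein_units"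
  unfolding h_def using entry_unit by (auto intro: unit_mult unit_cnj)

lemma h_zero: "x \<in> V \<Longrightarrow> x \<notin> nb s \<Longrightarrow> h r s x = 0"
  unfolding h_def nb_def by auto

lemma h_self: "r \<in> V \<Longrightarrow> x \<in> nb r \<Longrightarrow> h r r x = 1"
  unfolding h_def using unit_cnj_mult(1)[OF entry_unit] .

lemma h_sum:
  assumes "r \<in> V" "card (nb r) = 4" "s \<in> V" "s \<noteq> r"
  shows "(\<Sum>x\<in>nb r. h r s x) = 0"
proof -
  have "0 = (\<Sum>x\<in>V. h r s x)" using orth[OF assms(1) _ assms(3,4)] assms(2) unfolding nb_def h_def by simp
  also have "\<dots> = (\<Sum>x\<in>nb r. h r s x)"
    by (rule sum.mono_neutral_right) (auto simp: finite_V nb_V nb_def h_def)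
  finally show ?thesis by simp
qed

text \<open>This is orthogonality of the rows of \<open>a\<close> and \<open>b\<close>, read through
  the Hermitian symmetry as orthogonality of columns.\<close>

lemma h_col_sum:
  assumes "r \<in> V" "a \<in> nb r" "b \<in> nb r" "a \<noteq> b" "card (nb a) = 4"
  shows "(\<Sum>y\<in>nb a. h r y a * cnj (h r y b)) = 0"
proof -
  have V: "a \<in> V" "b \<in> V" using assms nbV by auto
  have "h r y a * cnj (h r y b) = (A b y * cnj (A a y)) * (cnj (A r a) * A r b)" if "y \<in> nb a" for y
  proof -
    have "A a y = cnj (A y a)" "A b y = cnj (A y b)" using entry_herm[OF nbV[OF that]] V by auto
    then show ?thesis by (simp add: h_def mult_ac)
  qed
  then have "(\<Sum>y\<in>nb a. h r y a * cnj (h r y b)) = (\<Sum>y\<in>nb a. A b y * cnj (A a y)) * (cnj (A r a) * A r b)"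
    by (simp add: sum_distrib_right)
  also have "(\<Sum>y\<in>nb a. A b y * cnj (A a y)) = (\<Sum>y\<in>nb a. h a b y)" by (simp add: h_def)
  also have "\<dots> = 0" using h_sum[OF V(1) assms(5) V(2)] assms(4) by simp
  finally show ?thesis by simp
qed

text \<open>A single common vertex would make the sum in \<open>h_sum\<close> a single unit; three
  are excluded by \<open>no3\<close>.\<close>

lemma meet_card:
  assumes "r \<in> V" "card (nb r) = 4" "s \<in> V" "s \<noteq> r"
  shows "card (nb s \<inter> nb r) \<in> {0, 2, 4}"
proof -
  have "card (nb s \<inter> nb r) \<le> 4" using assms(2) finite_nb by (metis card_mono inf_le2)
  moreover have "card (nb s \<inter> nb r) \<noteq> 3" using no3 assms by blast
  moreover have "card (nb s \<inter> nb r) \<noteq> 1"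
  proof
    assume "card (nb s \<inter> nb r) = 1"
    then obtain x where x: "nb s \<inter> nb r = {x}" by (meson card_1_singletonE)
    have "(\<Sum>y\<in>nb r. h r s y) = (\<Sum>y\<in>{x}. h r s y)"
    proof (rule sum.mono_neutral_right)
      show "\<forall>i\<in>nb r - {x}. h r s i = 0"
      proof
        fix i assume "i \<in> nb r - {x}"
        then have "i \<in> V" "i \<notin> nb s" using x nbV by auto
        then show "h r s i = 0" by (rule h_zero)
      qed
    qed (use x finite_nb in auto)
    then have "h r s x = 0" using h_sum[OF assms] by simp
    then show False using h_unit[of r s x] assms x unit_nz by blast
  qed
  ultimately show ?thesis by auto
qed

lemma meet4:
  assumes "r \<in> V" "card (nb r) = 4" "s \<in> V" "card (nb s \<inter> nb r) = 4"
  shows "nb s = nb r"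
proof -
  have "nb s \<inter> nb r = nb r" using assms finite_nb by (intro card_subset_eq) auto
  moreover have "nb s \<inter> nb r = nb s"
    using assms nb_card_le[OF assms(3)] finite_nb card_mono[of "nb s" "nb s \<inter> nb r"] by (intro card_subset_eq) auto
  ultimately show ?thesis by simp
qed

text \<open>The vector that is \<open>cnj (A r x)\<close> on \<open>a\<close>, \<open>b\<close> and its negative on \<open>c\<close>, \<open>d\<close> cannot be in the kernel;
  the vertex that sees it is the twin of \<open>r\<close>.\<close>

lemma kernel_witness:
  assumes r: "r \<in> V" "nb r = {a, b, c, d}" "distinct [a, b, c, d]"
  obtains s where "s \<in> V" "h r s a + h r s b - h r s c - h r s d \<noteq> 0"
proof (rule ccontr)
  note witness = that
  assume "\<not> thesis"
  then have z: "h r s a + h r s b - h r s c - h r s d = 0" if "s \<in> V" for s using witness[of s] that by blast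
  define f where "f x = (if x = a \<or> x = b then cnj (A r x) else if x = c \<or> x = d then - cnj (A r x) else 0)" for x
  have sub: "{a, b, c, d} \<subseteq> V" using r nb_V by blast
  have f0: "f x = 0" if "x \<notin> {a, b, c, d}" for x using that by (auto simp: f_def)
  have "f x \<in> eisenstein_ints" if "x \<in> V" for x
    using hermD(1)[OF herm_A r(1) that] R_cnj R_uminus by (auto simp: f_def)
  moreover have "(\<Sum>x\<in>V. (cmod (f x))\<^sup>2) = 4"
  proof -
    have "(\<Sum>x\<in>V. (cmod (f x))\<^sup>2) = (\<Sum>x\<in>{a, b, c, d}. (cmod (f x))\<^sup>2)"
      using sub finite_V f0 by (intro sum.mono_neutral_right) auto
    also have "\<dots> = (\<Sum>x\<in>{a, b, c, d}. 1)"
    proof (rule sum.cong[OF refl])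
      fix x assume x: "x \<in> {a, b, c, d}"
      then have "cmod (A r x) = 1" using entry_unit[OF r(1)] r(2) unit_cmod by auto
      then show "(cmod (f x))\<^sup>2 = 1" using x by (auto simp: f_def)
    qed
    finally show ?thesis using r(3) by simp
  qed
  moreover have "(\<Sum>x\<in>V. A s x * f x) = 0" if "s \<in> V" for s
  proof -
    have "(\<Sum>x\<in>V. A s x * f x) = (\<Sum>x\<in>{a, b, c, d}. A s x * f x)"
      using sub finite_V f0 by (intro sum.mono_neutral_right) auto
    also have "\<dots> = h r s a + h r s b - h r s c - h r s d"
    proof -
      have "a \<noteq> b" "c \<noteq> a" "c \<noteq> b" "d \<noteq> a" "d \<noteq> b" "c \<noteq> d" using r(3) by auto
      then show ?thesis by (simp add: f_def h_def)
    qed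
    finally show ?thesis using z[OF that] by simp
  qed
  ultimately show False using no_kernel by blast
qed

text \<open>The overlap of size two characterises vertices that see two rungs, as
  \<open>adjacent_rungs\<close> shows.\<close>

definition big :: "'a \<Rightarrow> bool"
  where "big r \<longleftrightarrow> r \<in> V \<and> card (nb r) = 4 \<and> (\<exists>k\<in>V. k \<noteq> r \<and> card (nb k \<inter> nb r) = 2)"

lemma nb_four:
  assumes "card (nb r) = 4" "a \<in> nb r" "b \<in> nb r" "a \<noteq> b"
  obtains c d where "nb r = {a, b, c, d}" "distinct [a, b, c, d]"
proof -
  have "card (nb r - {a, b}) = 2" using assms finite_nb by (simp add: card_Diff_subset)
  then obtain c d where cd: "nb r - {a, b} = {c, d}" "c \<noteq> d" by (meson card_2_iff)
  then have "nb r = {a, b, c, d}" "distinct [a, b, c, d]" using assms by auto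
  then show ?thesis using that by blast
qed

text \<open>The signed vector is + on \<open>a\<close>, \<open>b\<close> and - on \<open>c\<close>,
  \<open>d\<close>. A vertex that detects it sees all four: an overlap of size two would be
  \<open>{a, b}\<close> or \<open>{c, d}\<close>, where the two terms cancel. So \<open>a\<close>
  has neighbours \<open>r\<close>, \<open>s\<close>, \<open>k\<close> and a fourth one
  \<open>k'\<close>, which meets \<open>r\<close> like \<open>k\<close>. Orthogonality of
  \<open>a\<close> and \<open>b\<close> then fixes the relative signs of \<open>s\<close>.\<close>

lemma twin:
  assumes r: "r \<in> V" "nb r = {a, b, c, d}" "distinct [a, b, c, d]" and k: "k \<in> V" "k \<noteq> r" "nb k \<inter> nb r = {a, b}"
  obtains s k' where "s \<in> V" "k' \<in> V" "nb s = nb r" "nb a = {r, s, k, k'}" "nb b = {r, s, k, k'}" "distinct [r, s, k, k']"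
    "nb k' \<inter> nb r = {a, b}" "h r s b = h r s a" "h r s c = - h r s a" "h r s d = - h r s a"
proof -
  have c4: "card (nb r) = 4" using r(2,3) by simp
  have V: "a \<in> V" "b \<in> V" "c \<in> V" "d \<in> V" using r nbV by auto
  have S: "h r s a + h r s b + h r s c + h r s d = 0" if "s \<in> V" "s \<noteq> r" for s
    using h_sum[OF r(1) c4 that] r(2,3) by (simp add: add.assoc)
  have "c \<notin> nb k" "d \<notin> nb k" using k(3) r by auto
  then have hk: "h r k c = 0" "h r k d = 0" using V h_zero by simp_all
  then have kab: "h r k a + h r k b = 0" using S[OF k(1,2)] by simp
  obtain s where s: "s \<in> V" "h r s a + h r s b - h r s c - h r s d \<noteq> 0" using kernel_witness[OF r] .
  have hrr: "h r r a = 1" "h r r b = 1" "h r r c = 1" "h r r d = 1" using h_self r by auto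
  have sr: "s \<noteq> r" using s(2) hrr by auto
  have "card (nb s \<inter> nb r) \<noteq> 0"
  proof
    assume "card (nb s \<inter> nb r) = 0"
    then have "nb s \<inter> nb r = {}" using finite_nb by simp
    then have "h r s a = 0" "h r s b = 0" "h r s c = 0" "h r s d = 0" using h_zero V r(2) by auto
    then show False using s(2) by simp
  qed
  moreover have "card (nb s \<inter> nb r) \<noteq> 2"
  proof
    assume 2: "card (nb s \<inter> nb r) = 2"
    have "card (nb k \<inter> nb r) = 2" using k(3) r(3) by simp
    from pairs[OF r(1) c4 s(1) sr k(1,2) 2 this]
    have "h r s c = 0 \<and> h r s d = 0 \<or> h r s a = 0 \<and> h r s b = 0"
    proof
      assume "nb s \<inter> nb r = nb k \<inter> nb r"
      then have "c \<notin> nb s" "d \<notin> nb s" using k(3) r by auto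
      then show ?thesis using h_zero V by simp
    next
      assume "nb s \<inter> nb k \<inter> nb r = {}"
      then have "a \<notin> nb s" "b \<notin> nb s" using k(3) by auto
      then show ?thesis using h_zero V by simp
    qed
    then have "h r s c + h r s d = 0" "h r s a + h r s b = 0" using S[OF s(1) sr] by auto
    moreover have "h r s a + h r s b - h r s c - h r s d = (h r s a + h r s b) - (h r s c + h r s d)" by simp
    ultimately show False using s(2) by simp
  qed
  ultimately have "card (nb s \<inter> nb r) = 4" using meet_card[OF r(1) c4 s(1) sr] by auto
  then have ns: "nb s = nb r" by (rule meet4[OF r(1) c4 s(1)])
  have su: "h r s x \<in> eisenstein_units" if "x \<in> nb r" for x using h_unit[OF r(1) s(1)] ns that by simp
  have ks: "k \<noteq> s" using ns k(3) r by auto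
  have three: "{r, s, k} \<subseteq> nb x" if "x \<in> {a, b}" for x
    using that nb_iff[of x] V r k s ns by auto
  have card3: "card {r, s, k} = 3" using ks k(2) sr by auto
  have na4: "card (nb x) = 4" if "x \<in> {a, b}" for x
    using that V nb_card[of x] card_mono[OF finite_nb three[OF that]] card3 by auto
  have "card (nb a - {r, s, k}) = 1" using na4[of a] three[of a] card3 finite_nb by (simp add: card_Diff_subset)
  then obtain k' where k': "nb a - {r, s, k} = {k'}" by (meson card_1_singletonE)
  have na: "nb a = {r, s, k, k'}" and dis: "distinct [r, s, k, k']" using k' three[of a] ks k(2) sr by auto
  have k'V: "k' \<in> V" using na nbV by auto
  have ak': "a \<in> nb k'" using nb_iff[OF V(1) k'V] na by auto
  have k'r: "k' \<noteq> r" using dis by auto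
  have "card (nb k' \<inter> nb r) \<noteq> 0" using ak' r(2) finite_nb by auto
  \<comment> \<open>Otherwise \<open>a\<close> shares exactly \<open>r\<close>, \<open>s\<close>,
    \<open>k'\<close> with each of \<open>c\<close> and \<open>d\<close>. Orthogonality of columns
    makes the ratios of \<open>s\<close> there primitive cube roots, and the row of \<open>s\<close>
    contradicts \<open>units_no_sum\<close>.\<close>
  moreover have "card (nb k' \<inter> nb r) \<noteq> 4"
  proof
    assume "card (nb k' \<inter> nb r) = 4"
    then have nk': "nb k' = nb r" by (rule meet4[OF r(1) c4 k'V])
    have nb3: "{r, s, k'} \<subseteq> nb x" if "x \<in> {b, c, d}" for x
      using that nb_iff[of x] V r s ns nk' k'V by auto
    have kx: "k \<notin> nb x" if "x \<in> {c, d}" for x using that nb_iff[of x k] V k r by auto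
    have "nb b = {r, s, k, k'}"
      using nb3[of b] three[of b] na4[of b] dis by (intro card_subset_eq[symmetric] finite_nb) auto
    have key: "1 + h r s a * cnj (h r s x) + h r k' a * cnj (h r k' x) = 0" if x: "x \<in> {c, d}" for x
    proof -
      have xr: "x \<in> nb r" "a \<noteq> x" "x \<in> V" using x r V by auto
      have "(\<Sum>y\<in>nb a. h r y a * cnj (h r y x)) = 0"
        using h_col_sum[OF r(1) _ xr(1,2) na4] r(2) by auto
      then show ?thesis unfolding na using dis hrr(1) h_self[OF r(1) xr(1)] h_zero[OF k(1)] kx[OF x]
          nb_iff[OF xr(3) k(1)] h_zero[OF xr(3), of k r] by (auto simp: add.assoc)
    qed
    have k'u: "h r k' x \<in> eisenstein_units" if "x \<in> nb r" for x using h_unit[OF r(1) k'V] nk' that by simp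
    have pu: "h r s a * cnj (h r s x) \<in> eisenstein_units" "h r k' a * cnj (h r k' x) \<in> eisenstein_units" if "x \<in> nb r" for x
      using su k'u r(2) that by (auto intro!: unit_mult unit_cnj)
    have "h r s a * cnj (h r s x) = \<omega> - 1 \<or> h r s a * cnj (h r s x) = - \<omega>" if "x \<in> {c, d}" for x
      using units_cube_roots[OF pu(1) pu(2) key[OF that]] that r(2) by auto
    moreover have "1 + h r s a * cnj (h r s b) + h r s a * cnj (h r s c) + h r s a * cnj (h r s d) = 0"
    proof -
      have "1 + h r s a * cnj (h r s b) + h r s a * cnj (h r s c) + h r s a * cnj (h r s d)
        = h r s a * cnj (h r s a + h r s b + h r s c + h r s d)"
        using unit_cnj_mult(1)[OF su[of a]] r(2) by (simp add: distrib_left)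
      then show ?thesis using S[OF s(1) sr] by simp
    qed
    ultimately show False using units_no_sum[OF pu(1)[of b]] r(2) by blast
  qed
  ultimately have "card (nb k' \<inter> nb r) = 2" using meet_card[OF r(1) c4 k'V k'r] by auto
  moreover have "card (nb k \<inter> nb r) = 2" using k(3) r(3) by simp
  moreover have "nb k' \<inter> nb k \<inter> nb r \<noteq> {}" using ak' k(3) by auto
  ultimately have nk': "nb k' \<inter> nb r = {a, b}" using pairs[OF r(1) c4 k'V k'r k(1,2)] k(3) by blast
  have "k' \<in> nb b" using nb_iff[OF V(2) k'V] nk' by auto
  then have nb: "nb b = {r, s, k, k'}"
    using three[of b] na4[of b] dis by (intro card_subset_eq[symmetric] finite_nb) auto
  have "c \<notin> nb k'" "d \<notin> nb k'" using nk' r by auto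
  then have "h r k' c = 0" "h r k' d = 0" using V h_zero by simp_all
  then have k'ab: "h r k' a + h r k' b = 0" using S[OF k'V k'r] by simp
  have ku: "h r k a * cnj (h r k a) = 1" "h r k' a * cnj (h r k' a) = 1"
    using h_unit[OF r(1) k(1), of a] h_unit[OF r(1) k'V, of a] k(3) nk' unit_cnj_mult(1) by auto
  have "(\<Sum>y\<in>nb a. h r y a * cnj (h r y b)) = 0"
    using h_col_sum[OF r(1), of a b] r na4 by auto
  then have "1 + h r s a * cnj (h r s b) + h r k a * cnj (h r k b) + h r k' a * cnj (h r k' b) = 0"
    unfolding na using dis hrr by (simp add: add.assoc)
  moreover have "h r k b = - h r k a" "h r k' b = - h r k' a" using kab k'ab by (auto simp: add_eq_0_iff)
  \<comment> \<open>The terms of \<open>k\<close> and \<open>k'\<close> are both -1 and that of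
    \<open>r\<close> is 1, which leaves 1 for \<open>s\<close>.\<close>
  ultimately have ab1: "h r s a * cnj (h r s b) = 1" using ku by simp
  have ua: "cnj (h r s a) * h r s a = 1" "h r s b * cnj (h r s b) = 1" using unit_cnj_mult su r(2) by auto
  have ab: "h r s b = h r s a"
    using ab1 ua(2) by (metis mult.commute mult.left_commute mult_1)
  define p where "p x = cnj (h r s a) * h r s x" for x
  have pu: "p x \<in> eisenstein_units" if "x \<in> nb r" for x using su that r(2) unfolding p_def by (auto intro!: unit_mult unit_cnj)
  have "2 + p c + p d = cnj (h r s a) * (h r s a + h r s b + h r s c + h r s d)"
    using ua(1) ab by (simp add: p_def distrib_left)
  then have "2 + p c + p d = 0" using S[OF s(1) sr] by simp
  then have pcd: "p c = -1 \<and> p d = -1" using units_sum_two pu r(2) by auto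
  have hp: "h r s x = h r s a * p x" for x using unit_cnj_mult(1)[OF su[of a]] r(2) by (simp add: p_def mult.assoc[symmetric])
  have "h r s c = - h r s a" "h r s d = - h r s a" using hp[of c] hp[of d] pcd by simp_all
  then show ?thesis using that[of s k'] s(1) k'V ns na nb dis nk' ab by blast
qed

text \<open>Twin classes; as soon as there is a \<open>big\<close> vertex, each consists of two
  vertices, the top and bottom of a ladder rung.\<close>

definition rung :: "'a \<Rightarrow> 'a set" where "rung v = {w \<in> V. nb w = nb v}"

lemma rung_self: "v \<in> V \<Longrightarrow> v \<in> rung v" by (simp add: rung_def)

lemma rung_eq: "w \<in> rung v \<Longrightarrow> rung w = rung v" by (auto simp: rung_def)

text \<open>The neighbours split by the sign of \<open>s\<close> relative to \<open>r\<close>. The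
  pair \<open>{a, b}\<close> also sees \<open>k\<close> and \<open>k'\<close> and is
  \<open>big\<close> again, with \<open>c\<close> as a vertex that meets it in
  \<open>{r, s}\<close>. The pair \<open>{c, d}\<close> either continues the ladder or is an end
  that sees only \<open>r\<close> and \<open>s\<close>.\<close>

lemma big_structure:
  assumes "big r"
  obtains s a b c d where "r \<noteq> s" "rung r = {r, s}" "nb r = {a, b, c, d}" "distinct [a, b, c, d]"
    "big a" "rung a = {a, b}" "rung c = {c, d}" "big c \<or> nb c = {r, s}"
    "\<And>x. x \<in> {a, b} \<Longrightarrow> A s x = h r s a * A r x" "\<And>x. x \<in> {c, d} \<Longrightarrow> A s x = - h r s a * A r x"
proof -
  obtain k where k: "r \<in> V" "card (nb r) = 4" "k \<in> V" "k \<noteq> r" "card (nb k \<inter> nb r) = 2"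
    using assms unfolding big_def by blast
  then obtain a b where ab: "nb k \<inter> nb r = {a, b}" "a \<noteq> b" by (meson card_2_iff)
  then obtain c d where cd: "nb r = {a, b, c, d}" "distinct [a, b, c, d]"
    using nb_four[OF k(2), of a b] by blast
  obtain s k' where s: "s \<in> V" "k' \<in> V" "nb s = nb r" "nb a = {r, s, k, k'}" "nb b = {r, s, k, k'}" "distinct [r, s, k, k']"
    "nb k' \<inter> nb r = {a, b}" "h r s b = h r s a" "h r s c = - h r s a" "h r s d = - h r s a"
    using twin[OF k(1) cd k(3,4) ab(1)] .
  have V: "a \<in> V" "b \<in> V" "c \<in> V" "d \<in> V" using cd(1) nbV by auto
  have ru: "rung v = {v, t}" if "v \<in> V" "t \<in> V" "nb t = nb v" "x \<in> V" "x \<in> nb v" "nb x = {v, t, y, z}" "nb y \<noteq> nb v" "nb z \<noteq> nb v"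
    for v t x y z
  proof -
    have "w \<in> {v, t}" if "w \<in> rung v" for w
    proof -
      have "w \<in> V" "nb w = nb v" using that by (auto simp: rung_def)
      then have "w \<in> nb x" using nb_iff \<open>x \<in> V\<close> \<open>x \<in> nb v\<close> by blast
      then show ?thesis using \<open>nb x = {v, t, y, z}\<close> \<open>nb w = nb v\<close> \<open>nb y \<noteq> nb v\<close> \<open>nb z \<noteq> nb v\<close> by auto
    qed
    then show ?thesis using that(1-3) by (auto simp: rung_def)
  qed
  have kk: "nb k \<noteq> nb r" "nb k' \<noteq> nb r" using ab(1) s(7) cd by auto
  have rr: "rung r = {r, s}" by (rule ru[OF k(1) s(1,3) V(1) _ s(4) kk]) (use cd in simp)
  have notk: "k \<notin> nb x" "k' \<notin> nb x" if "x \<in> {c, d}" for x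
  proof -
    have "x \<in> V" "x \<in> nb r" "x \<notin> {a, b}" using that V cd by auto
    then show "k \<notin> nb x" "k' \<notin> nb x" using nb_iff[of x k] nb_iff[of x k'] k(3) s(2) ab(1) s(7) by auto
  qed
  have rs: "{r, s} \<subseteq> nb x" if "x \<in> nb r" for x
    using nb_iff[of x r] nb_iff[of x s] that s(1,3) k(1) nbV by auto
  have meet: "nb x \<inter> nb y = {r, s}" if "x \<in> {c, d}" "y \<in> {a, b}" for x y
    using that notk[OF that(1)] rs[of x] s(4,5) cd(1) by auto
  have big_ab: "big y" if "y \<in> {a, b}" for y
    unfolding big_def using that V meet[of c y] s(4,5,6) cd(2) by (intro conjI bexI[of _ c]) auto
  have big_cd: "big x" if "x \<in> {c, d}" "card (nb x) = 4" for x
    unfolding big_def using that V meet[of x a] s(6) cd(2) by (intro conjI bexI[of _ a]) (auto simp: Int_commute)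
  have ca: "nb c \<noteq> nb a" "nb d \<noteq> nb a" using notk[of c] notk[of d] s(4) by auto
  have ra: "rung a = {a, b}"
    by (rule ru[OF V(1,2) _ k(1) _ cd(1) ca]) (use s(4,5) in auto)
  \<comment> \<open>Applying \<open>twin\<close> at \<open>x\<close>, with \<open>a\<close> as the
    vertex of overlap two, yields a twin of \<open>x\<close>. It is a neighbour of \<open>r\<close>
    other than \<open>a\<close>, \<open>b\<close> and \<open>x\<close>, so it is
    \<open>y\<close>.\<close>
  have tc: "nb y = nb x" if xy: "x \<in> {c, d}" "y \<in> {c, d}" "x \<noteq> y" "card (nb x) = 4" for x y
  proof -
    have X: "x \<in> V" "r \<in> nb x" "s \<in> nb x" "r \<noteq> s" using xy V rs[of x] cd(1) s(6) by auto
    obtain e f where ef: "nb x = {r, s, e, f}" "distinct [r, s, e, f]" using nb_four[OF xy(4) X(2,3,4)] .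
    have "nb a \<inter> nb x = {r, s}" using meet[OF xy(1), of a] by (simp add: Int_commute)
    moreover have "a \<noteq> x" using xy cd by auto
    ultimately obtain s2 where s2: "s2 \<in> V" "nb s2 = nb x" "s2 \<noteq> x"
      using twin[OF X(1) ef V(1)] by (metis distinct_length_2_or_more)
    have "s2 \<in> nb r" using nb_iff[OF s2(1) k(1)] s2(2) X(2) by simp
    moreover have "s2 \<noteq> a" "s2 \<noteq> b" using s2(2) notk[OF xy(1)] s(4,5) by auto
    ultimately have "s2 = y" using xy(1-3) s2(3) cd(1) by auto
    then show ?thesis using s2 by simp
  qed
  have small: "nb x = {r, s}" if "x \<in> {c, d}" "card (nb x) \<noteq> 4" for x
  proof -
    have xV: "x \<in> V" "{r, s} \<subseteq> nb x" using that V rs[of x] cd(1) by auto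
    have "card {r, s} = 2" using s(6) by auto
    moreover have "card {r, s} \<le> card (nb x)" using xV(2) finite_nb by (intro card_mono)
    ultimately have "card (nb x) = 2" using nb_card[OF xV(1)] that(2) by auto
    then show ?thesis using xV(2) \<open>card {r, s} = 2\<close> finite_nb by (metis card_subset_eq)
  qed
  have ncd: "nb d = nb c"
  proof (cases "card (nb c) = 4 \<or> card (nb d) = 4")
    case True
    then show ?thesis using tc[of c d] tc[of d c] cd(2) by auto
  next
    case False
    then show ?thesis using small[of c] small[of d] by auto
  qed
  have rc: "rung c = {c, d}"
  proof -
    have "w \<in> {c, d}" if "w \<in> rung c" for w
    proof -
      have w: "w \<in> V" "nb w = nb c" using that by (auto simp: rung_def)
      then have "w \<in> nb r" using nb_iff[OF w(1) k(1)] rs[of c] cd(1) by auto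
      moreover have "w \<noteq> a" "w \<noteq> b" using w(2) notk[of c] s(4,5) by auto
      ultimately show ?thesis using cd(1) by auto
    qed
    then show ?thesis using V ncd by (auto simp: rung_def)
  qed
  have As: "A s x = h r s x * A r x" if "x \<in> nb r" for x
    unfolding h_def using unit_cnj_mult(2)[OF entry_unit[OF k(1) that]] by (simp add: mult.assoc)
  show ?thesis
  proof (rule that[of s a b c d])
    show "big c \<or> nb c = {r, s}" using big_cd[of c] small[of c] by auto
    show "A s x = h r s a * A r x" if "x \<in> {a, b}" for x using As[of x] that cd(1) s(8) by auto
    show "A s x = - h r s a * A r x" if "x \<in> {c, d}" for x using As[of x] that cd(1) s(9,10) by auto
  qed (use s(6) rr cd big_ab ra rc in auto)
qed

text \<open>By \<open>big_structure\<close> the vertices of these two kinds form a set closed under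
  neighbours.\<close>

lemma big_or_end:
  assumes "big r0" "v \<in> V"
  shows "big v \<or> (\<exists>r. big r \<and> nb v = rung r)"
proof -
  define X where "X = {v \<in> V. big v \<or> (\<exists>r. big r \<and> nb v = rung r)}"
  have twin_big: "big w" if "big v" "w \<in> rung v" for v w
  proof -
    obtain k where k: "v \<in> V" "card (nb v) = 4" "k \<in> V" "k \<noteq> v" "card (nb k \<inter> nb v) = 2"
      using \<open>big v\<close> unfolding big_def by blast
    have w: "w \<in> V" "nb w = nb v" using that(2) by (auto simp: rung_def)
    moreover have "k \<noteq> w" using k(2,5) w by auto
    ultimately show ?thesis using k unfolding big_def by auto
  qed
  have "w \<in> X" if v: "v \<in> X" "w \<in> V" "A v w \<noteq> 0" for v w
  proof -
    have wn: "w \<in> nb v" using v by (simp add: nb_def)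
    show ?thesis
    proof (cases "big v")
      case True
      obtain s a b c d where st: "v \<noteq> s" "rung v = {v, s}" "nb v = {a, b, c, d}" "distinct [a, b, c, d]"
        "big a" "rung a = {a, b}" "rung c = {c, d}" "big c \<or> nb c = {v, s}"
        by (rule big_structure[OF True]) (rule that, assumption+)
      have "big w \<or> w \<in> rung c" using wn st(3,6,7) twin_big[OF st(5), of w] by auto
      then have "big w \<or> nb w = rung v" using st(2,8) twin_big[of c w] by (auto simp: rung_def)
      then show ?thesis using True v(2) by (auto simp: X_def)
    next
      case False
      then obtain r where "big r" "nb v = rung r" using v(1) by (auto simp: X_def)
      then show ?thesis using twin_big wn v(2) by (auto simp: X_def)
    qed
  qed
  moreover have "r0 \<in> X" using assms(1) by (auto simp: X_def big_def)
  ultimately have "X = V" using con unfolding connected_on_def by (metis (no_types, lifting) X_def empty_iff mem_Collect_eq subsetI)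
  then show ?thesis using assms(2) by (auto simp: X_def)
qed

text \<open>This bounds the degrees in the quotient by rungs for \<open>path_or_cycle\<close>. A
  charged end rung is adjacent to itself, and the loop counts as one of its two neighbours.\<close>

lemma adjacent_rungs:
  assumes "big r0" "v \<in> V"
  shows "card (rung v) = 2" "card (rung ` nb v) \<le> 2" "big v \<longleftrightarrow> card (rung ` nb v) = 2"
proof -
  have bigv: "card (rung v) = 2 \<and> card (rung ` nb v) = 2" if v: "big v" for v
  proof -
    obtain s a b c d where st: "v \<noteq> s" "rung v = {v, s}" "nb v = {a, b, c, d}" "distinct [a, b, c, d]"
      "big a" "rung a = {a, b}" "rung c = {c, d}" by (rule big_structure[OF v]) (rule that, assumption+)
    have "rung b = rung a" "rung d = rung c" using rung_eq st(6,7) by blast+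
    then have "rung ` nb v = {rung a, rung c}" using st(3) by auto
    moreover have "rung a \<noteq> rung c" using st(4,6,7) by auto
    ultimately show ?thesis using st(1,2) by auto
  qed
  have endv: "card (rung v) = 2 \<and> card (rung ` nb v) = 1" if v: "v \<in> V" "big r" "nb v = rung r" for v r
  proof -
    have rV: "r \<in> V" using v(2) by (simp add: big_def)
    obtain s a b c d where st: "r \<noteq> s" "rung r = {r, s}" "nb r = {a, b, c, d}" "distinct [a, b, c, d]"
      "big a" "rung a = {a, b}" "rung c = {c, d}" by (rule big_structure[OF v(2)]) (rule that, assumption+)
    have "rung ` nb v = {rung r}" 
    proof
      show "rung ` nb v \<subseteq> {rung r}" unfolding v(3) using rung_eq by blast
      show "{rung r} \<subseteq> rung ` nb v" unfolding v(3) using rung_self[OF rV] by blast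
    qed
    moreover have "v \<in> nb r" using nb_iff[OF v(1) rV] v(3) rung_self[OF rV] by simp
    then have "v \<in> rung a \<or> v \<in> rung c" using st(3,6,7) by auto
    then have "rung v = rung a \<or> rung v = rung c" using rung_eq by blast
    then have "card (rung v) = 2" using st(4,6,7) by auto
    ultimately show ?thesis by simp
  qed
  show "card (rung v) = 2" "card (rung ` nb v) \<le> 2" "big v \<longleftrightarrow> card (rung ` nb v) = 2"
    using big_or_end[OF assms] bigv[of v] endv[OF assms(2)] by auto
qed

text \<open>The rungs form a path or a cycle. Tops are switched to weight 1 along it and bottoms are
  adjusted to them. The ratio of bottom to top on a rung is opposite towards its two neighbouring
  rungs, which is the sign pattern of a ladder; loops at the ends become charges.\<close>

lemma big_in_ladder:
  assumes b0: "big r0"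
  shows "in_ladder V A"
proof -
  define E where "E P Q \<longleftrightarrow> (\<exists>p\<in>P. \<exists>q\<in>Q. A p q \<noteq> 0)" for P Q
  have E_nb: "E (rung p) (rung q) \<longleftrightarrow> q \<in> nb p" if "p \<in> V" "q \<in> V" for p q
  proof
    assume "E (rung p) (rung q)"
    then obtain p' q' where pq: "p' \<in> V" "nb p' = nb p" "q' \<in> V" "nb q' = nb q" "A p' q' \<noteq> 0"
      by (auto simp: E_def rung_def)
    then have "q' \<in> nb p" by (auto simp: nb_def)
    then have "p \<in> nb q" using nb_iff[OF that(1) pq(3)] pq(4) by simp
    then show "q \<in> nb p" using nb_iff that by blast
  next
    assume "q \<in> nb p"
    then show "E (rung p) (rung q)" using rung_self that unfolding E_def nb_def by blast
  qed
  have r0V: "r0 \<in> V" using b0 by (simp add: big_def)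
  have nbr: "{Q \<in> rung ` V. E (rung v) Q} = rung ` nb v" if "v \<in> V" for v
    using E_nb[OF that] nb_V by auto
  obtain xs where xs: "distinct xs" "set xs = rung ` V" "\<And>i. Suc i < length xs \<Longrightarrow> E (xs ! i) (xs ! Suc i)"
    "\<And>i j. i < length xs \<Longrightarrow> j < length xs \<Longrightarrow> E (xs ! i) (xs ! j) \<Longrightarrow> Suc i = j \<or> i = Suc j \<or>
      (i = 0 \<or> Suc i = length xs) \<and> (j = 0 \<or> Suc j = length xs)"
  proof (rule path_or_cycle[of "rung ` V" E])
    show "E v u" if "u \<in> rung ` V" "v \<in> rung ` V" "E u v" for u v
      using that E_nb nb_iff by auto
    show "card {u \<in> rung ` V. E v u} \<le> 2" if "v \<in> rung ` V" for v
      using that nbr adjacent_rungs(2)[OF b0] by auto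
    show "X = rung ` V" if X: "X \<subseteq> rung ` V" "X \<noteq> {}" "\<And>u v. u \<in> X \<Longrightarrow> v \<in> rung ` V \<Longrightarrow> E u v \<Longrightarrow> v \<in> X" for X
    proof -
      define Y where "Y = {v \<in> V. rung v \<in> X}"
      have "j \<in> Y" if "i \<in> Y" "j \<in> V" "A i j \<noteq> 0" for i j
        using that X(3)[of "rung i" "rung j"] E_nb[of i j] by (auto simp: Y_def nb_def)
      moreover have "Y \<subseteq> V" "Y \<noteq> {}" using X(1,2) by (auto simp: Y_def)
      ultimately have "Y = V" using con unfolding connected_on_def by blast
      then show ?thesis using X(1) by (auto simp: Y_def)
    qed
  qed (use finite_V r0V in auto)
  define n where "n = length xs"
  have ex_tb: "\<exists>p q. xs ! i = {p, q} \<and> p \<noteq> q \<and> p \<in> V \<and> q \<in> V \<and> rung p = xs ! i \<and> rung q = xs ! i" if "i < n" for i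
  proof -
    obtain v where v: "v \<in> V" "xs ! i = rung v" using xs(2) nth_mem[of i xs] \<open>i < n\<close> unfolding n_def by fastforce
    obtain p q where pq: "rung v = {p, q}" "p \<noteq> q" using adjacent_rungs(1)[OF b0 v(1)] by (meson card_2_iff)
    then have "p \<in> rung v" "q \<in> rung v" by auto
    then show ?thesis using pq v rung_eq by (intro exI[of _ p] exI[of _ q]) (auto simp: rung_def)
  qed
  have "\<forall>i. \<exists>pq. i < n \<longrightarrow> (xs ! i = {fst pq, snd pq} \<and> fst pq \<noteq> snd pq \<and> fst pq \<in> V \<and> snd pq \<in> V
      \<and> rung (fst pq) = xs ! i \<and> rung (snd pq) = xs ! i)"
  proof
    fix i
    show "\<exists>pq. i < n \<longrightarrow> (xs ! i = {fst pq, snd pq} \<and> fst pq \<noteq> snd pq \<and> fst pq \<in> V \<and> snd pq \<in> V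
      \<and> rung (fst pq) = xs ! i \<and> rung (snd pq) = xs ! i)"
    proof (cases "i < n")
      case True
      then obtain p q where "xs ! i = {p, q} \<and> p \<noteq> q \<and> p \<in> V \<and> q \<in> V \<and> rung p = xs ! i \<and> rung q = xs ! i"
        using ex_tb by blast
      then show ?thesis by (intro exI[of _ "(p, q)"]) simp
    qed simp
  qed
  from choice[OF this] obtain pq where pq: "\<forall>i. i < n \<longrightarrow> (xs ! i = {fst (pq i), snd (pq i)} \<and> fst (pq i) \<noteq> snd (pq i)
      \<and> fst (pq i) \<in> V \<and> snd (pq i) \<in> V \<and> rung (fst (pq i)) = xs ! i \<and> rung (snd (pq i)) = xs ! i)" ..
  define t b where "t i = fst (pq i)" and "b i = snd (pq i)" for i
  have tb: "\<And>i. i < n \<Longrightarrow> xs ! i = {t i, b i}" "\<And>i. i < n \<Longrightarrow> t i \<noteq> b i"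
    "\<And>i. i < n \<Longrightarrow> t i \<in> V" "\<And>i. i < n \<Longrightarrow> b i \<in> V" "\<And>i. i < n \<Longrightarrow> rung (t i) = xs ! i" "\<And>i. i < n \<Longrightarrow> rung (b i) = xs ! i"
    using pq unfolding t_def b_def by blast+
  define vv where "vv i c = (if c then t i else b i)" for i c
  have vv: "vv i c \<in> V" "rung (vv i c) = xs ! i" "vv i c \<in> xs ! i" if "i < n" for i c
    using tb[OF that] by (auto simp: vv_def)
  have EA: "A (vv i c) (vv j d) \<noteq> 0 \<longleftrightarrow> E (xs ! i) (xs ! j)" if "i < n" "j < n" for i j c d
    using E_nb[OF vv(1)[OF that(1), of c] vv(1)[OF that(2), of d]] vv(1,2) that by (simp add: nb_def)
  have EA': "A (t i) (t j) \<noteq> 0 \<longleftrightarrow> E (xs ! i) (xs ! j)" "A (t i) (b j) \<noteq> 0 \<longleftrightarrow> E (xs ! i) (xs ! j)"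
    "A (b i) (t j) \<noteq> 0 \<longleftrightarrow> E (xs ! i) (xs ! j)" if "i < n" "j < n" for i j
    using EA[OF that, of True True] EA[OF that, of True False] EA[OF that, of False True] by (simp_all add: vv_def)
  have Esym: "E (xs ! j) (xs ! i)" if "i < n" "j < n" "E (xs ! i) (xs ! j)" for i j
    using EA'(1)[OF that(1,2)] EA'(1)[OF that(2,1)] entry_herm[OF tb(3)[OF that(1)] tb(3)[OF that(2)]] that(3) by auto
  have nbrs: "{Q. \<exists>j<n. Q = xs ! j \<and> E (xs ! i) (xs ! j)} = rung ` nb (t i)" if "i < n" for i
  proof -
    have "rung ` nb (t i) = {Q \<in> set xs. E (xs ! i) Q}"
      using nbr[OF tb(3)[OF that]] unfolding tb(5)[OF that] xs(2) by simp
    also have "\<dots> = {Q. \<exists>j<n. Q = xs ! j \<and> E (xs ! i) (xs ! j)}" by (auto simp: n_def in_set_conv_nth)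
    finally show ?thesis by (rule sym)
  qed
  have xsinj: "xs ! i = xs ! j \<longleftrightarrow> i = j" if "i < n" "j < n" for i j
    using xs(1) that by (simp add: nth_eq_iff_index_eq n_def)
  have not3: False if "i < n" "j < n" "m < n" "l < n" "distinct [j, m, l]" "E (xs ! i) (xs ! j)" "E (xs ! i) (xs ! m)" "E (xs ! i) (xs ! l)" for i j m l
  proof -
    have "{xs ! j, xs ! m, xs ! l} \<subseteq> rung ` nb (t i)" unfolding nbrs[OF that(1), symmetric] using that by auto
    then have "card {xs ! j, xs ! m, xs ! l} \<le> 2"
      using adjacent_rungs(2)[OF b0 tb(3)[OF that(1)]] finite_nb card_mono by (meson finite_imageI le_trans)
    then show False using that xsinj by auto
  qed
  \<comment> \<open>A rung with two neighbouring rungs has a \<open>big\<close> top vertex, and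
    \<open>big_structure\<close> yields the opposite ratios.\<close>
  have ratio: "\<exists>\<mu>. (\<forall>x\<in>xs ! j. A (b i) x = \<mu> * A (t i) x) \<and> (\<forall>x\<in>xs ! m. A (b i) x = - \<mu> * A (t i) x)"
    if ij: "i < n" "j < n" "m < n" "j \<noteq> m" "E (xs ! i) (xs ! j)" "E (xs ! i) (xs ! m)" for i j m
  proof -
    have sub: "{xs ! j, xs ! m} \<subseteq> rung ` nb (t i)" unfolding nbrs[OF ij(1), symmetric] using ij by auto
    moreover have "card {xs ! j, xs ! m} = 2" using xsinj ij by auto
    ultimately have "card (rung ` nb (t i)) = 2"
      using adjacent_rungs(2)[OF b0 tb(3)[OF ij(1)]] card_mono[OF finite_imageI[OF finite_nb] sub] by auto
    then have "big (t i)" using adjacent_rungs(3)[OF b0 tb(3)[OF ij(1)]] by simp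
    then show ?thesis
    proof (rule big_structure)
      fix s a b' c d
      assume st: "t i \<noteq> s" "rung (t i) = {t i, s}" "nb (t i) = {a, b', c, d}" "distinct [a, b', c, d]" "big a"
        "rung a = {a, b'}" "rung c = {c, d}" "big c \<or> nb c = {t i, s}"
        "\<And>x. x \<in> {a, b'} \<Longrightarrow> A s x = h (t i) s a * A (t i) x" "\<And>x. x \<in> {c, d} \<Longrightarrow> A s x = - h (t i) s a * A (t i) x"
      have "{t i, s} = {t i, b i}" using st(2) tb(1,5)[OF ij(1)] by simp
      then have "s = b i" using st(1) by (auto simp: doubleton_eq_iff)
      have "rung b' = rung a" "rung d = rung c" using rung_eq st(6,7) by blast+
      then have "rung ` nb (t i) = {rung a, rung c}" using st(3) by auto
      then have "xs ! j = {a, b'} \<and> xs ! m = {c, d} \<or> xs ! j = {c, d} \<and> xs ! m = {a, b'}"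
        using sub xsinj[OF ij(2,3)] ij(4) unfolding st(6,7) by auto
      then show ?thesis
      proof
        assume "xs ! j = {a, b'} \<and> xs ! m = {c, d}"
        then show ?thesis using st(9,10) \<open>s = b i\<close> by (intro exI[of _ "h (t i) s a"]) auto
      next
        assume "xs ! j = {c, d} \<and> xs ! m = {a, b'}"
        then show ?thesis using st(9,10) \<open>s = b i\<close> by (intro exI[of _ "- h (t i) s a"]) auto
      qed
    qed
  qed
  have ratio': "A (b i) y = - \<rho> * A (t i) y"
    if R: "i < n" "j < n" "m < n" "j \<noteq> m" "E (xs ! i) (xs ! j)" "E (xs ! i) (xs ! m)" "A (b i) (t j) = \<rho> * A (t i) (t j)" "y \<in> xs ! m" for i j m \<rho> y
  proof -
    obtain \<mu> where mu: "\<And>x. x \<in> xs ! j \<Longrightarrow> A (b i) x = \<mu> * A (t i) x" "\<And>x. x \<in> xs ! m \<Longrightarrow> A (b i) x = - \<mu> * A (t i) x"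
      using ratio[OF R(1-6)] by blast
    have "\<rho> * A (t i) (t j) = \<mu> * A (t i) (t j)" using mu(1)[of "t j"] R(7) tb(1)[OF R(2)] by simp
    then have "\<rho> = \<mu>" using EA'(1)[OF R(1,2)] R(5) by simp
    then show ?thesis using mu(2) R(8) by simp
  qed
  have card_rungs: "card (rung ` V) = n" using xs(1,2) distinct_card[of xs] by (simp add: n_def)
  have n2: "2 \<le> n"
  proof -
    have "card (rung ` nb r0) = 2" using adjacent_rungs(3)[OF b0 r0V] b0 by simp
    moreover have "rung ` nb r0 \<subseteq> rung ` V" using nb_V by auto
    ultimately show ?thesis using card_rungs card_mono[OF finite_imageI[OF finite_V]] by metis
  qed
  have Estep: "E (xs ! i) (xs ! Suc i)" "E (xs ! Suc i) (xs ! i)" if "Suc i < n" for i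
    using xs(3)[of i] Esym[of i "Suc i"] that by (auto simp: n_def)
  \<comment> \<open>If the first rung has only one neighbouring rung, its own ratios are not known
    to be constant. Then the second rung is \<open>big\<close>, and proportionality of the block is
    read off from there.\<close>
  have rank1: "A (b 0) (b 1) * A (t 0) (t 1) = A (b 0) (t 1) * A (t 0) (b 1)"
  proof (cases "\<exists>m<n. m \<noteq> 1 \<and> E (xs ! 0) (xs ! m)")
    case True
    then obtain m where m: "m < n" "m \<noteq> 1" "E (xs ! 0) (xs ! m)" by blast
    have "0 < n" "1 < n" "E (xs ! 0) (xs ! 1)" using n2 Estep(1)[of 0] by auto
    from ratio[OF this(1,2) m(1) m(2)[symmetric] this(3) m(3)]
    obtain \<mu> where "\<And>x. x \<in> xs ! 1 \<Longrightarrow> A (b 0) x = \<mu> * A (t 0) x" by blast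
    then show ?thesis using tb(1)[of 1] n2 by simp
  next
    case False
    have n0: "0 < n" "1 < n" using n2 by auto
    have "rung ` nb (t 0) = {xs ! 1}" unfolding nbrs[OF n0(1), symmetric]
      using False Estep(1)[of 0] n0 by auto
    then have "\<not> big (t 0)" using adjacent_rungs(3)[OF b0 tb(3)[of 0]] n2 by simp
    then obtain r where r: "big r" "nb (t 0) = rung r" using big_or_end[OF b0 tb(3)[of 0]] n2 by auto
    have rV: "r \<in> V" using r(1) by (simp add: big_def)
    have "rung r = xs ! 1" using \<open>rung ` nb (t 0) = {xs ! 1}\<close> r(2) rung_self[OF rV] by blast
    then have "nb (t 1) = nb r" using tb(1,3,5)[of 1] n2 by (auto simp: rung_def)
    then have "card (rung ` nb (t 1)) = 2" using adjacent_rungs(3)[OF b0 rV] r(1) by simp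
    then have "\<exists>Q. Q \<in> rung ` nb (t 1) \<and> Q \<noteq> xs ! 0"
      by (metis (no_types, lifting) card_2_iff insertCI)
    then obtain Q where Q: "Q \<in> rung ` nb (t 1)" "Q \<noteq> xs ! 0" by blast
    from Q(1) have "Q \<in> {Q. \<exists>j<n. Q = xs ! j \<and> E (xs ! 1) (xs ! j)}" unfolding nbrs[OF n0(2)] .
    then obtain m where m: "m < n" "Q = xs ! m" "E (xs ! 1) (xs ! m)" by auto
    have m0: "m \<noteq> 0" using m(2) Q(2) by auto
    have "1 < n" "0 < n" "E (xs ! 1) (xs ! 0)" using n2 Estep(2)[of 0] by auto
    from ratio[OF this(1,2) m(1) m0[symmetric] this(3) m(3)]
    obtain \<mu> where mu: "\<And>x. x \<in> xs ! 0 \<Longrightarrow> A (b 1) x = \<mu> * A (t 1) x" by blast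
    have h: "A x (b 1) = cnj \<mu> * A x (t 1)" if "x \<in> {t 0, b 0}" for x
    proof -
      have "x \<in> V" "x \<in> xs ! 0" using that tb(1,3,4)[of 0] n2 by auto
      then show ?thesis using mu[of x] entry_herm[of "b 1" x] entry_herm[of "t 1" x] tb(3,4)[of 1] n2 by simp
    qed
    show ?thesis using h[of "t 0"] h[of "b 0"] by simp
  qed
  define wt where "wt = rec_nat (1 :: complex) (\<lambda>i x. x * cnj (A (t i) (t (Suc i))))"
  have wt0: "wt 0 = 1" and wtS: "wt (Suc i) = wt i * cnj (A (t i) (t (Suc i)))" for i by (simp_all add: wt_def)
  \<comment> \<open>The value at 0 gives the first rung the ladder sign towards the second; the
    later values make the weight from each top to the next bottom 1.\<close>
  define wb where "wb i = (case i of 0 \<Rightarrow> - A (b 0) (t 1) * cnj (A (t 0) (t 1)) | Suc j \<Rightarrow> wt j * cnj (A (t j) (b (Suc j))))" for i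
  have Au: "A (vv i c) (vv j d) \<in> eisenstein_units" if "i < n" "j < n" "E (xs ! i) (xs ! j)" for i j c d
    using unit_entries[OF vv(1)[OF that(1)] vv(1)[OF that(2)]] EA[OF that(1,2)] that(3) by blast
  have Au': "A (t i) (t (Suc i)) \<in> eisenstein_units" "A (t i) (b (Suc i)) \<in> eisenstein_units" "A (b i) (t (Suc i)) \<in> eisenstein_units" if "Suc i < n" for i
    using Au[OF _ that Estep(1)[OF that], of True True] Au[OF _ that Estep(1)[OF that], of True False] Au[OF _ that Estep(1)[OF that], of False True] that
    by (simp_all add: vv_def)
  have wtu: "wt i \<in> eisenstein_units" if "i < n" for i
    using that by (induction i) (auto simp: wt0 wtS intro!: unit_mult unit_cnj Au')
  have wbu: "wb i \<in> eisenstein_units" if "i < n" for i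
    using that n2 Au'[of 0] by (cases i) (auto simp: wb_def intro!: unit_mult unit_cnj unit_uminus Au' wtu)
  have uu: "x * (y * cnj y) = x" if "y \<in> eisenstein_units" for x y using unit_cnj_mult(1)[OF that] by simp
  have ftt: "A (t i) (t (Suc i)) = wt i * cnj (wt (Suc i))" if "Suc i < n" for i
  proof -
    have "wt i * cnj (wt (Suc i)) = A (t i) (t (Suc i)) * (wt i * cnj (wt i))" by (simp add: wtS mult_ac)
    then show ?thesis using uu[OF wtu[of i]] that by simp
  qed
  have ftb: "A (t i) (b (Suc i)) = wt i * cnj (wb (Suc i))" if "Suc i < n" for i
  proof -
    have "wt i * cnj (wb (Suc i)) = A (t i) (b (Suc i)) * (wt i * cnj (wt i))" by (simp add: wb_def mult_ac)
    then show ?thesis using uu[OF wtu[of i]] that by simp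
  qed
  \<comment> \<open>The ratio of bottom to top towards the previous rung; towards the next rung it
    is the negative.\<close>
  define \<rho> where "\<rho> i = wb i * cnj (wt i)" for i
  have \<rho>w: "\<rho> i * wt i = wb i" if "i < n" for i using unit_cnj_mult(2)[OF wtu[OF that]] by (simp add: \<rho>_def mult.assoc)
  have bwd: "A (b (Suc i)) (t i) = \<rho> (Suc i) * A (t (Suc i)) (t i)" if "Suc i < n" for i
  proof -
    have "A (b (Suc i)) (t i) = wb (Suc i) * cnj (wt i)" "A (t (Suc i)) (t i) = wt (Suc i) * cnj (wt i)"
      using entry_herm[OF tb(3) tb(4), of i "Suc i"] entry_herm[OF tb(3) tb(3), of i "Suc i"] ftt ftb that by (simp_all add: mult.commute)
    then show ?thesis using \<rho>w[OF that] by (simp add: mult.assoc[symmetric])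
  qed
  have fwd: "A (b i) y = - \<rho> i * A (t i) y" if "Suc i < n" "y \<in> xs ! Suc i" for i y
  proof (cases i)
    case 0
    have u: "A (t 0) (t 1) \<in> eisenstein_units" using Au'(1)[of 0] that 0 by simp
    have \<rho>0: "- \<rho> 0 = A (b 0) (t 1) * cnj (A (t 0) (t 1))" by (simp add: \<rho>_def wt0 wb_def)
    have "A (b 0) (t 1) = - \<rho> 0 * A (t 0) (t 1)" unfolding \<rho>0 using unit_cnj_mult(2)[OF u] by (simp add: mult.assoc)
    moreover have "A (b 0) (b 1) = - \<rho> 0 * A (t 0) (b 1)"
    proof -
      have "- \<rho> 0 * A (t 0) (b 1) = (A (b 0) (b 1) * A (t 0) (t 1)) * cnj (A (t 0) (t 1))"
        unfolding \<rho>0 rank1 by (simp add: mult_ac)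
      then show ?thesis using unit_cnj_mult(1)[OF u] by (simp add: mult.assoc)
    qed
    ultimately show ?thesis using that tb(1)[of 1] 0 by auto
  next
    case (Suc j)
    show ?thesis
      by (rule ratio'[of i j "Suc i"]) (use that Suc bwd[of j] Estep(1)[of "Suc j"] Estep(2)[of j] in auto)
  qed
  \<comment> \<open>\<open>d\<close> tells which side is already known: the previous rung, with
    ratio \<rho>, or the next one, with the negative. The rung \<open>m\<close> then lies on the
    opposite side.\<close>
  have sides: "A (b i) y = (if d then - \<rho> i else \<rho> i) * A (t i) y"
    if R: "i < n" "m < n" "E (xs ! i) (xs ! m)" "y \<in> xs ! m" "d \<and> i > 0 \<and> m \<noteq> i - 1 \<or> \<not> d \<and> Suc i < n \<and> m \<noteq> Suc i" for i m y d
  proof (cases d)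
    case True
    then obtain j where j: "i = Suc j" "m \<noteq> j" using R by (cases i) auto
    show ?thesis using ratio'[of i j m "\<rho> i" y] R j bwd[of j] Estep(2)[of j] True by auto
  next
    case False
    then have "Suc i < n" "m \<noteq> Suc i" using R by auto
    then show ?thesis using ratio'[of i "Suc i" m "- \<rho> i" y] R fwd[of i "t (Suc i)"] tb(1)[of "Suc i"] Estep(1)[of i] False by auto
  qed
  define w where "w p = (if snd p then wt (fst p) else wb (fst p))" for p :: "nat \<times> bool"
  have wu: "w (i, c) \<in> eisenstein_units" if "i < n" for i c using wtu[OF that] wbu[OF that] by (simp add: w_def)
  have step: "A (vv i c) (vv (Suc i) d) = w (i, c) * sg c * cnj (w (Suc i, d))" if "Suc i < n" for i c d
  proof -
    have "A (t i) (vv (Suc i) d) = wt i * cnj (w (Suc i, d))" using ftt ftb that by (simp add: vv_def w_def)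
    moreover have "A (b i) (vv (Suc i) d) = - \<rho> i * A (t i) (vv (Suc i) d)" using fwd that vv(3) by simp
    ultimately show ?thesis using \<rho>w[of i] that by (cases c) (auto simp: vv_def w_def mult.assoc[symmetric])
  qed
  have hm: "A (vv j d) (vv i c) = cnj (A (vv i c) (vv j d))" if "i < n" "j < n" for i j c d
    using entry_herm[OF vv(1)[OF that(1)] vv(1)[OF that(2)]] .
  have step': "A (vv (Suc i) d) (vv i c) = w (Suc i, d) * sg c * cnj (w (i, c))" if "Suc i < n" for i c d
    using hm[of i "Suc i" d c] step[OF that, of c d] that by (simp add: mult_ac)
  define l where "l = n - 1"
  have l: "l < n" "Suc l = n" "l > 0" using n2 by (auto simp: l_def)
  text \<open>A loop or the closing edge is determined by its value on top vertices.\<close>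
  have spread: "A (vv i c) (vv j d) = w (i, c) * (\<epsilon> c * A (t i) (t j) * \<delta> d * cnj (wt i) * wt j) * cnj (w (j, d))"
    if ij: "i < n" "j < n" and i: "\<And>y. y \<in> xs ! j \<Longrightarrow> A (b i) y = \<epsilon> False * \<rho> i * A (t i) y"
      and j: "\<And>y. y \<in> xs ! i \<Longrightarrow> A (b j) y = \<delta> False * \<rho> j * A (t j) y"
      and e: "\<epsilon> True = 1" "\<delta> True = 1" "cnj (\<delta> False) = \<delta> False" for i j c d and \<epsilon> \<delta> :: "bool \<Rightarrow> complex"
  proof -
    have j': "A x (b j) = \<delta> False * cnj (\<rho> j) * A x (t j)" if "x \<in> xs ! i" "x \<in> V" for x
      using j[OF that(1)] entry_herm[OF tb(4)[OF ij(2)] that(2)] entry_herm[OF tb(3)[OF ij(2)] that(2)] e(3) by simp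
    have "A (vv i c) (vv j d) = (\<epsilon> c * w (i, c) * cnj (wt i)) * (\<delta> d * cnj (w (j, d)) * wt j) * A (t i) (t j)"
      using i[of "t j"] i[of "b j"] j'[of "t i"] j'[of "b i"] tb[OF ij(1)] tb[OF ij(2)] e
        unit_cnj_mult[OF wtu[OF ij(1)]] unit_cnj_mult[OF wtu[OF ij(2)]]
      by (cases c; cases d) (simp_all add: vv_def w_def \<rho>_def mult_ac)
    then show ?thesis by (simp add: mult_ac)
  qed
  define pos where "pos v = (let i = (THE i. i < n \<and> v \<in> xs ! i) in (i, v = t i))" for v
  have vx: "\<exists>i c. i < n \<and> v = vv i c" if "v \<in> V" for v
  proof -
    have "rung v \<in> set xs" using xs(2) that by auto
    then obtain i where "i < n" "xs ! i = rung v" by (auto simp: in_set_conv_nth n_def)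
    then have "v = vv i True \<or> v = vv i False" using rung_self[OF that] tb(1)[of i] by (auto simp: vv_def)
    then show ?thesis using \<open>i < n\<close> by blast
  qed
  have pos: "pos (vv i c) = (i, c)" if "i < n" for i c
  proof -
    have "(THE j. j < n \<and> vv i c \<in> xs ! j) = i"
    proof (rule the_equality)
      fix j assume j: "j < n \<and> vv i c \<in> xs ! j"
      then have "vv i c \<in> rung (t j)" using tb(5)[of j] by simp
      then have "rung (vv i c) = rung (t j)" by (rule rung_eq)
      then show "j = i" using vv(2)[OF that] tb(5)[of j] j xsinj that by auto
    qed (use vv(3) that in simp)
    then show ?thesis using tb(2)[OF that] by (auto simp: pos_def vv_def)
  qed
  have emb: "embeds V A (lad_verts n) (lad n \<alpha> \<beta> \<zeta>)"
    if val: "\<And>i j c d. i < n \<Longrightarrow> j < n \<Longrightarrow> A (vv i c) (vv j d) = w (i, c) * lad n \<alpha> \<beta> \<zeta> (i, c) (j, d) * cnj (w (j, d))" for \<alpha> \<beta> \<zeta>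
  proof (rule embeds_positions[of pos n w])
    show "inj_on pos V"
    proof (rule inj_onI)
      fix x y assume xy: "x \<in> V" "y \<in> V" "pos x = pos y"
      obtain i c j d where "i < n" "x = vv i c" "j < n" "y = vv j d" using vx[OF xy(1)] vx[OF xy(2)] by blast
      then show "x = y" using xy(3) pos by simp
    qed
    show "fst (pos x) < n" "w (pos x) \<in> eisenstein_units" if "x \<in> V" for x using vx[OF that] pos wu by auto
    show "A x y = w (pos x) * lad n \<alpha> \<beta> \<zeta> (pos x) (pos y) * cnj (w (pos y))" if "x \<in> V" "y \<in> V" for x y
      using vx[OF that(1)] vx[OF that(2)] pos val by auto
  qed
  have A0: "A (vv i c) (vv j d) = 0" if "i < n" "j < n" "\<not> E (xs ! i) (xs ! j)" for i j c d using EA[OF that(1,2)] that(3) by blast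
  have only: "Suc i = j \<or> i = Suc j \<or> (i = 0 \<or> i = l) \<and> (j = 0 \<or> j = l)" if "i < n" "j < n" "E (xs ! i) (xs ! j)" for i j
    using xs(4)[of i j] that l by (auto simp: n_def)
  show ?thesis
  proof (cases "n \<ge> 3 \<and> E (xs ! l) (xs ! 0)")
    case True
    then have n3: "n \<ge> 3" and El: "E (xs ! l) (xs ! 0)" by auto
    have El': "E (xs ! 0) (xs ! l)" using Esym[of l 0] El l by simp
    obtain l' where l': "l = Suc (Suc l')" using le_Suc_ex[of 2 l] n3 l(2) by auto
    \<comment> \<open>With a loop and the closing edge an end would have three neighbouring
      rungs.\<close>
    have noloop: "\<not> E (xs ! 0) (xs ! 0)" "\<not> E (xs ! l) (xs ! l)"
      using not3[of 0 0 1 l] not3[of l l "Suc l'" 0] El El' Estep(1)[of 0] Estep(2)[of "Suc l'"] l l' by auto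
    define z where "z = A (t l) (t 0) * cnj (wt l) * wt 0"
    have zu: "z \<in> eisenstein_units"
      using Au[of l 0 True True] El wtu l unfolding z_def by (auto simp: vv_def intro!: unit_mult unit_cnj)
    have cl: "A (vv l c) (vv 0 d) = w (l, c) * (z * sg c) * cnj (w (0, d))" for c d
    proof -
      have "A (vv l c) (vv 0 d) = w (l, c) * (sg c * A (t l) (t 0) * (\<lambda>_. 1) d * cnj (wt l) * wt 0) * cnj (w (0, d))"
      proof (rule spread)
        show "A (b l) y = sg False * \<rho> l * A (t l) y" if "y \<in> xs ! 0" for y
          using sides[of l 0 y True] that El l n3 by auto
        show "A (b 0) y = 1 * \<rho> 0 * A (t 0) y" if "y \<in> xs ! l" for y
          using sides[of 0 l y False] that El' l n3 by auto
      qed (use l in auto)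
      then show ?thesis by (simp add: z_def mult_ac)
    qed
    have cl': "A (vv 0 d) (vv l c) = w (0, d) * (cnj z * sg c) * cnj (w (l, c))" for c d
      using hm[of l 0 d c] cl[of c d] l by (simp add: mult_ac)
    have "A (vv i c) (vv j d) = w (i, c) * lad n 0 0 z (i, c) (j, d) * cnj (w (j, d))" if ij: "i < n" "j < n" for i j c d
    proof -
      consider "j = Suc i" | "i = Suc j" | "i = l" "j = 0" | "i = 0" "j = l" | "Suc i \<noteq> j" "i \<noteq> Suc j" "\<not> (i = l \<and> j = 0)" "\<not> (i = 0 \<and> j = l)"
        by blast
      then show ?thesis
      proof cases
        case 1
        then show ?thesis using step[of i c d] ij l n3 by (auto simp: lad_def)
      next
        case 2
        then show ?thesis using step'[of j c d] ij l n3 by (auto simp: lad_def)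
      next
        case 3
        then show ?thesis using cl[of c d] ij l n3 by (auto simp: lad_def)
      next
        case 4
        then show ?thesis using cl'[of c d] ij l n3 by (auto simp: lad_def)
      next
        case 5
        then have "\<not> E (xs ! i) (xs ! j)" using only[OF ij] noloop by auto
        then show ?thesis using A0[OF ij] 5 ij l by (auto simp: lad_def)
      qed
    qed
    from in_ladder_closed[OF n3 zu emb[OF this]] show ?thesis .
  next
    case False
    define \<alpha> where "\<alpha> = A (t 0) (t 0)"
    define \<beta> where "\<beta> = A (t l) (t l)"
    have lp0: "A (vv 0 c) (vv 0 d) = w (0, c) * \<alpha> * cnj (w (0, d))" for c d
    proof (cases "E (xs ! 0) (xs ! 0)")
      case True
      have "A (vv 0 c) (vv 0 d) = w (0, c) * ((\<lambda>_. 1) c * A (t 0) (t 0) * (\<lambda>_. 1) d * cnj (wt 0) * wt 0) * cnj (w (0, d))"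
        by (rule spread) (use sides[of 0 0 _ False] True n2 in auto)
      then show ?thesis by (simp add: \<alpha>_def wt0)
    next
      case False
      then show ?thesis using A0[of 0 0] EA'(1)[of 0 0] n2 by (simp add: \<alpha>_def)
    qed
    \<comment> \<open>On the last rung the loop takes the place of the next rung, so each bottom
      vertex contributes a sign; on the first rung it takes the place of the previous one, without
      signs.\<close>
    have lpl: "A (vv l c) (vv l d) = w (l, c) * (\<beta> * sg c * sg d) * cnj (w (l, d))" for c d
    proof (cases "E (xs ! l) (xs ! l)")
      case True
      have "A (vv l c) (vv l d) = w (l, c) * (sg c * A (t l) (t l) * sg d * cnj (wt l) * wt l) * cnj (w (l, d))"
        by (rule spread) (use sides[of l l _ True] True l in auto)
      then show ?thesis using unit_cnj_mult(2)[OF wtu[OF l(1)]] by (simp add: \<beta>_def mult_ac)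
    next
      case False
      then show ?thesis using A0[of l l] EA'(1)[of l l] l by (simp add: \<beta>_def)
    qed
    have "A (vv i c) (vv j d) = w (i, c) * lad n \<alpha> \<beta> 0 (i, c) (j, d) * cnj (w (j, d))" if ij: "i < n" "j < n" for i j c d
    proof -
      have nocl: "\<not> E (xs ! l) (xs ! 0) \<and> \<not> E (xs ! 0) (xs ! l)" if "n \<ge> 3"
        using False that Esym[of 0 l] l by auto
      consider "j = Suc i" | "i = Suc j" | "i = 0" "j = 0" | "i = l" "j = l" | "Suc i \<noteq> j" "i \<noteq> Suc j" "\<not> (i = j \<and> (i = 0 \<or> i = l))"
        by blast
      then show ?thesis
      proof cases
        case 1
        then show ?thesis using step[of i c d] ij l n2 by (auto simp: lad_def)
      next
        case 2
        then show ?thesis using step'[of j c d] ij l n2 by (auto simp: lad_def)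
      next
        case 3
        then show ?thesis using lp0[of c d] l by (auto simp: lad_def)
      next
        case 4
        then show ?thesis using lpl[of c d] l by (auto simp: lad_def)
      next
        case 5
        have "\<not> E (xs ! i) (xs ! j)"
        proof
          assume e: "E (xs ! i) (xs ! j)"
          then have ends: "i = 0 \<and> j = l \<or> i = l \<and> j = 0" using only[OF ij] 5 by auto
          then have "n \<ge> 3" using 5 l by auto
          then show False using nocl e ends by auto
        qed
        then show ?thesis using A0[OF ij] 5 ij l by (auto simp: lad_def)
      qed
    qed
    then have "embeds V A (lad_verts n) (lad n \<alpha> \<beta> 0)" by (rule emb)
    moreover have "\<alpha> \<in> {0, 1, -1}" "\<beta> \<in> {0, 1, -1}"
      using charge tb(3) n2 l(1) by (auto simp: \<alpha>_def \<beta>_def)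
    ultimately show ?thesis using in_ladder_open[of n \<alpha> \<beta> V A] n2 by auto
  qed
qed

end

subsection \<open>Entries of norm 3 and 4\<close>

text \<open>3 is ramified, and 1 + \<omega> generates the only prime above it.\<close>

lemma R_norm_three:
  assumes "z \<in> eisenstein_ints" "(cmod z)\<^sup>2 = 3"
  obtains u where "u \<in> eisenstein_units" "z = u * (1 + \<omega>)"
proof -
  obtain a b where z: "z = of_int a + of_int b * \<omega>" using assms R_iff by blast
  have "(cmod z)\<^sup>2 = of_int (a * a + a * b + b * b)" unfolding z by (rule cmod_omega_form)
  then have 3: "a * a + a * b + b * b = 3" using assms(2) by (metis of_int_eq_iff of_int_numeral)
  have "(a, b) \<in> {(1,1), (-1,2), (-2,1), (-1,-1), (1,-2), (2,-1)}"
    using small_norm_coords[of a b] 3 unfolding interval_m2_2 by auto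
  then have "z \<in> (\<lambda>u. u * (1 + \<omega>)) ` eisenstein_units"
    unfolding z eisenstein_units_def by (auto simp: omega_sq algebra_simps)
  then show ?thesis using that by blast
qed

lemma R_norm_four:
  assumes "z \<in> eisenstein_ints" "(cmod z)\<^sup>2 = 4"
  obtains u where "u \<in> eisenstein_units" "z = u * 2"
proof -
  obtain a b where z: "z = of_int a + of_int b * \<omega>" using assms R_iff by blast
  have "(cmod z)\<^sup>2 = of_int (a * a + a * b + b * b)" unfolding z by (rule cmod_omega_form)
  then have 4: "a * a + a * b + b * b = 4" using assms(2) by (metis of_int_eq_iff of_int_numeral)
  have "(a, b) \<in> {(2,0), (0,2), (-2,2), (-2,0), (0,-2), (2,-2)}"
    using small_norm_coords[of a b] 4 unfolding interval_m2_2 by auto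
  then have "z \<in> (\<lambda>u. u * 2) ` eisenstein_units"
    unfolding z eisenstein_units_def by (auto simp: algebra_simps)
  then show ?thesis using that by blast
qed

definition models :: "'v set \<Rightarrow> ('v \<Rightarrow> 'v \<Rightarrow> complex) \<Rightarrow> 'w R_graph \<Rightarrow> bool"
  where "models V A G \<longleftrightarrow> complete_on (fst G) (snd G) \<and> embeds V A (fst G) (snd G)"

section \<open>The four smallest graphs\<close>

lemma S1_entries: "fst S1 = {CHR ''a''}" "snd S1 CHR ''a'' CHR ''a'' = 2"
  by (simp_all add: S1_def letter_graph_def weight_of_def wt_def)

lemma S2_entries: "fst S2 = {CHR ''a'', CHR ''b''}" "snd S2 CHR ''a'' CHR ''a'' = 0" "snd S2 CHR ''b'' CHR ''b'' = 0"
  "snd S2 CHR ''a'' CHR ''b'' = 2" "snd S2 CHR ''b'' CHR ''a'' = 2"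
  by (simp_all add: S2_def letter_graph_def weight_of_def wt_def)

lemma S2_dagger_entries: "fst S2_dagger = {CHR ''a'', CHR ''b''}" "snd S2_dagger CHR ''a'' CHR ''a'' = -1"
  "snd S2_dagger CHR ''b'' CHR ''b'' = 1" "snd S2_dagger CHR ''b'' CHR ''a'' = 1 + \<omega>" "snd S2_dagger CHR ''a'' CHR ''b'' = 2 - \<omega>"
  by (simp_all add: S2_dagger_def letter_graph_def weight_of_def wt_def cnj_omega)

lemma S4_ddagger_entries: "fst S4_ddagger = {CHR ''a'', CHR ''b'', CHR ''c'', CHR ''d''}"
  "snd S4_ddagger CHR ''a'' CHR ''a'' = 0" "snd S4_ddagger CHR ''b'' CHR ''b'' = 0"
  "snd S4_ddagger CHR ''c'' CHR ''c'' = 0" "snd S4_ddagger CHR ''d'' CHR ''d'' = 0"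
  "snd S4_ddagger CHR ''a'' CHR ''b'' = 1" "snd S4_ddagger CHR ''b'' CHR ''a'' = 1"
  "snd S4_ddagger CHR ''c'' CHR ''d'' = 1" "snd S4_ddagger CHR ''d'' CHR ''c'' = 1"
  "snd S4_ddagger CHR ''a'' CHR ''c'' = - 1 - \<omega>" "snd S4_ddagger CHR ''c'' CHR ''a'' = \<omega> - 2"
  "snd S4_ddagger CHR ''b'' CHR ''d'' = 1 + \<omega>" "snd S4_ddagger CHR ''d'' CHR ''b'' = 2 - \<omega>"
  "snd S4_ddagger CHR ''a'' CHR ''d'' = 0" "snd S4_ddagger CHR ''d'' CHR ''a'' = 0"
  "snd S4_ddagger CHR ''b'' CHR ''c'' = 0" "snd S4_ddagger CHR ''c'' CHR ''b'' = 0"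
  by (simp_all add: S4_ddagger_def letter_graph_def weight_of_def wt_def cnj_omega)

lemma S1_complete: "complete_on (fst S1) (snd S1)"
proof -
  have "connected_on (fst S1) (snd S1)" by (rule connected_onI[of _ "''a''"]) (simp_all add: S1_entries)
  then show ?thesis unfolding complete_on_def herm_def by (simp add: S1_entries)
qed

lemma S2_complete: "complete_on (fst S2) (snd S2)"
proof -
  have "connected_on (fst S2) (snd S2)" by (rule connected_onI[of _ "''ab''"]) (auto simp: S2_entries less_Suc_eq)
  then show ?thesis unfolding complete_on_def herm_def by (simp add: S2_entries)
qed

lemma one_omega_nz: "1 + \<omega> \<noteq> 0" "\<omega> \<noteq> 2" "2 \<noteq> \<omega>" "- 1 \<noteq> \<omega>" "\<omega> \<noteq> - 1" "2 - \<omega> \<noteq> 0" "\<omega> - 2 \<noteq> 0" "- 1 - \<omega> \<noteq> 0"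
  by (auto simp: omega_def complex_eq_iff)

lemma S2_dagger_complete: "complete_on (fst S2_dagger) (snd S2_dagger)"
proof -
  have "connected_on (fst S2_dagger) (snd S2_dagger)"
    by (rule connected_onI[of _ "''ab''"]) (auto simp: S2_dagger_entries less_Suc_eq one_omega_nz)
  then show ?thesis unfolding complete_on_def herm_def
    by (simp add: S2_dagger_entries cnj_omega R_uminus R_add R_diff algebra_simps omega_sq)
qed

lemma S4_ddagger_complete: "complete_on (fst S4_ddagger) (snd S4_ddagger)"
proof -
  have "connected_on (fst S4_ddagger) (snd S4_ddagger)"
  proof (rule connected_onI[of _ "''abcd''"])
    show "\<exists>l<k. snd S4_ddagger (''abcd'' ! k) (''abcd'' ! l) \<noteq> 0" if "k < length ''abcd''" "k > 0" for k
    proof -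
      have "k < 4" using that by (simp add: numeral_eq_Suc)
      then consider "k = 1" | "k = 2" | "k = 3" using \<open>k > 0\<close> by linarith
      then show ?thesis
      proof cases
        case 1 then show ?thesis by (intro exI[of _ 0]) (simp add: S4_ddagger_entries)
      next
        case 2 then show ?thesis by (intro exI[of _ 0]) (simp add: S4_ddagger_entries one_omega_nz)
      next
        case 3 then show ?thesis by (intro exI[of _ 2]) (simp add: S4_ddagger_entries)
      qed
    qed
  qed (auto simp: S4_ddagger_entries one_omega_nz)
  then show ?thesis unfolding complete_on_def herm_def
    by (simp add: S4_ddagger_entries cnj_omega R_uminus R_add R_diff algebra_simps omega_sq)
qed

text \<open>Applied to what an entry of norm 3 leaves of its row: exactly one further entry, a
  unit.\<close>

lemma rest_one:
  fixes g :: "'a \<Rightarrow> real"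
  assumes "finite S" "\<And>x. x \<in> S \<Longrightarrow> g x \<in> {0, 1, 3, 4}" "sum g S \<le> 1" "sum g S \<noteq> 0"
  obtains c where "c \<in> S" "g c = 1" "\<And>x. x \<in> S \<Longrightarrow> x \<noteq> c \<Longrightarrow> g x = 0" "sum g S = 1"
proof -
  have pos: "0 \<le> g x" if "x \<in> S" for x using assms(2)[OF that] by auto
  obtain c where c: "c \<in> S" "g c \<noteq> 0" using assms(4) by (meson sum.neutral)
  have "g c \<le> sum g S" by (rule member_le_sum[OF c(1) _ assms(1)]) (use pos in blast)
  then have c1: "g c = 1" using assms(2)[OF c(1)] assms(3) c(2) by auto
  have "sum g S = g c + sum g (S - {c})" using sum.remove[OF assms(1) c(1)] .
  moreover have "0 \<le> sum g (S - {c})" using pos by (intro sum_nonneg) auto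
  ultimately have "sum g (S - {c}) = 0" "sum g S = 1" using c1 assms(3) by auto
  then have "g x = 0" if "x \<in> S" "x \<noteq> c" for x
    using sum_nonneg_eq_0_iff[of "S - {c}" g] assms(1) pos that by auto
  then show ?thesis using that c(1) c1 \<open>sum g S = 1\<close> by blast
qed

locale saturated =
  fixes V :: "'v set" and A :: "'v \<Rightarrow> 'v \<Rightarrow> complex"
  assumes fin: "finite V" and herm: "herm V A" and bounded: "bounded_by_2 V A"
    and conn: "connected_on V A" and sat: "saturated_on V A"
begin

definition nrm :: "'v \<Rightarrow> 'v \<Rightarrow> real" where "nrm i j = (cmod (A i j))\<^sup>2"

lemma entry_sym: "i \<in> V \<Longrightarrow> j \<in> V \<Longrightarrow> A i j = cnj (A j i)" using hermD(2)[OF herm] .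

lemma entry_R: "i \<in> V \<Longrightarrow> j \<in> V \<Longrightarrow> A i j \<in> eisenstein_ints" using hermD(1)[OF herm] .

lemma row_le: "i \<in> V \<Longrightarrow> sum (nrm i) V \<le> 4" using row_bound(1)[OF fin herm bounded] by (simp add: nrm_def)

lemma row_orth: "i \<in> V \<Longrightarrow> sum (nrm i) V = 4 \<Longrightarrow> k \<in> V \<Longrightarrow> k \<noteq> i \<Longrightarrow> (\<Sum>j\<in>V. A k j * cnj (A i j)) = 0"
  using row_bound(2)[OF fin herm bounded] by (simp add: nrm_def)

lemma row_not3: "i \<in> V \<Longrightarrow> sum (nrm i) V \<noteq> 3" using sat by (simp add: saturated_on_def nrm_def)

lemma nrm_values:
  assumes "i \<in> V" "j \<in> V"
  shows "nrm i j \<in> {0, 1, 3, 4}"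
proof -
  have "nrm i j \<le> sum (nrm i) V" by (rule member_le_sum[OF assms(2) _ fin]) (simp add: nrm_def)
  then show ?thesis using row_le[OF assms(1)] R_norm_values[OF entry_R[OF assms]] by (simp add: nrm_def)
qed

lemma nrm_0: "nrm i j = 0 \<longleftrightarrow> A i j = 0" by (simp add: nrm_def)

lemma nrm_sym: "i \<in> V \<Longrightarrow> j \<in> V \<Longrightarrow> nrm i j = nrm j i"
  unfolding nrm_def by (subst entry_sym) auto

lemma closed_V: "X \<subseteq> V \<Longrightarrow> X \<noteq> {} \<Longrightarrow> (\<And>i j. i \<in> X \<Longrightarrow> j \<in> V - X \<Longrightarrow> A i j = 0) \<Longrightarrow> V = X"
  using conn unfolding connected_on_def by blast

lemma charge_int: "i \<in> V \<Longrightarrow> \<exists>k. A i i = of_int k"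
  using R_real_int[OF entry_R[of i i]] entry_sym[of i i, symmetric] by blast

lemma charge_square:
  assumes "i \<in> V" "nrm i i = of_int m"
  obtains k where "A i i = of_int k" "k * k = m"
proof -
  obtain k where k: "A i i = of_int k" using charge_int[OF assms(1)] ..
  have "nrm i i = of_int (k * k)" unfolding nrm_def k by (simp add: power2_eq_square)
  then have "real_of_int (k * k) = real_of_int m" using assms(2) by metis
  then have "k * k = m" by (simp only: of_int_eq_iff)
  then show ?thesis using that k by blast
qed

text \<open>Such an entry exhausts the rows of both its vertices, so nothing else can be connected
  to them.\<close>

lemma norm_four:
  assumes ij: "i \<in> V" "j \<in> V" "nrm i j = 4"
  shows "models V A S1 \<or> models V A S2"
proof -
  have rest: "A k x = 0" if "k \<in> V" "l \<in> V" "nrm k l = 4" "x \<in> V" "x \<noteq> l" for k l x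
  proof -
    have "sum (nrm k) V = nrm k l + sum (nrm k) (V - {l})" using sum.remove[OF fin that(2)] .
    moreover have "nrm k x \<le> sum (nrm k) (V - {l})"
      by (rule member_le_sum) (use that fin in \<open>auto simp: nrm_def\<close>)
    ultimately have "nrm k x \<le> 0" using row_le[OF that(1)] that(3) by simp
    then show ?thesis by (simp add: nrm_def)
  qed
  show ?thesis
  proof (cases "i = j")
    case True
    have V: "V = {i}" by (rule closed_V) (use rest[OF ij] ij True in auto)
    have "nrm i i = of_int 4" using ij(3) True by simp
    then obtain k where k: "A i i = of_int k" "k * k = 4" by (rule charge_square[OF ij(1)])
    then have "(k - 2) * (k + 2) = 0" by (simp add: algebra_simps)
    then have "k - 2 = 0 \<or> k + 2 = 0" by (simp only: mult_eq_0_iff)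
    then have "k = 2 \<or> k = -2" by arith
    then have "A i i = 2 \<or> A i i = -2" using k(1) by auto
    then obtain s :: complex where s: "s \<in> {1, -1}" "A i i = s * 2" by auto
    have "embeds V A (fst S1) (snd S1)"
      by (rule embedsI[of "\<lambda>_. CHR ''a''" _ _ "\<lambda>_. 1" s id]) (use V s in \<open>auto simp: S1_entries\<close>)
    then show ?thesis using S1_complete by (simp add: models_def)
  next
    case False
    have ji: "nrm j i = 4" using ij nrm_sym by simp
    have V: "V = {i, j}" by (rule closed_V) (use rest[OF ij] rest[OF ij(2,1) ji] ij in auto)
    obtain u where u: "u \<in> eisenstein_units" "A i j = u * 2" using R_norm_four[OF entry_R[OF ij(1,2)]] ij(3) by (auto simp: nrm_def)
    have "A i i = 0" "A j j = 0" "A j i = cnj u * 2" using rest[OF ij ij(1)] rest[OF ij(2,1) ji ij(2)] False entry_sym[OF ij(2,1)] u by auto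
    then have "embeds V A (fst S2) (snd S2)"
      by (intro embedsI[of "\<lambda>x. if x = i then CHR ''a'' else CHR ''b''" _ _ "\<lambda>x. if x = i then u else 1" 1 id])
        (use V u False in \<open>auto simp: S2_entries inj_on_def\<close>)
    then show ?thesis using S2_complete by (simp add: models_def)
  qed
qed

lemma pair_charged:
  assumes ab: "V = {a, b}" "a \<noteq> b" "A a a = -1" "A b b = 1" "nrm a b = 3"
  shows "models V A S2_dagger"
proof -
  have V: "a \<in> V" "b \<in> V" using ab by auto
  obtain u where u: "u \<in> eisenstein_units" "A b a = u * (1 + \<omega>)"
    using R_norm_three[OF entry_R[OF V(2,1)]] nrm_sym[OF V] ab(5) by (auto simp: nrm_def)
  have "A a b = cnj u * (2 - \<omega>)" using entry_sym[OF V] u by (simp add: cnj_omega)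
  then have "embeds V A (fst S2_dagger) (snd S2_dagger)"
    by (intro embedsI[of "\<lambda>x. if x = a then CHR ''a'' else CHR ''b''" _ _ "\<lambda>x. if x = a then 1 else u" 1 id])
      (use ab u unit_cnj_mult[OF u(1)] in \<open>auto simp: S2_dagger_entries inj_on_def mult.commute\<close>)
  then show ?thesis using S2_dagger_complete by (simp add: models_def)
qed

text \<open>Saturation excludes row norm 3, so \<open>a\<close> and \<open>b\<close> have one more
  unit entry each, at \<open>c\<close> and \<open>d\<close>. By orthogonality either both entries
  are charges, which gives S_2^dagger, or the four vertices are distinct and close up to a cycle,
  which gives S_4^ddagger.\<close>

lemma norm_three:
  assumes ab: "a \<in> V" "b \<in> V" "nrm a b = 3"
  shows "models V A S2_dagger \<or> models V A S4_ddagger"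
proof -
  have ne: "a \<noteq> b"
  proof
    assume "a = b"
    then have "nrm a a = of_int 3" using ab(3) by simp
    then obtain k :: int where k: "k * k = 3" by (rule charge_square[OF ab(1)])
    have "\<bar>k\<bar> \<le> 1 \<or> \<bar>k\<bar> \<ge> 2" by linarith
    then show False
    proof
      assume "\<bar>k\<bar> \<ge> 2"
      then have "2 * 2 \<le> \<bar>k\<bar> * \<bar>k\<bar>" by (intro mult_mono) auto
      then show False using k by simp
    next
      assume "\<bar>k\<bar> \<le> 1"
      then have "\<bar>k\<bar> * \<bar>k\<bar> \<le> 1 * 1" by (intro mult_mono) auto
      then show False using k by simp
    qed
  qed
  have row: "\<exists>c\<in>V. c \<noteq> y \<and> nrm x c = 1 \<and> (\<forall>z\<in>V. z \<noteq> y \<longrightarrow> z \<noteq> c \<longrightarrow> A x z = 0) \<and> sum (nrm x) V = 4"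
    if xy: "x \<in> V" "y \<in> V" "nrm x y = 3" for x y
  proof -
    have s: "sum (nrm x) V = 3 + sum (nrm x) (V - {y})" using sum.remove[OF fin xy(2), of "nrm x"] xy(3) by simp
    obtain c where "c \<in> V - {y}" "nrm x c = 1" "\<And>z. z \<in> V - {y} \<Longrightarrow> z \<noteq> c \<Longrightarrow> nrm x z = 0" "sum (nrm x) (V - {y}) = 1"
      by (rule rest_one[of "V - {y}" "nrm x"]) (use s fin row_le[OF xy(1)] row_not3[OF xy(1)] nrm_values[OF xy(1)] in auto)
    then show ?thesis using s nrm_0 by (intro bexI[of _ c]) auto
  qed
  have ba: "nrm b a = 3" using nrm_sym[OF ab(1,2)] ab(3) by simp
  obtain c where c: "c \<in> V" "c \<noteq> b" "nrm a c = 1" "\<And>z. z \<in> V \<Longrightarrow> z \<noteq> b \<Longrightarrow> z \<noteq> c \<Longrightarrow> A a z = 0" "sum (nrm a) V = 4"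
    using row[OF ab] by blast
  obtain d where d: "d \<in> V" "d \<noteq> a" "nrm b d = 1" "\<And>z. z \<in> V \<Longrightarrow> z \<noteq> a \<Longrightarrow> z \<noteq> d \<Longrightarrow> A b z = 0" "sum (nrm b) V = 4"
    using row[OF ab(2,1) ba] by blast
  have oa: "A x b * cnj (A a b) + A x c * cnj (A a c) = 0" if "x \<in> V" "x \<noteq> a" for x
  proof -
    have "(\<Sum>j\<in>V. A x j * cnj (A a j)) = (\<Sum>j\<in>{b, c}. A x j * cnj (A a j))"
      using c ab fin by (intro sum.mono_neutral_right) auto
    then show ?thesis using row_orth[OF ab(1) c(5) that] c(2) by auto
  qed
  have ob: "A x a * cnj (A b a) + A x d * cnj (A b d) = 0" if "x \<in> V" "x \<noteq> b" for x
  proof -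
    have "(\<Sum>j\<in>V. A x j * cnj (A b j)) = (\<Sum>j\<in>{a, d}. A x j * cnj (A b j))"
      using d ab fin by (intro sum.mono_neutral_right) auto
    then show ?thesis using row_orth[OF ab(2) d(5) that] d(2) by auto
  qed
  have nz: "A a b \<noteq> 0" "A b a \<noteq> 0" "A a c \<noteq> 0" "A b d \<noteq> 0"
    using ab(3) ba c(3) d(3) nrm_0[of a b] nrm_0[of b a] nrm_0[of a c] nrm_0[of b d] by auto
  show ?thesis
  proof (cases "c = a \<or> d = b")
    case True
    have cd: "c = a" "d = b"
    proof -
      have "A b b \<noteq> 0" if "c = a" using oa[OF ab(2) ne[symmetric]] nz that by auto
      then have 1: "d = b" if "c = a" using d(4)[OF ab(2)] ne that by auto
      have "A a a \<noteq> 0" if "d = b" using ob[OF ab(1) ne] nz that by auto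
      then have "c = a" if "d = b" using c(4)[OF ab(1)] ne that by auto
      then show "c = a" "d = b" using 1 True by auto
    qed
    have V: "V = {a, b}" by (rule closed_V) (use c d cd ab in auto)
    have Aba: "A b a = cnj (A a b)" using entry_sym[OF ab(2,1)] .
    have "A b a * cnj (A a a) + A b b * A b a = 0" using oa[OF ab(2) ne[symmetric]] cd Aba by (simp add: add.commute)
    moreover have "cnj (A a a) = A a a" using entry_sym[OF ab(1) ab(1)] by (rule sym)
    ultimately have "A b a * (A a a + A b b) = 0" by (simp add: algebra_simps)
    then have opp: "A b b = - A a a" using nz by (simp add: add_eq_0_iff)
    have "nrm a a = of_int 1" using c(3) cd by simp
    then obtain k where k: "A a a = of_int k" "k * k = 1" by (rule charge_square[OF ab(1)])
    then have "k = 1 \<or> k = -1" by (metis zmult_eq_1_iff)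
    then show ?thesis
    proof
      assume "k = -1"
      then show ?thesis using pair_charged[OF V ne] k opp ab(3) by simp
    next
      assume "k = 1"
      then show ?thesis using pair_charged[of b a] V ne k opp ba by (simp add: insert_commute)
    qed
  next
    case False
    then have ca: "c \<noteq> a" "d \<noteq> b" by auto
    have cd: "c \<noteq> d"
    proof
      assume "c = d"
      then have "A b b = 0" using d(4)[OF ab(2)] ne ca by auto
      then show False using oa[OF ab(2) ne[symmetric]] nz \<open>c = d\<close> by simp
    qed
    have z: "A a a = 0" "A a d = 0" "A b b = 0" "A b c = 0"
      using c(4)[OF ab(1)] c(4)[OF d(1)] d(4)[OF ab(2)] d(4)[OF c(1)] ne ca cd by auto
    have zz: "A d a = 0" "A c b = 0" using entry_sym[OF d(1) ab(1)] entry_sym[OF c(1) ab(2)] z by auto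
    have cc: "A c c = 0" using oa[OF c(1) ca(1)] nz zz by simp
    have dd: "A d d = 0" using ob[OF d(1) ca(2)] nz zz by simp
    have xc: "A c x = 0" "A d x = 0" if "x \<in> V" "x \<notin> {a, b, c, d}" for x
    proof -
      have "A x a = 0" "A x b = 0" using entry_sym[OF that(1) ab(1)] entry_sym[OF that(1) ab(2)] c(4)[OF that(1)] d(4)[OF that(1)] that(2) by auto
      then have "A x c = 0" "A x d = 0" using oa[OF that(1)] ob[OF that(1)] that(2) nz by auto
      then show "A c x = 0" "A d x = 0" using entry_sym[OF c(1) that(1)] entry_sym[OF d(1) that(1)] by auto
    qed
    have V: "V = {a, b, c, d}" by (rule closed_V) (use c d ab xc in auto)
    have unit: "x \<in> eisenstein_units" if "x \<in> eisenstein_ints" "(cmod x)\<^sup>2 = 1" for x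
      using R_unit_iff[of x] that by (simp add: power2_eq_1_iff) (smt (verit) norm_ge_zero)
    obtain t where t: "t \<in> eisenstein_units" "A a b = t * (1 + \<omega>)" using R_norm_three[OF entry_R[OF ab(1,2)]] ab(3) by (auto simp: nrm_def)
    \<comment> \<open>These units give the edges ab, ac and bd the listed weights; the weight of cd
      is then forced by orthogonality of the rows of \<open>a\<close> and \<open>d\<close>.\<close>
    define ub where "ub = - cnj t"
    define uc where "uc = cnj (A a c)"
    define ud where "ud = cnj (A b d) * ub"
    have bdu: "A b d \<in> eisenstein_units" and acu: "A a c \<in> eisenstein_units"
      using unit[OF entry_R[OF ab(2) d(1)]] unit[OF entry_R[OF ab(1) c(1)]] c(3) d(3) by (auto simp: nrm_def)
    have u: "ub \<in> eisenstein_units" "uc \<in> eisenstein_units" "ud \<in> eisenstein_units"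
      using t bdu acu by (auto simp: ub_def uc_def ud_def intro!: unit_mult unit_cnj unit_uminus)
    have eab: "A a b = (- 1 - \<omega>) * cnj ub" using t by (simp add: ub_def algebra_simps)
    have eac: "A a c = cnj uc" by (simp add: uc_def)
    have ebd: "A b d = ub * cnj ud"
    proof -
      have "ub * cnj ud = A b d * (ub * cnj ub)" by (simp add: ud_def mult_ac)
      then show ?thesis using unit_cnj_mult(1)[OF u(1)] by simp
    qed
    have ecd: "A c d = uc * (1 + \<omega>) * cnj ud"
    proof -
      have "A d b * cnj (A a b) * A a c + A d c * (cnj (A a c) * A a c) = 0"
        using oa[OF d(1,2)] by (simp add: distrib_right[symmetric] mult.assoc[symmetric])
      then have "A d c = - (A d b * cnj (A a b) * A a c)" using unit_cnj_mult(2)[OF acu] by (simp add: add_eq_0_iff add.commute)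
      then have "cnj (A d c) = - (cnj (A d b) * A a b * cnj (A a c))" by simp
      then have "A c d = - (A b d * A a b * cnj (A a c))" using entry_sym[OF c(1) d(1)] entry_sym[OF ab(2) d(1)] by simp
      also have "\<dots> = (ub * cnj ub) * (uc * (1 + \<omega>) * cnj ud)" unfolding eab eac ebd by (simp add: algebra_simps)
      finally show ?thesis using unit_cnj_mult(1)[OF u(1)] by simp
    qed
    have rev: "A b a = ub * (\<omega> - 2)" "A c a = uc" "A d b = ud * cnj ub" "A d c = ud * (2 - \<omega>) * cnj uc"
      using entry_sym[OF ab(2,1)] entry_sym[OF c(1) ab(1)] entry_sym[OF d(1) ab(2)] entry_sym[OF d(1) c(1)] eab eac ebd ecd
      by (simp_all add: cnj_omega algebra_simps)
    \<comment> \<open>In the listed graph the norm 3 edge at its vertex a leads to c, so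
      \<open>b\<close> goes to c and \<open>c\<close> to b.\<close>
    define f where "f x = (if x = a then CHR ''a'' else if x = b then CHR ''c'' else if x = c then CHR ''b'' else CHR ''d'')" for x
    define v where "v x = (if x = a then 1 else if x = b then ub else if x = c then uc else ud)" for x
    have fv: "f a = CHR ''a''" "f b = CHR ''c''" "f c = CHR ''b''" "f d = CHR ''d''" "v a = 1" "v b = ub" "v c = uc" "v d = ud"
      using ne ca cd c d by (auto simp: f_def v_def)
    have "embeds V A (fst S4_ddagger) (snd S4_ddagger)"
    proof (rule embedsI[of f _ _ v 1 id])
      show "inj_on f V" using V fv by (auto simp: inj_on_def)
      show "f i \<in> fst S4_ddagger" "v i \<in> eisenstein_units" if "i \<in> V" for i
        using that V fv u by (auto simp: S4_ddagger_entries)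
      show "A i j = 1 * id (v i * snd S4_ddagger (f i) (f j) * cnj (v j))" if "i \<in> V" "j \<in> V" for i j
      proof -
        have "i = a \<or> i = b \<or> i = c \<or> i = d" "j = a \<or> j = b \<or> j = c \<or> j = d" using that V by auto
        then show ?thesis
          by (elim disjE; simp only: fv S4_ddagger_entries id_apply z zz cc dd eab eac ebd ecd rev; simp)
      qed
    qed auto
    then show ?thesis using S4_ddagger_complete by (simp add: models_def)
  qed
qed

end

subsection \<open>Classification of saturated weights\<close>

definition listed :: "'v set \<Rightarrow> ('v \<Rightarrow> 'v \<Rightarrow> complex) \<Rightarrow> bool"
  where "listed V A \<longleftrightarrow> in_ladder V A \<or>
    (\<exists>G\<in>{S1, S2, S2_dagger, S4_ddagger, S5, S6, S6_dagger, S7, S8, S8_prime}. models V A G) \<or>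
    (\<exists>G\<in>{S10, S12, S14, S16}. models V A G)"

definition codes :: "eis list list set"
  where "codes = {gS5, gS6, gS6d, gS7, gS8, gS8p, gS10, gS12, gS14, gS16, gC0, gC1, gT0, gT1}"

definition ladder_pos :: "nat \<Rightarrow> nat \<times> bool" where "ladder_pos i = (i div 2, even i)"

lemma ladder_pos_inj: "inj_on ladder_pos S"
  by (auto simp: inj_on_def ladder_pos_def) (metis div_mult_mod_eq even_iff_mod_2_eq_zero odd_iff_mod_2_eq_one)

lemma ladder_code:
  assumes g: "length G = 2 * k" and e: "embeds V A {..<length G} (\<lambda>i j. val (G ! i ! j))"
    and v: "\<And>i j. i < 2 * k \<Longrightarrow> j < 2 * k \<Longrightarrow> lad k \<alpha> \<beta> \<zeta> (ladder_pos i) (ladder_pos j) = val (G ! i ! j)"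
  shows "embeds V A (lad_verts k) (lad k \<alpha> \<beta> \<zeta>)"
  by (rule embeds_bij[OF ladder_pos_inj _ _ e]) (use g v in \<open>auto simp: ladder_pos_def lad_verts_def\<close>)

lemma below_four: "(i::nat) < 4 \<Longrightarrow> i = 0 \<or> i = 1 \<or> i = 2 \<or> i = 3" by arith

lemma below_eight: "(i::nat) < 8 \<Longrightarrow> i = 0 \<or> i = 1 \<or> i = 2 \<or> i = 3 \<or> i = 4 \<or> i = 5 \<or> i = 6 \<or> i = 7" by arith

lemma gC0_lad: "i < 4 \<Longrightarrow> j < 4 \<Longrightarrow> lad 2 1 1 0 (ladder_pos i) (ladder_pos j) = val (gC0 ! i ! j)"
  by (drule below_four, drule below_four, elim disjE; simp add: lad_def gC0_def ladder_pos_def sg_def)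

lemma gC1_lad: "i < 4 \<Longrightarrow> j < 4 \<Longrightarrow> lad 2 1 (-1) 0 (ladder_pos i) (ladder_pos j) = val (gC1 ! i ! j)"
  by (drule below_four, drule below_four, elim disjE; simp add: lad_def gC1_def ladder_pos_def sg_def)

lemma gT0_lad: "i < 8 \<Longrightarrow> j < 8 \<Longrightarrow> lad 4 0 0 1 (ladder_pos i) (ladder_pos j) = val (gT0 ! i ! j)"
  by (drule below_eight, drule below_eight, elim disjE; simp add: lad_def gT0_def ladder_pos_def sg_def)

lemma gT1_lad: "i < 8 \<Longrightarrow> j < 8 \<Longrightarrow> lad 4 0 0 \<omega> (ladder_pos i) (ladder_pos j) = val (gT1 ! i ! j)"
  by (drule below_eight, drule below_eight, elim disjE; simp add: lad_def gT1_def ladder_pos_def sg_def cnj_omega)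

lemma omega_unit: "\<omega> \<in> eisenstein_units" by (simp add: eisenstein_units_def)

lemma code_listed:
  assumes G: "G \<in> codes" and e: "embeds V A {..<length G} (\<lambda>i j. val (G ! i ! j))"
  shows "listed V A"
proof -
  have m: "listed V A" if "G = gS5 \<or> G = gS6 \<or> G = gS6d \<or> G = gS7 \<or> G = gS8 \<or> G = gS8p \<or> G = gS10 \<or> G = gS12 \<or> G = gS14 \<or> G = gS16"
    using that e by (elim disjE) (simp_all add: listed_def models_def S5_model S6_model S6d_model S7_model S8_model S8p_model
      S10_model S12_model S14_model S16_model)
  have C0: "listed V A" if "G = gC0"
    using in_ladder_open[of 2 1 1 V A] ladder_code[of gC0 2 V A 1 1 0] gC0_lad e that
    by (auto simp: listed_def gC0_def)
  have C1: "listed V A" if "G = gC1"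
    using in_ladder_open[of 2 1 "-1" V A] ladder_code[of gC1 2 V A 1 "-1" 0] gC1_lad e that
    by (auto simp: listed_def gC1_def)
  have T0: "listed V A" if "G = gT0"
    using in_ladder_closed[of 4 1 V A] ladder_code[of gT0 4 V A 0 0 1] gT0_lad e that
    by (auto simp: listed_def gT0_def)
  have T1: "listed V A" if "G = gT1"
    using in_ladder_closed[of 4 \<omega> V A] ladder_code[of gT1 4 V A 0 0 \<omega>] gT1_lad e that omega_unit
    by (auto simp: listed_def gT1_def)
  show ?thesis using G m C0 C1 T0 T1 unfolding codes_def by blast
qed

section \<open>Soundness of the certificates\<close>

definition hcertified :: "eis list list list \<Rightarrow> bool"
  where "hcertified L \<longleftrightarrow> (\<exists>qs. list_all (\<lambda>(G, q). G \<in> codes) qs \<and> list_all2 (\<lambda>B (G, q). hcert B G q) L qs)"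

text \<open>The two parts settle the two outcomes of \<open>closed_pair_cases\<close>: a bipartite
  graph, or a Hermitian matrix obtained by matching columns with rows. Distinct columns are required
  by \<open>realizes_hs\<close>.\<close>

definition wgood :: "eis list list \<Rightarrow> bool"
  where "wgood W \<longleftrightarrow> (\<exists>G\<in>codes. \<exists>q. hcert (dblc W) G q) \<and> distinct (tr W) \<and> hcertified (hs (length W) (tr W) [])"

lemma wgoodI:
  assumes "hcert (dblc W) G q" "G \<in> codes" "distinct (tr W)" "list_all2 (\<lambda>B (G, q). hcert B G q) (hs n (tr W) []) qs"
    "length W = n" "list_all (\<lambda>(G, q). G \<in> codes) qs"
  shows "wgood W"
  using assms unfolding wgood_def hcertified_def by blast

lemma wgood_E4: "wgood E4"
  by (rule wgoodI[OF dbl_E4 _ _ hs_E4]) (simp_all add: codes_def E4_def)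
lemma wgood_W5: "wgood W5"
  by (rule wgoodI[OF dbl_W5 _ _ hs_W5]) (simp_all add: codes_def W5_def)
lemma wgood_W6: "wgood W6"
  by (rule wgoodI[OF dbl_W6 _ _ hs_W6]) (simp_all add: codes_def W6_def)
lemma wgood_W7: "wgood W7"
  by (rule wgoodI[OF dbl_W7 _ _ hs_W7]) (simp_all add: codes_def W7_def)
lemma wgood_W8: "wgood W8"
  by (rule wgoodI[OF dbl_W8 _ _ hs_W8]) (simp_all add: codes_def W8_def)
lemma wgood_H0: "wgood H0"
  by (rule wgoodI[OF dbl_H0 _ _ hs_H0]) (simp_all add: codes_def H0_def)
lemma wgood_H1: "wgood H1"
  by (rule wgoodI[OF dbl_H1 _ _ hs_H1]) (simp_all add: codes_def H1_def)

lemmas wgoods = wgood_E4 wgood_W5 wgood_W6 wgood_W7 wgood_W8 wgood_H0 wgood_H1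

text \<open>The nonempty lists prevent the array \<open>[]\<close>, the sign of exhausted fuel, from
  being certified.\<close>

definition good_cert :: "(eis list list \<times> (nat \<times> eis) list \<times> (nat \<times> eis) list) + (eis list list \<times> eis \<times> (nat \<times> eis) list) \<Rightarrow> bool"
  where "good_cert q = (case q of Inl (W, rp, cp) \<Rightarrow> wgood W \<and> rp \<noteq> [] | Inr (G, s, fp) \<Rightarrow> G \<in> codes \<and> fp \<noteq> [])"

definition certified :: "eis list list list \<Rightarrow> bool"
  where "certified L \<longleftrightarrow> (\<exists>qs. list_all good_cert qs \<and> list_all2 chk_final L qs)"

lemma certifiedI: "list_all2 chk_final L qs \<Longrightarrow> list_all good_cert qs \<Longrightarrow> certified L"
  unfolding certified_def by blast

lemma certified_1: "certified (search 60 [[P0,P0,P0,P0],[P0,P2,P4,N]] [False,False] [False,False,False,False])"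
  by (rule certifiedI[OF finals_1]) (simp add: good_cert_def codes_def wgoods)
lemma certified_2: "certified (search 60 [[P0,P0,P0,P0],[P0,P4,P2,N]] [False,False] [False,False,False,False])"
  by (rule certifiedI[OF finals_2]) (simp add: good_cert_def codes_def wgoods)
lemma certified_3: "certified (search 60 [[P0,P0,P0,P0],[P0,P3,N,N],[P0,N,P3,N]] [False,False,False] [False,False,False,False])"
  by (rule certifiedI[OF finals_3]) (simp add: good_cert_def codes_def wgoods)
lemma certified_4: "certified (concat (map small_rows [P0,P1,P2,P3,P4,P5]))"
  by (rule certifiedI[OF finals_4]) (simp add: good_cert_def codes_def wgoods)

lemma list_all2_in_set: "list_all2 P xs ys \<Longrightarrow> x \<in> set xs \<Longrightarrow> \<exists>y\<in>set ys. P x y"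
  by (induction rule: list_all2_induct) auto

lemma certified_mem: "certified L \<Longrightarrow> M \<in> set L \<Longrightarrow> \<exists>q. good_cert q \<and> chk_final M q"
  unfolding certified_def list_all_iff by (blast dest: list_all2_in_set)

lemma certified_nonempty:
  assumes "certified L"
  shows "[] \<notin> set L"
proof
  assume "[] \<in> set L"
  then obtain q where q: "good_cert q" "chk_final [] q" using certified_mem[OF assms] by blast
  show False
  proof (cases q)
    case (Inl a)
    then show ?thesis using q by (cases a) (auto simp: good_cert_def chk_final_def wcert_def)
  next
    case (Inr a)
    then show ?thesis using q by (cases a) (auto simp: good_cert_def chk_final_def hcert_def dblc_def)
  qed
qed

text \<open>Against the all-ones row, three units with sum 0 starting at 1 are the cube roots of
  unity, two are 1 and -1, and four that begin with 1, -1 end in an opposite pair.\<close>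

lemma row_one_candidates:
  "list_all (\<lambda>x. (x ! 0 \<noteq> N \<and> x ! 1 \<noteq> N \<and> x ! 2 \<noteq> N \<and> x ! 3 = N \<longrightarrow> x = [P0,P2,P4,N] \<or> x = [P0,P4,P2,N]) \<and>
     (x ! 0 \<noteq> N \<and> x ! 1 \<noteq> N \<and> x ! 2 = N \<and> x ! 3 = N \<longrightarrow> x = [P0,P3,N,N]) \<and>
     (x ! 0 \<noteq> N \<and> x ! 1 = P3 \<and> x ! 2 \<noteq> N \<and> x ! 3 \<noteq> N \<longrightarrow> x = [P0,P3,x ! 2,emul P3 (x ! 2)]))
   (newrows [[P0,P0,P0,P0]] [False,False,False,False] [True,False,False,False])"
  by code_simp

lemma row_two_candidates:
  "list_all (\<lambda>x. x ! 0 \<noteq> N \<and> x ! 1 = N \<and> x ! 2 \<noteq> N \<and> x ! 3 = N \<longrightarrow> x = [P0,N,P3,N])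
   (newrows [[P0,P0,P0,P0],[P0,P3,N,N]] [False,False,False,False] [True,False,False,False])"
  by code_simp

lemma val_minus_1: "val x = -1 \<Longrightarrow> x = P3"
  by (cases x) (auto simp: omega_def complex_eq_iff)

text \<open>Four vectors of length 1 with sum 0 form a rhombus, so one of them is opposite to 1;
  here this is checked on the finitely many codes.\<close>

lemma units_opposite:
  assumes "q \<in> eisenstein_units" "r \<in> eisenstein_units" "s \<in> eisenstein_units" "1 + q + r + s = 0"
  shows "q = -1 \<or> r = -1 \<or> s = -1"
proof -
  obtain x y z where v: "val x = q" "val y = r" "val z = s" using val_surj assms(1-3) by meson
  have "pair_val (1, 0) = 1" by (simp add: pair_val_def)
  then have "pair_val (eadd x (eadd y (eadd z (1, 0)))) = q + (r + (s + 1))" by (simp add: pair_val_eadd v)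
  also have "\<dots> = 0" using assms(4) by (simp add: add_ac)
  finally have "pair_val (eadd x (eadd y (eadd z (1, 0)))) = 0" .
  then have "eadd x (eadd y (eadd z (1, 0))) = (0, 0)" unfolding pair_val_0 .
  moreover have "x \<noteq> N" "y \<noteq> N" "z \<noteq> N" using v assms(1-3) unit_nz val_0_iff by auto
  ultimately have "x = P3 \<or> y = P3 \<or> z = P3" by (cases x; cases y; cases z; simp)
  then show ?thesis using v by auto
qed

context frame
begin

lemma codes_hlisted: "hrealizes B xs w \<Longrightarrow> hcert B G q \<Longrightarrow> G \<in> codes \<Longrightarrow> listed V A"
  by (cases q) (use hcert_embeds code_listed in blast)

text \<open>A certificate of the second kind treats only the double cover. That suffices for an
  array that is not square, because its two sides cannot both enumerate \<open>V\<close>.\<close>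

lemma final_listed:
  assumes con: "connected_on V A" and r: "realizes M \<rho> \<gamma> u v" and c: "closed_pair \<rho> \<gamma>"
    and q: "good_cert q" "chk_final M q"
  shows "listed V A"
proof (cases q)
  case (Inl a)
  obtain W rp cp where a: "a = (W, rp, cp)" by (cases a) auto
  have W: "wgood W" "wcert M W (rp, cp)" using q Inl a by (auto simp: good_cert_def chk_final_def)
  obtain \<rho>' \<gamma>' u' v' where r': "realizes W \<rho>' \<gamma>' u' v'" "closed_pair \<rho>' \<gamma>'" using realizes_perm[OF r c W(2)] by blast
  from closed_pair_cases[OF con r'] show ?thesis
  proof
    assume "set \<rho>' \<inter> set \<gamma>' = {} \<and> set \<rho>' \<union> set \<gamma>' = V"
    then obtain xs w where "hrealizes (dblc W) xs w" using realizes_double[OF r'] by blast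
    then show ?thesis using W(1) codes_hlisted unfolding wgood_def by blast
  next
    assume "set \<rho>' = V \<and> set \<gamma>' = V"
    moreover have "distinct (tr W)" using W(1) by (simp add: wgood_def)
    ultimately obtain B xs w where B: "B \<in> set (hs (length W) (tr W) [])" "hrealizes B xs w"
      using realizes_hs[OF r'(1)] by blast
    obtain qs where qs: "list_all (\<lambda>(G, q). G \<in> codes) qs" "list_all2 (\<lambda>B (G, q). hcert B G q) (hs (length W) (tr W) []) qs"
      using W(1) unfolding wgood_def hcertified_def by blast
    obtain y where "y \<in> set qs" "case y of (G, q) \<Rightarrow> hcert B G q" using list_all2_in_set[OF qs(2) B(1)] by blast
    moreover from this have "fst y \<in> codes" using qs(1) by (auto simp: list_all_iff)
    ultimately show ?thesis using codes_hlisted[OF B(2)] by (cases y) auto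
  qed
next
  case (Inr a)
  obtain G s fp where a: "a = (G, s, fp)" by (cases a) auto
  have G: "G \<in> codes" "hcert (dblc M) G (s, fp)" "length M \<noteq> length (hd M)"
    using q Inr a by (auto simp: good_cert_def chk_final_def)
  have R: "distinct \<rho>" "distinct \<gamma>" "length M = length \<rho>" "\<rho> \<noteq> []" "\<And>r. r \<in> set M \<Longrightarrow> length r = length \<gamma>"
    using r unfolding realizes_def by blast+
  have "hd M \<in> set M" using R(3,4) by (cases M) auto
  then have "length (hd M) = length \<gamma>" by (rule R(5))
  then have "length \<rho> \<noteq> length \<gamma>" using G(3) R(3) by simp
  then have "\<not> (set \<rho> = V \<and> set \<gamma> = V)" using distinct_card[OF R(1)] distinct_card[OF R(2)] by auto
  then obtain xs w where "hrealizes (dblc M) xs w"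
    using closed_pair_cases[OF con r c] realizes_double[OF r c] by blast
  then show ?thesis using G(1,2) codes_hlisted by blast
qed

lemma search_listed:
  assumes con: "connected_on V A" and r: "realizes M \<rho> \<gamma> u v"
    and L: "certified (search f M (replicate (length \<rho>) False) (replicate (length \<gamma>) False))"
  shows "listed V A"
proof -
  have "\<exists>M'\<in>set (search f M (replicate (length \<rho>) False) (replicate (length \<gamma>) False)).
      \<exists>\<rho> \<gamma> u v. realizes M' \<rho> \<gamma> u v \<and> closed_pair \<rho> \<gamma>"
    using search_complete[OF r, of "replicate (length \<rho>) False" "replicate (length \<gamma>) False" f] certified_nonempty[OF L] by auto
  then show ?thesis using certified_mem[OF L] final_listed[OF con] by blast
qed

text \<open>The column units absorb the row of \<open>r\<close>, which becomes all ones.\<close>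

lemma star_realizes:
  assumes "r \<in> V" "nb r = {a, b, c, d}" "distinct [a, b, c, d]"
  shows "realizes [[P0,P0,P0,P0]] [r] [a, b, c, d] (\<lambda>_. 1) (\<lambda>j. cnj (A r ([a, b, c, d] ! j)))"
proof -
  have n: "A r ([a, b, c, d] ! j) \<in> eisenstein_units" if "j < length [a, b, c, d]" for j
  proof -
    have "[a, b, c, d] ! j \<in> set [a, b, c, d]" by (rule nth_mem[OF that])
    then show ?thesis using entry_unit[OF assms(1)] assms(2) by simp
  qed
  have row: "val ([P0,P0,P0,P0] ! j) = 1" if "j < 4" for j
    using that by (auto simp: numeral_eq_Suc less_Suc_eq)
  have "A ([r] ! i) ([a, b, c, d] ! j) = 1 * val ([[P0,P0,P0,P0]] ! i ! j) * cnj (cnj (A r ([a, b, c, d] ! j)))"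
    if "i < length [r]" "j < length [a, b, c, d]" for i j
    using that row[of j] by simp
  moreover have "{a, b, c, d} \<subseteq> V" using assms(2) nb_V[of r] by simp
  ultimately show ?thesis unfolding realizes_def using assms(1,3) unit_cnj[OF n] by simp
qed

lemma add_row:
  assumes r: "realizes M \<rho> [a, b, c, d] u v" and p: "p \<in> V" "p \<notin> set \<rho>" "a \<in> nb p"
  obtains x e where "realizes (M @ [x]) (\<rho> @ [p]) [a, b, c, d] (u(length \<rho> := e)) v"
    "x \<in> set (newrows M [False,False,False,False] [True,False,False,False])" "length x = 4"
    "x ! 0 \<noteq> N" "x ! 1 = N \<longleftrightarrow> b \<notin> nb p" "x ! 2 = N \<longleftrightarrow> c \<notin> nb p" "x ! 3 = N \<longleftrightarrow> d \<notin> nb p"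
proof -
  have pa: "A p ([a, b, c, d] ! 0) \<noteq> 0" using p(3) by (simp add: nb_def)
  obtain x e where x: "realizes (M @ [x]) (\<rho> @ [p]) [a, b, c, d] (u(length \<rho> := e)) v"
    "case filter (\<lambda>x. x \<noteq> N) x of [] \<Rightarrow> True | y # _ \<Rightarrow> y = P0" "length x = length [a, b, c, d]"
    by (rule realizes_new_row[OF r p(1,2) _ pa]) (simp, rule that, assumption+)
  have F: "\<not> [False,False,False,False] ! i" if "i < 4" for i using that by (auto simp: numeral_eq_Suc less_Suc_eq)
  have T: "[True,False,False,False] ! i \<longleftrightarrow> i = 0" if "i < 4" for i using that by (auto simp: numeral_eq_Suc less_Suc_eq)
  have "x \<in> set (newrows M [False,False,False,False] [True,False,False,False])"
    by (rule newrows_complete[OF x(1) r x(2) _ pa]) (use F T in auto)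
  moreover have len: "length M = length \<rho>" and V: "{a, b, c, d} \<subseteq> V" using r unfolding realizes_def by auto
  have nz: "A p ([a, b, c, d] ! j) \<noteq> 0 \<longleftrightarrow> x ! j \<noteq> N" if "j < 4" for j
    using realizes_nz[OF x(1), of "length \<rho>" j] that len by (simp add: nth_append)
  have "x ! 0 \<noteq> N" "x ! 1 = N \<longleftrightarrow> b \<notin> nb p" "x ! 2 = N \<longleftrightarrow> c \<notin> nb p" "x ! 3 = N \<longleftrightarrow> d \<notin> nb p"
    using nz[of 0] nz[of 1] nz[of 2] nz[of 3] V pa by (auto simp: nb_def)
  ultimately show ?thesis using x(1,3) that by simp
qed

text \<open>After scaling only two second rows are possible, and both searches are
  certified.\<close>

lemma meet_three_listed:
  assumes con: "connected_on V A" and r: "r \<in> V" "card (nb r) = 4" and s: "s \<in> V" "s \<noteq> r" "card (nb s \<inter> nb r) = 3"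
  shows "listed V A"
proof -
  obtain a b c where abc: "nb s \<inter> nb r = {a, b, c}" "distinct [a, b, c]" using s(3) by (auto simp: card_3_iff)
  have sub: "{a, b, c} \<subseteq> nb r" using abc by blast
  then have "card (nb r - {a, b, c}) = 1" using r(2) abc(2) by (simp add: card_Diff_subset)
  then obtain d where d: "nb r - {a, b, c} = {d}" by (meson card_1_singletonE)
  have nr: "nb r = {a, b, c, d}" "distinct [a, b, c, d]" using sub d abc(2) by auto
  have ns: "a \<in> nb s" "b \<in> nb s" "c \<in> nb s" "d \<notin> nb s" using abc d by blast+
  obtain x e where x: "realizes ([[P0,P0,P0,P0]] @ [x]) ([r] @ [s]) [a, b, c, d] ((\<lambda>_. 1)(length [r] := e)) (\<lambda>j. cnj (A r ([a, b, c, d] ! j)))"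
    "x \<in> set (newrows [[P0,P0,P0,P0]] [False,False,False,False] [True,False,False,False])"
    "x ! 0 \<noteq> N" "x ! 1 = N \<longleftrightarrow> b \<notin> nb s" "x ! 2 = N \<longleftrightarrow> c \<notin> nb s" "x ! 3 = N \<longleftrightarrow> d \<notin> nb s"
    by (rule add_row[OF star_realizes[OF r(1) nr] s(1) _ ns(1)]) (use s(2) in simp, rule that, assumption+)
  have "x = [P0,P2,P4,N] \<or> x = [P0,P4,P2,N]" using row_one_candidates x(2-6) ns by (auto simp: list_all_iff)
  then show ?thesis
    using search_listed[OF con x(1), of 60] certified_1 certified_2 by (auto simp: numeral_eq_Suc)
qed

text \<open>An overlap of size two has opposite signs, so after scaling the three rows are the
  starting array of a certified search.\<close>

lemma meet_two_listed:
  assumes con: "connected_on V A" and r: "r \<in> V" "card (nb r) = 4" and s: "s \<in> V" "s \<noteq> r" "nb s \<inter> nb r = {a, b}"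
    and s': "s' \<in> V" "s' \<noteq> r" "nb s' \<inter> nb r = {a, c}" and dis: "distinct [a, b, c]"
  shows "listed V A"
proof -
  have sub: "{a, b, c} \<subseteq> nb r" using s s' by blast
  then have "card (nb r - {a, b, c}) = 1" using r(2) dis by (simp add: card_Diff_subset)
  then obtain d where d: "nb r - {a, b, c} = {d}" by (meson card_1_singletonE)
  have nr: "nb r = {a, b, c, d}" "distinct [a, b, c, d]" using sub d dis by auto
  have ns: "a \<in> nb s" "b \<in> nb s" "c \<notin> nb s" "d \<notin> nb s" using s(3) nr by auto
  have ns': "a \<in> nb s'" "b \<notin> nb s'" "c \<in> nb s'" "d \<notin> nb s'" using s'(3) nr by auto
  obtain x e where x: "realizes ([[P0,P0,P0,P0]] @ [x]) ([r] @ [s]) [a, b, c, d] ((\<lambda>_. 1)(length [r] := e)) (\<lambda>j. cnj (A r ([a, b, c, d] ! j)))"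
    "x \<in> set (newrows [[P0,P0,P0,P0]] [False,False,False,False] [True,False,False,False])"
    "x ! 0 \<noteq> N" "x ! 1 = N \<longleftrightarrow> b \<notin> nb s" "x ! 2 = N \<longleftrightarrow> c \<notin> nb s" "x ! 3 = N \<longleftrightarrow> d \<notin> nb s"
    by (rule add_row[OF star_realizes[OF r(1) nr] s(1) _ ns(1)]) (use s(2) in simp, rule that, assumption+)
  have x2: "x = [P0,P3,N,N]" using row_one_candidates x(2-6) ns by (auto simp: list_all_iff)
  have s's: "s' \<notin> set ([r] @ [s])" using s'(2) ns ns' by auto
  obtain y e' where y: "realizes (([[P0,P0,P0,P0]] @ [x]) @ [y]) (([r] @ [s]) @ [s']) [a, b, c, d]
      (((\<lambda>_. 1)(length [r] := e))(length ([r] @ [s]) := e')) (\<lambda>j. cnj (A r ([a, b, c, d] ! j)))"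
    "y \<in> set (newrows ([[P0,P0,P0,P0]] @ [x]) [False,False,False,False] [True,False,False,False])"
    "y ! 0 \<noteq> N" "y ! 1 = N \<longleftrightarrow> b \<notin> nb s'" "y ! 2 = N \<longleftrightarrow> c \<notin> nb s'" "y ! 3 = N \<longleftrightarrow> d \<notin> nb s'"
    by (rule add_row[OF x(1) s'(1) s's ns'(1)]) (rule that, assumption+)
  have "y = [P0,N,P3,N]" using row_two_candidates y(2-6) ns' x2 by (auto simp: list_all_iff)
  then show ?thesis
    using search_listed[OF con y(1), of 60] certified_3 x2 by (auto simp: numeral_eq_Suc)
qed

lemma toral_or_listed:
  assumes con: "connected_on V A"
    and nk: "\<nexists>c. (\<forall>i\<in>V. c i \<in> eisenstein_ints) \<and> (\<Sum>i\<in>V. (cmod (c i))\<^sup>2) = 4 \<and> (\<forall>i\<in>V. (\<Sum>j\<in>V. A i j * c j) = 0)"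
  shows "toral V A \<or> listed V A"
proof (cases "listed V A")
  case False
  have "toral V A"
  proof unfold_locales
    show "connected_on V A" by (rule con)
    show "\<nexists>c. (\<forall>i\<in>V. c i \<in> eisenstein_ints) \<and> (\<Sum>i\<in>V. (cmod (c i))\<^sup>2) = 4 \<and> (\<forall>i\<in>V. (\<Sum>j\<in>V. A i j * c j) = 0)"
      by (rule nk)
    show "card (nb s \<inter> nb r) \<noteq> 3" if "r \<in> V" "card (nb r) = 4" "s \<in> V" "s \<noteq> r" for r s
      using meet_three_listed[OF con that] False by blast
    show "nb s \<inter> nb r = nb s' \<inter> nb r \<or> nb s \<inter> nb s' \<inter> nb r = {}"
      if r: "r \<in> V" "card (nb r) = 4" and s: "s \<in> V" "s \<noteq> r" and s': "s' \<in> V" "s' \<noteq> r"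
        and two: "card (nb s \<inter> nb r) = 2" "card (nb s' \<inter> nb r) = 2" for r s s'
    proof (rule ccontr)
      assume neg: "\<not> (nb s \<inter> nb r = nb s' \<inter> nb r \<or> nb s \<inter> nb s' \<inter> nb r = {})"
      then obtain a where a: "a \<in> nb s \<inter> nb r" "a \<in> nb s' \<inter> nb r" by blast
      have "card (nb s \<inter> nb r - {a}) = 1" "card (nb s' \<inter> nb r - {a}) = 1"
        using a two finite_nb by (simp_all add: card_Diff_singleton)
      then obtain b c where "nb s \<inter> nb r - {a} = {b}" "nb s' \<inter> nb r - {a} = {c}" by (meson card_1_singletonE)
      then have bc: "nb s \<inter> nb r = {a, b}" "nb s' \<inter> nb r = {a, c}" "a \<noteq> b" "a \<noteq> c" using a by blast+
      then have "distinct [a, b, c]" using neg by auto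
      then show False using meet_two_listed[OF con r s bc(1) s' bc(2)] False by blast
    qed
  qed
  then show ?thesis ..
qed simp

end

context toral
begin

text \<open>Without overlaps of size two, a vertex that shares a neighbour with \<open>r\<close> has
  the same neighbourhood as \<open>r\<close>. The kernel condition yields a second and a third such
  vertex; degree 3 being excluded, there are four, and the block between them and
  \<open>nb r\<close> is a full 4 by 4 array.\<close>

lemma small_star_listed:
  assumes nobig: "\<And>v. \<not> big v" and r: "r \<in> V" "card (nb r) = 4"
  shows "listed V A"
proof -
  have same: "nb s = nb r" if "s \<in> V" "x \<in> nb s" "x \<in> nb r" for s x
  proof (cases "s = r")
    case False
    have "card (nb s \<inter> nb r) \<noteq> 0" using that finite_nb by auto
    moreover have "card (nb s \<inter> nb r) \<noteq> 2" using nobig[of r] r that(1) False unfolding big_def by blast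
    ultimately have "card (nb s \<inter> nb r) = 4" using meet_card[OF r that(1) False] by auto
    then show ?thesis by (rule meet4[OF r that(1)])
  qed simp
  obtain a where a: "a \<in> nb r" using r(2) by (metis card.empty equals0I zero_neq_numeral)
  have aV: "a \<in> V" using a nbV by blast
  define K where "K = nb a"
  have K: "s \<in> K \<longleftrightarrow> s \<in> V \<and> nb s = nb r" for s
    using same[of s a] nb_iff[OF _ aV, of s] a nbV unfolding K_def by blast
  have rK: "r \<in> K" using K r by simp
  have K_nb: "nb x = K" if "x \<in> nb r" for x
    using K same[of _ x] nb_iff[of _ x] that nbV by blast
  have out: "h r s x = 0" if "s \<in> V" "s \<notin> K" "x \<in> nb r" for s x
    using same[OF that(1) _ that(3)] K that(1,2) h_zero nbV[OF that(3)] by blast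
  have su: "h r s x \<in> eisenstein_units" if "s \<in> K" "x \<in> nb r" for s x
    using h_unit[OF r(1), of s x] K that by blast
  \<comment> \<open>By \<open>units_opposite\<close> the four relative weights of \<open>s\<close>
    fall into opposite pairs, and the neighbours are renamed accordingly.\<close>
  have order: "\<exists>b c d. nb r = {a, b, c, d} \<and> distinct [a, b, c, d] \<and> h r s b = - h r s a \<and> h r s d = - h r s c"
    if s: "s \<in> K" "s \<noteq> r" for s
  proof -
    obtain b where b: "b \<in> nb r" "b \<noteq> a"
    proof -
      have "\<not> nb r \<subseteq> {a}" using r(2) card_mono[of "{a}" "nb r"] by auto
      then show ?thesis using that by blast
    qed
    obtain c d where cd: "nb r = {a, b, c, d}" "distinct [a, b, c, d]" by (rule nb_four[OF r(2) a b(1) b(2)[symmetric]])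
    have "s \<in> V" using s K by blast
    then have sum: "h r s a + h r s b + h r s c + h r s d = 0" using h_sum[OF r _ s(2)] cd by (simp add: add.assoc)
    define p where "p x = cnj (h r s a) * h r s x" for x
    have un: "cnj (h r s a) * h r s a = 1" "h r s a * cnj (h r s a) = 1" using unit_cnj_mult su[OF s(1) a] by auto
    have pu: "p x \<in> eisenstein_units" if "x \<in> nb r" for x using su[OF s(1)] that a unfolding p_def by (auto intro!: unit_mult unit_cnj)
    have "1 + p b + p c + p d = cnj (h r s a) * (h r s a + h r s b + h r s c + h r s d)"
      using un(1) by (simp add: p_def distrib_left)
    then have "1 + p b + p c + p d = 0" using sum by simp
    then have "p b = -1 \<or> p c = -1 \<or> p d = -1" using units_opposite[of "p b" "p c" "p d"] pu cd(1) by auto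
    moreover have hp: "h r s x = h r s a * p x" for x using un(2) by (simp add: p_def mult.assoc[symmetric])
    have "h r s x = - h r s a" if "p x = -1" for x using hp[of x] that by simp
    ultimately consider "h r s b = - h r s a" | "h r s c = - h r s a" | "h r s d = - h r s a" by blast
    then show ?thesis
    proof cases
      case 1
      then have "h r s d = - h r s c" using sum by (simp add: add_eq_0_iff add.commute)
      then show ?thesis using cd 1 by blast
    next
      case 2
      then have "h r s d = - h r s b" using sum by (simp add: add_eq_0_iff add.commute)
      moreover have "nb r = {a, c, b, d}" "distinct [a, c, b, d]" using cd by (auto simp: insert_commute)
      ultimately show ?thesis using 2 by blast
    next
      case 3
      then have "h r s c = - h r s b" using sum by (simp add: add_eq_0_iff add.commute)
      moreover have "nb r = {a, d, b, c}" "distinct [a, d, b, c]" using cd by (auto simp: insert_commute)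
      ultimately show ?thesis using 3 by blast
    qed
  qed
  have witness: "\<exists>s\<in>K. s \<noteq> r \<and> h r s a + h r s b - h r s c - h r s d \<noteq> 0"
    if abcd: "nb r = {a, b, c, d}" "distinct [a, b, c, d]" for b c d
  proof (rule kernel_witness[OF r(1) abcd])
    fix s assume s: "s \<in> V" "h r s a + h r s b - h r s c - h r s d \<noteq> 0"
    have "s \<in> K"
    proof (rule ccontr)
      assume "s \<notin> K"
      then have "h r s a = 0" "h r s b = 0" "h r s c = 0" "h r s d = 0" using out[OF s(1)] abcd(1) by auto
      then show False using s(2) by simp
    qed
    moreover have "s \<noteq> r"
    proof
      assume "s = r"
      moreover have "h r r x = 1" if "x \<in> {a, b, c, d}" for x using h_self[OF r(1)] abcd(1) that by simp
      ultimately have "h r s a = 1" "h r s b = 1" "h r s c = 1" "h r s d = 1" by simp_all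
      then show False using s(2) by simp
    qed
    ultimately show ?thesis using s(2) by blast
  qed
  obtain b0 where b0: "b0 \<in> nb r" "a \<noteq> b0"
  proof -
    have "\<not> nb r \<subseteq> {a}" using r(2) card_mono[of "{a}" "nb r"] by auto
    then show ?thesis using that by blast
  qed
  obtain c0 d0 where "nb r = {a, b0, c0, d0}" "distinct [a, b0, c0, d0]" by (rule nb_four[OF r(2) a b0])
  then obtain s where s: "s \<in> K" "s \<noteq> r" using witness by blast
  obtain b c d where abcd: "nb r = {a, b, c, d}" "distinct [a, b, c, d]" "h r s b = - h r s a" "h r s d = - h r s c"
    using order[OF s] by blast
  \<comment> \<open>In this order the row of \<open>s\<close> annihilates the signed vector, so the
    witness is yet another vertex.\<close>
  obtain s2 where s2: "s2 \<in> K" "s2 \<noteq> r" "h r s2 a + h r s2 b - h r s2 c - h r s2 d \<noteq> 0" using witness[OF abcd(1,2)] by blast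
  have "s2 \<noteq> s" using s2(3) abcd(3,4) by auto
  have card3: "card {r, s, s2} = 3" using s(2) s2(2) \<open>s2 \<noteq> s\<close> by auto
  have sub3: "{r, s, s2} \<subseteq> K" using rK s(1) s2(1) by blast
  have "card K = 4" using card_mono[OF _ sub3] card3 nb_card[OF aV] finite_nb[of a] unfolding K_def by auto
  then have "card (K - {r, s, s2}) = 1" using sub3 card3 by (simp add: card_Diff_subset)
  then obtain s3 where s3: "K - {r, s, s2} = {s3}" by (meson card_1_singletonE)
  have KV: "s \<in> V" "s2 \<in> V" "s3 \<in> V" "nb s = nb r" "nb s2 = nb r" "nb s3 = nb r" using K s(1) s2(1) s3 by blast+
  have Keq: "K = {r, s, s2, s3}" using sub3 s3 by blast
  have dist: "s \<notin> set [r]" "s2 \<notin> set ([r] @ [s])" "s3 \<notin> set (([r] @ [s]) @ [s2])" using s(2) s2(2) \<open>s2 \<noteq> s\<close> s3 by auto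
  let ?v = "\<lambda>j. cnj (A r ([a, b, c, d] ! j))"
  have as: "a \<in> nb s" "a \<in> nb s2" "a \<in> nb s3" using KV a by auto
  obtain x e where x: "realizes ([[P0,P0,P0,P0]] @ [x]) ([r] @ [s]) [a, b, c, d] ((\<lambda>_. 1)(length [r] := e)) ?v"
    "x \<in> set (newrows [[P0,P0,P0,P0]] [False,False,False,False] [True,False,False,False])" "length x = 4"
    "x ! 0 \<noteq> N" "x ! 1 = N \<longleftrightarrow> b \<notin> nb s" "x ! 2 = N \<longleftrightarrow> c \<notin> nb s" "x ! 3 = N \<longleftrightarrow> d \<notin> nb s"
    by (rule add_row[OF star_realizes[OF r(1) abcd(1,2)] KV(1) dist(1) as(1)]) (rule that, assumption+)
  have hx: "h r s ([a, b, c, d] ! j) = e * val (x ! j)" if "j < 4" for j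
  proof -
    have "[a, b, c, d] ! j \<in> set [a, b, c, d]" by (rule nth_mem) (use that in simp)
    then have "[a, b, c, d] ! j \<in> nb r" using abcd(1) by simp
    then have "A r ([a, b, c, d] ! j) * cnj (A r ([a, b, c, d] ! j)) = 1" using unit_cnj_mult(1)[OF entry_unit[OF r(1)]] by blast
    moreover have "A s ([a, b, c, d] ! j) = e * val (x ! j) * A r ([a, b, c, d] ! j)"
    proof -
      have "\<forall>i<length ([r] @ [s]). \<forall>j<length [a, b, c, d]. A (([r] @ [s]) ! i) ([a, b, c, d] ! j) =
          ((\<lambda>_. 1)(length [r] := e)) i * val (([[P0,P0,P0,P0]] @ [x]) ! i ! j) * cnj (cnj (A r ([a, b, c, d] ! j)))"
        using x(1) unfolding realizes_def by blast
      from this[rule_format, of 1 j] show ?thesis using that by simp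
    qed
    ultimately show ?thesis by (simp add: h_def mult.assoc)
  qed
  obtain y e2 where y: "realizes (([[P0,P0,P0,P0]] @ [x]) @ [y]) (([r] @ [s]) @ [s2]) [a, b, c, d]
      (((\<lambda>_. 1)(length [r] := e))(length ([r] @ [s]) := e2)) ?v"
    "y \<in> set (newrows ([[P0,P0,P0,P0]] @ [x]) [False,False,False,False] [True,False,False,False])" "length y = 4"
    "y ! 0 \<noteq> N" "y ! 1 = N \<longleftrightarrow> b \<notin> nb s2" "y ! 2 = N \<longleftrightarrow> c \<notin> nb s2" "y ! 3 = N \<longleftrightarrow> d \<notin> nb s2"
    by (rule add_row[OF x(1) KV(2) dist(2) as(2)]) (rule that, assumption+)
  obtain z e3 where z: "realizes ((([[P0,P0,P0,P0]] @ [x]) @ [y]) @ [z]) ((([r] @ [s]) @ [s2]) @ [s3]) [a, b, c, d]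
      ((((\<lambda>_. 1)(length [r] := e))(length ([r] @ [s]) := e2))(length (([r] @ [s]) @ [s2]) := e3)) ?v"
    "z \<in> set (newrows (([[P0,P0,P0,P0]] @ [x]) @ [y]) [False,False,False,False] [True,False,False,False])" "length z = 4"
    "z ! 0 \<noteq> N" "z ! 1 = N \<longleftrightarrow> b \<notin> nb s3" "z ! 2 = N \<longleftrightarrow> c \<notin> nb s3" "z ! 3 = N \<longleftrightarrow> d \<notin> nb s3"
    by (rule add_row[OF y(1) KV(3) dist(3) as(3)]) (rule that, assumption+)
  have full: "N \<notin> set w" if w: "length w = 4" "w ! 0 \<noteq> N" "w ! 1 \<noteq> N" "w ! 2 \<noteq> N" "w ! 3 \<noteq> N" for w
  proof
    assume "N \<in> set w"
    then obtain j where "j < 4" "w ! j = N" using w(1) by (auto simp: in_set_conv_nth)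
    then show False using below_four[of j] w by auto
  qed
  have nx: "x ! 1 \<noteq> N" "x ! 2 \<noteq> N" "x ! 3 \<noteq> N" using x(5-7) KV(4) abcd(1) by auto
  have ny: "N \<notin> set y" by (rule full) (use y(3-7) KV(5) abcd(1) in auto)
  have nz: "N \<notin> set z" by (rule full) (use z(3-7) KV(6) abcd(1) in auto)
  have e0: "e \<noteq> 0" using hx[of 0] unit_nz[OF su[OF s(1) a]] by auto
  have x0: "x ! 0 = P0"
  proof -
    have "list_all (\<lambda>x. x ! 0 = P0) (newrows [[P0,P0,P0,P0]] [False,False,False,False] [True,False,False,False])" by code_simp
    then show ?thesis using x(2) by (simp add: list_all_iff)
  qed
  have "e * val (x ! 1) = e * (- 1)" using hx[of 0] hx[of 1] abcd(3) x0 by simp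
  then have "x ! 1 = P3" using e0 val_minus_1 by (metis mult_cancel_left)
  then have xeq: "x = [P0,P3,x ! 2,emul P3 (x ! 2)]" using row_one_candidates x(2,4) nx by (auto simp: list_all_iff)
  obtain t where t: "x = [P0,P3,t,emul P3 t]" "t \<noteq> N" using xeq nx(2) by blast
  have xs: "[P0,P0,P0,P0] # x # [y, z] \<in> set (small_rows t)"
    unfolding small_rows_def Let_def using y(2) z(2) ny nz t by auto
  moreover have "t \<in> set [P0,P1,P2,P3,P4,P5]" using t(2) by (cases t) auto
  ultimately have "[P0,P0,P0,P0] # x # [y, z] \<in> set (concat (map small_rows [P0,P1,P2,P3,P4,P5]))" by auto
  then obtain q where q: "good_cert q" "chk_final ([P0,P0,P0,P0] # x # [y, z]) q" using certified_mem[OF certified_4] by blast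
  have "closed_pair ((([r] @ [s]) @ [s2]) @ [s3]) [a, b, c, d]"
    unfolding closed_pair_def using KV abcd(1) K_nb Keq by auto
  then show ?thesis using final_listed[OF con z(1) _ q(1)] q(2) by simp
qed

lemma toral_listed: "listed V A"
proof (cases "\<exists>v. big v")
  case True
  then show ?thesis using big_in_ladder unfolding listed_def by blast
next
  case nobig: False
  show ?thesis
  proof (cases "\<exists>r\<in>V. card (nb r) = 4")
    case True
    then show ?thesis using small_star_listed nobig by blast
  next
    case False
    then show ?thesis using unsaturated_in_ladder[OF con] unfolding listed_def by blast
  qed
qed

end

context saturated
begin

text \<open>A zero row isolates its vertex, which is then the whole graph; it has degree 0 and is
  placed on a ladder directly.\<close>

lemma frame_or_zero:
  assumes small: "\<And>i j. i \<in> V \<Longrightarrow> j \<in> V \<Longrightarrow> nrm i j \<notin> {3, 4}"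
  shows "frame V A \<or> in_ladder V A"
proof (cases "\<exists>i\<in>V. \<forall>j\<in>V. A i j = 0")
  case True
  then obtain i where i: "i \<in> V" "\<And>j. j \<in> V \<Longrightarrow> A i j = 0" by blast
  have V: "V = {i}" by (rule closed_V) (use i in auto)
  have "embeds V A (lad_verts 1) (lad 1 0 0 0)"
    by (rule embedsI[of "\<lambda>_. (0, True)" _ _ "\<lambda>_. 1" 1 id]) (use V i in \<open>auto simp: lad_verts_def lad_def\<close>)
  then show ?thesis using in_ladder_open[of 1 0 0 V A] by simp
next
  case False
  have u: "A i j = 0 \<or> A i j \<in> eisenstein_units" if "i \<in> V" "j \<in> V" for i j
  proof (cases "A i j = 0")
    case False
    then have "nrm i j = 1" using nrm_values[OF that] small[OF that] nrm_0 by auto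
    then have "cmod (A i j) = 1" by (simp add: nrm_def power2_eq_1_iff) (smt (verit) norm_ge_zero)
    then show ?thesis using R_unit_iff entry_R[OF that] by blast
  qed simp
  have c: "sum (nrm i) V = real (card {j \<in> V. A i j \<noteq> 0})" if "i \<in> V" for i
  proof -
    have "sum (nrm i) V = (\<Sum>j\<in>V. if A i j \<noteq> 0 then 1 else 0)"
    proof (rule sum.cong[OF refl])
      fix j assume "j \<in> V"
      then have "A i j = 0 \<or> cmod (A i j) = 1" using u[OF that] unit_cmod by blast
      then show "nrm i j = (if A i j \<noteq> 0 then 1 else 0)" by (auto simp: nrm_def)
    qed
    also have "\<dots> = real (card {j \<in> V. A i j \<noteq> 0})" using fin by (simp add: sum.If_cases Int_def)
    finally show ?thesis .
  qed
  have "frame V A"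
  proof
    show "card {j \<in> V. A i j \<noteq> 0} \<in> {1, 2, 4}" if "i \<in> V" for i
    proof -
      have "card {j \<in> V. A i j \<noteq> 0} \<le> 4" "card {j \<in> V. A i j \<noteq> 0} \<noteq> 3" using row_le[OF that] row_not3[OF that] c[OF that] by auto
      moreover have "card {j \<in> V. A i j \<noteq> 0} \<noteq> 0" using False that fin by auto
      ultimately show ?thesis by auto
    qed
    show "(\<Sum>j\<in>V. A k j * cnj (A i j)) = 0" if "i \<in> V" "card {j \<in> V. A i j \<noteq> 0} = 4" "k \<in> V" "k \<noteq> i" for i k
      using row_orth[OF that(1) _ that(3,4)] c[OF that(1)] that(2) by simp
  qed (use fin herm u in auto)
  then show ?thesis ..
qed

lemma saturated_listed: "listed V A"
proof (cases "\<exists>i\<in>V. \<exists>j\<in>V. nrm i j \<in> {3, 4}")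
  case True
  then obtain i j where "i \<in> V" "j \<in> V" "nrm i j = 3 \<or> nrm i j = 4" by auto
  then show ?thesis using norm_three norm_four unfolding listed_def by blast
next
  case False
  then have "frame V A \<or> in_ladder V A" using frame_or_zero by blast
  then show ?thesis
  proof
    assume "frame V A"
    then interpret frame V A .
    have "toral V A \<or> listed V A" by (rule toral_or_listed[OF conn]) (use sat in \<open>simp add: saturated_on_def\<close>)
    then show ?thesis using toral.toral_listed by blast
  qed (simp add: listed_def)
qed

end

section \<open>Return to matrices\<close>

definition in_table :: "complex mat \<Rightarrow> bool"
  where "in_table A \<longleftrightarrow>
            (\<exists>k\<ge>3. equivalent_to_graph A (T2k k)) \<or>
            (\<exists>k\<ge>3. equivalent_to_graph A (T2k_omega k)) \<or>
            equivalent_to_graph A S2 \<or>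
            equivalent_to_graph A S4_ddagger \<or>
            equivalent_to_graph A S10 \<or>
            equivalent_to_graph A S12 \<or>
            equivalent_to_graph A S14 \<or>
            equivalent_to_graph A S16 \<or>
            equivalent_to_graph A S1 \<or>
            equivalent_to_graph A S2_dagger \<or>
            (\<exists>k\<ge>2. equivalent_to_graph A (C2k_pp k)) \<or>
            (\<exists>k\<ge>2. equivalent_to_graph A (C2k_pm k)) \<or>
            equivalent_to_graph A S5 \<or>
            equivalent_to_graph A S6 \<or>
            equivalent_to_graph A S6_dagger \<or>
            equivalent_to_graph A S7 \<or>
            equivalent_to_graph A S8 \<or>
            equivalent_to_graph A S8_prime"

lemma listed_extension:
  fixes B :: "nat \<Rightarrow> nat \<Rightarrow> complex"
  assumes "listed {..<n} B"
  shows "\<exists>N C. n \<le> N \<and> (\<forall>i<n. \<forall>j<n. C i j = B i j) \<and> complete_on {..<N} C \<and> in_table (mat N N (\<lambda>(i, j). C i j))"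
proof -
  from assms consider "in_ladder {..<n} B"
    | G where "G \<in> {S1, S2, S2_dagger, S4_ddagger, S5, S6, S6_dagger, S7, S8, S8_prime}" "models {..<n} B G"
    | G where "G \<in> {S10, S12, S14, S16}" "models {..<n} B G"
    unfolding listed_def by blast
  then show ?thesis
  proof cases
    case 1
    then obtain k G where G: "k \<ge> 3 \<and> G \<in> {T2k k, T2k_omega k} \<or> k \<ge> 2 \<and> G \<in> {C2k_pp k, C2k_pm k}"
      "complete_on (fst G) (snd G)" "embeds {..<n} B (fst G) (snd G)" unfolding in_ladder_def by blast
    have "in_table M" if "equivalent_to_graph M G" for M using G(1) that unfolding in_table_def by blast
    then show ?thesis using embeds_complete[OF G(3,2)] unfolding prod.collapse by blast
  next
    case (2 G)
    have "in_table M" if "equivalent_to_graph M G" for M using 2(1) that unfolding in_table_def by blast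
    then show ?thesis using embeds_complete[of n B "fst G" "snd G"] 2(2) unfolding models_def prod.collapse by blast
  next
    case (3 G)
    have "in_table M" if "equivalent_to_graph M G" for M using 3(1) that unfolding in_table_def by blast
    then show ?thesis using embeds_complete[of n B "fst G" "snd G"] 3(2) unfolding models_def prod.collapse by blast
  qed
qed

lemma table_extension:
  assumes "herm {..<n} A" "bounded_by_2 {..<n} A" "connected_on {..<n} A"
  shows "\<exists>N B. n \<le> N \<and> (\<forall>i<n. \<forall>j<n. B i j = A i j) \<and> complete_on {..<N} B \<and> in_table (mat N N (\<lambda>(i, j). B i j))"
proof (rule saturated_extension[OF assms])
  fix N B
  assume B: "n \<le> N" "\<And>i j. i < n \<Longrightarrow> j < n \<Longrightarrow> B i j = A i j" "herm {..<N} B" "bounded_by_2 {..<N} B"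
    "connected_on {..<N} B" "saturated_on {..<N} B"
  have "listed {..<N} B" by (rule saturated.saturated_listed) (use B in \<open>unfold_locales, auto\<close>)
  then obtain N' C where "N \<le> N'" "\<forall>i<N. \<forall>j<N. C i j = B i j" "complete_on {..<N'} C" "in_table (mat N' N' (\<lambda>(i, j). C i j))"
    using listed_extension by blast
  then show ?thesis using B(1,2) by (intro exI[of _ N'] exI[of _ C]) auto
qed

theorem theorem3p7:
  shows "(\<forall>A. maximal_cyclotomic A \<longrightarrow>
            (\<exists>k\<ge>3. equivalent_to_graph A (T2k k)) \<or>
            (\<exists>k\<ge>3. equivalent_to_graph A (T2k_omega k)) \<or>
            equivalent_to_graph A S2 \<or>
            equivalent_to_graph A S4_ddagger \<or>
            equivalent_to_graph A S10 \<or>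
            equivalent_to_graph A S12 \<or>
            equivalent_to_graph A S14 \<or>
            equivalent_to_graph A S16 \<or>
            equivalent_to_graph A S1 \<or>
            equivalent_to_graph A S2_dagger \<or>
            (\<exists>k\<ge>2. equivalent_to_graph A (C2k_pp k)) \<or>
            (\<exists>k\<ge>2. equivalent_to_graph A (C2k_pm k)) \<or>
            equivalent_to_graph A S5 \<or>
            equivalent_to_graph A S6 \<or>
            equivalent_to_graph A S6_dagger \<or>
            equivalent_to_graph A S7 \<or>
            equivalent_to_graph A S8 \<or>
            equivalent_to_graph A S8_prime)
       \<and> (\<forall>B. cyclotomic B \<and> indecomposable B \<longrightarrow>
            (\<exists>M. maximal_cyclotomic M \<and> contained_in B M))"
  using reduction_to_extension[of in_table, OF table_extension] unfolding in_table_def .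

end
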